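(* Let $k$ be a field, let $n\ge 1$, let $b=2$, and let $t\in\{n,n-1,n-2\}$ with $t\ge 1$. Let $J_t$, $I_t(\mathbf P)\subset R=k[x_{ij}:1\le i\le n,\ 1\le j\le 2]$ and $I_t(\mathbf D)\subset S=k[y_{i,j}:1\le i\le n,\ 1\le j\le 2]$ be the ideals defined in the context. Then the ideals $J_t$, $I_t(\mathbf D)$ and $I_t(\mathbf P)$ have equal Betti numbers, i.e. $$\beta_q(J_t)=\beta_q(I_t(\mathbf D))=\beta_q(I_t(\mathbf P))\qquad\text{for all } q=0,\dots,2n-t.$$
   Context: For a homogeneous ideal $I$ of a polynomial ring, $\beta_q(I)$ denotes the (total) $q$-th Betti number of $I$ as a module, i.e. the rank of the $q$-th free module in the minimal graded free resolution of $I$ (so $\beta_0(I)$ is the minimal number of generators). The ideal $I_t(\mathbf D)$: $\mathbf D$ is the $n\times 2n$ matrix over $S$ whose $i$-th row has entries $y_{i,1},y_{i,2}$ in columns $2i-1,2i$ and zeros elsewhere; $I_t(\mathbf D)$ is the ideal of $S$ generated by its $t$-minors, i.e. by all $y_{i_1,j_1}\cdots y_{i_t,j_t}$ with $1\le i_1<\cdots<i_t\le n$ and $j_u\in\{1,2\}$. The ideal $I_t(\mathbf P)$: $\mathbf P=[M_1\ M_2]$ is the $n\times 2n$ generic pluri-circulant matrix, where $M_j$ is the $n\times n$ generic circulant matrix with first row $(x_{1j},x_{2j},\dots,x_{nj})$, each following row being the cyclic shift to the right by one place of the preceding row (so the second row is $(x_{nj},x_{1j},\dots,x_{n-1,j})$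 and the last row is $(x_{2j},x_{3j},\dots,x_{1j})$). $I_t(\mathbf P)$ is the ideal of $R$ generated by the $t$-minors of $\mathbf P$. The ideal $J_t$: let $T_j$ ($j=1,2$) be the $t\times n$ matrix whose entry in row $r$ and column $c$ is $x_{c-r+1,j}$ if $c\ge r$ and $0$ if $c<r$, and let $\mathbf T=[T_1\ T_2]$, a $t\times 2n$ matrix. $J_t$ is the monomial ideal of $R$ generated by the products of the entries of the main diagonals of the $t\times t$ submatrices of $\mathbf T$, i.e. by all nonzero products $\mathbf T_{1,c_1}\mathbf T_{2,c_2}\cdots\mathbf T_{t,c_t}$ with $1\le c_1<c_2<\cdots<c_t\le 2n$. *)

theory Defs
  imports
    "HOL-Library.Poly_Mapping"
    "HOL-Algebra.Ideal"
    "Jordan_Normal_Form.Determinant"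
    "Jordan_Normal_Form.DL_Submatrix"
begin

section \<open>Polynomial rings\<close>

text \<open>Polynomials are finitely supported functions from monomials to coefficients, and monomials are
  finitely supported functions from variables to exponents. The type allows all elements of
  \<open>'v\<close> as variables; \<open>poly_ring V\<close> is its subring \<open>k[V]\<close>.\<close>

type_synonym ('v, 'k) mpoly = "('v \<Rightarrow>\<^sub>0 nat) \<Rightarrow>\<^sub>0 'k"

definition var :: "'v \<Rightarrow> ('v, 'k::field) mpoly" where
  "var v = Poly_Mapping.single (Poly_Mapping.single v 1) 1"

definition poly_ring :: "'v set \<Rightarrow> ('v, 'k::field) mpoly ring" where
  "poly_ring V = \<lparr>carrier = {p. \<forall>m\<in>Poly_Mapping.keys p. Poly_Mapping.keys m \<subseteq> V},
                  monoid.mult = (*), one = 1, zero = 0, add = (+)\<rparr>"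

definition mon_degree :: "('v \<Rightarrow>\<^sub>0 nat) \<Rightarrow> nat" where
  "mon_degree m = (\<Sum>v\<in>Poly_Mapping.keys m. Poly_Mapping.lookup m v)"

text \<open>The zero polynomial is homogeneous of every degree, and it is the only polynomial that is
  homogeneous of a negative degree.\<close>

definition homogeneous :: "int \<Rightarrow> ('v, 'k::field) mpoly \<Rightarrow> bool" where
  "homogeneous d p \<longleftrightarrow> (\<forall>m\<in>Poly_Mapping.keys p. int (mon_degree m) = d)"

definition irrelevant_ideal :: "'v set \<Rightarrow> ('v, 'k::field) mpoly set" where
  "irrelevant_ideal V = Idl\<^bsub>poly_ring V\<^esub> (var ` V)"


section \<open>Minimal graded free resolutions and Betti numbers\<close>

definition free_module :: "'v set \<Rightarrow> nat \<Rightarrow> ('v, 'k::field) mpoly vec set" where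
  "free_module V r = {v \<in> carrier_vec r. \<forall>i<r. v $ i \<in> carrier (poly_ring V)}"

definition matrix_over :: "'v set \<Rightarrow> nat \<Rightarrow> nat \<Rightarrow> ('v, 'k::field) mpoly mat set" where
  "matrix_over V r c =
    {A \<in> carrier_mat r c. \<forall>i<r. \<forall>j<c. A $$ (i, j) \<in> carrier (poly_ring V)}"

text \<open>\<open>b\<close>, \<open>a\<close>, \<open>\<phi>\<close> describe a minimal graded free resolution
  \<open>\<dots> \<rightarrow> F\<^sub>1 \<rightarrow> F\<^sub>0 \<rightarrow> I \<rightarrow> 0\<close> of the module \<open>I\<close> over \<open>k[V]\<close>. The free module \<open>F\<^sub>q\<close> has rank \<open>b q\<close>,
  and its \<open>j\<close>-th basis vector has degree \<open>a q j\<close>. The matrix of \<open>F\<^sub>q\<^sub>+\<^sub>1 \<rightarrow> F\<^sub>q\<close> is \<open>\<phi> (Suc q)\<close>, and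
  the \<open>1 \<times> b 0\<close> matrix \<open>\<phi> 0\<close> is the augmentation \<open>F\<^sub>0 \<rightarrow> I\<close>. The conditions
  are, in order: the maps are maps of modules over \<open>k[V]\<close>, they are homogeneous of degree 0, the
  complex is exact, and each \<open>F\<^sub>q\<^sub>+\<^sub>1\<close> maps into \<open>\<mm> F\<^sub>q\<close>, where \<open>\<mm>\<close> is the irrelevant ideal.\<close>

definition minimal_graded_free_resolution ::
  "'v set \<Rightarrow> ('v, 'k::field) mpoly set \<Rightarrow>
   (nat \<Rightarrow> nat) \<Rightarrow> (nat \<Rightarrow> nat \<Rightarrow> int) \<Rightarrow> (nat \<Rightarrow> ('v, 'k) mpoly mat) \<Rightarrow> bool" where
  "minimal_graded_free_resolution V I b a \<phi> \<longleftrightarrow>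
     \<phi> 0 \<in> matrix_over V 1 (b 0) \<and>
     (\<forall>q. \<phi> (Suc q) \<in> matrix_over V (b q) (b (Suc q))) \<and>
     (\<forall>j<b 0. homogeneous (a 0 j) (\<phi> 0 $$ (0, j))) \<and>
     (\<forall>q. \<forall>i<b q. \<forall>j<b (Suc q). homogeneous (a (Suc q) j - a q i) (\<phi> (Suc q) $$ (i, j))) \<and>
     (\<lambda>v. (\<phi> 0 *\<^sub>v v) $ 0) ` free_module V (b 0) = I \<and>
     (\<forall>q. (*\<^sub>v) (\<phi> (Suc q)) ` free_module V (b (Suc q)) =
          {v \<in> free_module V (b q). \<phi> q *\<^sub>v v = 0\<^sub>v (dim_row (\<phi> q))}) \<and>
     (\<forall>q. \<forall>i<b q. \<forall>j<b (Suc q). \<phi> (Suc q) $$ (i, j) \<in> irrelevant_ideal V)"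

text \<open>For finite \<open>V\<close> and a homogeneous ideal \<open>I\<close> of \<open>k[V]\<close> a minimal graded free resolution exists
  and its ranks are unique, so the definite description is well defined.\<close>

definition betti :: "'v set \<Rightarrow> ('v, 'k::field) mpoly set \<Rightarrow> nat \<Rightarrow> nat" where
  "betti V I q = (THE r. \<exists>b a \<phi>. minimal_graded_free_resolution V I b a \<phi> \<and> b q = r)"


section \<open>The three ideals\<close>

text \<open>The pair \<open>(i, j)\<close> is the index of the variable \<open>x\<^sub>i\<^sub>j\<close> of \<open>R\<close>, respectively \<open>y\<^sub>i\<^sub>,\<^sub>j\<close> of \<open>S\<close>; both rings
  are represented by \<open>poly_ring (xvars n)\<close>. Variable indices start at 1, but rows and
  columns of matrices start at 0.\<close>

definition xvars :: "nat \<Rightarrow> (nat \<times> nat) set" where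
  "xvars n = {1..n} \<times> {1..2}"

definition minors :: "nat \<Rightarrow> 'a::comm_ring_1 mat \<Rightarrow> 'a set" where
  "minors t A = {det (submatrix A I J) | I J.
     I \<subseteq> {..<dim_row A} \<and> J \<subseteq> {..<dim_col A} \<and> card I = t \<and> card J = t}"

definition minors_ideal :: "'v set \<Rightarrow> nat \<Rightarrow> ('v, 'k::field) mpoly mat \<Rightarrow> ('v, 'k) mpoly set" where
  "minors_ideal V t A = Idl\<^bsub>poly_ring V\<^esub> (minors t A)"

definition beside :: "'a::zero mat \<Rightarrow> 'a mat \<Rightarrow> 'a mat" where
  "beside A B = four_block_mat A B (0\<^sub>m 0 (dim_col A)) (0\<^sub>m 0 (dim_col B))"

definition D_mat :: "nat \<Rightarrow> (nat \<times> nat, 'k::field) mpoly mat" where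
  "D_mat n = mat n (2 * n) (\<lambda>(r, c). if c div 2 = r then var (r + 1, c mod 2 + 1) else 0)"

definition circulant :: "nat \<Rightarrow> nat \<Rightarrow> (nat \<times> nat, 'k::field) mpoly mat" where
  "circulant n j = mat n n (\<lambda>(r, c). var ((c + n - r) mod n + 1, j))"

definition P_mat :: "nat \<Rightarrow> (nat \<times> nat, 'k::field) mpoly mat" where
  "P_mat n = beside (circulant n 1) (circulant n 2)"

definition T_block :: "nat \<Rightarrow> nat \<Rightarrow> nat \<Rightarrow> (nat \<times> nat, 'k::field) mpoly mat" where
  "T_block n t j = mat t n (\<lambda>(r, c). if r \<le> c then var (c - r + 1, j) else 0)"

definition T_mat :: "nat \<Rightarrow> nat \<Rightarrow> (nat \<times> nat, 'k::field) mpoly mat" where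
  "T_mat n t = beside (T_block n t 1) (T_block n t 2)"

definition I_D :: "nat \<Rightarrow> nat \<Rightarrow> (nat \<times> nat, 'k::field) mpoly set" where
  "I_D n t = minors_ideal (xvars n) t (D_mat n)"

definition I_P :: "nat \<Rightarrow> nat \<Rightarrow> (nat \<times> nat, 'k::field) mpoly set" where
  "I_P n t = minors_ideal (xvars n) t (P_mat n)"

definition J_ideal :: "nat \<Rightarrow> nat \<Rightarrow> (nat \<times> nat, 'k::field) mpoly set" where
  "J_ideal n t = Idl\<^bsub>poly_ring (xvars n)\<^esub>
     ({\<Prod>r<t. T_mat n t $$ (r, c r) | c. strict_mono_on {..<t} c \<and> c ` {..<t} \<subseteq> {..<2 * n}} - {0})"

end

theory Submission
  imports "HOL-Algebra.Algebraic_Closure_Type" Defs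
begin

text \<open>Suppose that an ideal generated in degree \<open>t\<close> is the direct sum of spaces \<open>k[V - Y u] g u\<close>. If
  the sets \<open>Y u\<close> are initial segments of one list of the variables, or if multiplying \<open>g u\<close> by a
  variable in \<open>Y u\<close> only involves generators that are smaller in some order, then the ideal has a linear
  resolution, whose \<open>q\<close>-th rank is the sum over \<open>u\<close> of the number of \<open>q\<close>-element subsets of \<open>Y u\<close>. The monomial
  generators of \<open>J\<close> and of the ideal of minors of D give such decompositions, and the numbers \<open>card (Y u)\<close>
  have the same distribution for both ideals because their generating functions
  satisfy the same recurrence.

  For P, each generator \<open>u\<close> of \<open>J\<close> is the leading monomial of a minor, so the sum of the spaces formed with
  these minors and the sets \<open>Y u\<close> of \<open>J\<close> is direct. To see that the sum is the
  whole ideal of minors it suffices to bound the dimension of that ideal in each degree by the dimension for D.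
  Over an algebraically closed field, the shift that generates the circulant matrices is a root of
  \<open>z ^ n = 1\<close>. It is deformed to a root of \<open>z ^ n = 1 + \<epsilon> z\<close> with distinct eigenvalues. Both blocks of
  the deformed matrix become diagonal after multiplication by the same two constant matrices, which writes its
  minors in terms of minors of D, and dimensions do not drop under generic deformations.\<close>

section \<open>Polynomials and monomials\<close>

text \<open>Both shapes of decomposition are needed. The sets \<open>D_nonmult n u\<close> are in
  general not initial segments of one list, but products of generators with these variables can be
  rewritten explicitly, and this yields an order. For P the normal form of such a product is only
  known to exist, by a dimension count, so no order on the generators can be read off. There the
  sets are those of J, which are initial segments, and rewriting terminates whatever generators
  occur. T consists of the entries in the first \<open>t\<close> rows of P whose indices do not wrap
  around, which is why the diagonal products of T are leading monomials of minors of P. The common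
  recurrence is used twice: the ranks of the resolution and the dimensions of the graded pieces are
  both sums, over the generators, of a function of \<open>card (Y u)\<close>. The passage from an
  algebraically closed field to an arbitrary one uses that minors of P have integer coefficients and
  that the closure has a linear retraction onto the base field, which carries linear relations
  back.\<close>

abbreviation lookup where "lookup \<equiv> Poly_Mapping.lookup"
abbreviation keys where "keys \<equiv> Poly_Mapping.keys"
abbreviation single where "single \<equiv> Poly_Mapping.single"

definition polys :: "'v set \<Rightarrow> ('v, 'k::field) mpoly set" where
  "polys V = {p. \<forall>m\<in>keys p. keys m \<subseteq> V}"

lemma carrier_poly_ring: "carrier (poly_ring V) = polys V"
  by (simp add: poly_ring_def polys_def)

lemma poly_ring_simps [simp]:
  "monoid.mult (poly_ring V) = (*)" "one (poly_ring V) = 1" "zero (poly_ring V) = 0" "add (poly_ring V) = (+)"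
  by (auto simp: poly_ring_def)

lemma keys_plus_nat: "keys ((m :: 'v \<Rightarrow>\<^sub>0 nat) + m') = keys m \<union> keys m'"
  by (auto simp: in_keys_iff lookup_add)

lemma single_eq_0_iff [simp]: "single k c = 0 \<longleftrightarrow> c = 0"
  by (metis lookup_single_eq lookup_zero single_zero)

lemma polys_zero [simp]: "0 \<in> polys V"
  and polys_one [simp]: "1 \<in> polys V"
  by (auto simp: polys_def)

lemma polys_single: "keys m \<subseteq> V \<Longrightarrow> single m c \<in> polys V"
  by (auto simp: polys_def)

lemma polys_const [simp]: "single 0 c \<in> polys V"
  by (auto simp: polys_def)

lemma polys_var: "v \<in> V \<Longrightarrow> var v \<in> polys V"
  by (auto simp: polys_def var_def)

lemma polys_add: "p \<in> polys V \<Longrightarrow> q \<in> polys V \<Longrightarrow> p + q \<in> polys V"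
  using keys_add[of p q] by (fastforce simp: polys_def)

lemma polys_uminus: "p \<in> polys V \<Longrightarrow> - p \<in> polys V"
  by (auto simp: polys_def in_keys_iff)

lemma polys_diff: "p \<in> polys V \<Longrightarrow> q \<in> polys V \<Longrightarrow> p - q \<in> polys V"
  using polys_add[of p V "- q"] polys_uminus[of q V] by simp

lemma polys_mult: "p \<in> polys V \<Longrightarrow> q \<in> polys V \<Longrightarrow> p * q \<in> polys V"
  using keys_mult[of p q] by (fastforce simp: polys_def keys_plus_nat)

lemma polys_sum: "(\<And>i. i \<in> A \<Longrightarrow> f i \<in> polys V) \<Longrightarrow> sum f A \<in> polys V"
  by (induction A rule: infinite_finite_induct) (auto intro: polys_add)

lemma polys_prod: "(\<And>i. i \<in> A \<Longrightarrow> f i \<in> polys V) \<Longrightarrow> prod f A \<in> polys V"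
  by (induction A rule: infinite_finite_induct) (auto intro: polys_mult)

lemma polys_mono: "p \<in> polys V \<Longrightarrow> V \<subseteq> W \<Longrightarrow> p \<in> polys W"
  by (auto simp: polys_def)

lemmas polys_intros = polys_zero polys_one polys_add polys_uminus polys_diff polys_mult polys_sum
  polys_prod polys_var

lemma sum_singles: "(\<Sum>m\<in>keys p. single m (lookup p m)) = p"
proof (rule poly_mapping_eqI)
  fix k
  have "lookup (\<Sum>m\<in>keys p. single m (lookup p m)) k = (\<Sum>m\<in>keys p. if m = k then lookup p m else 0)"
    by (auto simp: lookup_sum lookup_single when_def intro!: sum.cong)
  also have "\<dots> = lookup p k" by (auto simp: in_keys_iff)
  finally show "lookup (\<Sum>m\<in>keys p. single m (lookup p m)) k = lookup p k" .
qed

lemma lookup_single_times: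
  fixes p :: "('v \<Rightarrow>\<^sub>0 nat) \<Rightarrow>\<^sub>0 'k::comm_ring_1"
  shows "lookup (single m c * p) (m + k) = c * lookup p k"
proof -
  have "lookup (single m c * p) (m + k) = (\<Sum>q\<in>keys p. lookup (single m c * single q (lookup p q)) (m + k))"
    by (subst (1) sum_singles[of p, symmetric]) (simp add: sum_distrib_left lookup_sum)
  also have "\<dots> = (\<Sum>q\<in>keys p. if q = k then c * lookup p q else 0)"
    by (intro sum.cong) (auto simp: mult_single lookup_single when_def)
  also have "\<dots> = c * lookup p k" by (auto simp: in_keys_iff)
  finally show ?thesis .
qed

lemma keys_single_times:
  fixes p :: "('v \<Rightarrow>\<^sub>0 nat) \<Rightarrow>\<^sub>0 'k::comm_ring_1"
  shows "keys (single m c * p) \<subseteq> (\<lambda>k. m + k) ` keys p"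
  using keys_mult[of "single m c" p] by (auto split: if_splits)

lemma lookup_mult_0:
  fixes p q :: "('v \<Rightarrow>\<^sub>0 nat) \<Rightarrow>\<^sub>0 'k::comm_ring_1"
  shows "lookup (p * q) 0 = lookup p 0 * lookup q 0"
proof -
  have *: "lookup (single m c * q) 0 = (if m = 0 then c * lookup q 0 else 0)" for m c
  proof (cases "m = 0")
    case True then show ?thesis using lookup_single_times[of 0 c q 0] by simp
  next
    case False
    then obtain v where "v \<in> keys m" using keys_eq_empty by fastforce
    then have "m + k \<noteq> 0" for k using keys_plus_nat[of m k] by force
    then show ?thesis using keys_single_times[of m c q] False by (force simp: in_keys_iff)
  qed
  have "lookup (p * q) 0 = (\<Sum>m\<in>keys p. lookup (single m (lookup p m) * q) 0)"
    by (subst (1) sum_singles[of p, symmetric]) (simp add: sum_distrib_right lookup_sum)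
  also have "\<dots> = (\<Sum>m\<in>keys p. if m = 0 then lookup p m * lookup q 0 else 0)"
    by (intro sum.cong) (auto simp: *)
  also have "\<dots> = lookup p 0 * lookup q 0" by (auto simp: in_keys_iff)
  finally show ?thesis .
qed

section \<open>Weighted degrees of monomials, used as term orders and as termination
  measures\<close>

definition wsum :: "('v \<Rightarrow> nat) \<Rightarrow> ('v \<Rightarrow>\<^sub>0 nat) \<Rightarrow> nat" where
  "wsum f m = (\<Sum>v\<in>keys m. lookup m v * f v)"

lemma wsum_superset: "finite A \<Longrightarrow> keys m \<subseteq> A \<Longrightarrow> wsum f m = (\<Sum>v\<in>A. lookup m v * f v)"
  unfolding wsum_def by (rule sum.mono_neutral_left) (auto simp: in_keys_iff)

lemma wsum_add [simp]: "wsum f (m + m') = wsum f m + wsum f m'"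
proof -
  let ?A = "keys m \<union> keys m'"
  have "wsum f (m + m') = (\<Sum>v\<in>?A. lookup (m + m') v * f v)"
    by (simp add: wsum_def keys_plus_nat)
  then show ?thesis
    by (simp add: wsum_superset[of ?A] lookup_add sum.distrib algebra_simps)
qed

lemma wsum_zero [simp]: "wsum f 0 = 0" by (simp add: wsum_def)

lemma wsum_single [simp]: "wsum f (single v c) = c * f v" by (simp add: wsum_def)

lemma wsum_sum: "wsum f (sum g A) = (\<Sum>a\<in>A. wsum f (g a))"
  by (induction A rule: infinite_finite_induct) auto

lemma mon_degree_wsum: "mon_degree m = wsum (\<lambda>_. 1) m"
  by (simp add: mon_degree_def wsum_def)

lemma mon_degree_simps [simp]:
  "mon_degree (m + m') = mon_degree m + mon_degree m'" "mon_degree 0 = 0" "mon_degree (single v c) = c"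
  by (simp_all add: mon_degree_wsum)

lemma mon_degree_sum: "mon_degree (sum g A) = (\<Sum>a\<in>A. mon_degree (g a))"
  by (simp add: mon_degree_wsum wsum_sum)

lemma mon_degree_eq_0_iff: "mon_degree m = 0 \<longleftrightarrow> m = 0"
proof
  assume "mon_degree m = 0"
  then have "\<forall>v\<in>keys m. lookup m v = 0" by (simp add: mon_degree_def)
  then show "m = 0" by (intro poly_mapping_eqI) (auto simp: in_keys_iff)
qed simp

lemma mon_degree_eq_1:
  assumes "mon_degree m = 1"
  obtains v where "m = single v 1"
proof -
  have "m \<noteq> 0" using assms by auto
  then obtain v where v: "v \<in> keys m" using keys_eq_empty by fastforce
  have "m = single v 1 + (m - single v 1)"
    using v by (intro poly_mapping_eqI) (auto simp: lookup_add lookup_minus lookup_single when_def in_keys_iff)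
  moreover from this have "mon_degree (m - single v 1) = 0"
    using assms by (metis mon_degree_simps(1,3) add_cancel_right_right)
  ultimately show ?thesis using that by (simp add: mon_degree_eq_0_iff)
qed

lemma mon_split: "v \<in> keys m \<Longrightarrow> (m :: 'v \<Rightarrow>\<^sub>0 nat) = single v 1 + (m - single v 1)"
  by (intro poly_mapping_eqI) (auto simp: lookup_add lookup_minus lookup_single when_def in_keys_iff)

lemma finite_bounded_monomials:
  assumes "finite V"
  shows "finite {m :: 'v \<Rightarrow>\<^sub>0 nat. keys m \<subseteq> V \<and> mon_degree m = d}"
proof -
  have "{m. keys m \<subseteq> V \<and> mon_degree m = d} \<subseteq>
    (\<lambda>f. Abs_poly_mapping (\<lambda>v. if v \<in> V then f v else 0)) ` (V \<rightarrow>\<^sub>E {..d})"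
  proof
    fix m :: "'v \<Rightarrow>\<^sub>0 nat" assume "m \<in> {m. keys m \<subseteq> V \<and> mon_degree m = d}"
    then have m: "keys m \<subseteq> V" "mon_degree m = d" by auto
    have le: "lookup m v \<le> d" for v
    proof (cases "v \<in> keys m")
      case True
      then show ?thesis using mon_split[OF True] m(2) member_le_sum[of v "keys m" "lookup m"]
        by (simp add: mon_degree_def)
    qed (simp add: in_keys_iff)
    have "m = Abs_poly_mapping (\<lambda>v. if v \<in> V then restrict (lookup m) V v else 0)"
    proof -
      have "(\<lambda>v. if v \<in> V then restrict (lookup m) V v else 0) = lookup m"
        using m by (auto simp: in_keys_iff fun_eq_iff)
      then show ?thesis by simp
    qed
    moreover have "restrict (lookup m) V \<in> V \<rightarrow>\<^sub>E {..d}" using le by auto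
    ultimately show "m \<in> (\<lambda>f. Abs_poly_mapping (\<lambda>v. if v \<in> V then f v else 0)) ` (V \<rightarrow>\<^sub>E {..d})"
      by blast
  qed
  moreover have "finite (V \<rightarrow>\<^sub>E {..d})" using assms by (intro finite_PiE) auto
  ultimately show ?thesis by (meson finite_imageI finite_subset)
qed

section \<open>Homogeneous components\<close>

definition hcomp :: "nat \<Rightarrow> ('v, 'k::field) mpoly \<Rightarrow> ('v, 'k) mpoly" where
  "hcomp d p = Abs_poly_mapping (\<lambda>m. if mon_degree m = d then lookup p m else 0)"

lemma lookup_hcomp: "lookup (hcomp d p) m = (if mon_degree m = d then lookup p m else 0)"
proof -
  have "finite {m. (if mon_degree m = d then lookup p m else 0) \<noteq> 0}"
    by (rule finite_subset[of _ "keys p"]) (auto simp: in_keys_iff split: if_splits)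
  then show ?thesis by (simp add: hcomp_def)
qed

lemma hcomp_add [simp]: "hcomp d (p + q) = hcomp d p + hcomp d q"
  by (rule poly_mapping_eqI) (simp add: lookup_hcomp lookup_add)

lemma hcomp_zero [simp]: "hcomp d 0 = 0"
  by (rule poly_mapping_eqI) (simp add: lookup_hcomp)

lemma hcomp_sum: "hcomp d (sum f A) = (\<Sum>a\<in>A. hcomp d (f a))"
  by (induction A rule: infinite_finite_induct) auto

lemma hcomp_single: "hcomp d (single m c) = (if mon_degree m = d then single m c else 0)"
  by (rule poly_mapping_eqI) (auto simp: lookup_hcomp lookup_single when_def)

lemma hcomp_polys: "p \<in> polys V \<Longrightarrow> hcomp d p \<in> polys V"
  by (auto simp: polys_def in_keys_iff lookup_hcomp split: if_splits)

lemma homogeneous_hcomp: "homogeneous (int d) (hcomp d p)"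
  by (auto simp: homogeneous_def in_keys_iff lookup_hcomp split: if_splits)

lemma hcomp_homogeneous: "homogeneous (int d) p \<Longrightarrow> hcomp d p = p"
  by (rule poly_mapping_eqI) (auto simp: lookup_hcomp homogeneous_def in_keys_iff)

lemma hcomp_mult:
  assumes "homogeneous (int d) h"
  shows "hcomp (d + e) (h * q) = h * hcomp e q"
proof -
  have *: "hcomp (d + e) (single m c * single m' c') = single m c * hcomp e (single m' c')"
    if "mon_degree m = d" for m m' c c'
    using that by (auto simp: mult_single hcomp_single)
  have "hcomp (d + e) (h * q) =
     (\<Sum>m\<in>keys h. \<Sum>m'\<in>keys q. hcomp (d + e) (single m (lookup h m) * single m' (lookup q m')))"
    by (subst (1) sum_singles[of h, symmetric], subst (1) sum_singles[of q, symmetric])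
       (simp only: sum_product hcomp_sum)
  also have "\<dots> = (\<Sum>m\<in>keys h. \<Sum>m'\<in>keys q. single m (lookup h m) * hcomp e (single m' (lookup q m')))"
    using assms by (intro sum.cong refl *) (auto simp: homogeneous_def)
  also have "\<dots> = (\<Sum>m\<in>keys h. single m (lookup h m)) * (\<Sum>m'\<in>keys q. hcomp e (single m' (lookup q m')))"
    by (simp only: sum_product)
  also have "\<dots> = h * hcomp e q"
    by (simp only: sum_singles hcomp_sum[symmetric])
  finally show ?thesis .
qed

lemma homogeneous_var: "homogeneous 1 (var v)"
  by (simp add: homogeneous_def var_def)

lemma homogeneous_zero [simp]: "homogeneous d 0"
  by (simp add: homogeneous_def)

lemma homogeneous_uminus: "homogeneous d p \<Longrightarrow> homogeneous d (- p)"
  by (simp add: homogeneous_def in_keys_iff)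

lemma homogeneous_add: "homogeneous d p \<Longrightarrow> homogeneous d q \<Longrightarrow> homogeneous d (p + q)"
  using keys_add[of p q] by (fastforce simp: homogeneous_def)

lemma homogeneous_diff: "homogeneous d p \<Longrightarrow> homogeneous d q \<Longrightarrow> homogeneous d (p - q)"
  using homogeneous_add[of d p "- q"] homogeneous_uminus[of d q] by simp

lemma homogeneous_sum: "(\<And>a. a \<in> A \<Longrightarrow> homogeneous d (f a)) \<Longrightarrow> homogeneous d (sum f A)"
  by (induction A rule: infinite_finite_induct) (auto intro: homogeneous_add)

lemma homogeneous_mult: "homogeneous d p \<Longrightarrow> homogeneous e q \<Longrightarrow> homogeneous (d + e) (p * q)"
  using keys_mult[of p q] by (fastforce simp: homogeneous_def)

section \<open>Ideals of \<open>poly_ring V\<close>\<close>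

lemma ring_poly_ring: "ring (poly_ring V :: ('v, 'k::field) mpoly ring)"
proof (rule ringI)
  show "abelian_group (poly_ring V :: ('v, 'k) mpoly ring)"
  proof (rule abelian_groupI)
    fix x :: "('v, 'k) mpoly" assume "x \<in> carrier (poly_ring V)"
    then show "\<exists>y\<in>carrier (poly_ring V). y \<oplus>\<^bsub>poly_ring V\<^esub> x = \<zero>\<^bsub>poly_ring V\<^esub>"
      by (intro bexI[of _ "- x"]) (auto simp: carrier_poly_ring polys_uminus)
  qed (auto simp: carrier_poly_ring polys_add algebra_simps)
  show "Group.monoid (poly_ring V :: ('v, 'k) mpoly ring)"
    by (rule Group.monoidI) (auto simp: carrier_poly_ring polys_mult algebra_simps)
qed (auto simp: algebra_simps)

lemma a_inv_poly_ring: "p \<in> polys V \<Longrightarrow> \<ominus>\<^bsub>poly_ring V\<^esub> p = - p"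
  by (intro abelian_group.minus_equality ring.is_abelian_group ring_poly_ring)
     (auto simp: carrier_poly_ring polys_uminus)

lemma Idl_subsetI:
  assumes "0 \<in> M" "\<And>p q. p \<in> M \<Longrightarrow> q \<in> M \<Longrightarrow> p + q \<in> M"
    and "\<And>p q. p \<in> polys V \<Longrightarrow> q \<in> M \<Longrightarrow> p * q \<in> M"
    and "S \<subseteq> M" "M \<subseteq> polys V"
  shows "Idl\<^bsub>poly_ring V\<^esub> S \<subseteq> M"
proof (rule ring.genideal_minimal[OF ring_poly_ring])
  have "- p \<in> M" if "p \<in> M" for p
    using assms(3)[of "- 1" p] that by (simp add: polys_uminus)
  moreover have "inv\<^bsub>add_monoid (poly_ring V)\<^esub> p = - p" if "p \<in> M" for p
    using a_inv_poly_ring[of p V] assms(5) that by (auto simp: a_inv_def)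
  ultimately have "subgroup M (add_monoid (poly_ring V))"
    using assms
    by (intro group.subgroupI abelian_group.a_group ring.is_abelian_group ring_poly_ring)
       (auto simp: carrier_poly_ring)
  moreover have "q * p \<in> M" if "p \<in> polys V" "q \<in> M" for p q
    using assms(3)[OF that] by (simp add: mult.commute)
  ultimately show "ideal M (poly_ring V)"
    using assms(3) by (intro idealI[OF ring_poly_ring]) (simp_all add: carrier_poly_ring)
qed (use assms in simp)

context
  fixes V :: "'v set" and S :: "('v, 'k::field) mpoly set"
  assumes S: "S \<subseteq> polys V"
begin

lemma ideal_Idl_poly: "ideal (Idl\<^bsub>poly_ring V\<^esub> S) (poly_ring V)"
  using ring.genideal_ideal[OF ring_poly_ring, of S V] S by (simp add: carrier_poly_ring)

lemma Idl_self: "p \<in> S \<Longrightarrow> p \<in> Idl\<^bsub>poly_ring V\<^esub> S"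
  using ring.genideal_self[OF ring_poly_ring, of S V] S by (auto simp: carrier_poly_ring)

lemma Idl_zero: "0 \<in> Idl\<^bsub>poly_ring V\<^esub> S"
  using additive_subgroup.zero_closed[OF ideal.axioms(1)[OF ideal_Idl_poly]] by simp

lemma Idl_add: "p \<in> Idl\<^bsub>poly_ring V\<^esub> S \<Longrightarrow> q \<in> Idl\<^bsub>poly_ring V\<^esub> S \<Longrightarrow> p + q \<in> Idl\<^bsub>poly_ring V\<^esub> S"
  using additive_subgroup.a_closed[OF ideal.axioms(1)[OF ideal_Idl_poly], of p q] by simp

lemma Idl_mult: "p \<in> polys V \<Longrightarrow> q \<in> Idl\<^bsub>poly_ring V\<^esub> S \<Longrightarrow> p * q \<in> Idl\<^bsub>poly_ring V\<^esub> S"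
  using ideal.I_l_closed[OF ideal_Idl_poly, of q p] by (simp add: carrier_poly_ring)

lemma Idl_sum: "(\<And>i. i \<in> A \<Longrightarrow> f i \<in> Idl\<^bsub>poly_ring V\<^esub> S) \<Longrightarrow> sum f A \<in> Idl\<^bsub>poly_ring V\<^esub> S"
  by (induction A rule: infinite_finite_induct) (auto intro: Idl_add Idl_zero)

end

text \<open>Taking the constant coefficient is the reduction modulo the irrelevant ideal; it turns
  the differentials of a minimal resolution into zero matrices.\<close>

lemma irrelevant_ideal_const:
  assumes "p \<in> irrelevant_ideal V"
  shows "lookup p 0 = 0"
proof -
  have "irrelevant_ideal V \<subseteq> {p \<in> polys V. lookup p 0 = 0}"
    unfolding irrelevant_ideal_def
    by (rule Idl_subsetI)
       (auto simp: polys_intros lookup_add lookup_mult_0 var_def lookup_single when_def polys_single)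
  then show ?thesis using assms by blast
qed

text \<open>Source of minimality later on: all differentials constructed below have linear
  entries.\<close>

lemma linear_form_irrelevant:
  assumes "p \<in> polys V" "homogeneous 1 p"
  shows "p \<in> irrelevant_ideal V"
proof -
  have "single m (lookup p m) \<in> irrelevant_ideal V" if m: "m \<in> keys p" for m
  proof -
    from assms(2) m have "mon_degree m = 1" by (auto simp: homogeneous_def)
    then obtain v where v: "m = single v 1" by (rule mon_degree_eq_1)
    then have "v \<in> V" using assms(1) m by (auto simp: polys_def)
    then have "single 0 (lookup p m) * var v \<in> irrelevant_ideal V"
      unfolding irrelevant_ideal_def by (intro Idl_mult Idl_self) (auto intro: polys_var)
    then show ?thesis by (simp add: var_def mult_single v)
  qed
  then have "(\<Sum>m\<in>keys p. single m (lookup p m)) \<in> irrelevant_ideal V"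
    unfolding irrelevant_ideal_def by (intro Idl_sum) (auto intro: polys_var)
  then show ?thesis by (simp add: sum_singles)
qed

section \<open>Uniqueness of the ranks of a minimal resolution\<close>

lemma matrix_overI:
  assumes "A \<in> carrier_mat r c" "\<And>i j. i < r \<Longrightarrow> j < c \<Longrightarrow> A $$ (i, j) \<in> polys V"
  shows "A \<in> matrix_over V r c"
  using assms by (auto simp: matrix_over_def carrier_poly_ring)

lemma matrix_over_carrier: "A \<in> matrix_over V r c \<Longrightarrow> A \<in> carrier_mat r c"
  by (auto simp: matrix_over_def)

lemma matrix_over_entry: "A \<in> matrix_over V r c \<Longrightarrow> i < r \<Longrightarrow> j < c \<Longrightarrow> A $$ (i, j) \<in> polys V"
  by (auto simp: matrix_over_def carrier_poly_ring)

lemma free_moduleI: "v \<in> carrier_vec r \<Longrightarrow> (\<And>i. i < r \<Longrightarrow> v $ i \<in> polys V) \<Longrightarrow> v \<in> free_module V r"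
  by (auto simp: free_module_def carrier_poly_ring)

lemma free_module_carrier: "v \<in> free_module V r \<Longrightarrow> v \<in> carrier_vec r"
  by (auto simp: free_module_def)

lemma free_module_entry: "v \<in> free_module V r \<Longrightarrow> i < r \<Longrightarrow> v $ i \<in> polys V"
  by (auto simp: free_module_def carrier_poly_ring)

lemma matrix_over_mult:
  assumes "A \<in> matrix_over V r c" "B \<in> matrix_over V c d"
  shows "A * B \<in> matrix_over V r d"
proof (rule matrix_overI)
  note A = matrix_over_carrier[OF assms(1)] and B = matrix_over_carrier[OF assms(2)]
  show "A * B \<in> carrier_mat r d" using A B by simp
  fix i j assume ij: "i < r" "j < d"
  have "(A * B) $$ (i, j) = (\<Sum>l<c. A $$ (i, l) * B $$ (l, j))"
    using A B ij by (auto simp: scalar_prod_def atLeast0LessThan)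
  also have "\<dots> \<in> polys V"
    using ij assms by (intro polys_sum polys_mult) (auto simp: matrix_over_entry)
  finally show "(A * B) $$ (i, j) \<in> polys V" .
qed

lemma matrix_over_minus:
  "A \<in> matrix_over V r c \<Longrightarrow> B \<in> matrix_over V r c \<Longrightarrow> A - B \<in> matrix_over V r c"
  by (intro matrix_overI) (auto simp: matrix_over_def carrier_poly_ring intro!: polys_diff)

lemma matrix_over_one: "1\<^sub>m r \<in> matrix_over V r r"
  by (intro matrix_overI) (auto simp: one_mat_def)

lemma col_free_module: "A \<in> matrix_over V r c \<Longrightarrow> j < c \<Longrightarrow> col A j \<in> free_module V r"
  by (intro free_moduleI) (auto simp: matrix_over_def carrier_poly_ring)

lemma unit_vec_free_module: "unit_vec r j \<in> free_module V r"
  by (intro free_moduleI) (auto simp: unit_vec_def)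

text \<open>Projectivity of a free module in matrix form: the columns are lifted one at a
  time.\<close>

lemma factor_through:
  assumes A: "A \<in> matrix_over V r c" and B: "B \<in> matrix_over V r d"
    and im: "\<And>j. j < c \<Longrightarrow> col A j \<in> (*\<^sub>v) B ` free_module V d"
  obtains C where "C \<in> matrix_over V d c" "A = B * C"
proof -
  have "\<forall>j. \<exists>w. j < c \<longrightarrow> w \<in> free_module V d \<and> col A j = B *\<^sub>v w" using im by blast
  then obtain w where w: "\<And>j. j < c \<Longrightarrow> w j \<in> free_module V d" "\<And>j. j < c \<Longrightarrow> col A j = B *\<^sub>v w j"
    by metis
  define C where "C = mat d c (\<lambda>(i, j). w j $ i)"
  have colC: "col C j = w j" if "j < c" for j
    using free_module_carrier[OF w(1)[OF that]] that by (intro eq_vecI) (auto simp: C_def)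
  note AB = matrix_over_carrier[OF A] matrix_over_carrier[OF B]
  have "C \<in> matrix_over V d c"
    using w(1) by (intro matrix_overI) (auto simp: C_def intro: free_module_entry)
  moreover have "A = B * C"
  proof (rule eq_matI)
    fix i j assume "i < dim_row (B * C)" "j < dim_col (B * C)"
    then have ij: "i < r" "j < c" using AB by (auto simp: C_def)
    have "A $$ (i, j) = col A j $ i" using ij AB by simp
    also have "\<dots> = (B *\<^sub>v col C j) $ i" using ij w(2) colC by simp
    also have "\<dots> = (B * C) $$ (i, j)" using ij AB by (simp add: C_def)
    finally show "A $$ (i, j) = (B * C) $$ (i, j)" .
  qed (use AB in \<open>auto simp: C_def\<close>)
  ultimately show ?thesis using that by blast
qed

lemma col_in_image:
  assumes A: "A \<in> matrix_over V r c" and j: "j < c"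
  shows "col A j \<in> (*\<^sub>v) A ` free_module V c"
proof (rule image_eqI)
  note cA = matrix_over_carrier[OF A]
  show "col A j = A *\<^sub>v unit_vec c j"
  proof (rule eq_vecI)
    fix i assume "i < dim_vec (A *\<^sub>v unit_vec c j)"
    then have i: "i < r" using cA by simp
    have "row A i \<in> carrier_vec c" using cA by (simp add: carrier_vecI)
    then have "row A i \<bullet> unit_vec c j = row A i $ j" using scalar_prod_right_unit j by blast
    then show "col A j $ i = (A *\<^sub>v unit_vec c j) $ i" using cA i j by simp
  qed (use cA in simp)
qed (rule unit_vec_free_module)

lemma mult_mat_col: "A \<in> carrier_mat r c \<Longrightarrow> B \<in> carrier_mat c d \<Longrightarrow> j < d \<Longrightarrow>
    col (A * B) j = A *\<^sub>v col B j"
  by (intro eq_vecI) auto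

context
  fixes V :: "'v set" and I :: "('v, 'k::field) mpoly set" and b a \<phi>
  assumes res: "minimal_graded_free_resolution V I b a \<phi>"
begin

lemma resolution_zero: "\<phi> 0 \<in> matrix_over V 1 (b 0)"
  and resolution_Suc: "\<phi> (Suc q) \<in> matrix_over V (b q) (b (Suc q))"
  and resolution_image: "(\<lambda>v. (\<phi> 0 *\<^sub>v v) $ 0) ` free_module V (b 0) = I"
  and resolution_exact: "(*\<^sub>v) (\<phi> (Suc q)) ` free_module V (b (Suc q)) =
          {v \<in> free_module V (b q). \<phi> q *\<^sub>v v = 0\<^sub>v (dim_row (\<phi> q))}"
  and resolution_minimal: "i < b q \<Longrightarrow> j < b (Suc q) \<Longrightarrow> \<phi> (Suc q) $$ (i, j) \<in> irrelevant_ideal V"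
  using res by (auto simp: minimal_graded_free_resolution_def)

lemma resolution_dim_col: "\<phi> q \<in> matrix_over V (dim_row (\<phi> q)) (b q)"
  using resolution_zero resolution_Suc[of "q - 1"] by (cases q) (auto simp: matrix_over_def)

text \<open>Exactness read columnwise: each column of \<open>A\<close> is a cycle, hence a
  boundary.\<close>

lemma resolution_factor:
  assumes A: "A \<in> matrix_over V (b q) c" and z: "\<phi> q * A = 0\<^sub>m (dim_row (\<phi> q)) c"
  obtains C where "C \<in> matrix_over V (b (Suc q)) c" "A = \<phi> (Suc q) * C"
proof (rule factor_through[OF A resolution_Suc])
  fix j assume j: "j < c"
  have "\<phi> q *\<^sub>v col A j = col (\<phi> q * A) j"
    using mult_mat_col[OF matrix_over_carrier[OF resolution_dim_col] matrix_over_carrier[OF A] j] by simp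
  also have "\<dots> = 0\<^sub>v (dim_row (\<phi> q))" using j by (simp add: z)
  finally show "col A j \<in> (*\<^sub>v) (\<phi> (Suc q)) ` free_module V (b (Suc q))"
    using col_free_module[OF A j] by (simp add: resolution_exact)
qed

lemma resolution_complex: "\<phi> q * \<phi> (Suc q) = 0\<^sub>m (dim_row (\<phi> q)) (b (Suc q))"
proof -
  note c = matrix_over_carrier[OF resolution_dim_col[of q]] matrix_over_carrier[OF resolution_Suc[of q]]
  have "col (\<phi> q * \<phi> (Suc q)) j = 0\<^sub>v (dim_row (\<phi> q))" if j: "j < b (Suc q)" for j
  proof -
    have "col (\<phi> (Suc q)) j \<in> {v \<in> free_module V (b q). \<phi> q *\<^sub>v v = 0\<^sub>v (dim_row (\<phi> q))}"
      using col_in_image[OF resolution_Suc j] unfolding resolution_exact .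
    then show ?thesis using mult_mat_col[OF c j] by simp
  qed
  moreover have "dim_col (\<phi> (Suc q)) = b (Suc q)" using c(2) by (rule carrier_matD)
  ultimately show ?thesis by (intro mat_col_eqI) simp_all
qed

end

text \<open>If \<open>c < b\<close>, both factors can be padded with zeros to square matrices
  without changing the product. The padded \<open>B\<close> has a zero row and so determinant 0,
  although the product is the identity.\<close>

lemma field_mat_inverse_le:
  fixes A B :: "'k::field mat"
  assumes A: "A \<in> carrier_mat b c" and B: "B \<in> carrier_mat c b" and AB: "A * B = 1\<^sub>m b"
  shows "b \<le> c"
proof (rule ccontr)
  assume "\<not> b \<le> c"
  then have cb: "c < b" by simp
  define A' where "A' = mat b b (\<lambda>(i, j). if j < c then A $$ (i, j) else 0)"
  define B' where "B' = mat b b (\<lambda>(i, j). if i < c then B $$ (i, j) else 0)"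
  have "A' * B' = 1\<^sub>m b"
  proof (rule eq_matI)
    fix i j assume "i < dim_row (1\<^sub>m b :: 'k mat)" "j < dim_col (1\<^sub>m b :: 'k mat)"
    then have ij: "i < b" "j < b" by auto
    have "(A' * B') $$ (i, j) = (\<Sum>l\<in>{0..<b}. A' $$ (i, l) * B' $$ (l, j))"
      using ij by (simp add: A'_def B'_def scalar_prod_def)
    also have "\<dots> = (\<Sum>l\<in>{0..<c}. A $$ (i, l) * B $$ (l, j))"
      using ij cb by (intro sum.mono_neutral_cong_right) (auto simp: A'_def B'_def)
    also have "\<dots> = (A * B) $$ (i, j)" using A B ij by (simp add: scalar_prod_def)
    finally show "(A' * B') $$ (i, j) = 1\<^sub>m b $$ (i, j)" by (simp add: AB)
  qed (auto simp: A'_def B'_def)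
  moreover have "det B' = 0"
  proof -
    define w where "w i = vec b (\<lambda>j. B' $$ (i, j))" for i
    have "B' = mat\<^sub>r b b (\<lambda>i. if i = c then 0\<^sub>v b else w i)"
      by (rule eq_matI) (auto simp: w_def B'_def)
    moreover have "det (mat\<^sub>r b b (\<lambda>i. if i = c then 0\<^sub>v b else w i)) = 0"
      by (rule det_row_0) (use cb in \<open>auto simp: w_def\<close>)
    ultimately show ?thesis by metis
  qed
  moreover have "det (A' * B') = det A' * det B'"
    by (rule det_mult) (auto simp: A'_def B'_def)
  ultimately show False by simp
qed

lemma comm_ring_hom_const:
  "comm_ring_hom (\<lambda>p :: ('v \<Rightarrow>\<^sub>0 nat) \<Rightarrow>\<^sub>0 'k::field. lookup p 0)"
  by unfold_locales (auto simp: lookup_add lookup_mult_0)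

section \<open>Comparison maps and homotopies between resolutions\<close>

lemma resolution_lift:
  assumes F: "minimal_graded_free_resolution V I b a \<phi>"
    and G: "minimal_graded_free_resolution V I b' a' \<psi>"
  shows "\<exists>\<alpha>. (\<forall>q. \<alpha> q \<in> matrix_over V (b' q) (b q)) \<and> \<psi> 0 * \<alpha> 0 = \<phi> 0 \<and>
    (\<forall>q. \<psi> (Suc q) * \<alpha> (Suc q) = \<alpha> q * \<phi> (Suc q))"
proof -
  have "\<exists>C. C \<in> matrix_over V (b' 0) (b 0) \<and> \<phi> 0 = \<psi> 0 * C"
  proof (rule factor_through[OF resolution_zero[OF F] resolution_zero[OF G]])
    fix j assume j: "j < b 0"
    note c = matrix_over_carrier[OF resolution_zero[OF F]] matrix_over_carrier[OF resolution_zero[OF G]]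
    obtain u where u: "u \<in> free_module V (b 0)" "col (\<phi> 0) j = \<phi> 0 *\<^sub>v u"
      using col_in_image[OF resolution_zero[OF F] j] by (elim imageE)
    then have "col (\<phi> 0) j $ 0 \<in> I"
      unfolding resolution_image[OF F, symmetric] by (intro image_eqI[of _ _ u]) simp_all
    then obtain w where w: "w \<in> free_module V (b' 0)" "col (\<phi> 0) j $ 0 = (\<psi> 0 *\<^sub>v w) $ 0"
      unfolding resolution_image[OF G, symmetric] by (elim imageE)
    have "col (\<phi> 0) j = \<psi> 0 *\<^sub>v w"
    proof (rule eq_vecI)
      fix i assume "i < dim_vec (\<psi> 0 *\<^sub>v w)"
      then have "i = 0" using c(2) by simp
      then show "col (\<phi> 0) j $ i = (\<psi> 0 *\<^sub>v w) $ i" using w(2) by (simp only:)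
    qed (use carrier_matD[OF c(1)] carrier_matD[OF c(2)] in simp)
    then show "col (\<phi> 0) j \<in> (*\<^sub>v) (\<psi> 0) ` free_module V (b' 0)"
      using w(1) by (rule image_eqI)
  qed blast
  then obtain \<alpha>0 where \<alpha>0: "\<alpha>0 \<in> matrix_over V (b' 0) (b 0)" "\<phi> 0 = \<psi> 0 * \<alpha>0" by (elim exE conjE)
  \<comment> \<open>The second conjunct says that \<open>A * \<phi> (Suc q)\<close> consists of
    cycles, which is what the next lift needs. The third remembers the choice at level 0, which the
    choice principle would otherwise forget.\<close>
  define P where "P q A \<longleftrightarrow> A \<in> matrix_over V (b' q) (b q) \<and>
      \<psi> q * A * \<phi> (Suc q) = 0\<^sub>m (dim_row (\<psi> q)) (b (Suc q)) \<and> (q = 0 \<longrightarrow> \<psi> 0 * A = \<phi> 0)" for q A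
  have "\<exists>f. \<forall>q. P q (f q) \<and> \<psi> (Suc q) * f (Suc q) = f q * \<phi> (Suc q)"
  proof (rule dependent_nat_choice)
    have "dim_row (\<phi> 0) = dim_row (\<psi> 0)"
      using resolution_zero[OF F] resolution_zero[OF G] by (auto simp: matrix_over_def)
    then have "P 0 \<alpha>0"
      using \<alpha>0 resolution_complex[OF F, of 0] unfolding P_def by (simp only: simp_thms)
    then show "\<exists>x. P 0 x" by (rule exI)
  next
    fix A q assume P: "P q A"
    note c = matrix_over_carrier[OF resolution_Suc[OF F, of q]]
      matrix_over_carrier[OF resolution_Suc[OF F, of "Suc q"]]
      matrix_over_carrier[OF resolution_dim_col[OF G, of q]]
      matrix_over_carrier[OF resolution_Suc[OF G, of q]]
    from P have A: "A \<in> matrix_over V (b' q) (b q)" by (simp add: P_def)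
    note cA = matrix_over_carrier[OF A]
    have "\<psi> q * (A * \<phi> (Suc q)) = 0\<^sub>m (dim_row (\<psi> q)) (b (Suc q))"
      using P assoc_mult_mat[OF c(3) cA c(1)] by (simp add: P_def)
    then obtain C where C: "C \<in> matrix_over V (b' (Suc q)) (b (Suc q))" "A * \<phi> (Suc q) = \<psi> (Suc q) * C"
      by (rule resolution_factor[OF G matrix_over_mult[OF A resolution_Suc[OF F]]])
    have "\<psi> (Suc q) * C * \<phi> (Suc (Suc q)) = A * (\<phi> (Suc q) * \<phi> (Suc (Suc q)))"
      using assoc_mult_mat[OF cA c(1) c(2)] unfolding C(2)[symmetric] .
    also have "\<dots> = 0\<^sub>m (dim_row (\<psi> (Suc q))) (b (Suc (Suc q)))"
      using resolution_complex[OF F, of "Suc q"] cA c by simp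
    finally have "P (Suc q) C" using C(1) by (simp add: P_def)
    then show "\<exists>C. P (Suc q) C \<and> \<psi> (Suc q) * C = A * \<phi> (Suc q)"
      using C(2) by (intro exI[of _ C]) simp
  qed
  then obtain f where "\<forall>q. P q (f q) \<and> \<psi> (Suc q) * f (Suc q) = f q * \<phi> (Suc q)" ..
  then show ?thesis unfolding P_def by (intro exI[of _ f]) simp
qed

lemma mat_diff_eqD:
  fixes A :: "'a::ab_group_add mat"
  assumes "A \<in> carrier_mat r c" "B \<in> carrier_mat r c" "C \<in> carrier_mat r c"
  shows "A - B = C \<Longrightarrow> A = C + B" "A = C + B \<Longrightarrow> A - C = B"
proof -
  assume "A - B = C"
  then show "A = C + B"
    using assms by (intro eq_matI) auto
next
  assume "A = C + B"
  then show "A - C = B"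
    using assms by (intro eq_matI) auto
qed

text \<open>The remainder of \<open>\<gamma> - 1\<close> after subtracting \<open>h * \<phi>\<close>
  is mapped by \<open>\<phi>\<close> to a multiple of the remainder one level below. Once that
  multiple vanishes, the upper remainder consists of cycles and can be lifted.\<close>

lemma homotopy_step:
  fixes \<phi> :: "'a::comm_ring_1 mat"
  assumes \<phi>: "\<phi> \<in> carrier_mat m n" and h: "h \<in> carrier_mat n m"
    and \<gamma>: "\<gamma> \<in> carrier_mat n n" and \<gamma>': "\<gamma>' \<in> carrier_mat m m"
    and comm: "\<phi> * \<gamma> = \<gamma>' * \<phi>"
  shows "\<phi> * (\<gamma> - 1\<^sub>m n - h * \<phi>) = (\<gamma>' - 1\<^sub>m m - \<phi> * h) * \<phi>"
proof -
  have h\<phi>: "h * \<phi> \<in> carrier_mat n n" and \<phi>h: "\<phi> * h \<in> carrier_mat m m"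
    using \<phi> h by auto
  have d: "\<gamma> - 1\<^sub>m n \<in> carrier_mat n n" and d': "\<gamma>' - 1\<^sub>m m \<in> carrier_mat m m"
    using \<gamma> \<gamma>' by auto
  have "\<phi> * (\<gamma> - 1\<^sub>m n - h * \<phi>) = \<phi> * \<gamma> - \<phi> - \<phi> * (h * \<phi>)"
    by (simp only: mult_minus_distrib_mat[OF \<phi> d h\<phi>] mult_minus_distrib_mat[OF \<phi> \<gamma> one_carrier_mat]
        right_mult_one_mat[OF \<phi>])
  moreover have "(\<gamma>' - 1\<^sub>m m - \<phi> * h) * \<phi> = \<gamma>' * \<phi> - \<phi> - \<phi> * h * \<phi>"
    by (simp only: minus_mult_distrib_mat[OF d' \<phi>h \<phi>] minus_mult_distrib_mat[OF \<gamma>' one_carrier_mat \<phi>]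
        left_mult_one_mat[OF \<phi>])
  ultimately show ?thesis
    by (simp only: comm assoc_mult_mat[OF \<phi> h \<phi>])
qed

text \<open>A chain map that covers the identity of the ideal differs from the identity by a
  null-homotopic map; the homotopy is built upwards from level 0.\<close>

lemma resolution_homotopy:
  assumes F: "minimal_graded_free_resolution V I b a \<phi>"
    and \<gamma>: "\<And>q. \<gamma> q \<in> matrix_over V (b q) (b q)" "\<phi> 0 * \<gamma> 0 = \<phi> 0"
    and comm: "\<And>q. \<phi> (Suc q) * \<gamma> (Suc q) = \<gamma> q * \<phi> (Suc q)"
  shows "\<exists>h. (\<forall>q. h q \<in> matrix_over V (b (Suc q)) (b q)) \<and>
    \<gamma> 0 - 1\<^sub>m (b 0) = \<phi> (Suc 0) * h 0 \<and>
    (\<forall>q. \<gamma> (Suc q) - 1\<^sub>m (b (Suc q)) = \<phi> (Suc (Suc q)) * h (Suc q) + h q * \<phi> (Suc q))"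
proof -
  note c = matrix_over_carrier[OF resolution_dim_col[OF F]]
  note cS = matrix_over_carrier[OF resolution_Suc[OF F]]
  note c\<gamma> = matrix_over_carrier[OF \<gamma>(1)]
  have "\<phi> 0 * (\<gamma> 0 - 1\<^sub>m (b 0)) = \<phi> 0 - \<phi> 0"
    by (simp only: mult_minus_distrib_mat[OF c c\<gamma> one_carrier_mat] right_mult_one_mat[OF c] \<gamma>(2))
  also have "\<dots> = 0\<^sub>m (dim_row (\<phi> 0)) (b 0)" by (rule minus_r_inv_mat[OF c])
  finally obtain h0 where h0: "h0 \<in> matrix_over V (b (Suc 0)) (b 0)" "\<gamma> 0 - 1\<^sub>m (b 0) = \<phi> (Suc 0) * h0"
    by (rule resolution_factor[OF F matrix_over_minus[OF \<gamma>(1) matrix_over_one]])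
  \<comment> \<open>The remainder left at level \<open>q\<close> must vanish after composition with
    \<open>\<phi> (Suc q)\<close>; by \<open>homotopy_step\<close> this is the cycle condition one
    level higher.\<close>
  define P where "P q h \<longleftrightarrow> h \<in> matrix_over V (b (Suc q)) (b q) \<and>
     (\<gamma> q - 1\<^sub>m (b q) - \<phi> (Suc q) * h) * \<phi> (Suc q) = 0\<^sub>m (b q) (b (Suc q)) \<and>
     (q = 0 \<longrightarrow> \<gamma> 0 - 1\<^sub>m (b 0) = \<phi> (Suc 0) * h)" for q h
  have "\<exists>h. \<forall>q. P q (h q) \<and>
     \<gamma> (Suc q) - 1\<^sub>m (b (Suc q)) = \<phi> (Suc (Suc q)) * h (Suc q) + h q * \<phi> (Suc q)"
  proof (rule dependent_nat_choice)
    have "(\<gamma> 0 - 1\<^sub>m (b 0) - \<phi> (Suc 0) * h0) = 0\<^sub>m (b 0) (b 0)"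
      unfolding h0(2)
      by (rule minus_r_inv_mat[OF mult_carrier_mat[OF cS matrix_over_carrier[OF h0(1)]]])
    moreover have "0\<^sub>m (b 0) (b 0) * \<phi> (Suc 0) = 0\<^sub>m (b 0) (b (Suc 0))"
      by (rule left_mult_zero_mat[OF cS])
    ultimately have "P 0 h0" using h0 unfolding P_def by simp
    then show "\<exists>x. P 0 x" by (rule exI)
  next
    fix h q assume P: "P q h"
    then have h: "h \<in> matrix_over V (b (Suc q)) (b q)" by (simp add: P_def)
    note ch = matrix_over_carrier[OF h]
    let ?D = "\<gamma> (Suc q) - 1\<^sub>m (b (Suc q)) - h * \<phi> (Suc q)"
    have D: "?D \<in> matrix_over V (b (Suc q)) (b (Suc q))"
      using \<gamma>(1) matrix_over_one h resolution_Suc[OF F] by (intro matrix_over_minus matrix_over_mult)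
    have "\<phi> (Suc q) * ?D = (\<gamma> q - 1\<^sub>m (b q) - \<phi> (Suc q) * h) * \<phi> (Suc q)"
      by (rule homotopy_step[OF cS ch c\<gamma> c\<gamma> comm])
    also have "\<dots> = 0\<^sub>m (dim_row (\<phi> (Suc q))) (b (Suc q))"
      using P carrier_matD(1)[OF cS[of q]] unfolding P_def by simp
    finally obtain C where C: "C \<in> matrix_over V (b (Suc (Suc q))) (b (Suc q))" "?D = \<phi> (Suc (Suc q)) * C"
      by (rule resolution_factor[OF F D])
    note cC = matrix_over_carrier[OF C(1)]
    have cd: "\<gamma> (Suc q) - 1\<^sub>m (b (Suc q)) \<in> carrier_mat (b (Suc q)) (b (Suc q))"
      "h * \<phi> (Suc q) \<in> carrier_mat (b (Suc q)) (b (Suc q))"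
      "\<phi> (Suc (Suc q)) * C \<in> carrier_mat (b (Suc q)) (b (Suc q))"
      by (intro minus_carrier_mat one_carrier_mat mult_carrier_mat[OF ch cS] mult_carrier_mat[OF cS cC])+
    note eq = mat_diff_eqD(1)[OF cd C(2)]
    have "(h * \<phi> (Suc q)) * \<phi> (Suc (Suc q)) = h * (\<phi> (Suc q) * \<phi> (Suc (Suc q)))"
      by (rule assoc_mult_mat[OF ch cS cS])
    also have "\<dots> = 0\<^sub>m (b (Suc q)) (b (Suc (Suc q)))"
      using ch carrier_matD(1)[OF cS[of q]] unfolding resolution_complex[OF F, of "Suc q"] by simp
    finally have "P (Suc q) C"
      using C(1) unfolding P_def mat_diff_eqD(2)[OF cd eq] by simp
    then show "\<exists>C. P (Suc q) C \<and>
        \<gamma> (Suc q) - 1\<^sub>m (b (Suc q)) = \<phi> (Suc (Suc q)) * C + h * \<phi> (Suc q)"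
      using eq by (intro exI[of _ C] conjI)
  qed
  then obtain h where "\<forall>q. P q (h q) \<and>
     \<gamma> (Suc q) - 1\<^sub>m (b (Suc q)) = \<phi> (Suc (Suc q)) * h (Suc q) + h q * \<phi> (Suc q)" ..
  then show ?thesis unfolding P_def by (intro exI[of _ h]) simp
qed

text \<open>Composing the two comparison maps gives a chain map homotopic to the identity. By minimality
  the homotopy vanishes modulo the irrelevant ideal.\<close>

lemma resolution_rank_le:
  assumes F: "minimal_graded_free_resolution V I b a \<phi>"
    and G: "minimal_graded_free_resolution V I b' a' \<psi>"
  shows "b q \<le> b' q"
proof -
  from resolution_lift[OF F G]
  obtain \<alpha> where "(\<forall>q. \<alpha> q \<in> matrix_over V (b' q) (b q)) \<and> \<psi> 0 * \<alpha> 0 = \<phi> 0 \<and>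
    (\<forall>q. \<psi> (Suc q) * \<alpha> (Suc q) = \<alpha> q * \<phi> (Suc q))" ..
  note \<alpha> = this[THEN conjunct1, rule_format] this[THEN conjunct2, THEN conjunct1]
    this[THEN conjunct2, THEN conjunct2, rule_format]
  from resolution_lift[OF G F]
  obtain \<beta> where "(\<forall>q. \<beta> q \<in> matrix_over V (b q) (b' q)) \<and> \<phi> 0 * \<beta> 0 = \<psi> 0 \<and>
    (\<forall>q. \<phi> (Suc q) * \<beta> (Suc q) = \<beta> q * \<psi> (Suc q))" ..
  note \<beta> = this[THEN conjunct1, rule_format] this[THEN conjunct2, THEN conjunct1]
    this[THEN conjunct2, THEN conjunct2, rule_format]
  note c\<alpha> = matrix_over_carrier[OF \<alpha>(1)] and c\<beta> = matrix_over_carrier[OF \<beta>(1)]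
  note c\<phi> = matrix_over_carrier[OF resolution_Suc[OF F]]
    and c\<psi> = matrix_over_carrier[OF resolution_Suc[OF G]]
  have \<gamma>1: "\<beta> q * \<alpha> q \<in> matrix_over V (b q) (b q)" for q
      using \<alpha>(1) \<beta>(1) by (rule matrix_over_mult[rotated])
  have \<gamma>2: "\<phi> 0 * (\<beta> 0 * \<alpha> 0) = \<phi> 0"
      using assoc_mult_mat[OF matrix_over_carrier[OF resolution_zero[OF F]] c\<beta> c\<alpha>] \<alpha>(2) \<beta>(2) by simp
  have \<gamma>3: "\<phi> (Suc q) * (\<beta> (Suc q) * \<alpha> (Suc q)) = \<beta> q * \<alpha> q * \<phi> (Suc q)" for q
    proof -
      have "\<phi> (Suc q) * (\<beta> (Suc q) * \<alpha> (Suc q)) = \<beta> q * \<psi> (Suc q) * \<alpha> (Suc q)"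
        using assoc_mult_mat[OF c\<phi> c\<beta> c\<alpha>] \<beta>(3) by simp
      also have "\<dots> = \<beta> q * (\<alpha> q * \<phi> (Suc q))"
        using assoc_mult_mat[OF c\<beta> c\<psi> c\<alpha>] \<alpha>(3) by simp
      also have "\<dots> = \<beta> q * \<alpha> q * \<phi> (Suc q)"
        using assoc_mult_mat[OF c\<beta> c\<alpha> c\<phi>] by simp
      finally show ?thesis .
    qed
  from resolution_homotopy[OF F, of "\<lambda>q. \<beta> q * \<alpha> q", OF \<gamma>1 \<gamma>2 \<gamma>3]
  obtain h where "(\<forall>q. h q \<in> matrix_over V (b (Suc q)) (b q)) \<and>
    \<beta> 0 * \<alpha> 0 - 1\<^sub>m (b 0) = \<phi> (Suc 0) * h 0 \<and>
    (\<forall>q. \<beta> (Suc q) * \<alpha> (Suc q) - 1\<^sub>m (b (Suc q)) = \<phi> (Suc (Suc q)) * h (Suc q) + h q * \<phi> (Suc q))" ..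
  note h = this[THEN conjunct1, rule_format] this[THEN conjunct2, THEN conjunct1]
    this[THEN conjunct2, THEN conjunct2, rule_format]
  let ?c = "\<lambda>p :: ('a, 'b) mpoly. lookup p 0"
  interpret c: comm_ring_hom ?c by (rule comm_ring_hom_const)
  note ch = matrix_over_carrier[OF h(1)]
  have \<phi>0: "lookup (\<phi> (Suc q) $$ (i, j)) 0 = 0" if "i < b q" "j < b (Suc q)" for q i j
    using resolution_minimal[OF F that] by (rule irrelevant_ideal_const)
  have 1: "lookup ((\<phi> (Suc q) * h q) $$ (i, j)) 0 = 0" if "i < b q" "j < b q" for q i j
    using that ch[of q] c\<phi>[of q]
    by (auto simp: scalar_prod_def lookup_sum lookup_mult_0 \<phi>0 intro!: sum.neutral)
  have 2: "lookup ((h q * \<phi> (Suc q)) $$ (i, j)) 0 = 0" if "i < b (Suc q)" "j < b (Suc q)" for q i j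
    using that ch[of q] c\<phi>[of q]
    by (auto simp: scalar_prod_def lookup_sum lookup_mult_0 \<phi>0 intro!: sum.neutral)
  have 3: "lookup ((\<beta> q * \<alpha> q - 1\<^sub>m (b q)) $$ (i, j)) 0 = 0" if "i < b q" "j < b q" for i j
  proof (cases q)
    case 0
    then show ?thesis using 1[of i 0 j] that h(2) by simp
  next
    case (Suc q')
    have "(\<phi> (Suc (Suc q')) * h (Suc q') + h q' * \<phi> (Suc q')) $$ (i, j) =
       (\<phi> (Suc (Suc q')) * h (Suc q')) $$ (i, j) + (h q' * \<phi> (Suc q')) $$ (i, j)"
      using that Suc ch[of q'] c\<phi>[of q'] by (intro index_add_mat) auto
    then show ?thesis
      using 1[of i "Suc q'" j] 2[of i q' j] that h(3)[of q'] Suc by (simp add: lookup_add)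
  qed
  \<comment> \<open>Modulo the irrelevant ideal the homotopy terms disappear, so the constant parts
    of \<open>\<beta> q\<close> and \<open>\<alpha> q\<close> multiply to the identity over the
    field, which bounds the ranks.\<close>
  have "map_mat ?c (\<beta> q) * map_mat ?c (\<alpha> q) = map_mat ?c (\<beta> q * \<alpha> q)"
    by (rule c.mat_hom_mult[OF c\<beta> c\<alpha>, symmetric])
  also have "\<dots> = 1\<^sub>m (b q)"
  proof (rule eq_matI)
    fix i j assume "i < dim_row (1\<^sub>m (b q) :: 'b mat)" "j < dim_col (1\<^sub>m (b q) :: 'b mat)"
    then have ij: "i < b q" "j < b q" by auto
    have d: "dim_row (\<beta> q) = b q" "dim_col (\<alpha> q) = b q" using c\<alpha>[of q] c\<beta>[of q] by auto
    have "lookup ((\<beta> q * \<alpha> q) $$ (i, j)) 0 = lookup (1\<^sub>m (b q) $$ (i, j)) 0"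
      using 3[OF ij] ij d by (simp add: lookup_minus)
    then show "map_mat ?c (\<beta> q * \<alpha> q) $$ (i, j) = 1\<^sub>m (b q) $$ (i, j)"
      using ij d by (auto simp: one_mat_def)
  qed (use c\<alpha>[of q] c\<beta>[of q] in auto)
  finally show ?thesis
    using c\<alpha>[of q] c\<beta>[of q] by (intro field_mat_inverse_le[of "map_mat ?c (\<beta> q)" _ _ "map_mat ?c (\<alpha> q)"]) auto
qed

lemma betti_eqI:
  assumes "minimal_graded_free_resolution V I b a \<phi>"
  shows "betti V I q = b q"
  unfolding betti_def
proof (rule the_equality)
  show "\<exists>b' a \<phi>. minimal_graded_free_resolution V I b' a \<phi> \<and> b' q = b q"
    by (intro exI[of _ b] exI[of _ a] exI[of _ \<phi>] conjI assms refl)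
next
  fix r assume "\<exists>b' a \<phi>. minimal_graded_free_resolution V I b' a \<phi> \<and> b' q = r"
  then obtain b' a' \<psi> where G: "minimal_graded_free_resolution V I b' a' \<psi>" "b' q = r"
    by (elim exE conjE)
  show "r = b q"
    using resolution_rank_le[OF G(1) assms, of q] resolution_rank_le[OF assms G(1), of q] G(2) by simp
qed

section \<open>Linear resolutions from direct sum decompositions\<close>

definition normal_forms :: "'v set \<Rightarrow> 'i set \<Rightarrow> ('i \<Rightarrow> 'v list) \<Rightarrow> ('i \<Rightarrow> ('v, 'k::field) mpoly) set" where
  "normal_forms V U Y = {f. \<forall>u\<in>U. f u \<in> polys (V - set (Y u))}"

text \<open>A node \<open>(i, js)\<close> labels a basis element of the resolution: the generator
  \<open>i\<close> together with the positions of the variables chosen at the successive syzygy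
  steps, the latest one first. One index type for all levels makes the recursion over the levels
  possible.\<close>

type_synonym 'i node = "'i \<times> nat list"

definition child :: "'i node \<Rightarrow> nat \<Rightarrow> 'i node" where
  "child u j = (fst u, j # snd u)"

definition parent :: "'i node \<Rightarrow> 'i node" where
  "parent c = (fst c, tl (snd c))"

definition label :: "'i node \<Rightarrow> nat" where
  "label c = hd (snd c)"

lemma child_simps [simp]: "parent (child u j) = u" "label (child u j) = j"
  by (simp_all add: child_def parent_def label_def)

lemma child_eq_iff [simp]: "child u j = child u' j' \<longleftrightarrow> u = u' \<and> j = j'"
  by (auto simp: child_def prod_eq_iff)

definition children :: "'i node set \<Rightarrow> ('i node \<Rightarrow> 'v list) \<Rightarrow> 'i node set" where
  "children U Y = (\<lambda>(u, j). child u j) ` (SIGMA u:U. {..<length (Y u)})"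

text \<open>The nonmultiplicative variables of a syzygy are those that precede its own variable in
  the list of its parent. So positions strictly decrease from step to step, and the nodes with
  \<open>q\<close> positions above a generator correspond to the \<open>q\<close>-element subsets of
  its list.\<close>

definition restrict_vars :: "('i node \<Rightarrow> 'v list) \<Rightarrow> 'i node \<Rightarrow> 'v list" where
  "restrict_vars Y c = take (label c) (Y (parent c))"

lemma in_children_iff: "c \<in> children U Y \<longleftrightarrow>
    (\<exists>u\<in>U. \<exists>j<length (Y u). c = child u j)"
  by (auto simp: children_def)

lemma childrenE:
  assumes "c \<in> children U Y"
  obtains u j where "u \<in> U" "j < length (Y u)" "c = child u j"
  using assms unfolding in_children_iff by blast

lemma childrenI: "u \<in> U \<Longrightarrow> j < length (Y u) \<Longrightarrow> child u j \<in> children U Y"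
  unfolding in_children_iff by blast

lemma finite_children [simp]: "finite U \<Longrightarrow> finite (children U Y)"
  by (auto simp: children_def)

text \<open>The rewriting rule \<open>y e\<^sub>u \<rightarrow> \<Sum>\<^sub>v \<tau>\<^sub>u\<^sub>,\<^sub>j\<^sub>,\<^sub>v e\<^sub>v\<close>, where \<open>y\<close> is the \<open>j\<close>-th nonmultiplicative variable of \<open>u\<close>,
  gives the syzygy \<open>y e\<^sub>u - \<Sum>\<^sub>v \<tau>\<^sub>u\<^sub>,\<^sub>j\<^sub>,\<^sub>v e\<^sub>v\<close>.\<close>

definition syz :: "('i node \<Rightarrow> 'v list) \<Rightarrow> ('i node \<Rightarrow> nat \<Rightarrow> 'i node \<Rightarrow> ('v, 'k::field) mpoly) \<Rightarrow>
    'i node \<Rightarrow> 'i node \<Rightarrow> ('v, 'k) mpoly" where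
  "syz Y \<tau> v c = (if v = parent c then var (Y (parent c) ! label c) else 0) - \<tau> (parent c) (label c) v"

text \<open>The condition \<open>decreasing\<close> is imposed only where rewriting continues: the
  cofactor \<open>m\<close> avoids the variables before position \<open>j\<close>, because always
  the first nonmultiplicative variable is rewritten, and the new term is not yet normal. This weak
  form admits both a measure on monomials and an order on nodes.\<close>

locale rewriting =
  fixes V :: "'v set" and U :: "'i node set" and Y :: "'i node \<Rightarrow> 'v list"
    and \<tau> :: "'i node \<Rightarrow> nat \<Rightarrow> 'i node \<Rightarrow> ('v, 'k::field) mpoly"
    and \<mu> :: "('v \<Rightarrow>\<^sub>0 nat) \<Rightarrow> 'i node \<Rightarrow> nat"
  assumes finU: "finite U"
    and Y: "\<And>u. u \<in> U \<Longrightarrow> distinct (Y u)" "\<And>u. u \<in> U \<Longrightarrow> set (Y u) \<subseteq> V"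
    and \<tau>_nf: "\<And>u j v. u \<in> U \<Longrightarrow> j < length (Y u) \<Longrightarrow> v \<in> U \<Longrightarrow> \<tau> u j v \<in> polys (V - set (Y v))"
    and \<tau>_hom: "\<And>u j v. u \<in> U \<Longrightarrow> j < length (Y u) \<Longrightarrow> v \<in> U \<Longrightarrow> homogeneous 1 (\<tau> u j v)"
    and decreasing: "\<And>u j v x m. u \<in> U \<Longrightarrow> j < length (Y u) \<Longrightarrow> v \<in> U \<Longrightarrow> single x 1 \<in> keys (\<tau> u j v) \<Longrightarrow>
       keys m \<subseteq> V - set (take j (Y u)) \<Longrightarrow> \<not> keys (m + single x 1) \<subseteq> V - set (Y v) \<Longrightarrow>
       \<mu> (m + single x 1) v < \<mu> (m + single (Y u ! j) 1) u"
begin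

abbreviation "C \<equiv> children U Y"
abbreviation "S \<equiv> syz Y \<tau>"
abbreviation "Y' \<equiv> restrict_vars Y"

definition good :: "('i node \<Rightarrow> ('v, 'k) mpoly) \<Rightarrow> bool" where
  "good f \<longleftrightarrow> (\<exists>n\<in>normal_forms V U Y. \<exists>p\<in>normal_forms V C Y'.
     \<forall>v\<in>U. f v = n v + (\<Sum>c\<in>C. S v c * p c))"

lemma good_add: assumes "good f" "good g" shows "good (\<lambda>v. f v + g v)"
proof -
  obtain n p n' p' where
    "n \<in> normal_forms V U Y" "p \<in> normal_forms V C Y'" "\<forall>v\<in>U. f v = n v + (\<Sum>c\<in>C. S v c * p c)"
    "n' \<in> normal_forms V U Y" "p' \<in> normal_forms V C Y'" "\<forall>v\<in>U. g v = n' v + (\<Sum>c\<in>C. S v c * p' c)"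
    using assms by (auto simp: good_def)
  then show ?thesis unfolding good_def
    by (intro bexI[of _ "\<lambda>v. n v + n' v"] bexI[of _ "\<lambda>c. p c + p' c"])
       (auto simp: normal_forms_def polys_add sum.distrib algebra_simps)
qed

lemma good_normal_form: "f \<in> normal_forms V U Y \<Longrightarrow> good f"
  unfolding good_def by (intro bexI[of _ f] bexI[of _ "\<lambda>_. 0"]) (auto simp: normal_forms_def)

lemma good_syz: "p \<in> normal_forms V C Y' \<Longrightarrow> good (\<lambda>v. \<Sum>c\<in>C. S v c * p c)"
  unfolding good_def by (intro bexI[of _ "\<lambda>_. 0"] bexI[of _ p]) (auto simp: normal_forms_def)

lemma good_sum: "(\<And>a. a \<in> A \<Longrightarrow> good (f a)) \<Longrightarrow> good (\<lambda>v. \<Sum>a\<in>A. f a v)"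
proof (induction A rule: infinite_finite_induct)
  case (insert a A)
  then show ?case using good_add[of "f a" "\<lambda>v. \<Sum>a\<in>A. f a v"] by simp
qed (auto intro!: good_normal_form simp: normal_forms_def)

lemma good_cong: "good f \<Longrightarrow> (\<And>v. v \<in> U \<Longrightarrow> f v = g v) \<Longrightarrow> good g"
  by (simp add: good_def)

lemma expand_terms:
  assumes "v \<in> U"
  shows "f v = (\<Sum>w\<in>U. \<Sum>m\<in>keys (f w). if v = w then single m (lookup (f w) m) else 0)"
proof -
  have "(\<Sum>w\<in>U. \<Sum>m\<in>keys (f w). if v = w then single m (lookup (f w) m) else 0) =
     (\<Sum>w\<in>U. if v = w then f w else 0)"
    by (intro sum.cong refl) (auto simp: sum_singles)
  then show ?thesis using assms finU by simp
qed

text \<open>Termination of the rewriting: a step replaces the term by terms that are normal or have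
  smaller measure.\<close>

lemma good_term:
  assumes "u \<in> U" "keys m \<subseteq> V"
  shows "good (\<lambda>v. if v = u then single m c else 0)"
  using assms
proof (induction "\<mu> m u" arbitrary: m u c rule: less_induct)
  case less
  show ?case
  proof (cases "keys m \<subseteq> V - set (Y u)")
    case True
    then show ?thesis by (intro good_normal_form) (auto simp: normal_forms_def polys_single)
  next
    case False
    \<comment> \<open>Rewriting the first nonmultiplicative variable that divides \<open>m\<close>
      leaves a cofactor free of all earlier ones, which is exactly what is allowed as a coefficient
      of \<open>child u j\<close>.\<close>
    define P where "P j \<longleftrightarrow> j < length (Y u) \<and> Y u ! j \<in> keys m" for j
    define j where "j = (LEAST j. P j)"
    have "\<exists>j. P j" using False less.prems by (auto simp: P_def in_set_conv_nth)
    then have j: "P j" unfolding j_def by (rule LeastI_ex)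
    then have ju: "j < length (Y u)" by (simp add: P_def)
    have jmin: "\<not> P i" if "i < j" for i using that not_less_Least unfolding j_def by blast
    define m' where "m' = m - single (Y u ! j) 1"
    have m: "m = single (Y u ! j) 1 + m'" 
      unfolding m'_def by (rule mon_split) (use j in \<open>simp add: P_def\<close>)
    have m': "keys m' \<subseteq> V - set (take j (Y u))"
    proof
      fix x assume x: "x \<in> keys m'"
      then have xm: "x \<in> keys m" unfolding m keys_plus_nat by blast
      moreover have "x \<notin> set (take j (Y u))"
        using jmin xm ju by (auto simp: in_set_conv_nth P_def)
      ultimately show "x \<in> V - set (take j (Y u))" using less.prems by blast
    qed
    have uj: "child u j \<in> C" using less.prems ju by (auto simp: in_children_iff)
    define p where "p c' = (if c' = child u j then single m' c else 0)" for c'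
    have "p \<in> normal_forms V C Y'"
      using m' by (auto simp: normal_forms_def p_def restrict_vars_def polys_single)
    then have g1: "good (\<lambda>v. \<Sum>c'\<in>C. S v c' * p c')" by (rule good_syz)
    have S: "(\<Sum>c'\<in>C. S v c' * p c') = (if v = u then single m c else 0) - \<tau> u j v * single m' c" for v
    proof -
      have "(\<Sum>c'\<in>C. S v c' * p c') = (\<Sum>c'\<in>C. if c' = child u j then S v (child u j) * single m' c else 0)"
        by (intro sum.cong) (auto simp: p_def)
      also have "\<dots> = S v (child u j) * single m' c" using uj finU by simp
      also have "\<dots> = (if v = u then single m c else 0) - \<tau> u j v * single m' c"
        by (simp add: syz_def algebra_simps var_def mult_single m)
      finally show ?thesis .
    qed
    have g2: "good (\<lambda>v. \<tau> u j v * single m' c)"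
    proof (rule good_cong)
      let ?f = "\<lambda>v. \<tau> u j v * single m' c"
      show "good (\<lambda>v. \<Sum>w\<in>U. \<Sum>a\<in>keys (?f w). if v = w then single a (lookup (?f w) a) else 0)"
      proof (intro good_sum)
        fix w a assume w: "w \<in> U" and a: "a \<in> keys (?f w)"
        then obtain a' where a': "a' \<in> keys (\<tau> u j w)" "a = a' + m'"
          using keys_mult[of "\<tau> u j w" "single m' c"] by (auto split: if_splits)
        have "mon_degree a' = 1" using \<tau>_hom[OF less.prems(1) ju w] a'(1) by (auto simp: homogeneous_def)
        then obtain x where x: "a' = single x 1" by (rule mon_degree_eq_1)
        have xV: "x \<in> V" using \<tau>_nf[OF less.prems(1) ju w] a'(1) x by (auto simp: polys_def)
        show "good (\<lambda>v. if v = w then single a (lookup (?f w) a) else 0)"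
        proof (cases "keys a \<subseteq> V - set (Y w)")
          case True
          then show ?thesis by (intro good_normal_form) (auto simp: normal_forms_def polys_single)
        next
          case False
          have "\<mu> (m' + single x 1) w < \<mu> (m' + single (Y u ! j) 1) u"
            using decreasing[OF less.prems(1) ju w _ m'] a' x False by (auto simp: add.commute)
          then have "\<mu> a w < \<mu> m u" using a'(2) x m by (simp add: add.commute)
          moreover have "keys a \<subseteq> V" using a'(2) x xV m' by (auto simp: keys_plus_nat)
          ultimately show ?thesis using less.hyps w by blast
        qed
      qed
    next
      fix v assume "v \<in> U"
      then show "(\<Sum>w\<in>U. \<Sum>a\<in>keys (\<tau> u j w * single m' c). if v = w then single a (lookup (\<tau> u j w * single m' c) a) else 0)
        = \<tau> u j v * single m' c"
        using expand_terms[of v "\<lambda>v. \<tau> u j v * single m' c"] by simp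
    qed
    show ?thesis using good_add[OF g1 g2] by (rule good_cong) (simp add: S)
  qed
qed

lemma spanning:
  assumes "\<And>u. u \<in> U \<Longrightarrow> f u \<in> polys V"
  shows "\<exists>n\<in>normal_forms V U Y. \<exists>p\<in>normal_forms V C Y'.
     \<forall>v\<in>U. f v = n v + (\<Sum>c\<in>C. S v c * p c)"
proof -
  have "good (\<lambda>v. \<Sum>w\<in>U. \<Sum>m\<in>keys (f w). if v = w then single m (lookup (f w) m) else 0)"
    using assms by (intro good_sum good_term) (auto simp: polys_def)
  then have "good f" by (rule good_cong) (rule expand_terms[symmetric])
  then show ?thesis by (simp add: good_def)
qed

text \<open>The head of a term \<open>m\<close> of \<open>p c\<close> is \<open>m\<close> times the
  variable of \<open>c\<close>, at the component \<open>parent c\<close>. A head of greatest measure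
  cannot cancel: terms arising from the tails have smaller measure, and two equal heads at one
  component belong to the same position.\<close>

lemma independent:
  assumes p: "p \<in> normal_forms V C Y'" and zero: "\<And>v. v \<in> U \<Longrightarrow> (\<Sum>c\<in>C. S v c * p c) = 0"
    and c0: "c0 \<in> C"
  shows "p c0 = 0"
proof (rule ccontr)
  assume "p c0 \<noteq> 0"
  define T where "T = (SIGMA c:C. keys (p c))"
  define top :: "'i node \<Rightarrow> ('v \<Rightarrow>\<^sub>0 nat) \<Rightarrow> ('v \<Rightarrow>\<^sub>0 nat)"
    where "top c m = m + single (Y (parent c) ! label c) 1" for c m
  have "finite T" using finU by (auto simp: T_def)
  obtain m0 where "m0 \<in> keys (p c0)"
    using \<open>p c0 \<noteq> 0\<close> by (metis poly_mapping_eqI in_keys_iff lookup_zero)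
  then have "T \<noteq> {}" using c0 unfolding T_def by blast
  define w where "w s = \<mu> (top (fst s) (snd s)) (parent (fst s))" for s
  have "Max (w ` T) \<in> w ` T" using \<open>finite T\<close> \<open>T \<noteq> {}\<close> by (intro Max_in) auto
  then obtain t where t: "t \<in> T" "w t = Max (w ` T)" by auto
  have wmax: "w s \<le> w t" if "s \<in> T" for s
    unfolding t(2) using \<open>finite T\<close> that by (intro Max_ge) auto
  obtain c m where cm: "t = (c, m)" by fastforce
  define u j where "u = parent c" and "j = label c"
  have c: "c \<in> C" and m: "m \<in> keys (p c)" using t(1) by (auto simp: T_def cm)
  then have u: "u \<in> U" "j < length (Y u)" "c = child u j"
    by (auto simp: in_children_iff u_def j_def)
  have pV: "keys m' \<subseteq> V - set (take j' (Y u'))"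
    if "child u' j' \<in> C" "m' \<in> keys (p (child u' j'))" for u' j' m'
  proof -
    have "p (child u' j') \<in> polys (V - set (Y' (child u' j')))"
      using p that(1) unfolding normal_forms_def by blast
    then show ?thesis using that(2) unfolding polys_def restrict_vars_def by simp
  qed
  have mV: "keys m \<subseteq> V - set (take j (Y u))" using pV[of u j m] c m u(3) by simp
  define M where "M = m + single (Y u ! j) 1"
  have yM: "Y u ! j \<in> keys M" by (simp add: M_def keys_plus_nat)
  have \<mu>max: "\<mu> (m' + single (Y (parent c') ! label c') 1) (parent c') \<le> \<mu> M u"
    if "c' \<in> C" "m' \<in> keys (p c')" for c' m'
    using wmax[of "(c', m')"] that by (simp add: w_def T_def cm top_def M_def u_def j_def)
  have tail: "lookup (\<tau> (parent c') (label c') u * p c') M = 0" if c': "c' \<in> C" for c'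
  proof (rule ccontr)
    obtain u' j' where u': "u' \<in> U" "j' < length (Y u')" "c' = child u' j'"
      using c' by (auto simp: in_children_iff)
    assume "lookup (\<tau> (parent c') (label c') u * p c') M \<noteq> 0"
    then have "M \<in> keys (\<tau> u' j' u * p c')" using u' by (simp add: in_keys_iff)
    then obtain a m' where am: "M = a + m'" "a \<in> keys (\<tau> u' j' u)" "m' \<in> keys (p c')"
      using keys_mult[of "\<tau> u' j' u" "p c'"] by blast
    have "mon_degree a = 1" using \<tau>_hom[OF u'(1,2) u(1)] am(2) by (auto simp: homogeneous_def)
    then obtain x where x: "a = single x 1" by (rule mon_degree_eq_1)
    have "keys m' \<subseteq> V - set (take j' (Y u'))"
      using pV[of u' j' m'] c' am(3) u'(3) by simp
    \<comment> \<open>The monomial \<open>M\<close> contains a nonmultiplicative variable of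
      \<open>u\<close>, so it is not normal there and \<open>decreasing\<close> applies to the
      tail.\<close>
    moreover have "\<not> keys (m' + single x 1) \<subseteq> V - set (Y u)"
      using yM u(2) am(1) x by (auto simp: add.commute)
    ultimately have "\<mu> (m' + single x 1) u < \<mu> (m' + single (Y u' ! j') 1) u'"
      using decreasing[OF u'(1,2) u(1)] am(2) x by blast
    also have "\<dots> \<le> \<mu> M u" using \<mu>max[OF c' am(3)] u'(3) by simp
    finally show False using am(1) x by (simp add: add.commute)
  qed
  have head: "lookup ((if u = parent c' then var (Y (parent c') ! label c') else 0) * p c') M =
      (if c' = c then lookup (p c) m else 0)" if c': "c' \<in> C" for c'
  proof (cases "u = parent c'")
    case False
    then show ?thesis using u_def by auto
  next
    case True
    define j' where "j' = label c'"
    have j': "j' < length (Y u)" "c' = child u j'"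
      using c' True by (auto simp: in_children_iff j'_def)
    show ?thesis
    proof (cases "j' = j")
      case True
      then show ?thesis using j' u(3) lookup_single_times[of "single (Y u ! j) 1" 1 "p c" m]
        by (simp add: var_def M_def add.commute)
    next
      case False
      have "lookup (var (Y u ! j') * p c') M = 0"
      proof (rule ccontr)
        assume "lookup (var (Y u ! j') * p c') M \<noteq> 0"
        then have "M \<in> keys (single (single (Y u ! j') 1) 1 * p c')" by (simp add: in_keys_iff var_def)
        then obtain m'' where m'': "M = single (Y u ! j') 1 + m''" "m'' \<in> keys (p c')"
          using keys_single_times[of "single (Y u ! j') 1" 1 "p c'"] by blast
        have "Y u ! j' \<noteq> Y u ! j" using False j' u Y by (simp add: nth_eq_iff_index_eq)
        moreover have "keys M = insert (Y u ! j) (keys m)" "keys M = insert (Y u ! j') (keys m'')"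
          by (simp add: M_def keys_plus_nat) (simp add: m''(1) keys_plus_nat)
        ultimately have "Y u ! j' \<in> keys m" "Y u ! j \<in> keys m''" by (metis insert_iff)+
        moreover have "keys m'' \<subseteq> V - set (take j' (Y u))"
          using pV[of u j' m''] c' m''(2) j'(2) by simp
        \<comment> \<open>Each of the two variables divides the cofactor belonging to the other, and
          a cofactor avoids all variables before its position; so neither position precedes the
          other.\<close>
        ultimately have "Y u ! j' \<notin> set (take j (Y u))" "Y u ! j \<notin> set (take j' (Y u))"
          using mV by auto
        then have "\<not> j' < j" "\<not> j < j'" using j' u by (auto simp: in_set_conv_nth)
        then show False using False by simp
      qed
      moreover have "c' \<noteq> c" using False unfolding j_def j'_def by auto
      ultimately show ?thesis by (simp add: True[symmetric] j'_def[symmetric])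
    qed
  qed
  have SM: "lookup (S u c' * p c') M = (if c' = c then lookup (p c) m else 0)" if c': "c' \<in> C" for c'
    unfolding syz_def left_diff_distrib lookup_minus head[OF c'] tail[OF c'] by simp
  have "0 = lookup (\<Sum>c'\<in>C. S u c' * p c') M" using zero[OF u(1)] by simp
  also have "\<dots> = (\<Sum>c'\<in>C. lookup (S u c' * p c') M)" by (rule lookup_sum)
  also have "\<dots> = (\<Sum>c'\<in>C. if c' = c then lookup (p c) m else 0)"
    using SM by (rule sum.cong[OF refl])
  also have "\<dots> = lookup (p c) m" using c finU by simp
  finally show False using m by (simp add: in_keys_iff)
qed

end

text \<open>The columns of \<open>G\<close> span the module and every element of it is uniquely
  \<open>\<Sum>\<^sub>u f\<^sub>u G\<^sub>u\<close> with \<open>f\<^sub>u\<close> a polynomial in the variables outside \<open>Y u\<close>.\<close>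

definition lin_dec :: "'v set \<Rightarrow> 'a set \<Rightarrow> 'i node set \<Rightarrow> ('a \<Rightarrow> 'i node \<Rightarrow> ('v, 'k::field) mpoly) \<Rightarrow>
    ('i node \<Rightarrow> 'v list) \<Rightarrow> nat \<Rightarrow> bool" where
  "lin_dec V A U G Y d \<longleftrightarrow> finite U \<and> (\<forall>u\<in>U. distinct (Y u) \<and> set (Y u) \<subseteq> V) \<and>
    (\<forall>a\<in>A. \<forall>u\<in>U. G a u \<in> polys V \<and> homogeneous (int d) (G a u)) \<and>
    (\<forall>f\<in>normal_forms V U Y. (\<forall>a\<in>A. (\<Sum>u\<in>U. G a u * f u) = 0) \<longrightarrow> (\<forall>u\<in>U. f u = 0)) \<and>
    (\<forall>f. (\<forall>u\<in>U. f u \<in> polys V) \<longrightarrow>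
       (\<exists>n\<in>normal_forms V U Y. \<forall>a\<in>A. (\<Sum>u\<in>U. G a u * f u) = (\<Sum>u\<in>U. G a u * n u)))"

definition nested :: "'v list \<Rightarrow> 'i node set \<Rightarrow> ('i node \<Rightarrow> 'v list) \<Rightarrow> bool" where
  "nested Vl U Y \<longleftrightarrow> distinct Vl \<and> (\<forall>u\<in>U. \<exists>k. Y u = take k Vl)"

definition triangular :: "'v set \<Rightarrow> 'a set \<Rightarrow> 'i node set \<Rightarrow> ('a \<Rightarrow> 'i node \<Rightarrow> ('v, 'k::field) mpoly) \<Rightarrow>
    ('i node \<Rightarrow> 'v list) \<Rightarrow> ('i node \<Rightarrow> nat) \<Rightarrow> bool" where
  "triangular V A U G Y ord \<longleftrightarrow> (\<forall>u\<in>U. \<forall>j<length (Y u). \<exists>n\<in>normal_forms V U Y.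
     (\<forall>a\<in>A. G a u * var (Y u ! j) = (\<Sum>v\<in>U. G a v * n v)) \<and> (\<forall>v\<in>U. n v \<noteq> 0 \<longrightarrow> ord v < ord u))"

text \<open>All generators have the same degree, so the parts of degree 1 of the coefficients
  already give the expansion. Linear tails keep the next differential linear.\<close>

lemma linear_normal_form:
  assumes G: "\<And>a v. a \<in> A \<Longrightarrow> v \<in> U \<Longrightarrow> homogeneous (int d) (G a v)" and u: "u \<in> U"
    and n: "n \<in> normal_forms V U Y" and eq: "\<And>a. a \<in> A \<Longrightarrow> G a u * var y = (\<Sum>v\<in>U. G a v * n v)"
  shows "\<exists>n'\<in>normal_forms V U Y. (\<forall>v\<in>U. homogeneous 1 (n' v)) \<and>
    (\<forall>a\<in>A. G a u * var y = (\<Sum>v\<in>U. G a v * n' v)) \<and> (\<forall>v. n v = 0 \<longrightarrow> n' v = 0)"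
proof (intro bexI[of _ "\<lambda>v. hcomp 1 (n v)"] conjI ballI allI impI)
  show "(\<lambda>v. hcomp 1 (n v)) \<in> normal_forms V U Y"
    using n by (auto simp: normal_forms_def hcomp_polys)
  show "homogeneous 1 (hcomp 1 (n v))" for v using homogeneous_hcomp[of 1 "n v"] by simp
  show "hcomp 1 (n v) = 0" if "n v = 0" for v using that by simp
  fix a assume a: "a \<in> A"
  have "homogeneous (int (d + 1)) (G a u * var y)"
    using homogeneous_mult[OF G[OF a u] homogeneous_var[of y]] by (simp add: add.commute)
  then have "G a u * var y = hcomp (d + 1) (G a u * var y)" by (rule hcomp_homogeneous[symmetric])
  also have "\<dots> = (\<Sum>v\<in>U. hcomp (d + 1) (G a v * n v))" by (simp add: eq[OF a] hcomp_sum)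
  also have "\<dots> = (\<Sum>v\<in>U. G a v * hcomp 1 (n v))" using G[OF a] by (intro sum.cong hcomp_mult) auto
  finally show "G a u * var y = (\<Sum>v\<in>U. G a v * hcomp 1 (n v))" .
qed

lemma normal_forms_polys: "f \<in> normal_forms V U Y \<Longrightarrow> u \<in> U \<Longrightarrow> f u \<in> polys V"
  by (auto simp: normal_forms_def intro: polys_mono)

text \<open>The measure ignores the node and adds up, over the variables of the monomial, their
  distances from the end of \<open>Vl\<close>. A rewriting step that does not end in a normal term
  moves a variable towards the end.\<close>

lemma rewriting_nested:
  fixes Vl :: "'v list" and \<tau> :: "'i node \<Rightarrow> nat \<Rightarrow> 'i node \<Rightarrow> ('v, 'k::field) mpoly"
  assumes "finite U" "nested Vl U Y"
    and \<tau>: "\<And>u j v. u \<in> U \<Longrightarrow> j < length (Y u) \<Longrightarrow> v \<in> U \<Longrightarrow> \<tau> u j v \<in> polys (set Vl - set (Y v))"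
     "\<And>u j v. u \<in> U \<Longrightarrow> j < length (Y u) \<Longrightarrow> v \<in> U \<Longrightarrow> homogeneous 1 (\<tau> u j v)"
  shows "\<exists>\<mu>. rewriting (set Vl) U Y \<tau> \<mu>"
proof -
  have Vl: "distinct Vl" and pre: "\<And>u. u \<in> U \<Longrightarrow> \<exists>k. Y u = take k Vl"
    using assms by (auto simp: nested_def)
  define pos where "pos = the_inv_into {..<length Vl} ((!) Vl)"
  have inj: "inj_on ((!) Vl) {..<length Vl}" using Vl by (simp add: inj_on_nth)
  have pos: "pos (Vl ! i) = i" if "i < length Vl" for i
    unfolding pos_def using inj that by (simp add: the_inv_into_f_f)
  have "rewriting (set Vl) U Y \<tau> (\<lambda>m _. wsum (\<lambda>x. length Vl - pos x) m)"
  proof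
    show "distinct (Y u)" "set (Y u) \<subseteq> set Vl" if "u \<in> U" for u
      using pre[OF that] Vl by (auto dest: in_set_takeD)
  next
    fix u j v x and m :: "'v \<Rightarrow>\<^sub>0 nat"
    assume uv: "u \<in> U" "j < length (Y u)" "v \<in> U" and x: "single x 1 \<in> keys (\<tau> u j v)"
      and m: "keys m \<subseteq> set Vl - set (take j (Y u))"
      and not_nf: "\<not> keys (m + single x 1) \<subseteq> set Vl - set (Y v)"
    obtain k where k: "Y u = take k Vl" using pre uv by blast
    obtain l where l: "Y v = take l Vl" using pre uv by blast
    have j: "j < length Vl" "j < k" using uv k by auto
    have yj: "Y u ! j = Vl ! j" using k j by simp
    have tj: "take j (Y u) = take j Vl" using k j by simp
    have xV: "x \<in> set Vl - set (take l Vl)" using \<tau>(1)[OF uv] x l by (auto simp: polys_def)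
    then obtain i where i: "i < length Vl" "x = Vl ! i" by (auto simp: in_set_conv_nth)
    have "l \<le> i"
    proof (rule ccontr)
      assume "\<not> l \<le> i"
      then have "x \<in> set (take l Vl)" using i by (auto simp: in_set_conv_nth intro!: exI[of _ i])
      then show False using xV by simp
    qed
    obtain z where z: "z \<in> keys m" "z \<in> set (take l Vl)"
      using not_nf m xV unfolding l keys_plus_nat by auto
    then obtain h where h: "h < l" "h < length Vl" "z = Vl ! h" by (auto simp: in_set_conv_nth)
    have "j \<le> h"
    proof (rule ccontr)
      assume "\<not> j \<le> h"
      then have "z \<in> set (take j Vl)" using h by (auto simp: in_set_conv_nth intro!: exI[of _ h])
      then show False using m z(1) unfolding tj by blast
    qed
    \<comment> \<open>The replaced variable is at position \<open>j\<close>, the new one at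
      \<open>i\<close>. The new term is not normal because of a variable of \<open>m\<close> at a
      position \<open>h < l\<close>, while \<open>m\<close> avoids the positions before
      \<open>j\<close>; hence \<open>j \<le> h < l \<le> i\<close>.\<close>
    then have "j < i" using h \<open>l \<le> i\<close> by simp
    then show "wsum (\<lambda>x. length Vl - pos x) (m + single x 1) <
        wsum (\<lambda>x. length Vl - pos x) (m + single (Y u ! j) 1)"
      using i j by (simp add: yj pos diff_less_mono2)
  qed (use assms in auto)
  then show ?thesis by blast
qed

lemma sum_distrib_syz:
  fixes G :: "'a \<Rightarrow> 'i node \<Rightarrow> ('v, 'k::field) mpoly"
  assumes "\<And>c. c \<in> C \<Longrightarrow> (\<Sum>u\<in>U. G a u * S u c) = 0"
  shows "(\<Sum>u\<in>U. G a u * (\<Sum>c\<in>C. S u c * p c)) = 0"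
proof -
  have "(\<Sum>u\<in>U. G a u * (\<Sum>c\<in>C. S u c * p c)) = (\<Sum>u\<in>U. \<Sum>c\<in>C. G a u * S u c * p c)"
    by (simp add: sum_distrib_left mult.assoc)
  also have "\<dots> = (\<Sum>c\<in>C. (\<Sum>u\<in>U. G a u * S u c) * p c)"
    by (subst sum.swap) (simp add: sum_distrib_right)
  also have "\<dots> = 0" using assms by (intro sum.neutral) simp
  finally show ?thesis .
qed

text \<open>The step that is iterated to obtain the resolution: the syzygies of a decomposition have
  a decomposition of the same shape. Being nested is inherited directly. Being triangular has to be
  re-established, by reducing the overlaps of two syzygies above the same node.\<close>

lemma syzygies_step:
  fixes G :: "'a \<Rightarrow> 'i node \<Rightarrow> ('v, 'k::field) mpoly"
  assumes dec: "lin_dec V A U G Y d"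
    and shape: "(nested Vl U Y \<and> V = set Vl) \<or> (\<exists>ord. triangular V A U G Y ord)"
  shows "\<exists>S. lin_dec V U (children U Y) S (restrict_vars Y) 1 \<and>
    ((nested Vl (children U Y) (restrict_vars Y) \<and> V = set Vl) \<or>
      (\<exists>ord. triangular V U (children U Y) S (restrict_vars Y) ord)) \<and>
    (\<forall>a\<in>A. \<forall>c\<in>children U Y. (\<Sum>u\<in>U. G a u * S u c) = 0) \<and>
    (\<forall>f. (\<forall>u\<in>U. f u \<in> polys V) \<longrightarrow> (\<forall>a\<in>A. (\<Sum>u\<in>U. G a u * f u) = 0) \<longrightarrow>
      (\<exists>p. (\<forall>c\<in>children U Y. p c \<in> polys V) \<and> (\<forall>u\<in>U. f u = (\<Sum>c\<in>children U Y. S u c * p c))))"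
proof -
  have finU: "finite U" and Y: "\<And>u. u \<in> U \<Longrightarrow> distinct (Y u)" "\<And>u. u \<in> U \<Longrightarrow> set (Y u) \<subseteq> V"
    and G: "\<And>a u. a \<in> A \<Longrightarrow> u \<in> U \<Longrightarrow> G a u \<in> polys V"
     "\<And>a u. a \<in> A \<Longrightarrow> u \<in> U \<Longrightarrow> homogeneous (int d) (G a u)"
    using dec by (auto simp: lin_dec_def)
  have indep: "f u = 0" if "f \<in> normal_forms V U Y" "\<And>a. a \<in> A \<Longrightarrow> (\<Sum>u\<in>U. G a u * f u) = 0" "u \<in> U" for f u
    using dec that unfolding lin_dec_def by blast
  have span: "\<exists>n\<in>normal_forms V U Y. \<forall>a\<in>A. (\<Sum>u\<in>U. G a u * f u) = (\<Sum>u\<in>U. G a u * n u)"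
    if "\<And>u. u \<in> U \<Longrightarrow> f u \<in> polys V" for f
    using dec that unfolding lin_dec_def by blast
  define tri where "tri ord \<longleftrightarrow> triangular V A U G Y ord" for ord
  define T where "T u j n \<longleftrightarrow> n \<in> normal_forms V U Y \<and> (\<forall>v\<in>U. homogeneous 1 (n v)) \<and>
      (\<forall>a\<in>A. G a u * var (Y u ! j) = (\<Sum>v\<in>U. G a v * n v))" for u j n
  have ex: "\<exists>n. T u j n" if u: "u \<in> U" and j: "j < length (Y u)" for u j
  proof -
    let ?f = "\<lambda>v. if v = u then var (Y u ! j) else (0 :: ('v, 'k) mpoly)"
    have "Y u ! j \<in> V" using Y(2)[OF u] j by auto
    then have "?f v \<in> polys V" for v by (simp add: polys_var)
    from span[OF this]
    obtain n where n: "n \<in> normal_forms V U Y" "\<forall>a\<in>A. (\<Sum>v\<in>U. G a v * ?f v) = (\<Sum>v\<in>U. G a v * n v)" ..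
    have "(\<Sum>v\<in>U. G a v * ?f v) = G a u * var (Y u ! j)" for a
    proof -
      have "(\<Sum>v\<in>U. G a v * ?f v) = (\<Sum>v\<in>U. if v = u then G a u * var (Y u ! j) else 0)"
        by (intro sum.cong) auto
      then show ?thesis using u finU by simp
    qed
    then have eq: "G a u * var (Y u ! j) = (\<Sum>v\<in>U. G a v * n v)" if "a \<in> A" for a
      using n(2) that by simp
    from linear_normal_form[of A U d G u n V Y "Y u ! j", OF G(2) u n(1) eq]
    obtain n' where "n' \<in> normal_forms V U Y" "(\<forall>v\<in>U. homogeneous 1 (n' v)) \<and>
      (\<forall>a\<in>A. G a u * var (Y u ! j) = (\<Sum>v\<in>U. G a v * n' v)) \<and> (\<forall>v. n v = 0 \<longrightarrow> n' v = 0)" ..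
    then show ?thesis unfolding T_def by (intro exI[of _ n']) simp
  qed
  have ex_tri: "\<exists>n. T u j n \<and> (\<forall>v\<in>U. n v \<noteq> 0 \<longrightarrow> ord v < ord u)"
    if tr: "tri ord" and u: "u \<in> U" and j: "j < length (Y u)" for u j ord
  proof -
    obtain n where n: "n \<in> normal_forms V U Y" "\<forall>a\<in>A. G a u * var (Y u ! j) = (\<Sum>v\<in>U. G a v * n v)"
      "\<forall>v\<in>U. n v \<noteq> 0 \<longrightarrow> ord v < ord u"
      using tr u j unfolding tri_def triangular_def by blast
    have eq: "G a u * var (Y u ! j) = (\<Sum>v\<in>U. G a v * n v)" if "a \<in> A" for a using n(2) that by blast
    from linear_normal_form[of A U d G u n V Y "Y u ! j", OF G(2) u n(1) eq]
    obtain n' where n': "n' \<in> normal_forms V U Y" "(\<forall>v\<in>U. homogeneous 1 (n' v)) \<and>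
      (\<forall>a\<in>A. G a u * var (Y u ! j) = (\<Sum>v\<in>U. G a v * n' v)) \<and> (\<forall>v. n v = 0 \<longrightarrow> n' v = 0)" ..
    then have "\<forall>v\<in>U. n' v \<noteq> 0 \<longrightarrow> ord v < ord u" using n(3) by metis
    then show ?thesis using n' unfolding T_def by (intro exI[of _ n']) simp
  qed
  \<comment> \<open>In the nested case any linear expansion will do, since the measure only looks at
    monomials. In the triangular case the expansions must be those into smaller nodes, and the order
    itself is the measure.\<close>
  have "\<exists>\<tau> \<mu>. (\<forall>u\<in>U. \<forall>j<length (Y u). T u j (\<tau> u j)) \<and> rewriting V U Y \<tau> \<mu> \<and>
     ((nested Vl U Y \<and> V = set Vl) \<or>
      (\<exists>ord. (\<forall>u\<in>U. \<forall>j<length (Y u). \<forall>v\<in>U. \<tau> u j v \<noteq> 0 \<longrightarrow> ord v < ord u) \<and> (\<mu> = (\<lambda>_. ord))))"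
    using shape
  proof (elim disjE exE conjE)
    assume n: "nested Vl U Y" and V: "V = set Vl"
    have "\<forall>u j. \<exists>n. u \<in> U \<longrightarrow> j < length (Y u) \<longrightarrow> T u j n" using ex by blast
    then obtain \<tau> where \<tau>: "\<And>u j. u \<in> U \<Longrightarrow> j < length (Y u) \<Longrightarrow> T u j (\<tau> u j)" by metis
    have "\<exists>\<mu>. rewriting (set Vl) U Y \<tau> \<mu>"
      using \<tau> V by (intro rewriting_nested[OF finU n]) (auto simp: T_def normal_forms_def)
    with n V \<tau> show ?thesis by blast
  next
    fix ord assume "triangular V A U G Y ord"
    then have "\<forall>u j. \<exists>n. u \<in> U \<longrightarrow> j < length (Y u) \<longrightarrow> T u j n \<and> (\<forall>v\<in>U. n v \<noteq> 0 \<longrightarrow> ord v < ord u)"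
      using ex_tri unfolding tri_def by blast
    then obtain \<tau> where \<tau>: "\<And>u j. u \<in> U \<Longrightarrow> j < length (Y u) \<Longrightarrow> T u j (\<tau> u j)"
      "\<And>u j v. u \<in> U \<Longrightarrow> j < length (Y u) \<Longrightarrow> v \<in> U \<Longrightarrow> \<tau> u j v \<noteq> 0 \<Longrightarrow> ord v < ord u" by metis
    have "rewriting V U Y \<tau> (\<lambda>_. ord)"
    proof
      fix u j v x m
      assume "u \<in> U" "j < length (Y u)" "v \<in> U" "single x 1 \<in> keys (\<tau> u j v)"
      moreover from this have "\<tau> u j v \<noteq> 0" by (metis keys_zero empty_iff)
      ultimately show "ord v < ord u" using \<tau>(2)[of u j v] by blast
    qed (use finU Y \<tau>(1) in \<open>auto simp: T_def normal_forms_def\<close>)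
    with \<tau> show ?thesis by blast
  qed
  then obtain \<tau> \<mu> where T: "\<And>u j. u \<in> U \<Longrightarrow> j < length (Y u) \<Longrightarrow> T u j (\<tau> u j)"
    and rw: "rewriting V U Y \<tau> \<mu>" and shape': "(nested Vl U Y \<and> V = set Vl) \<or>
      (\<exists>ord. (\<forall>u\<in>U. \<forall>j<length (Y u). \<forall>v\<in>U. \<tau> u j v \<noteq> 0 \<longrightarrow> ord v < ord u) \<and> (\<mu> = (\<lambda>_. ord)))"
    by (elim exE conjE) (rule that, blast+)
  interpret rw: rewriting V U Y \<tau> \<mu> by (rule rw)
  let ?C = "children U Y" and ?S = "syz Y \<tau>" and ?Y = "restrict_vars Y"
  have \<tau>V: "\<tau> u j v \<in> polys V" if "u \<in> U" "j < length (Y u)" "v \<in> U" for u j v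
    using rw.\<tau>_nf[OF that] by (rule polys_mono) blast
  have S_polys: "?S v c \<in> polys V" if v: "v \<in> U" and c: "c \<in> ?C" for v c
  proof -
    obtain u j where u: "u \<in> U" "j < length (Y u)" "c = child u j" using c by (rule childrenE)
    then have "var (Y u ! j) \<in> polys V" using Y(2)[OF u(1)] by (auto intro!: polys_var)
    then show ?thesis using \<tau>V[OF u(1,2) v] by (auto simp: syz_def u(3) intro!: polys_diff polys_uminus)
  qed
  have S_hom: "homogeneous 1 (?S v c)" if v: "v \<in> U" and c: "c \<in> ?C" for v c
  proof -
    obtain u j where u: "u \<in> U" "j < length (Y u)" "c = child u j" using c by (rule childrenE)
    then show ?thesis using rw.\<tau>_hom[OF u(1,2) v]
      by (auto simp: syz_def u(3) intro!: homogeneous_diff homogeneous_var homogeneous_uminus)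
  qed
  have GS: "(\<Sum>u\<in>U. G a u * ?S u c) = 0" if a: "a \<in> A" and c: "c \<in> ?C" for a c
  proof -
    obtain u j where u: "u \<in> U" "j < length (Y u)" "c = child u j" using c by (rule childrenE)
    have "(\<Sum>v\<in>U. G a v * ?S v c) = (\<Sum>v\<in>U. (if v = u then G a u * var (Y u ! j) else 0) - G a v * \<tau> u j v)"
      by (intro sum.cong) (auto simp: syz_def u algebra_simps)
    also have "\<dots> = G a u * var (Y u ! j) - (\<Sum>v\<in>U. G a v * \<tau> u j v)"
      using u finU by (simp add: sum_subtractf)
    also have "\<dots> = 0" using T[OF u(1,2)] a by (simp add: T_def)
    finally show ?thesis .
  qed
  have decomp: "\<exists>p\<in>normal_forms V ?C ?Y. \<forall>v\<in>U. f v = (\<Sum>c\<in>?C. ?S v c * p c)"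
    if f: "\<And>u. u \<in> U \<Longrightarrow> f u \<in> polys V" and Gf: "\<And>a. a \<in> A \<Longrightarrow> (\<Sum>u\<in>U. G a u * f u) = 0" for f
  proof -
    obtain n p where np: "n \<in> normal_forms V U Y" "p \<in> normal_forms V ?C ?Y"
      "\<And>v. v \<in> U \<Longrightarrow> f v = n v + (\<Sum>c\<in>?C. ?S v c * p c)"
      using rw.spanning[of f, OF f] by blast
    \<comment> \<open>Applying \<open>G\<close> kills the syzygies, so the normal part is mapped to
      0 and vanishes by uniqueness.\<close>
    have "(\<Sum>u\<in>U. G a u * n u) = 0" if a: "a \<in> A" for a
    proof -
      have "0 = (\<Sum>u\<in>U. G a u * n u) + (\<Sum>u\<in>U. G a u * (\<Sum>c\<in>?C. ?S u c * p c))"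
        using Gf[OF a] np(3) by (simp add: distrib_left sum.distrib)
      then show ?thesis using sum_distrib_syz[of ?C G a ?S U p, OF GS[OF a]] by simp
    qed
    then have "n u = 0" if "u \<in> U" for u using indep[OF np(1) _ that] by blast
    then show ?thesis using np by (intro bexI[of _ p]) auto
  qed
  have dec': "lin_dec V U ?C ?S ?Y 1"
    unfolding lin_dec_def
  proof (intro conjI ballI allI impI)
    show "finite ?C" using finU by simp
    show "distinct (?Y c)" if "c \<in> ?C" for c
      using that by (rule childrenE) (simp add: Y restrict_vars_def)
    show "set (?Y c) \<subseteq> V" if "c \<in> ?C" for c
      using that by (rule childrenE) (use Y(2) set_take_subset in \<open>fastforce simp: restrict_vars_def\<close>)
    show "?S v c \<in> polys V" "homogeneous (int 1) (?S v c)" if "v \<in> U" "c \<in> ?C" for v c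
      using that S_polys S_hom by auto
    show "p c = 0" if "p \<in> normal_forms V ?C ?Y" "\<forall>v\<in>U. (\<Sum>c\<in>?C. ?S v c * p c) = 0" "c \<in> ?C" for p c
      using rw.independent that by blast
    show "\<exists>n\<in>normal_forms V ?C ?Y. \<forall>v\<in>U. (\<Sum>c\<in>?C. ?S v c * f c) = (\<Sum>c\<in>?C. ?S v c * n c)"
      if "\<forall>c\<in>?C. f c \<in> polys V" for f
    proof (rule decomp)
      show "(\<Sum>c\<in>?C. ?S v c * f c) \<in> polys V" if "v \<in> U" for v
        using that \<open>\<forall>c\<in>?C. f c \<in> polys V\<close> S_polys by (intro polys_sum polys_mult) auto
      show "(\<Sum>v\<in>U. G a v * (\<Sum>c\<in>?C. ?S v c * f c)) = 0" if "a \<in> A" for a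
        by (rule sum_distrib_syz) (rule GS[OF that])
    qed
  qed
  have "(nested Vl ?C ?Y \<and> V = set Vl) \<or> (\<exists>ord. triangular V U ?C ?S ?Y ord)"
    using shape'
  proof (elim disjE exE conjE)
    assume n: "nested Vl U Y" and V: "V = set Vl"
    have "\<exists>k. ?Y c = take k Vl" if c: "c \<in> ?C" for c
    proof -
      obtain u j where u: "u \<in> U" "j < length (Y u)" "c = child u j" using c by (rule childrenE)
      then obtain k where "Y u = take k Vl" using n by (auto simp: nested_def)
      then show ?thesis using u by (intro exI[of _ "min j k"]) (simp add: restrict_vars_def)
    qed
    then show ?thesis using n V by (auto simp: nested_def)
  next
    fix ord
    assume supp: "\<forall>u\<in>U. \<forall>j<length (Y u). \<forall>v\<in>U. \<tau> u j v \<noteq> 0 \<longrightarrow> ord v < ord u" and \<mu>: "\<mu> = (\<lambda>_. ord)"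
    have supp0: "\<tau> u j v = 0" if "u \<in> U" "j < length (Y u)" "v \<in> U" "\<not> ord v < ord u" for u j v
      using supp that by blast
    \<comment> \<open>Any number above all positions serves as the base of a lexicographic order:
      first the order of the parent, then the position.\<close>
    define B where "B = Suc (\<Sum>u\<in>U. length (Y u))"
    have B: "j < B" if "u \<in> U" "j < length (Y u)" for u j
      using member_le_sum[of u U "\<lambda>u. length (Y u)"] that finU by (simp add: B_def)
    have "triangular V U ?C ?S ?Y (\<lambda>c. ord (parent c) * B + label c)"
      unfolding triangular_def
    proof (intro ballI allI impI)
      fix c i assume c: "c \<in> ?C" and i: "i < length (?Y c)"
      obtain u j where u: "u \<in> U" "j < length (Y u)" "c = child u j"
        using c by (rule childrenE)
      have ij: "i < j" "i < length (Y u)" using i u by (auto simp: restrict_vars_def)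
      have yi: "?Y c ! i = Y u ! i" using ij u by (simp add: restrict_vars_def)
      \<comment> \<open>Rewriting is restricted to the nodes below \<open>u\<close>, which is
        possible because tails of such nodes stay among them.\<close>
      define D where "D = {v \<in> U. ord v < ord u}"
      have DU: "D \<subseteq> U" by (auto simp: D_def)
      interpret D: rewriting V D Y \<tau> \<mu>
        using rw.\<tau>_nf rw.\<tau>_hom rw.decreasing Y finite_subset[OF DU finU] DU
        by unfold_locales (auto simp: D_def)
      \<comment> \<open>The overlap of the syzygies at positions \<open>i < j\<close> of
        \<open>u\<close>: in the difference of their cross multiples the component \<open>u\<close>
        cancels and only tails remain, which are supported on \<open>D\<close>.\<close>
      define f where "f v = var (Y u ! j) * \<tau> u i v - var (Y u ! i) * \<tau> u j v" for v
      have yV: "Y u ! i \<in> V" "Y u ! j \<in> V" using Y(2)[OF u(1)] ij u by auto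
      have f_polys: "f v \<in> polys V" if "v \<in> U" for v
        unfolding f_def using that u ij yV by (intro polys_diff polys_mult polys_var \<tau>V) auto
      obtain n p where np: "n \<in> normal_forms V D Y" "p \<in> normal_forms V (children D Y) ?Y"
        "\<And>v. v \<in> D \<Longrightarrow> f v = n v + (\<Sum>c\<in>children D Y. ?S v c * p c)"
        using D.spanning[of f] f_polys DU by blast
      define n' where "n' v = (if v \<in> D then n v else 0)" for v
      define p' where "p' c = (if c \<in> children D Y then p c else 0)" for c
      have n': "n' \<in> normal_forms V U Y" using np(1) by (auto simp: normal_forms_def n'_def)
      have DC: "children D Y \<subseteq> ?C" using DU by (fastforce elim!: childrenE intro!: childrenI)
      have Sp: "(\<Sum>c\<in>?C. ?S v c * p' c) = (\<Sum>c\<in>children D Y. ?S v c * p c)" for v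
        using finU DC by (intro sum.mono_neutral_cong_right) (auto simp: p'_def)
      have f_eq: "f v = n' v + (\<Sum>c\<in>?C. ?S v c * p' c)" if v: "v \<in> U" for v
      proof (cases "v \<in> D")
        case True
        then show ?thesis using np(3) by (simp add: n'_def Sp)
      next
        case False
        then have nlt: "\<not> ord v < ord u" using v by (simp add: D_def)
        \<comment> \<open>Outside \<open>D\<close> both the overlap and the syzygies of nodes of
          \<open>D\<close> have zero components, so the decomposition found on \<open>D\<close>
          holds everywhere.\<close>
        have "?S v c' * p c' = 0" if c': "c' \<in> children D Y" for c'
        proof -
          obtain w l where w: "w \<in> D" "l < length (Y w)" "c' = child w l"
            using c' by (rule childrenE)
          then have "w \<in> U" "ord w < ord u" by (auto simp: D_def)
          then have "\<tau> w l v = 0" using supp0[of w l v] w v nlt by simp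
          then show ?thesis using w False by (auto simp: syz_def)
        qed
        then show ?thesis using False supp0[OF u(1) _ v nlt] u ij
          by (simp add: n'_def Sp f_def sum.neutral)
      qed
      have f_syz: "f v = var (Y u ! i) * ?S v (child u j) - var (Y u ! j) * ?S v (child u i)" for v
        by (simp add: f_def syz_def algebra_simps)
      have ci: "child u i \<in> ?C" "child u j \<in> ?C" using u ij by (auto intro!: childrenI)
      have Gn: "(\<Sum>v\<in>U. G a v * n' v) = 0" if a: "a \<in> A" for a
      proof -
        have "(\<Sum>v\<in>U. G a v * f v) = (\<Sum>v\<in>U. var (Y u ! i) * (G a v * ?S v (child u j)) -
            var (Y u ! j) * (G a v * ?S v (child u i)))"
          by (intro sum.cong) (auto simp: f_syz algebra_simps)
        also have "\<dots> = var (Y u ! i) * (\<Sum>v\<in>U. G a v * ?S v (child u j)) -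
            var (Y u ! j) * (\<Sum>v\<in>U. G a v * ?S v (child u i))"
          by (simp only: sum_subtractf sum_distrib_left)
        also have "\<dots> = 0" using GS[OF a] ci by simp
        finally have "0 = (\<Sum>v\<in>U. G a v * n' v) + (\<Sum>v\<in>U. G a v * (\<Sum>c\<in>?C. ?S v c * p' c))"
          using f_eq by (simp add: distrib_left sum.distrib)
        then show ?thesis using sum_distrib_syz[of ?C G a ?S U p', OF GS[OF a]] by simp
      qed
      have n0: "n' v = 0" if "v \<in> U" for v using indep[OF n' Gn that] .
      \<comment> \<open>As the normal part of the overlap vanishes, the variable at \<open>i\<close>
        times the syzygy \<open>child u j\<close> equals the variable at \<open>j\<close> times
        \<open>child u i\<close> plus syzygies above nodes of \<open>D\<close>; all of these come
        earlier in the new order.\<close>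
      define q where "q c' = (if c' = child u i then var (Y u ! j) else 0) + p' c'" for c'
      show "\<exists>q\<in>normal_forms V ?C ?Y. (\<forall>v\<in>U. ?S v c * var (?Y c ! i) = (\<Sum>c'\<in>?C. ?S v c' * q c')) \<and>
          (\<forall>c'\<in>?C. q c' \<noteq> 0 \<longrightarrow> ord (parent c') * B + label c' < ord (parent c) * B + label c)"
      proof (intro bexI[of _ q] conjI ballI impI)
        show "q \<in> normal_forms V ?C ?Y"
          unfolding normal_forms_def
        proof (intro CollectI ballI)
          fix c' assume c': "c' \<in> ?C"
          have "p' c' \<in> polys (V - set (?Y c'))" using np(2) by (auto simp: p'_def normal_forms_def)
          moreover have "Y u ! j \<notin> set (?Y (child u i))"
            using Y(1)[OF u(1)] u ij by (auto simp: restrict_vars_def in_set_conv_nth nth_eq_iff_index_eq)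
          ultimately show "q c' \<in> polys (V - set (?Y c'))"
            using yV unfolding q_def by (intro polys_add) (auto intro: polys_var)
        qed
      next
        fix v assume v: "v \<in> U"
        have "(\<Sum>c'\<in>?C. ?S v c' * q c') =
            (\<Sum>c'\<in>?C. if c' = child u i then ?S v (child u i) * var (Y u ! j) else 0) + (\<Sum>c'\<in>?C. ?S v c' * p' c')"
          unfolding sum.distrib[symmetric] by (intro sum.cong) (auto simp: q_def distrib_left)
        also have "\<dots> = ?S v (child u i) * var (Y u ! j) + f v"
          using ci finU f_eq[OF v] n0[OF v] by simp
        also have "\<dots> = ?S v (child u j) * var (Y u ! i)" by (simp add: f_syz algebra_simps)
        finally show "?S v c * var (?Y c ! i) = (\<Sum>c'\<in>?C. ?S v c' * q c')"
          unfolding yi by (simp only: u(3))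
      next
        fix c' assume c': "c' \<in> ?C" and "q c' \<noteq> 0"
        then consider "c' = child u i" | "c' \<in> children D Y" by (auto simp: q_def p'_def split: if_splits)
        then show "ord (parent c') * B + label c' < ord (parent c) * B + label c"
        proof cases
          case 1 then show ?thesis using ij u by simp
        next
          case 2
          then obtain w l where w: "w \<in> D" "l < length (Y w)" "c' = child w l"
            by (rule childrenE)
          then have "w \<in> U" "Suc (ord w) \<le> ord u" by (auto simp: D_def)
          then have "Suc (ord w) * B \<le> ord u * B" "l < B" using B w by (auto simp only: mult_le_mono1)
          then show ?thesis using w u by simp
        qed
      qed
    qed
    then show ?thesis by blast
  qed
  moreover have "\<exists>p. (\<forall>c\<in>?C. p c \<in> polys V) \<and> (\<forall>u\<in>U. f u = (\<Sum>c\<in>?C. ?S u c * p c))"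
    if f: "\<forall>u\<in>U. f u \<in> polys V" and Gf: "\<forall>a\<in>A. (\<Sum>u\<in>U. G a u * f u) = 0" for f
  proof -
    from f Gf have "\<exists>p\<in>normal_forms V ?C ?Y. \<forall>v\<in>U. f v = (\<Sum>c\<in>?C. ?S v c * p c)"
      by (intro decomp) simp_all
    then obtain p where p: "p \<in> normal_forms V ?C ?Y" "\<forall>v\<in>U. f v = (\<Sum>c\<in>?C. ?S v c * p c)" ..
    then show ?thesis using normal_forms_polys[OF p(1)] by blast
  qed
  ultimately show ?thesis using dec' GS by (intro exI[of _ ?S]) blast
qed

section \<open>Assembling the resolution from its levels\<close>

fun level :: "'i node set \<Rightarrow> ('i node \<Rightarrow> 'v list) \<Rightarrow> nat \<Rightarrow> 'i node set \<times> ('i node \<Rightarrow> 'v list)" where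
  "level U Y 0 = (U, Y)"
| "level U Y (Suc q) = (case level U Y q of (U', Y') \<Rightarrow> (children U' Y', restrict_vars Y'))"

lemma level_Suc:
  "fst (level U Y (Suc q)) = children (fst (level U Y q)) (snd (level U Y q))"
  "snd (level U Y (Suc q)) = restrict_vars (snd (level U Y q))"
  by (simp_all add: case_prod_beta)

fun chain_bound :: "nat \<Rightarrow> nat list \<Rightarrow> nat" where
  "chain_bound c [] = c"
| "chain_bound c (j # js) = j"

text \<open>Increasing lists of \<open>q\<close> numbers below \<open>c\<close>, equivalent to the
  \<open>q\<close>-element subsets of \<open>{..<c}\<close>. Their number is never evaluated; only
  its dependence on \<open>c\<close> alone matters.\<close>

fun chains :: "nat \<Rightarrow> nat \<Rightarrow> nat list set" where
  "chains c 0 = {[]}"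
| "chains c (Suc q) = (\<Union>js\<in>chains c q. (\<lambda>j. j # js) ` {..<chain_bound c js})"

lemma finite_chains [simp]: "finite (chains c q)"
  by (induction q) auto

lemma level_chains:
  assumes U: "U = (\<lambda>i. (i, [])) ` I"
  shows "fst (level U Y q) = (SIGMA i:I. chains (length (Y (i, []))) q) \<and>
    (\<forall>i\<in>I. \<forall>js\<in>chains (length (Y (i, []))) q.
      length (snd (level U Y q) (i, js)) = chain_bound (length (Y (i, []))) js)"
proof (induction q)
  case 0
  then show ?case using U by auto
next
  case (Suc q)
  define W Z where "W = fst (level U Y q)" and "Z = snd (level U Y q)"
  have W: "W = (SIGMA i:I. chains (length (Y (i, []))) q)"
    and Z: "\<And>i js. i \<in> I \<Longrightarrow> js \<in> chains (length (Y (i, []))) q \<Longrightarrow>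
      length (Z (i, js)) = chain_bound (length (Y (i, []))) js"
    using Suc by (auto simp: W_def Z_def)
  have "children W Z = (SIGMA i:I. chains (length (Y (i, []))) (Suc q))"
    (is "?L = ?R")
  proof
    show "?L \<subseteq> ?R"
    proof
      fix c assume "c \<in> ?L"
      then obtain u j where u: "u \<in> W" "j < length (Z u)" "c = child u j" by (rule childrenE)
      obtain i js where ij: "u = (i, js)" by fastforce
      then have "i \<in> I" "js \<in> chains (length (Y (i, []))) q" using u(1) W by auto
      then show "c \<in> ?R" using u Z ij by (auto simp: child_def)
    qed
    show "?R \<subseteq> ?L"
    proof
      fix c assume "c \<in> ?R"
      then obtain i j js where "i \<in> I" "js \<in> chains (length (Y (i, []))) q"
        "j < chain_bound (length (Y (i, []))) js" "c = child (i, js) j"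
        by (auto simp: child_def)
      then show "c \<in> ?L" using W Z by (auto intro!: childrenI)
    qed
  qed
  moreover have "length (restrict_vars Z (i, js)) = chain_bound (length (Y (i, []))) js"
    if "i \<in> I" "js \<in> chains (length (Y (i, []))) (Suc q)" for i js
    using that Z by (auto simp: restrict_vars_def label_def parent_def)
  ultimately show ?case unfolding level_Suc W_def Z_def by blast
qed

text \<open>Passage from families indexed by nodes to matrices indexed by numbers.\<close>

definition indexed_mat :: "nat \<Rightarrow> nat \<Rightarrow> (nat \<Rightarrow> 'a) \<Rightarrow> (nat \<Rightarrow> 'b) \<Rightarrow> ('a \<Rightarrow> 'b \<Rightarrow> 'c) \<Rightarrow> 'c mat" where
  "indexed_mat m n e e' G = mat m n (\<lambda>(i, j). G (e i) (e' j))"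

lemma indexed_mat_mult_vec:
  fixes G :: "'a \<Rightarrow> 'b \<Rightarrow> 'c::comm_ring_1"
  assumes e': "bij_betw e' {..<n} U" and i: "i < m"
  shows "(indexed_mat m n e e' G *\<^sub>v vec n (\<lambda>j. f (e' j))) $ i = (\<Sum>u\<in>U. G (e i) u * f u)"
proof -
  have "(indexed_mat m n e e' G *\<^sub>v vec n (\<lambda>j. f (e' j))) $ i = (\<Sum>j<n. G (e i) (e' j) * f (e' j))"
    using i by (simp add: indexed_mat_def scalar_prod_def atLeast0LessThan)
  also have "\<dots> = (\<Sum>u\<in>U. G (e i) u * f u)"
    by (rule sum.reindex_bij_betw[OF e'])
  finally show ?thesis .
qed

lemma free_module_indexed:
  fixes V :: "'v set" and e :: "nat \<Rightarrow> 'i"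
  assumes e: "bij_betw e {..<n} U"
  shows "(free_module V n :: ('v, 'k::field) mpoly vec set) = (\<lambda>f. vec n (\<lambda>j. f (e j))) ` {f. \<forall>u\<in>U. f u \<in> polys V}" (is "_ = ?R")
proof
  show "free_module V n \<subseteq> ?R"
  proof
    fix v :: "('v, 'k) mpoly vec" assume v: "v \<in> free_module V n"
    let ?f = "\<lambda>u. v $ (the_inv_into {..<n} e u)"
    have inj: "inj_on e {..<n}" and im: "e ` {..<n} = U" using e by (auto simp: bij_betw_def)
    have "v = vec n (\<lambda>j. ?f (e j))"
      using free_module_carrier[OF v] inj by (intro eq_vecI) (auto simp: the_inv_into_f_f)
    moreover have "\<forall>u\<in>U. ?f u \<in> polys V"
      using im inj v by (auto simp: the_inv_into_f_f intro: free_module_entry)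
    ultimately show "v \<in> ?R" by (intro image_eqI[of _ _ ?f]) simp_all
  qed
  show "?R \<subseteq> free_module V n"
    using bij_betw_apply[OF e] by (auto intro!: free_moduleI)
qed

lemma resolution_from_sequence:
  fixes G :: "nat \<Rightarrow> 'i node \<Rightarrow> 'i node \<Rightarrow> ('v, 'k::field) mpoly"
  assumes dec: "\<And>q. lin_dec V (R q) (W q) (G q) (Z q) (d q)"
    and R0: "R 0 = {r0}" and R: "\<And>q. R (Suc q) = W q"
    and d: "d 0 = t" "\<And>q. d (Suc q) = 1"
    and comp: "\<And>q a c. a \<in> R q \<Longrightarrow> c \<in> W (Suc q) \<Longrightarrow> (\<Sum>u\<in>W q. G q a u * G (Suc q) u c) = 0"
    and exact: "\<And>q f. (\<forall>u\<in>W q. f u \<in> polys V) \<Longrightarrow> (\<forall>a\<in>R q. (\<Sum>u\<in>W q. G q a u * f u) = 0) \<Longrightarrow>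
      (\<exists>p. (\<forall>c\<in>W (Suc q). p c \<in> polys V) \<and> (\<forall>u\<in>W q. f u = (\<Sum>c\<in>W (Suc q). G (Suc q) u c * p c)))"
    and I: "I = {\<Sum>u\<in>W 0. G 0 r0 u * f u | f. \<forall>u\<in>W 0. f u \<in> polys V}"
  shows "\<exists>a \<phi>. minimal_graded_free_resolution V I (\<lambda>q. card (W q)) a \<phi>"
proof -
  have fin: "finite (W q)" for q using dec[of q] by (simp add: lin_dec_def)
  have G_polys: "G q a u \<in> polys V" and G_hom: "homogeneous (int (d q)) (G q a u)"
    if "a \<in> R q" "u \<in> W q" for q a u
    using dec[of q] that by (auto simp: lin_dec_def)
  have "\<exists>e. bij_betw e {..<card (W q)} (W q)" for q
    using ex_bij_betw_nat_finite[OF fin[of q]] by (simp add: atLeast0LessThan)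
  then obtain e where e: "\<And>q. bij_betw (e q) {..<card (W q)} (W q)" by metis
  have eW: "e q j \<in> W q" if "j < card (W q)" for q j using bij_betw_apply[OF e] that by blast
  \<comment> \<open>The rows of a differential are enumerated like the columns of the preceding one,
    so that consecutive matrices compose; the augmentation has the single row
    \<open>r0\<close>.\<close>
  define er where "er q = (case q of 0 \<Rightarrow> (\<lambda>_. r0) | Suc p \<Rightarrow> e p)" for q
  define nr where "nr q = (case q of 0 \<Rightarrow> 1 | Suc p \<Rightarrow> card (W p))" for q
  define \<phi> where "\<phi> q = indexed_mat (nr q) (card (W q)) (er q) (e q) (G q)" for q
  have er: "er q i \<in> R q" if "i < nr q" for q i
    using that eW R0 R by (auto simp: er_def nr_def split: nat.splits)
  have er_surj: "\<exists>i<nr q. er q i = a" if "a \<in> R q" for q a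
  proof (cases q)
    case 0 then show ?thesis using that R0 by (auto simp: er_def nr_def)
  next
    case (Suc p)
    then have "a \<in> e p ` {..<card (W p)}" using that R e[of p] by (simp add: bij_betw_def)
    then show ?thesis using Suc by (auto simp: er_def nr_def)
  qed
  have entry: "\<phi> q $$ (i, j) = G q (er q i) (e q j)" if "i < nr q" "j < card (W q)" for q i j
    using that by (simp add: \<phi>_def indexed_mat_def)
  have \<phi>_over: "\<phi> q \<in> matrix_over V (nr q) (card (W q))" for q
    by (rule matrix_overI) (auto simp: \<phi>_def indexed_mat_def intro!: G_polys er eW)
  have mult: "(\<phi> q *\<^sub>v vec (card (W q)) (\<lambda>j. f (e q j))) $ i = (\<Sum>u\<in>W q. G q (er q i) u * f u)"
    if "i < nr q" for q i f
    unfolding \<phi>_def using e that by (rule indexed_mat_mult_vec)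
  have dims: "dim_row (\<phi> q) = nr q" "dim_col (\<phi> q) = card (W q)" for q
    by (auto simp: \<phi>_def indexed_mat_def)
  \<comment> \<open>Generators in degree \<open>t\<close> and linear differentials force every basis
    element of level \<open>q\<close> into degree \<open>t + q\<close>.\<close>
  define a where "a q j = (case q of 0 \<Rightarrow> int t | Suc p \<Rightarrow> int t + int (Suc p))" for q and j :: nat
  have "minimal_graded_free_resolution V I (\<lambda>q. card (W q)) a \<phi>"
    unfolding minimal_graded_free_resolution_def
  proof (intro conjI allI impI)
    show "\<phi> 0 \<in> matrix_over V 1 (card (W 0))" using \<phi>_over[of 0] by (simp add: nr_def)
    show "\<phi> (Suc q) \<in> matrix_over V (card (W q)) (card (W (Suc q)))" for q
      using \<phi>_over[of "Suc q"] by (simp add: nr_def)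
    show "homogeneous (a 0 j) (\<phi> 0 $$ (0, j))" if "j < card (W 0)" for j
      using G_hom[OF er eW, of 0 0 j] that d by (simp add: entry nr_def a_def)
    fix q i j assume ij: "i < card (W q)" "j < card (W (Suc q))"
    have "homogeneous 1 (\<phi> (Suc q) $$ (i, j))"
      using G_hom[OF er eW, of i "Suc q" j] ij d by (simp add: entry nr_def)
    moreover have "\<phi> (Suc q) $$ (i, j) \<in> polys V"
      using matrix_over_entry[OF \<phi>_over[of "Suc q"]] ij by (simp add: nr_def)
    ultimately show "homogeneous (a (Suc q) j - a q i) (\<phi> (Suc q) $$ (i, j))"
      "\<phi> (Suc q) $$ (i, j) \<in> irrelevant_ideal V"
      by (auto simp: a_def split: nat.splits intro: linear_form_irrelevant)
  next
    have "(\<lambda>v. (\<phi> 0 *\<^sub>v v) $ 0) ` free_module V (card (W 0)) =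
       (\<lambda>f. (\<phi> 0 *\<^sub>v vec (card (W 0)) (\<lambda>j. f (e 0 j))) $ 0) ` {f. \<forall>u\<in>W 0. f u \<in> polys V}"
      unfolding free_module_indexed[OF e] image_image ..
    also have "\<dots> = (\<lambda>f. \<Sum>u\<in>W 0. G 0 r0 u * f u) ` {f. \<forall>u\<in>W 0. f u \<in> polys V}"
      using mult[of 0 0] by (simp add: nr_def er_def)
    also have "\<dots> = I" unfolding I by blast
    finally show "(\<lambda>v. (\<phi> 0 *\<^sub>v v) $ 0) ` free_module V (card (W 0)) = I" .
  next
    fix q
    let ?n = "card (W q)" and ?n' = "card (W (Suc q))"
    show "(*\<^sub>v) (\<phi> (Suc q)) ` free_module V ?n' =
        {v \<in> free_module V ?n. \<phi> q *\<^sub>v v = 0\<^sub>v (dim_row (\<phi> q))}" (is "?L = ?K")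
    proof
      show "?L \<subseteq> ?K"
      proof
        fix w assume "w \<in> ?L"
        then obtain p where p: "\<forall>c\<in>W (Suc q). p c \<in> polys V"
          "w = \<phi> (Suc q) *\<^sub>v vec ?n' (\<lambda>j. p (e (Suc q) j))"
          unfolding free_module_indexed[OF e] by blast
        define f where "f u = (\<Sum>c\<in>W (Suc q). G (Suc q) u c * p c)" for u
        have w: "w = vec ?n (\<lambda>j. f (e q j))"
          unfolding p(2)
        proof (rule eq_vecI)
          fix i assume "i < dim_vec (vec ?n (\<lambda>j. f (e q j)))"
          then show "(\<phi> (Suc q) *\<^sub>v vec ?n' (\<lambda>j. p (e (Suc q) j))) $ i = vec ?n (\<lambda>j. f (e q j)) $ i"
            using mult[of i "Suc q" p] by (simp add: nr_def er_def f_def)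
        qed (simp add: dims nr_def)
        have "f u \<in> polys V" if "u \<in> W q" for u
          unfolding f_def using that p(1) R[of q] by (intro polys_sum polys_mult G_polys) auto
        then have "w \<in> free_module V ?n" unfolding w free_module_indexed[OF e] by blast
        moreover have "\<phi> q *\<^sub>v w = 0\<^sub>v (dim_row (\<phi> q))"
        proof (rule eq_vecI)
          fix i assume "i < dim_vec (0\<^sub>v (dim_row (\<phi> q)) :: ('v, 'k) mpoly vec)"
          then have i: "i < nr q" by (simp add: dims)
          have "(\<phi> q *\<^sub>v w) $ i = (\<Sum>u\<in>W q. G q (er q i) u * f u)" unfolding w by (rule mult[OF i])
          also have "\<dots> = 0" unfolding f_def
            by (rule sum_distrib_syz) (rule comp[OF er[OF i]])
          finally show "(\<phi> q *\<^sub>v w) $ i = 0\<^sub>v (dim_row (\<phi> q)) $ i" using i by (simp add: dims)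
        qed simp
        ultimately show "w \<in> ?K" by simp
      qed
      show "?K \<subseteq> ?L"
      proof
        fix w assume "w \<in> ?K"
        then have w0: "\<phi> q *\<^sub>v w = 0\<^sub>v (nr q)" and "w \<in> free_module V ?n" by (simp_all add: dims)
        then obtain f where f: "\<forall>u\<in>W q. f u \<in> polys V" "w = vec ?n (\<lambda>j. f (e q j))"
          unfolding free_module_indexed[OF e] by blast
        have "(\<Sum>u\<in>W q. G q a u * f u) = 0" if "a \<in> R q" for a
        proof -
          obtain i where i: "i < nr q" "er q i = a" using er_surj[OF \<open>a \<in> R q\<close>] by blast
          then show ?thesis using mult[OF i(1), of f] w0 unfolding f(2) by simp
        qed
        then obtain p where p: "\<forall>c\<in>W (Suc q). p c \<in> polys V"
          "\<forall>u\<in>W q. f u = (\<Sum>c\<in>W (Suc q). G (Suc q) u c * p c)"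
          using exact[OF f(1)] by blast
        have "w = \<phi> (Suc q) *\<^sub>v vec ?n' (\<lambda>j. p (e (Suc q) j))"
          unfolding f(2)
        proof (rule eq_vecI)
          fix i assume "i < dim_vec (\<phi> (Suc q) *\<^sub>v vec ?n' (\<lambda>j. p (e (Suc q) j)))"
          then have "i < ?n" by (simp add: dims nr_def)
          then show "vec ?n (\<lambda>j. f (e q j)) $ i = (\<phi> (Suc q) *\<^sub>v vec ?n' (\<lambda>j. p (e (Suc q) j))) $ i"
            using mult[of i "Suc q" p] p(2) eW[of i q] by (simp add: nr_def er_def)
        qed (simp add: dims nr_def)
        moreover have "vec ?n' (\<lambda>j. p (e (Suc q) j)) \<in> free_module V ?n'"
          unfolding free_module_indexed[OF e] using p(1) by blast
        ultimately show "w \<in> ?L" by blast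
      qed
    qed
  qed
  then show ?thesis by blast
qed

text \<open>An ideal generated in degree \<open>t\<close>, written as an internal direct sum of spaces
  \<open>k[V - Y i] g i\<close>.\<close>

definition linear_decomposition :: "'v set \<Rightarrow> 'i set \<Rightarrow> ('i \<Rightarrow> ('v, 'k::field) mpoly) \<Rightarrow> ('i \<Rightarrow> 'v list) \<Rightarrow>
    nat \<Rightarrow> bool" where
  "linear_decomposition V U g Y t \<longleftrightarrow> finite U \<and>
    (\<forall>i\<in>U. distinct (Y i) \<and> set (Y i) \<subseteq> V \<and> g i \<in> polys V \<and> homogeneous (int t) (g i)) \<and>
    (\<forall>f\<in>normal_forms V U Y. (\<Sum>i\<in>U. g i * f i) = 0 \<longrightarrow> (\<forall>i\<in>U. f i = 0)) \<and>
    (\<forall>f. (\<forall>i\<in>U. f i \<in> polys V) \<longrightarrow> (\<exists>n\<in>normal_forms V U Y. (\<Sum>i\<in>U. g i * f i) = (\<Sum>i\<in>U. g i * n i)))"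

definition combinations :: "'v set \<Rightarrow> 'i set \<Rightarrow> ('i \<Rightarrow> ('v, 'k::field) mpoly) \<Rightarrow> ('v, 'k) mpoly set" where
  "combinations V U g = {\<Sum>i\<in>U. g i * f i | f. \<forall>i\<in>U. f i \<in> polys V}"

lemma betti_linear_decomposition:
  fixes g :: "'i \<Rightarrow> ('v, 'k::field) mpoly"
  assumes dec: "linear_decomposition V U g Y t"
    and shape: "(\<exists>Vl. distinct Vl \<and> set Vl = V \<and> (\<forall>i\<in>U. \<exists>k. Y i = take k Vl)) \<or>
      (\<exists>ord :: 'i \<Rightarrow> nat. \<forall>i\<in>U. \<forall>y\<in>set (Y i). \<exists>n\<in>normal_forms V U Y.
        g i * var y = (\<Sum>v\<in>U. g v * n v) \<and> (\<forall>v\<in>U. n v \<noteq> 0 \<longrightarrow> ord v < ord i))"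
  shows "betti V (combinations V U g) q = (\<Sum>i\<in>U. card (chains (length (Y i)) q))"
proof -
  define U' :: "'i node set" where "U' = (\<lambda>i. (i, [])) ` U"
  define Y' :: "'i node \<Rightarrow> 'v list" where "Y' u = Y (fst u)" for u
  define G0 :: "'i node \<Rightarrow> 'i node \<Rightarrow> ('v, 'k) mpoly" where "G0 r u = g (fst u)" for r u
  define r0 :: "'i node" where "r0 = undefined"
  have inj: "inj_on (\<lambda>i. (i, [] :: nat list)) U" by (simp add: inj_on_def)
  have sum: "(\<Sum>u\<in>U'. h u) = (\<Sum>i\<in>U. h (i, []))" for h :: "'i node \<Rightarrow> ('v, 'k) mpoly"
    unfolding U'_def by (simp add: sum.reindex[OF inj])
  have nf: "f \<in> normal_forms V U' Y' \<longleftrightarrow> (\<lambda>i. f (i, [])) \<in> normal_forms V U Y"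
    for f :: "'i node \<Rightarrow> ('v, 'k) mpoly"
    by (auto simp: normal_forms_def U'_def Y'_def)
  have nf': "f \<in> normal_forms V U Y \<Longrightarrow> (\<lambda>u. f (fst u)) \<in> normal_forms V U' Y'"
    for f :: "'i \<Rightarrow> ('v, 'k) mpoly"
    by (auto simp: normal_forms_def U'_def Y'_def)
  have U'I: "(\<forall>u\<in>U'. P u) \<longleftrightarrow> (\<forall>i\<in>U. P (i, []))" for P by (auto simp: U'_def)
  note dec' = dec[unfolded linear_decomposition_def]
  note fin = dec'[THEN conjunct1] and gen = dec'[THEN conjunct2, THEN conjunct1]
    and ind = dec'[THEN conjunct2, THEN conjunct2, THEN conjunct1]
    and spn = dec'[THEN conjunct2, THEN conjunct2, THEN conjunct2]
  have dec0: "lin_dec V {r0} U' G0 Y' t"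
    unfolding lin_dec_def
  proof (intro conjI allI impI ballI)
    show "finite U'" using fin by (simp add: U'_def)
    show "distinct (Y' u)" "set (Y' u) \<subseteq> V" "G0 r u \<in> polys V" "homogeneous (int t) (G0 r u)" if "u \<in> U'" for u r
      using gen that by (auto simp: U'_def Y'_def G0_def)
    show "f u = 0" if f: "f \<in> normal_forms V U' Y'" and z: "\<forall>a\<in>{r0}. (\<Sum>u\<in>U'. G0 a u * f u) = 0" and u: "u \<in> U'" for f u
    proof -
      have 1: "(\<Sum>i\<in>U. g i * f (i, [])) = 0" using z by (simp add: sum G0_def)
      have 2: "(\<lambda>i. f (i, [])) \<in> normal_forms V U Y" using f by (simp add: nf)
      show ?thesis using bspec[OF ind 2, rule_format, OF 1] u by (auto simp: U'_def)
    qed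
    show "\<exists>n\<in>normal_forms V U' Y'. \<forall>a\<in>{r0}. (\<Sum>u\<in>U'. G0 a u * f u) = (\<Sum>u\<in>U'. G0 a u * n u)"
      if f: "\<forall>u\<in>U'. f u \<in> polys V" for f
    proof -
      have "\<forall>i\<in>U. f (i, []) \<in> polys V" using f by (simp add: U'I)
      then have "\<exists>n\<in>normal_forms V U Y. (\<Sum>i\<in>U. g i * f (i, [])) = (\<Sum>i\<in>U. g i * n i)"
        using spn[rule_format, of "\<lambda>i. f (i, [])"] by simp
      then obtain n where n: "n \<in> normal_forms V U Y" "(\<Sum>i\<in>U. g i * f (i, [])) = (\<Sum>i\<in>U. g i * n i)" ..
      then show ?thesis using nf'[OF n(1)] by (intro bexI[of _ "\<lambda>u. n (fst u)"]) (simp_all add: sum G0_def)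
    qed
  qed
  have "(\<exists>Vl. nested Vl U' Y' \<and> V = set Vl) \<or> (\<exists>ord. triangular V {r0} U' G0 Y' ord)"
    using shape
  proof (elim disjE exE conjE)
    fix Vl assume "distinct Vl" "set Vl = V" "\<forall>i\<in>U. \<exists>k. Y i = take k Vl"
    then have "nested Vl U' Y' \<and> V = set Vl" by (auto simp: nested_def U'I Y'_def)
    then show ?thesis by blast
  next
    fix ord :: "'i \<Rightarrow> nat"
    assume ord: "\<forall>i\<in>U. \<forall>y\<in>set (Y i). \<exists>n\<in>normal_forms V U Y.
        g i * var y = (\<Sum>v\<in>U. g v * n v) \<and> (\<forall>v\<in>U. n v \<noteq> 0 \<longrightarrow> ord v < ord i)"
    have "triangular V {r0} U' G0 Y' (\<lambda>u. ord (fst u))"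
      unfolding triangular_def
    proof (intro ballI allI impI)
      fix u j assume u: "u \<in> U'" and j: "j < length (Y' u)"
      obtain i where i: "i \<in> U" "u = (i, [])" using u by (auto simp: U'_def)
      then have "Y i ! j \<in> set (Y i)" using j by (simp add: Y'_def)
      with ord i obtain n where n: "n \<in> normal_forms V U Y"
        "g i * var (Y i ! j) = (\<Sum>v\<in>U. g v * n v) \<and> (\<forall>v\<in>U. n v \<noteq> 0 \<longrightarrow> ord v < ord i)" by blast
      then show "\<exists>n\<in>normal_forms V U' Y'. (\<forall>a\<in>{r0}. G0 a u * var (Y' u ! j) = (\<Sum>v\<in>U'. G0 a v * n v)) \<and>
          (\<forall>v\<in>U'. n v \<noteq> 0 \<longrightarrow> ord (fst v) < ord (fst u))"
        using nf'[OF n(1)] i by (intro bexI[of _ "\<lambda>u. n (fst u)"]) (simp_all add: sum G0_def Y'_def U'I)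
    qed
    then show ?thesis by blast
  qed
  then obtain Vl where shape0: "(nested Vl U' Y' \<and> V = set Vl) \<or> (\<exists>ord. triangular V {r0} U' G0 Y' ord)"
    by blast
  \<comment> \<open>The nodes and lists of all levels are determined by \<open>U\<close> and
    \<open>Y\<close>. Only the matrices have to be chosen, one after the other, with
    \<open>Q\<close> tying each matrix to its successor.\<close>
  define W Z where "W q = fst (level U' Y' q)" and "Z q = snd (level U' Y' q)" for q
  have W0: "W 0 = U'" "Z 0 = Y'" by (simp_all add: W_def Z_def)
  have WS: "W (Suc q) = children (W q) (Z q)" "Z (Suc q) = restrict_vars (Z q)" for q
    unfolding W_def Z_def by (rule level_Suc)+
  define R where "R q = (case q of 0 \<Rightarrow> {r0} | Suc p \<Rightarrow> W p)" for q
  define d where "d q = (case q of 0 \<Rightarrow> t | Suc p \<Rightarrow> 1)" for q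
  define P where "P q G \<longleftrightarrow> lin_dec V (R q) (W q) G (Z q) (d q) \<and>
    ((nested Vl (W q) (Z q) \<and> V = set Vl) \<or> (\<exists>ord. triangular V (R q) (W q) G (Z q) ord)) \<and>
    (q = 0 \<longrightarrow> G = G0)" for q G
  define Q where "Q q G S \<longleftrightarrow> (\<forall>a\<in>R q. \<forall>c\<in>W (Suc q). (\<Sum>u\<in>W q. G a u * S u c) = 0) \<and>
    (\<forall>f. (\<forall>u\<in>W q. f u \<in> polys V) \<longrightarrow> (\<forall>a\<in>R q. (\<Sum>u\<in>W q. G a u * f u) = 0) \<longrightarrow>
      (\<exists>p. (\<forall>c\<in>W (Suc q). p c \<in> polys V) \<and> (\<forall>u\<in>W q. f u = (\<Sum>c\<in>W (Suc q). S u c * p c))))"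
    for q and G S :: "'i node \<Rightarrow> 'i node \<Rightarrow> ('v, 'k) mpoly"
  have "\<exists>G. \<forall>q. P q (G q) \<and> Q q (G q) (G (Suc q))"
  proof (rule dependent_nat_choice)
    have "P 0 G0" using dec0 shape0 by (simp add: P_def R_def d_def W0)
    then show "\<exists>G. P 0 G" by (rule exI[where x = G0])
  next
    fix G q assume "P q G"
    then have 1: "lin_dec V (R q) (W q) G (Z q) (d q)"
      and 2: "(nested Vl (W q) (Z q) \<and> V = set Vl) \<or> (\<exists>ord. triangular V (R q) (W q) G (Z q) ord)"
      by (simp_all add: P_def)
    from syzygies_step[OF 1 2] obtain S where
      S: "lin_dec V (W q) (W (Suc q)) S (Z (Suc q)) 1 \<and>
        ((nested Vl (W (Suc q)) (Z (Suc q)) \<and> V = set Vl) \<or>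
          (\<exists>ord. triangular V (W q) (W (Suc q)) S (Z (Suc q)) ord)) \<and> Q q G S"
      unfolding Q_def WS by (elim exE)
    then have "P (Suc q) S" by (simp add: P_def R_def d_def)
    with S show "\<exists>S. P (Suc q) S \<and> Q q G S" by (intro exI[of _ S]) simp
  qed
  then obtain G where "\<forall>q. P q (G q) \<and> Q q (G q) (G (Suc q))" ..
  then have G: "P q (G q)" "Q q (G q) (G (Suc q))" for q by simp_all
  have "\<exists>a \<phi>. minimal_graded_free_resolution V (combinations V U g) (\<lambda>q. card (W q)) a \<phi>"
  proof (rule resolution_from_sequence[of V R W G Z d r0 t])
    show "lin_dec V (R q) (W q) (G q) (Z q) (d q)" for q using G(1) by (simp add: P_def)
    show "R 0 = {r0}" "R (Suc q) = W q" "d 0 = t" "d (Suc q) = 1" for q by (simp_all add: R_def d_def)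
    show "(\<Sum>u\<in>W q. G q a u * G (Suc q) u c) = 0" if "a \<in> R q" "c \<in> W (Suc q)" for q a c
      using G(2)[of q] that unfolding Q_def by blast
    show "\<exists>p. (\<forall>c\<in>W (Suc q). p c \<in> polys V) \<and> (\<forall>u\<in>W q. f u = (\<Sum>c\<in>W (Suc q). G (Suc q) u c * p c))"
      if "\<forall>u\<in>W q. f u \<in> polys V" "\<forall>a\<in>R q. (\<Sum>u\<in>W q. G q a u * f u) = 0" for q f
      using G(2)[of q] that unfolding Q_def by blast
    have G00: "G 0 = G0" using G(1)[of 0] by (simp add: P_def)
    show "combinations V U g = {\<Sum>u\<in>W 0. G 0 r0 u * f u |f. \<forall>u\<in>W 0. f u \<in> polys V}" (is "_ = ?R")
    proof
      show "combinations V U g \<subseteq> ?R"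
      proof
        fix x assume "x \<in> combinations V U g"
        then obtain f where f: "\<forall>i\<in>U. f i \<in> polys V" "x = (\<Sum>i\<in>U. g i * f i)"
          unfolding combinations_def by blast
        then show "x \<in> ?R"
          by (intro CollectI exI[of _ "\<lambda>u. f (fst u)"]) (simp add: W0 G00 G0_def sum U'I)
      qed
      show "?R \<subseteq> combinations V U g"
      proof
        fix x assume "x \<in> ?R"
        then obtain f where f: "\<forall>u\<in>U'. f u \<in> polys V" "x = (\<Sum>u\<in>U'. G0 r0 u * f u)"
          unfolding W0 G00 by blast
        then show "x \<in> combinations V U g" unfolding combinations_def
          by (intro CollectI exI[of _ "\<lambda>i. f (i, [])"]) (simp add: G0_def sum U'I)
      qed
    qed
  qed
  then obtain a \<phi> where "minimal_graded_free_resolution V (combinations V U g) (\<lambda>q. card (W q)) a \<phi>" by (elim exE)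
  then have "betti V (combinations V U g) q = card (W q)" by (rule betti_eqI)
  also have "W q = (SIGMA i:U. chains (length (Y i)) q)"
    using level_chains[of U' U Y' q] by (simp add: W_def U'_def Y'_def)
  also have "card \<dots> = (\<Sum>i\<in>U. card (chains (length (Y i)) q))"
    using fin by (intro card_SigmaI) simp_all
  finally show ?thesis .
qed

section \<open>Decompositions with prescribed leading monomials\<close>

text \<open>The multiples of \<open>u\<close> by monomials outside \<open>Y u\<close> form disjoint
  sets for different \<open>u\<close>. This condition on monomials alone is what transfers from a
  monomial ideal to polynomials with the same leading monomials.\<close>

locale leading_monomials =
  fixes V :: "'v set" and U :: "('v \<Rightarrow>\<^sub>0 nat) set" and Y :: "('v \<Rightarrow>\<^sub>0 nat) \<Rightarrow> 'v list"
  assumes finU: "finite U"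
    and unique: "\<And>u u' w w'. u \<in> U \<Longrightarrow> u' \<in> U \<Longrightarrow> keys w \<subseteq> V - set (Y u) \<Longrightarrow> keys w' \<subseteq> V - set (Y u') \<Longrightarrow>
      u + w = u' + w' \<Longrightarrow> u = u'"
begin

text \<open>A product \<open>u * w\<close> of least weight occurring in the sum cannot cancel. The
  weight need not separate all monomials: products of equal weight are told apart by
  \<open>unique\<close>.\<close>

lemma leading_independent:
  fixes g :: "('v \<Rightarrow>\<^sub>0 nat) \<Rightarrow> ('v, 'k::field) mpoly"
  assumes lead: "\<And>u. u \<in> U \<Longrightarrow> lookup (g u) u \<noteq> 0"
    and least: "\<And>u m. u \<in> U \<Longrightarrow> m \<in> keys (g u) \<Longrightarrow> m \<noteq> u \<Longrightarrow> wsum \<omega> u < wsum \<omega> m"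
    and f: "f \<in> normal_forms V U Y" and zero: "(\<Sum>u\<in>U. g u * f u) = 0" and i: "i \<in> U"
  shows "f i = 0"
proof (rule ccontr)
  assume "f i \<noteq> 0"
  define T where "T = (SIGMA u:U. keys (f u))"
  define \<nu> where "\<nu> s = wsum \<omega> (fst s + snd s)" for s :: "('v \<Rightarrow>\<^sub>0 nat) \<times> ('v \<Rightarrow>\<^sub>0 nat)"
  have finT: "finite T" using finU by (auto simp: T_def)
  obtain m0 where "m0 \<in> keys (f i)"
    using \<open>f i \<noteq> 0\<close> by (metis poly_mapping_eqI in_keys_iff lookup_zero)
  then have neT: "T \<noteq> {}" using i by (auto simp: T_def)
  have "Min (\<nu> ` T) \<in> \<nu> ` T" using finT neT by (intro Min_in) auto
  then obtain s where s: "s \<in> T" "\<nu> s = Min (\<nu> ` T)" by auto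
  have smin: "\<nu> s \<le> \<nu> s'" if "s' \<in> T" for s'
    unfolding s(2) using finT that by (intro Min_le) auto
  obtain u0 w0 where uw: "s = (u0, w0)" by fastforce
  have u0: "u0 \<in> U" and w0: "w0 \<in> keys (f u0)" using s(1) by (auto simp: T_def uw)
  have nf: "keys w \<subseteq> V - set (Y u)" if "u \<in> U" "w \<in> keys (f u)" for u w
    using f that by (auto simp: normal_forms_def polys_def)
  define M where "M = u0 + w0"
  have coeff: "lookup (single w c * g u) M = (if u = u0 \<and> w = w0 then c * lookup (g u0) u0 else 0)"
    if u: "u \<in> U" and w: "w \<in> keys (f u)" for u w c
  proof (cases "u = u0 \<and> w = w0")
    case True
    then show ?thesis using lookup_single_times[of w0 c "g u0" u0] by (simp add: M_def add.commute)
  next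
    case False
    have "M \<notin> keys (single w c * g u)"
    proof
      assume "M \<in> keys (single w c * g u)"
      then obtain m where m: "m \<in> keys (g u)" "M = w + m" using keys_single_times[of w c "g u"] by blast
      have "m = u"
      proof (rule ccontr)
        assume "m \<noteq> u"
        then have "wsum \<omega> (u + w) < wsum \<omega> M" using least[OF u m(1)] m(2) by simp
        moreover have "wsum \<omega> M \<le> wsum \<omega> (u + w)"
          using smin[of "(u, w)"] u w by (simp add: T_def \<nu>_def uw M_def)
        ultimately show False by simp
      qed
      then have eq: "u + w = u0 + w0" using m(2) by (simp add: M_def add.commute)
      then have "u = u0" using unique[OF u u0 nf[OF u w] nf[OF u0 w0]] by simp
      then show False using eq False by simp
    qed
    then show ?thesis using False by (auto simp: in_keys_iff)
  qed
  have "lookup (g u * f u) M = (if u = u0 then lookup (f u0) w0 * lookup (g u0) u0 else 0)"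
    if u: "u \<in> U" for u
  proof -
    have "lookup (g u * f u) M = (\<Sum>w\<in>keys (f u). lookup (single w (lookup (f u) w) * g u) M)"
      by (subst (1) sum_singles[of "f u", symmetric]) (simp add: sum_distrib_left lookup_sum mult.commute)
    also have "\<dots> = (\<Sum>w\<in>keys (f u). if w = w0 then (if u = u0 then lookup (f u) w0 * lookup (g u0) u0 else 0) else 0)"
      using coeff[OF u] by (intro sum.cong) auto
    also have "\<dots> = (if u = u0 then lookup (f u0) w0 * lookup (g u0) u0 else 0)"
      using w0 by auto
    finally show ?thesis .
  qed
  then have "lookup (\<Sum>u\<in>U. g u * f u) M = (\<Sum>u\<in>U. if u = u0 then lookup (f u0) w0 * lookup (g u0) u0 else 0)"
    by (simp add: lookup_sum)
  also have "\<dots> = lookup (f u0) w0 * lookup (g u0) u0" using u0 finU by simp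
  finally show False using zero w0 lead[OF u0] by (simp add: in_keys_iff)
qed

definition decomposable :: "(('v \<Rightarrow>\<^sub>0 nat) \<Rightarrow> ('v, 'k::field) mpoly) \<Rightarrow> ('v, 'k) mpoly \<Rightarrow> bool" where
  "decomposable g x \<longleftrightarrow> (\<exists>n\<in>normal_forms V U Y. x = (\<Sum>u\<in>U. g u * n u))"

lemma decomposable_add: "decomposable g x \<Longrightarrow> decomposable g y \<Longrightarrow> decomposable g (x + y)"
  unfolding decomposable_def
proof (elim bexE)
  fix n n' assume "n \<in> normal_forms V U Y" "x = (\<Sum>u\<in>U. g u * n u)"
    "n' \<in> normal_forms V U Y" "y = (\<Sum>u\<in>U. g u * n' u)"
  then show "\<exists>n\<in>normal_forms V U Y. x + y = (\<Sum>u\<in>U. g u * n u)"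
    by (intro bexI[of _ "\<lambda>u. n u + n' u"])
       (auto simp: sum.distrib distrib_left normal_forms_def polys_add)
qed

lemma decomposable_zero: "decomposable g 0"
  unfolding decomposable_def by (rule bexI[of _ "\<lambda>_. 0"]) (simp_all add: normal_forms_def)

lemma decomposable_sum: "(\<And>a. a \<in> A \<Longrightarrow> decomposable g (x a)) \<Longrightarrow> decomposable g (sum x A)"
proof (induction A rule: infinite_finite_induct)
  case (insert a A)
  then show ?case using decomposable_add[of g "x a" "sum x A"] by simp
qed (simp_all add: decomposable_zero)

lemma decomposable_normal:
  assumes "u \<in> U" "p \<in> polys (V - set (Y u))"
  shows "decomposable g (g u * p)"
  unfolding decomposable_def
proof (rule bexI[of _ "\<lambda>v. if v = u then p else 0"])
  have "(\<Sum>v\<in>U. g v * (if v = u then p else 0)) = (\<Sum>v\<in>U. if v = u then g u * p else 0)"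
    by (intro sum.cong) auto
  then show "g u * p = (\<Sum>v\<in>U. g v * (if v = u then p else 0))" using assms finU by simp
qed (use assms in \<open>auto simp: normal_forms_def\<close>)

lemma linear_decomposition_leading:
  fixes g :: "('v \<Rightarrow>\<^sub>0 nat) \<Rightarrow> ('v, 'k::field) mpoly"
  assumes Y: "\<And>u. u \<in> U \<Longrightarrow> distinct (Y u)" "\<And>u. u \<in> U \<Longrightarrow> set (Y u) \<subseteq> V"
    and g: "\<And>u. u \<in> U \<Longrightarrow> g u \<in> polys V" "\<And>u. u \<in> U \<Longrightarrow> homogeneous (int t) (g u)"
    and lead: "\<And>u. u \<in> U \<Longrightarrow> lookup (g u) u \<noteq> 0"
    and least: "\<And>u m. u \<in> U \<Longrightarrow> m \<in> keys (g u) \<Longrightarrow> m \<noteq> u \<Longrightarrow> wsum \<omega> u < wsum \<omega> m"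
    and span: "\<And>u m. u \<in> U \<Longrightarrow> keys m \<subseteq> V \<Longrightarrow> decomposable g (single m 1 * g u)"
  shows "linear_decomposition V U g Y t"
  unfolding linear_decomposition_def
proof (intro conjI ballI allI impI)
  show "f i = 0" if "f \<in> normal_forms V U Y" "(\<Sum>i\<in>U. g i * f i) = 0" "i \<in> U" for f i
    using leading_independent[OF lead least that] by blast
  fix f :: "_ \<Rightarrow> ('v, 'k) mpoly" assume f: "\<forall>u\<in>U. f u \<in> polys V"
  have scale: "decomposable g (single 0 c * x)" if x: "decomposable g x" for c x
  proof -
    from x obtain n where n: "n \<in> normal_forms V U Y" "x = (\<Sum>u\<in>U. g u * n u)"
      unfolding decomposable_def ..
    then show ?thesis unfolding decomposable_def
      by (intro bexI[of _ "\<lambda>u. single 0 c * n u"])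
         (auto simp: sum_distrib_left normal_forms_def polys_mult mult.left_commute)
  qed
  have "decomposable g (g u * f u)" if u: "u \<in> U" for u
  proof -
    have "decomposable g (\<Sum>m\<in>keys (f u). single 0 (lookup (f u) m) * (single m 1 * g u))"
      using f u by (intro decomposable_sum scale span) (auto simp: polys_def)
    also have "(\<Sum>m\<in>keys (f u). single 0 (lookup (f u) m) * (single m 1 * g u)) =
        (\<Sum>m\<in>keys (f u). single m (lookup (f u) m)) * g u"
      by (simp add: sum_distrib_right mult.assoc[symmetric] mult_single)
    finally show ?thesis by (simp add: sum_singles mult.commute)
  qed
  then have "decomposable g (\<Sum>u\<in>U. g u * f u)" by (rule decomposable_sum)
  then show "\<exists>n\<in>normal_forms V U Y. (\<Sum>i\<in>U. g i * f i) = (\<Sum>i\<in>U. g i * n i)"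
    unfolding decomposable_def by simp
qed (use Y g finU in auto)

lemma linear_decomposition_monomials:
  assumes Y: "\<And>u. u \<in> U \<Longrightarrow> distinct (Y u)" "\<And>u. u \<in> U \<Longrightarrow> set (Y u) \<subseteq> V"
    and deg: "\<And>u. u \<in> U \<Longrightarrow> keys u \<subseteq> V" "\<And>u. u \<in> U \<Longrightarrow> mon_degree u = t"
    and ex: "\<And>u m. u \<in> U \<Longrightarrow> keys m \<subseteq> V \<Longrightarrow> \<exists>u'\<in>U. \<exists>w. m + u = u' + w \<and> keys w \<subseteq> V - set (Y u')"
  shows "linear_decomposition V U (\<lambda>u. single u (1 :: 'k::field)) Y t"
proof (rule linear_decomposition_leading)
  fix u m :: "'v \<Rightarrow>\<^sub>0 nat" assume u: "u \<in> U" and m: "keys m \<subseteq> V"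
  then obtain u' w where "u' \<in> U" "m + u = u' + w" "keys w \<subseteq> V - set (Y u')" using ex by blast
  then show "decomposable (\<lambda>u. single u (1 :: 'k)) (single m 1 * single u 1)"
    using decomposable_normal[of u' "single w 1" "\<lambda>u. single u (1 :: 'k)"] by (simp add: mult_single polys_single)
qed (use Y deg in \<open>auto simp: polys_single homogeneous_def\<close>)

end

section \<open>Minors\<close>

lemma strict_mono_on_card_less:
  fixes c :: "nat \<Rightarrow> nat"
  assumes "strict_mono_on {..<t} c" "k < t"
  shows "card {a \<in> c ` {..<t}. a < c k} = k"
proof -
  have inj: "inj_on c {..<t}" using assms(1) by (rule strict_mono_on_imp_inj_on)
  have "c x < c k \<longleftrightarrow> x < k" if "x < t" for x
    using strict_mono_on_less[OF assms(1), of x k] assms(2) that by simp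
  then have "{a \<in> c ` {..<t}. a < c k} = c ` {..<k}" using assms(2) by auto
  then show ?thesis using inj assms(2) by (simp add: card_image inj_on_subset)
qed

text \<open>The function \<open>pick\<close> enumerates a finite set increasingly, so sets of rows
  and columns turn into strictly increasing maps.\<close>

lemma minors_alt:
  "minors t A = {det (mat t t (\<lambda>(i, j). A $$ (r i, c j))) | r c.
     strict_mono_on {..<t} r \<and> r ` {..<t} \<subseteq> {..<dim_row A} \<and>
     strict_mono_on {..<t} c \<and> c ` {..<t} \<subseteq> {..<dim_col A}}" (is "_ = ?R")
proof
  have inI: "{i. i < d \<and> i \<in> I} = I" if "I \<subseteq> {..<d}" for I and d :: nat using that by auto
  have mono: "strict_mono_on {..<t} (pick I)" "pick I ` {..<t} \<subseteq> I" if "card I = t" for I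
    using that by (auto simp: strict_mono_on_def pick_mono_le pick_in_set_le)
  show "minors t A \<subseteq> ?R"
  proof
    fix x assume "x \<in> minors t A"
    then obtain I J where IJ: "I \<subseteq> {..<dim_row A}" "J \<subseteq> {..<dim_col A}" "card I = t" "card J = t"
      "x = det (submatrix A I J)" by (auto simp: minors_def)
    have "submatrix A I J = mat t t (\<lambda>(i, j). A $$ (pick I i, pick J j))"
      unfolding submatrix_def using IJ by (simp add: inI)
    then show "x \<in> ?R" using IJ mono[of I] mono[of J]
      by (intro CollectI exI[of _ "pick I"] exI[of _ "pick J"]) auto
  qed
  show "?R \<subseteq> minors t A"
  proof
    fix x assume "x \<in> ?R"
    then obtain r c where rc: "strict_mono_on {..<t} r" "r ` {..<t} \<subseteq> {..<dim_row A}"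
      "strict_mono_on {..<t} c" "c ` {..<t} \<subseteq> {..<dim_col A}"
      "x = det (mat t t (\<lambda>(i, j). A $$ (r i, c j)))" by blast
    have pick: "pick (c ` {..<t}) k = c k" if "strict_mono_on {..<t} c" "k < t" for c :: "nat \<Rightarrow> nat" and k
      using pick_card_in_set[of "c k" "c ` {..<t}"] strict_mono_on_card_less[OF that] that by auto
    have card: "card (c ` {..<t}) = t" if "strict_mono_on {..<t} c" for c :: "nat \<Rightarrow> nat"
      using strict_mono_on_imp_inj_on[OF that] by (simp add: card_image)
    have "submatrix A (r ` {..<t}) (c ` {..<t}) = mat t t (\<lambda>(i, j). A $$ (r i, c j))"
      unfolding submatrix_def inI[OF rc(2)] inI[OF rc(4)] card[OF rc(1)] card[OF rc(3)]
      using rc by (intro eq_matI) (auto simp: pick)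
    then show "x \<in> minors t A" unfolding minors_def
      using rc card by (intro CollectI exI[of _ "r ` {..<t}"] exI[of _ "c ` {..<t}"]) auto
  qed
qed

lemma det_mat_sum:
  "det (mat t t f) = (\<Sum>p\<in>{p. p permutes {0..<t}}. of_int (sign p) * (\<Prod>i<t. f (i, p i)))"
  by (subst det_def'[of _ t]) (auto simp: atLeast0LessThan permutes_in_image intro!: sum.cong prod.cong)

lemma of_int_polys: "of_int k \<in> polys V"
proof -
  have "of_int k = single (0 :: 'a \<Rightarrow>\<^sub>0 nat) (of_int k :: 'b)" by (rule single_of_int[symmetric])
  then show ?thesis by (simp only: polys_const)
qed

lemma prod_var: "(\<Prod>i\<in>A. var (f i)) = single (\<Sum>i\<in>A. single (f i) 1) (1 :: 'k::field)"
  by (induction A rule: infinite_finite_induct) (auto simp: var_def mult_single)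

lemma combinations_subset_Idl:
  assumes S: "S \<subseteq> polys V" and g: "\<And>i. i \<in> U \<Longrightarrow> g i \<in> Idl\<^bsub>poly_ring V\<^esub> S"
  shows "combinations V U g \<subseteq> Idl\<^bsub>poly_ring V\<^esub> S"
proof
  fix x assume "x \<in> combinations V U g"
  then obtain f where f: "\<forall>i\<in>U. f i \<in> polys V" "x = (\<Sum>i\<in>U. f i * g i)"
    unfolding combinations_def by (auto simp: mult.commute)
  then show "x \<in> Idl\<^bsub>poly_ring V\<^esub> S" using g by (auto intro!: Idl_sum[OF S] Idl_mult[OF S])
qed

lemma combinations_zero: "0 \<in> combinations V U g"
  unfolding combinations_def by (intro CollectI exI[of _ "\<lambda>_. 0"]) simp

lemma combinations_add:
  assumes "p \<in> combinations V U g" "q \<in> combinations V U g"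
  shows "p + q \<in> combinations V U g"
proof -
  obtain f f' where "\<forall>i\<in>U. f i \<in> polys V" "p = (\<Sum>i\<in>U. g i * f i)"
    "\<forall>i\<in>U. f' i \<in> polys V" "q = (\<Sum>i\<in>U. g i * f' i)"
    using assms unfolding combinations_def by blast
  then show ?thesis unfolding combinations_def
    by (intro CollectI exI[of _ "\<lambda>i. f i + f' i"]) (simp add: distrib_left sum.distrib polys_add)
qed

lemma combinations_mult:
  assumes "p \<in> polys V" "q \<in> combinations V U g"
  shows "p * q \<in> combinations V U g"
proof -
  obtain f where "\<forall>i\<in>U. f i \<in> polys V" "q = (\<Sum>i\<in>U. g i * f i)"
    using assms(2) unfolding combinations_def by blast
  then show ?thesis using assms(1) unfolding combinations_def
    by (intro CollectI exI[of _ "\<lambda>i. p * f i"]) (simp add: sum_distrib_left mult.left_commute polys_mult)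
qed

lemma combinations_sum: "(\<And>a. a \<in> A \<Longrightarrow> x a \<in> combinations V U g) \<Longrightarrow> sum x A \<in> combinations V U g"
  by (induction A rule: infinite_finite_induct) (auto intro: combinations_add combinations_zero)

lemma combinations_subset_polys: "(\<And>i. i \<in> U \<Longrightarrow> g i \<in> polys V) \<Longrightarrow> combinations V U g \<subseteq> polys V"
  by (auto simp: combinations_def intro!: polys_sum polys_mult)

lemma Idl_subset_combinations:
  assumes g: "\<And>i. i \<in> U \<Longrightarrow> g i \<in> polys V" and S: "S \<subseteq> combinations V U g"
  shows "Idl\<^bsub>poly_ring V\<^esub> S \<subseteq> combinations V U g"
  using S by (intro Idl_subsetI combinations_zero combinations_add combinations_mult
      combinations_subset_polys g)

lemma single_in_combinations:
  assumes "finite U" "u \<in> U"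
  shows "g u \<in> combinations V U g"
proof -
  have "(\<Sum>i\<in>U. g i * (if i = u then 1 else 0)) = (\<Sum>i\<in>U. if i = u then g u else 0)"
    by (intro sum.cong) auto
  then have "g u = (\<Sum>i\<in>U. g i * (if i = u then 1 else 0))" using assms by simp
  then show ?thesis unfolding combinations_def
    by (intro CollectI exI[of _ "\<lambda>i. if i = u then 1 else 0"]) simp
qed

section \<open>The ideal of minors of D\<close>

definition block_degree :: "(nat \<times> nat \<Rightarrow>\<^sub>0 nat) \<Rightarrow> nat \<Rightarrow> nat" where
  "block_degree u i = lookup u (i, 1) + lookup u (i, 2)"

definition D_monomials :: "nat \<Rightarrow> nat \<Rightarrow> (nat \<times> nat \<Rightarrow>\<^sub>0 nat) set" where
  "D_monomials n t = {u. keys u \<subseteq> xvars n \<and> mon_degree u = t \<and> (\<forall>i. block_degree u i \<le> 1)}"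

text \<open>The factor 2 lets the row outweigh the column index, so that every exchange described by
  \<open>D_nonmult\<close> lowers the weight.\<close>

definition D_weight :: "nat \<times> nat \<Rightarrow> nat" where
  "D_weight x = 2 * fst x + snd x"

definition D_nonmult :: "nat \<Rightarrow> (nat \<times> nat \<Rightarrow>\<^sub>0 nat) \<Rightarrow> (nat \<times> nat) set" where
  "D_nonmult n u = {y \<in> xvars n. \<exists>x\<in>keys u. fst y = fst x \<and> snd y < snd x \<or>
     fst y < fst x \<and> fst y \<notin> fst ` keys u}"

definition some_list :: "'a set \<Rightarrow> 'a list" where
  "some_list A = (SOME l. distinct l \<and> set l = A)"

lemma some_list:
  assumes "finite A"
  shows "distinct (some_list A)" "set (some_list A) = A" "length (some_list A) = card A"
proof -
  have "\<exists>l. distinct l \<and> set l = A" using finite_distinct_list[OF assms] by blast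
  from someI_ex[OF this] show "distinct (some_list A)" "set (some_list A) = A"
    unfolding some_list_def by blast+
  then show "length (some_list A) = card A" by (metis distinct_card)
qed

lemma finite_xvars [simp]: "finite (xvars n)"
  by (simp add: xvars_def)

lemma finite_D_nonmult [simp]: "finite (D_nonmult n u)"
  by (rule finite_subset[of _ "xvars n"]) (auto simp: D_nonmult_def)

lemma finite_D_monomials [simp]: "finite (D_monomials n t)"
  by (rule finite_subset[OF _ finite_bounded_monomials[of "xvars n" t]]) (auto simp: D_monomials_def)

lemma block_degree_add [simp]: "block_degree (u + v) i = block_degree u i + block_degree v i"
  by (simp add: block_degree_def lookup_add)

lemma xvars_cases: "x \<in> xvars n \<Longrightarrow> (fst x, snd x) = x \<and> (snd x = 1 \<or> snd x = 2)"
  by (cases x) (auto simp: xvars_def)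

lemma block_degree_single: "x \<in> xvars n \<Longrightarrow> block_degree (single x 1) i = (if fst x = i then 1 else 0)"
  using xvars_cases[of x n] by (cases x) (auto simp: block_degree_def lookup_single when_def)

lemma block_degree_eq_0: "keys u \<subseteq> xvars n \<Longrightarrow> i \<notin> fst ` keys u \<Longrightarrow> block_degree u i = 0"
  by (force simp: block_degree_def in_keys_iff)

lemma lookup_le_block_degree:
  assumes "x \<in> xvars n"
  shows "lookup u x \<le> block_degree u (fst x)"
proof -
  obtain a b where x: "x = (a, b)" by fastforce
  then have "b = 1 \<or> b = 2" using xvars_cases[OF assms] by simp
  then show ?thesis using x by (elim disjE) (simp_all add: block_degree_def)
qed

lemma block_degree_pos: "keys u \<subseteq> xvars n \<Longrightarrow> x \<in> keys u \<Longrightarrow> block_degree u (fst x) \<ge> 1"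
  using lookup_le_block_degree[of x n u] subsetD[of "keys u" "xvars n" x] in_keys_iff[of x u] by linarith

lemma D_swap:
  assumes u: "u \<in> D_monomials n t" and y: "y \<in> D_nonmult n u"
  obtains x v where "x \<in> keys u" "single y 1 + u = v + single x 1" "v \<in> D_monomials n t"
    "wsum D_weight v < wsum D_weight u"
proof -
  from y obtain x where yV: "y \<in> xvars n" and x: "x \<in> keys u"
    and xy: "fst y = fst x \<and> snd y < snd x \<or> fst y < fst x \<and> fst y \<notin> fst ` keys u"
    unfolding D_nonmult_def by blast
  have uV: "keys u \<subseteq> xvars n" using u by (simp add: D_monomials_def)
  have xV: "x \<in> xvars n" using x uV by blast
  define r where "r = u - single x 1"
  have ur: "u = single x 1 + r" unfolding r_def by (rule mon_split[OF x])
  define v where "v = single y 1 + r"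
  have wt: "D_weight y < D_weight x"
    using xy xvars_cases[OF yV, THEN conjunct2] xvars_cases[OF xV, THEN conjunct2]
    unfolding D_weight_def by linarith
  have deg: "block_degree v i \<le> 1" for i
  proof -
    have ui: "block_degree u i \<le> 1" using u unfolding D_monomials_def by blast
    have vi: "block_degree v i = (if fst y = i then 1 else 0) + block_degree r i"
      unfolding v_def block_degree_add block_degree_single[OF yV] ..
    have ui': "block_degree u i = (if fst x = i then 1 else 0) + block_degree r i"
      unfolding ur block_degree_add block_degree_single[OF xV] ..
    consider "fst y = fst x" | "fst y \<notin> fst ` keys u" using xy by blast
    then show ?thesis
    proof cases
      case 1
      then show ?thesis using ui vi ui' by simp
    next
      case 2
      then have "block_degree u (fst y) = 0" by (rule block_degree_eq_0[OF uV])
      then show ?thesis using ui vi ui' by (cases "fst y = i") auto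
    qed
  qed
  have rV: "keys r \<subseteq> xvars n" using uV unfolding ur keys_plus_nat by blast
  then have "keys v \<subseteq> xvars n" using yV unfolding v_def keys_plus_nat by simp
  moreover have "mon_degree v = t"
    using u unfolding v_def D_monomials_def ur by simp
  ultimately have 1: "v \<in> D_monomials n t" using deg by (simp add: D_monomials_def)
  have 2: "wsum D_weight v < wsum D_weight u" using wt by (simp add: v_def ur)
  have 3: "single y 1 + u = v + single x 1" by (simp add: ur v_def add_ac)
  show ?thesis by (rule that[OF x 3 1 2])
qed

text \<open>A generator of least weight dividing the monomial does the job, because a
  nonmultiplicative variable in the cofactor would permit an exchange. Its minimality is kept in the
  conclusion for the sake of \<open>triangular_D\<close>.\<close>

lemma D_decompose:
  assumes u: "u \<in> D_monomials n t" and m: "keys m \<subseteq> xvars n"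
  shows "\<exists>v w. v \<in> D_monomials n t \<and> m + u = v + w \<and> keys w \<subseteq> xvars n - D_nonmult n v \<and>
    (\<forall>v' w'. v' \<in> D_monomials n t \<longrightarrow> m + u = v' + w' \<longrightarrow> wsum D_weight v \<le> wsum D_weight v')"
proof -
  define P where "P v \<longleftrightarrow> v \<in> D_monomials n t \<and> (\<exists>w. m + u = v + w)" for v
  have Pu: "P u" using u unfolding P_def by (metis add.commute)
  obtain v where v: "P v" and min: "\<And>v'. P v' \<Longrightarrow> wsum D_weight v \<le> wsum D_weight v'"
    using ex_has_least_nat[of P u "wsum D_weight", OF Pu] by blast
  then obtain w where w: "m + u = v + w" by (auto simp: P_def)
  have vD: "v \<in> D_monomials n t" using v by (simp add: P_def)
  have "keys (m + u) \<subseteq> xvars n" using u m by (auto simp: keys_plus_nat D_monomials_def)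
  then have wV: "keys w \<subseteq> xvars n" unfolding w keys_plus_nat by blast
  have "y \<notin> D_nonmult n v" if y: "y \<in> keys w" for y
  proof
    assume "y \<in> D_nonmult n v"
    then obtain x v' where v': "single y 1 + v = v' + single x 1" "v' \<in> D_monomials n t"
      "wsum D_weight v' < wsum D_weight v"
      using D_swap[OF vD] by metis
    have "m + u = v + (single y 1 + (w - single y 1))"
      unfolding w using mon_split[OF y] by simp
    also have "\<dots> = v' + (single x 1 + (w - single y 1))"
      using v'(1) by (metis (no_types, lifting) add.assoc add.commute)
    finally have "P v'" using v'(2) unfolding P_def by blast
    then show False using min v'(3) by force
  qed
  then have "keys w \<subseteq> xvars n - D_nonmult n v" using wV by blast
  moreover have "wsum D_weight v \<le> wsum D_weight v'" if "v' \<in> D_monomials n t" "m + u = v' + w'" for v' w'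
    using that by (intro min) (auto simp: P_def)
  ultimately show ?thesis using vD w by (intro exI[of _ v] exI[of _ w]) simp
qed

text \<open>The variable of \<open>v\<close> in row \<open>i\<close> must divide the cofactor
  \<open>w\<close>. If \<open>u\<close> used a later row, that variable would be nonmultiplicative
  for \<open>u\<close>.\<close>

lemma D_unique_aux:
  assumes u: "u \<in> D_monomials n t" and v: "v \<in> D_monomials n t"
    and w: "keys w \<subseteq> xvars n - D_nonmult n u" and w': "keys w' \<subseteq> xvars n - D_nonmult n v"
    and eq: "u + w = v + w'" and i: "i \<in> fst ` keys v" "i \<notin> fst ` keys u" and i': "i' \<in> fst ` keys u"
  shows "i' \<le> i"
proof (rule ccontr)
  assume "\<not> i' \<le> i"
  then have ii: "i < i'" by simp
  obtain y where y: "y \<in> keys v" "fst y = i" using i by auto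
  obtain x where x: "x \<in> keys u" "fst x = i'" using i' by auto
  have "y \<in> keys (u + w)" using y unfolding eq keys_plus_nat by blast
  moreover have "y \<notin> keys u" using y i by blast
  ultimately have "y \<in> keys w" by (simp add: keys_plus_nat)
  moreover have "y \<in> D_nonmult n u"
    unfolding D_nonmult_def using y v x ii i by (auto simp: D_monomials_def)
  ultimately show False using w by blast
qed

lemma card_blocks:
  assumes u: "u \<in> D_monomials n t"
  shows "inj_on fst (keys u)" "card (fst ` keys u) = t" "\<And>x. x \<in> keys u \<Longrightarrow> lookup u x = 1"
proof -
  have uV: "keys u \<subseteq> xvars n" and bd: "\<And>i. block_degree u i \<le> 1" and deg: "mon_degree u = t"
    using u by (auto simp: D_monomials_def)
  show "inj_on fst (keys u)"
  proof (rule inj_onI)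
    fix x y assume xy: "x \<in> keys u" "y \<in> keys u" "fst x = fst y"
    show "x = y"
    proof (rule ccontr)
      assume "x \<noteq> y"
      define r where "r = u - single x 1"
      have ur: "u = single x 1 + r" unfolding r_def by (rule mon_split[OF xy(1)])
      have rV: "keys r \<subseteq> xvars n" using uV unfolding ur keys_plus_nat by blast
      have "y \<in> keys r" using xy(2) \<open>x \<noteq> y\<close> unfolding ur keys_plus_nat by simp
      then have "block_degree r (fst x) \<ge> 1" using block_degree_pos[OF rV] xy(3) by metis
      moreover have "block_degree (single x 1) (fst x) = 1"
        using block_degree_single[of x n] xy(1) uV by auto
      ultimately show False using bd[of "fst x"] unfolding ur by simp
    qed
  qed
  then have card: "card (fst ` keys u) = card (keys u)" by (rule card_image)
  show 1: "lookup u x = 1" if "x \<in> keys u" for x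
  proof -
    have "lookup u x \<le> block_degree u (fst x)" using lookup_le_block_degree that uV by blast
    then show ?thesis using bd[of "fst x"] that by (simp add: in_keys_iff)
  qed
  have "t = (\<Sum>x\<in>keys u. 1)" using 1 deg by (simp add: mon_degree_def)
  then show "card (fst ` keys u) = t" using card by simp
qed

text \<open>Both row sets have \<open>t\<close> elements, so if they differed, each would contain a
  row missing from the other, and these two rows would each be at most the other. In a common row
  with different entries, the smaller variable would divide the cofactor of the other generator, for
  which it is nonmultiplicative.\<close>

lemma D_unique:
  assumes u: "u \<in> D_monomials n t" and v: "v \<in> D_monomials n t"
    and w: "keys w \<subseteq> xvars n - D_nonmult n u" and w': "keys w' \<subseteq> xvars n - D_nonmult n v"
    and eq: "u + w = v + w'"
  shows "u = v"
proof -
  have blocks: "fst ` keys u = fst ` keys v"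
  proof (rule ccontr)
    assume ne: "fst ` keys u \<noteq> fst ` keys v"
    have fin: "finite (fst ` keys u)" "finite (fst ` keys v)" by auto
    have "\<not> fst ` keys u \<subseteq> fst ` keys v" "\<not> fst ` keys v \<subseteq> fst ` keys u"
      using card_subset_eq[OF fin(2), of "fst ` keys u"] card_subset_eq[OF fin(1), of "fst ` keys v"]
        card_blocks(2)[OF u] card_blocks(2)[OF v] ne by auto
    then obtain i i' where i: "i \<in> fst ` keys u" "i \<notin> fst ` keys v"
      "i' \<in> fst ` keys v" "i' \<notin> fst ` keys u" by blast
    then have "i \<le> i'" "i' \<le> i"
      using D_unique_aux[OF u v w w' eq, of i' i] D_unique_aux[OF v u w' w eq[symmetric], of i i'] by blast+
    then show False using i by simp
  qed
  have sub: "keys u \<subseteq> keys v"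
    if u: "u \<in> D_monomials n t" and v: "v \<in> D_monomials n t" and w: "keys w \<subseteq> xvars n - D_nonmult n u"
      and w': "keys w' \<subseteq> xvars n - D_nonmult n v" and eq: "u + w = v + w'" and bl: "fst ` keys u = fst ` keys v"
    for u v w w'
  proof
    fix x assume x: "x \<in> keys u"
    then have "fst x \<in> fst ` keys v" using bl by blast
    then obtain y where y: "y \<in> keys v" "fst y = fst x" by auto
    have V: "x \<in> xvars n" "y \<in> xvars n" using x y u v by (auto simp: D_monomials_def)
    show "x \<in> keys v"
    proof (rule ccontr)
      assume nx: "x \<notin> keys v"
      then have "x \<in> keys w'" using x arg_cong[OF eq, of keys] by (auto simp: keys_plus_nat)
      moreover have "x \<in> D_nonmult n v" if "snd x < snd y"
        unfolding D_nonmult_def using V y that by (intro CollectI conjI bexI[of _ y]) simp_all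
      ultimately have "\<not> snd x < snd y" using w' by blast
      have "y \<notin> keys u" using card_blocks(1)[OF u] x y nx by (auto simp: inj_on_def)
      then have "y \<in> keys w" using y arg_cong[OF eq, of keys] by (auto simp: keys_plus_nat)
      moreover have "y \<in> D_nonmult n u" if "snd y < snd x"
        unfolding D_nonmult_def using V x y that by (intro CollectI conjI bexI[of _ x]) simp_all
      ultimately have "\<not> snd y < snd x" using w by blast
      with \<open>\<not> snd x < snd y\<close> have "x = y" using y by (simp add: prod_eq_iff)
      then show False using nx y by simp
    qed
  qed
  have "keys u = keys v"
    using sub[OF u v w w' eq blocks] sub[OF v u w' w eq[symmetric] blocks[symmetric]] by blast
  then show ?thesis
    using card_blocks(3)[OF u] card_blocks(3)[OF v] by (intro poly_mapping_eqI) (metis in_keys_iff)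
qed

definition D_vars :: "nat \<Rightarrow> (nat \<times> nat \<Rightarrow>\<^sub>0 nat) \<Rightarrow> (nat \<times> nat) list" where
  "D_vars n u = some_list (D_nonmult n u)"

lemma D_vars [simp]: "distinct (D_vars n u)" "set (D_vars n u) = D_nonmult n u"
  "length (D_vars n u) = card (D_nonmult n u)"
  by (simp_all add: D_vars_def some_list)

lemma leading_monomials_D: "leading_monomials (xvars n) (D_monomials n t) (D_vars n)"
proof
  show "u = u'" if "u \<in> D_monomials n t" "u' \<in> D_monomials n t" "keys w \<subseteq> xvars n - set (D_vars n u)"
    "keys w' \<subseteq> xvars n - set (D_vars n u')" "u + w = u' + w'" for u u' w w'
    using D_unique[of u n t u' w w'] that by simp
qed simp

lemma linear_decomposition_D:
  "linear_decomposition (xvars n) (D_monomials n t) (\<lambda>u. single u (1 :: 'k::field)) (D_vars n) t"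
proof -
  interpret leading_monomials "xvars n" "D_monomials n t" "D_vars n" by (rule leading_monomials_D)
  show ?thesis
  proof (rule linear_decomposition_monomials)
    fix u m :: "nat \<times> nat \<Rightarrow>\<^sub>0 nat" assume u: "u \<in> D_monomials n t" and m: "keys m \<subseteq> xvars n"
    show "\<exists>u'\<in>D_monomials n t. \<exists>w. m + u = u' + w \<and> keys w \<subseteq> xvars n - set (D_vars n u')"
      using D_decompose[OF u m] by (elim exE conjE) (intro bexI exI conjI, auto)
  qed (auto simp: D_monomials_def D_nonmult_def)
qed

text \<open>The normal form is a single term. Its generator has least weight among those dividing
  the product, and \<open>D_swap\<close> provides one lighter than \<open>u\<close>.\<close>

lemma triangular_D:
  fixes u :: "nat \<times> nat \<Rightarrow>\<^sub>0 nat"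
  assumes u: "u \<in> D_monomials n t" and y: "y \<in> set (D_vars n u)"
  shows "\<exists>f\<in>normal_forms (xvars n) (D_monomials n t) (D_vars n).
     single u 1 * var y = (\<Sum>v\<in>D_monomials n t. single v (1 :: 'k::field) * f v) \<and>
     (\<forall>v\<in>D_monomials n t. f v \<noteq> 0 \<longrightarrow> wsum D_weight v < wsum D_weight u)"
proof -
  have yN: "y \<in> D_nonmult n u" using y by simp
  then have "keys (single y (1 :: nat)) \<subseteq> xvars n" by (auto simp: D_nonmult_def)
  from D_decompose[OF u this] obtain v w where vw: "v \<in> D_monomials n t \<and> single y 1 + u = v + w \<and>
    keys w \<subseteq> xvars n - D_nonmult n v \<and>
    (\<forall>v' w'. v' \<in> D_monomials n t \<longrightarrow> single y 1 + u = v' + w' \<longrightarrow> wsum D_weight v \<le> wsum D_weight v')"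
    by (elim exE)
  note v = vw[THEN conjunct1] vw[THEN conjunct2, THEN conjunct1] vw[THEN conjunct2, THEN conjunct2, THEN conjunct1]
    and min = vw[THEN conjunct2, THEN conjunct2, THEN conjunct2, rule_format]
  obtain x v' where v': "single y 1 + u = v' + single x 1" "v' \<in> D_monomials n t" "wsum D_weight v' < wsum D_weight u"
    by (rule D_swap[OF u yN])
  have lt: "wsum D_weight v < wsum D_weight u" using min[OF v'(2,1)] v'(3) by simp
  define f where "f v' = (if v' = v then single w (1 :: 'k) else 0)" for v'
  have "(\<Sum>v'\<in>D_monomials n t. single v' 1 * f v') = (\<Sum>v'\<in>D_monomials n t. if v' = v then single v 1 * single w 1 else 0)"
    by (intro sum.cong) (auto simp: f_def)
  also have "\<dots> = single v 1 * single w 1" using v(1) by simp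
  also have "\<dots> = single u 1 * var y"
    by (simp add: mult_single var_def v(2)[symmetric] add.commute)
  finally have 1: "single u 1 * var y = (\<Sum>v\<in>D_monomials n t. single v (1 :: 'k) * f v)" by (rule sym)
  have 2: "f \<in> normal_forms (xvars n) (D_monomials n t) (D_vars n)"
    using v(3) by (simp add: f_def normal_forms_def polys_single)
  have 3: "\<forall>v'\<in>D_monomials n t. f v' \<noteq> 0 \<longrightarrow> wsum D_weight v' < wsum D_weight u"
    using lt by (simp add: f_def)
  show ?thesis by (rule bexI[OF _ 2]) (rule conjI[OF 1 3])
qed

lemma betti_D:
  "betti (xvars n) (combinations (xvars n) (D_monomials n t) (\<lambda>u. single u (1 :: 'k::field))) q =
     (\<Sum>u\<in>D_monomials n t. card (chains (card (D_nonmult n u)) q))"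
proof -
  have "\<exists>ord :: _ \<Rightarrow> nat. \<forall>u\<in>D_monomials n t. \<forall>y\<in>set (D_vars n u).
     \<exists>f\<in>normal_forms (xvars n) (D_monomials n t) (D_vars n).
       single u 1 * var y = (\<Sum>v\<in>D_monomials n t. single v (1 :: 'k) * f v) \<and>
       (\<forall>v\<in>D_monomials n t. f v \<noteq> 0 \<longrightarrow> ord v < ord u)"
    using triangular_D by (intro exI[of _ "wsum D_weight"] ballI)
  from betti_linear_decomposition[OF linear_decomposition_D disjI2[OF this], of q]
  show ?thesis unfolding D_vars(3) .
qed

lemma keys_sum_singles:
  assumes "x \<in> keys (\<Sum>r\<in>A. single (f r) (1 :: nat))"
  shows "\<exists>r\<in>A. x = f r"
  using assms by (induction A rule: infinite_finite_induct) (auto simp: keys_plus_nat)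

lemma sum_singles_D_monomials:
  assumes xV: "\<And>i. i < t \<Longrightarrow> x i \<in> xvars n" and inj: "inj_on (fst \<circ> x) {..<t}"
  shows "(\<Sum>i<t. single (x i) (1 :: nat)) \<in> D_monomials n t"
proof -
  have bd: "block_degree (\<Sum>i\<in>A. single (x i) 1) l = card {i\<in>A. fst (x i) = l}" if "A \<subseteq> {..<t}" "finite A" for A l
    using that(2,1)
  proof (induction A rule: finite_induct)
    case empty
    then show ?case by (simp add: block_degree_def)
  next
    case (insert a A)
    have "block_degree (single (x a) 1) l = (if fst (x a) = l then 1 else 0)"
      using block_degree_single[OF xV, of a l] insert by simp
    moreover have "{i \<in> insert a A. fst (x i) = l} =
        (if fst (x a) = l then insert a {i\<in>A. fst (x i) = l} else {i\<in>A. fst (x i) = l})" by auto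
    ultimately show ?case using insert by simp
  qed
  have "card {i\<in>{..<t}. fst (x i) = l} \<le> 1" for l
  proof (rule ccontr)
    assume "\<not> card {i\<in>{..<t}. fst (x i) = l} \<le> 1"
    then have "Suc (Suc 0) \<le> card {i\<in>{..<t}. fst (x i) = l}" by simp
    then obtain i j where "i \<in> {i\<in>{..<t}. fst (x i) = l}" "j \<in> {i\<in>{..<t}. fst (x i) = l}" "i \<noteq> j"
      by (auto simp: card_le_Suc_iff)
    then show False using inj by (auto simp: inj_on_def)
  qed
  moreover have "keys (\<Sum>i<t. single (x i) (1::nat)) \<subseteq> xvars n"
    using keys_sum_singles[of _ x "{..<t}"] xV by fastforce
  ultimately show ?thesis
    using bd[of "{..<t}"] by (simp add: D_monomials_def mon_degree_sum)
qed

text \<open>A term of the Leibniz expansion survives only if every chosen column belongs to the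
  block of its row, and then it takes one variable from each of \<open>t\<close> different
  rows.\<close>

lemma prod_nonzero_D_mat:
  assumes r: "strict_mono_on {..<t} r" "r ` {..<t} \<subseteq> {..<n}" and c: "c ` {..<t} \<subseteq> {..<2 * n}"
    and p: "p permutes {0..<t}"
  shows "(\<Prod>i<t. D_mat n $$ (r i, c (p i))) \<in> insert 0 ((\<lambda>u. single u (1 :: 'k::field)) ` D_monomials n t)"
proof (cases "\<forall>i<t. c (p i) div 2 = r i")
  case False
  then obtain i where i: "i < t" "c (p i) div 2 \<noteq> r i" by blast
  then have "p i < t" using permutes_in_image[OF p, of i] by simp
  then have "r i < n" "c (p i) < 2 * n" using r(2) c i(1) by auto
  then have "D_mat n $$ (r i, c (p i)) = (0 :: (nat \<times> nat, 'k) mpoly)"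
    using i(2) by (simp add: D_mat_def)
  then have "(\<Prod>i<t. D_mat n $$ (r i, c (p i))) = (0 :: (nat \<times> nat, 'k) mpoly)"
    using i by (intro prod_zero) auto
  then show ?thesis by simp
next
  case True
  define x where "x i = (r i + 1, c (p i) mod 2 + 1)" for i
  have pi: "p i < t" if "i < t" for i using permutes_in_image[OF p, of i] that by simp
  have "(\<Prod>i<t. D_mat n $$ (r i, c (p i))) = (\<Prod>i<t. var (x i) :: (nat \<times> nat, 'k) mpoly)"
  proof (rule prod.cong)
    fix i assume "i \<in> {..<t}"
    then have "r i < n" "c (p i) < 2 * n" "c (p i) div 2 = r i" using r c pi True by auto
    then show "D_mat n $$ (r i, c (p i)) = (var (x i) :: (nat \<times> nat, 'k) mpoly)"
      by (simp add: D_mat_def x_def)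
  qed simp
  also have "\<dots> = single (\<Sum>i<t. single (x i) 1) 1" by (rule prod_var)
  finally have eq: "(\<Prod>i<t. D_mat n $$ (r i, c (p i))) = single (\<Sum>i<t. single (x i) 1) (1 :: 'k)" .
  have "(\<Sum>i<t. single (x i) 1) \<in> D_monomials n t"
  proof (rule sum_singles_D_monomials)
    show "x i \<in> xvars n" if "i < t" for i
      using r(2) that by (auto simp: x_def xvars_def image_subset_iff Suc_le_eq)
    show "inj_on (fst \<circ> x) {..<t}"
      using strict_mono_on_imp_inj_on[OF r(1)] by (simp add: x_def inj_on_def)
  qed
  then show ?thesis unfolding eq by blast
qed

lemma minor_D:
  assumes "u \<in> D_monomials n t"
  shows "single u (1 :: 'k::field) \<in> minors t (D_mat n)"
proof -
  define r where "r = pick (fst ` keys u)"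
  note cb = card_blocks[OF assms]
  have uV: "keys u \<subseteq> xvars n" using assms by (simp add: D_monomials_def)
  have rin: "r k \<in> fst ` keys u" if "k < t" for k
    unfolding r_def using that cb(2) by (intro pick_in_set_le) simp
  have rmono: "r k < r l" if "k < l" "l < t" for k l
    unfolding r_def using that cb(2) by (intro pick_mono_le) simp_all
  have "\<forall>k. \<exists>x. k < t \<longrightarrow> x \<in> keys u \<and> fst x = r k" using rin by (metis imageE)
  then obtain x where x: "\<And>k. k < t \<Longrightarrow> x k \<in> keys u" "\<And>k. k < t \<Longrightarrow> fst (x k) = r k" by metis
  have xV: "x k \<in> xvars n" if "k < t" for k using x(1)[OF that] uV by blast
  have rb: "1 \<le> r k" "r k \<le> n" "1 \<le> snd (x k)" "snd (x k) \<le> 2" if "k < t" for k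
    using xV[OF that] x(2)[OF that] by (auto simp: xvars_def mem_Times_iff)
  \<comment> \<open>The column of the variable \<open>x k\<close>: the block of row number
    \<open>r k\<close>, counted from 1, starts at column \<open>2 * (r k - 1)\<close>. The resulting
    submatrix is diagonal.\<close>
  define c where "c k = 2 * (r k - 1) + (snd (x k) - 1)" for k
  define f where "f = (\<lambda>(i, j). D_mat n $$ (r i - 1, c j) :: (nat \<times> nat, 'k) mpoly)"
  have cdiv: "c k div 2 = r k - 1" "c k mod 2 = snd (x k) - 1" "c k < 2 * n" if "k < t" for k
  proof -
    have s: "snd (x k) = 1 \<or> snd (x k) = 2" and r: "r k - 1 < n" using rb[OF that] by linarith+
    from s show "c k div 2 = r k - 1" by (elim disjE) (simp_all add: c_def)
    from s show "c k mod 2 = snd (x k) - 1" by (elim disjE) (simp_all add: c_def)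
    from s r show "c k < 2 * n" unfolding c_def by linarith
  qed
  have rlt: "r k - 1 < n" if "k < t" for k using rb[OF that] by linarith
  have f: "f (i, j) = (if i = j then var (x i) else 0)" if ij: "i < t" "j < t" for i j
  proof -
    have D: "f (i, j) = (if c j div 2 = r i - 1 then var (r i - 1 + 1, c j mod 2 + 1) else 0)"
      unfolding f_def D_mat_def using rlt[OF ij(1)] cdiv(3)[OF ij(2)] by simp
    show ?thesis
    proof (cases "i = j")
      case True
      have "(r i - 1 + 1, c j mod 2 + 1) = x i"
        unfolding True cdiv(2)[OF ij(2)] using rb[OF ij(2)] x(2)[OF ij(2)]
        by (intro prod_eqI) simp_all
      then show ?thesis using D cdiv(1)[OF ij(2)] True by simp
    next
      case False
      then have "r i < r j \<or> r j < r i" using rmono[of i j] rmono[of j i] ij by linarith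
      then have "c j div 2 \<noteq> r i - 1"
        unfolding cdiv(1)[OF ij(2)] using rb(1)[OF ij(1)] rb(1)[OF ij(2)] by linarith
      then show ?thesis using D False by simp
    qed
  qed
  have "det (mat t t f) = (\<Prod>i<t. var (x i))"
  proof -
    have "det (mat t t f) = prod_list (diag_mat (mat t t f))"
      by (rule det_upper_triangular[of _ t]) (auto simp: f upper_triangular_def)
    also have "\<dots> = (\<Prod>i<t. f (i, i))" by (simp add: prod_list_diag_prod atLeast0LessThan)
    also have "\<dots> = (\<Prod>i<t. var (x i))" by (intro prod.cong) (auto simp: f)
    finally show ?thesis .
  qed
  also have "\<dots> = single (\<Sum>i<t. single (x i) 1) 1" by (rule prod_var)
  also have "(\<Sum>i<t. single (x i) 1) = u"
  proof -
    have inj: "inj_on x {..<t}"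
    proof (rule inj_onI)
      fix i j assume "i \<in> {..<t}" "j \<in> {..<t}" "x i = x j"
      then show "i = j" using x(2) rmono by (metis lessThan_iff less_irrefl linorder_neqE_nat)
    qed
    have "card (keys u) = t" using cb(1,2) by (simp add: card_image)
    then have "x ` {..<t} = keys u"
      using inj x(1) by (intro card_subset_eq) (auto simp: card_image)
    then have "(\<Sum>i<t. single (x i) 1) = (\<Sum>y\<in>keys u. single y (lookup u y))"
      using cb(3) sum.reindex[OF inj, of "\<lambda>y. single y (1::nat)"] by simp
    then show ?thesis by (simp add: sum_singles)
  qed
  finally have "single u 1 = det (mat t t f)" ..
  moreover have "strict_mono_on {..<t} (\<lambda>k. r k - 1)"
  proof (rule strict_mono_onI)
    fix k l assume kl: "k \<in> {..<t}" "l \<in> {..<t}" "k < l"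
    then show "r k - 1 < r l - 1" using rmono[of k l] rb(1)[of k] by simp
  qed
  moreover have "strict_mono_on {..<t} c"
  proof (rule strict_mono_onI)
    fix k l assume kl: "k \<in> {..<t}" "l \<in> {..<t}" "k < l"
    then show "c k < c l" using rmono[of k l] rb[of k] rb[of l] unfolding c_def by simp
  qed
  moreover have "dim_row (D_mat n :: (nat \<times> nat, 'k) mpoly mat) = n"
    "dim_col (D_mat n :: (nat \<times> nat, 'k) mpoly mat) = 2 * n"
    by (simp_all add: D_mat_def)
  moreover have "(\<lambda>k. r k - 1) ` {..<t} \<subseteq> {..<n}" "c ` {..<t} \<subseteq> {..<2 * n}"
    using rlt cdiv by auto
  ultimately show ?thesis
    unfolding minors_alt f_def by (intro CollectI exI[of _ "\<lambda>k. r k - 1"] exI[of _ c]) simp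
qed

lemma I_D_combinations:
  "(I_D n t :: (nat \<times> nat, 'k::field) mpoly set) =
     combinations (xvars n) (D_monomials n t) (\<lambda>u. single u 1)"
proof
  let ?C = "combinations (xvars n) (D_monomials n t) (\<lambda>u. single u (1 :: 'k))"
  have gen: "single u (1 :: 'k) \<in> polys (xvars n)" if "u \<in> D_monomials n t" for u
    using that by (auto simp: D_monomials_def polys_single)
  have sub: "minors t (D_mat n) \<subseteq> ?C"
  proof
    fix x :: "(nat \<times> nat, 'k) mpoly" assume "x \<in> minors t (D_mat n)"
    then obtain r c where rc: "strict_mono_on {..<t} r" "r ` {..<t} \<subseteq> {..<n}" "c ` {..<t} \<subseteq> {..<2 * n}"
      "x = det (mat t t (\<lambda>(i, j). D_mat n $$ (r i, c j)))"
      unfolding minors_alt by (auto simp: D_mat_def)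
    have "(\<Prod>i<t. D_mat n $$ (r i, c (p i))) \<in> ?C" if "p permutes {0..<t}" for p
      using prod_nonzero_D_mat[OF rc(1-3) that, where 'k = 'k] combinations_zero
        single_in_combinations[of "D_monomials n t" _ "\<lambda>u. single u (1 :: 'k)" "xvars n"]
      by auto
    then show "x \<in> ?C" unfolding rc(4) det_mat_sum
      by (intro combinations_sum combinations_mult of_int_polys) auto
  qed
  then have sub': "minors t (D_mat n :: (nat \<times> nat, 'k) mpoly mat) \<subseteq> polys (xvars n)"
    using combinations_subset_polys[of "D_monomials n t" "\<lambda>u. single u (1 :: 'k)" "xvars n"] gen by blast
  show "I_D n t \<subseteq> ?C" unfolding I_D_def minors_ideal_def
    using gen sub by (rule Idl_subset_combinations)
  show "?C \<subseteq> I_D n t" unfolding I_D_def minors_ideal_def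
    using sub' by (rule combinations_subset_Idl) (intro Idl_self[OF sub'] minor_D)
qed

section \<open>The strongly stable ideal J\<close>

definition x_degree :: "(nat \<times> nat \<Rightarrow>\<^sub>0 nat) \<Rightarrow> nat" where
  "x_degree u = wsum (\<lambda>x. if snd x = 1 then 1 else 0) u"

text \<open>With \<open>p = n - t + 1\<close> the variables are ordered
  \<open>x\<^sub>1\<^sub>2, \<dots>, x\<^sub>p\<^sub>2, x\<^sub>1\<^sub>1, \<dots>, x\<^sub>n\<^sub>1, x\<^sub>p\<^sub>+\<^sub>1\<^sub>,\<^sub>2, \<dots>, x\<^sub>n\<^sub>2\<close>. For this order \<open>J\<close> is strongly stable.\<close>

definition J_monomials :: "nat \<Rightarrow> nat \<Rightarrow> (nat \<times> nat \<Rightarrow>\<^sub>0 nat) set" where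
  "J_monomials n t = {u. keys u \<subseteq> xvars n \<and> mon_degree u = t \<and>
     (\<forall>i. (i, 2) \<in> keys u \<longrightarrow> i \<le> n - t + 1) \<and> (\<forall>i. (i, 1) \<in> keys u \<longrightarrow> i + x_degree u \<le> n + 1)}"

definition J_var :: "nat \<Rightarrow> nat \<Rightarrow> nat \<Rightarrow> nat \<times> nat" where
  "J_var n t k = (if k < n - t + 1 then (k + 1, 2)
     else if k < n - t + 1 + n then (k - (n - t + 1) + 1, 1) else (k - n + 1, 2))"

definition J_pos :: "nat \<Rightarrow> nat \<Rightarrow> nat \<times> nat \<Rightarrow> nat" where
  "J_pos n t x = (if snd x = 1 then n - t + 1 + (fst x - 1)
     else if fst x \<le> n - t + 1 then fst x - 1 else n + (fst x - 1))"

definition J_list :: "nat \<Rightarrow> nat \<Rightarrow> (nat \<times> nat) list" where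
  "J_list n t = map (J_var n t) [0..<2 * n]"

definition J_max :: "nat \<Rightarrow> nat \<Rightarrow> (nat \<times> nat \<Rightarrow>\<^sub>0 nat) \<Rightarrow> nat" where
  "J_max n t u = Max (J_pos n t ` keys u)"

text \<open>The decomposition of Eliahou and Kervaire: the nonmultiplicative variables of
  \<open>u\<close> are those before its last variable.\<close>

definition J_vars :: "nat \<Rightarrow> nat \<Rightarrow> (nat \<times> nat \<Rightarrow>\<^sub>0 nat) \<Rightarrow> (nat \<times> nat) list" where
  "J_vars n t u = take (J_max n t u) (J_list n t)"

lemma x_degree_simps [simp]:
  "x_degree (u + v) = x_degree u + x_degree v" "x_degree 0 = 0"
  "x_degree (single x c) = (if snd x = 1 then c else 0)"
  unfolding x_degree_def wsum_add wsum_zero wsum_single by simp_all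

lemma finite_J_monomials [simp]: "finite (J_monomials n t)"
  by (rule finite_subset[OF _ finite_bounded_monomials[of "xvars n" t]]) (auto simp: J_monomials_def)

context
  fixes n t :: nat
  assumes t: "1 \<le> t" "t \<le> n"
begin

lemma J_pos_var: "k < 2 * n \<Longrightarrow> J_pos n t (J_var n t k) = k"
  unfolding J_pos_def J_var_def using t by auto

lemma J_var_xvars: "k < 2 * n \<Longrightarrow> J_var n t k \<in> xvars n"
  unfolding J_var_def xvars_def using t by auto

lemma J_var_pos:
  assumes "x \<in> xvars n"
  shows "J_var n t (J_pos n t x) = x" "J_pos n t x < 2 * n"
proof -
  obtain i j where x: "x = (i, j)" by fastforce
  have b: "1 \<le> i" "i \<le> n" and j: "j = 1 \<or> j = 2" using assms x by (auto simp: xvars_def)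
  show "J_var n t (J_pos n t x) = x"
    using j b t unfolding x J_var_def J_pos_def by (elim disjE) auto
  show "J_pos n t x < 2 * n"
    using j b t unfolding x J_var_def J_pos_def by (elim disjE) auto
qed

lemma J_list: "distinct (J_list n t)" "set (J_list n t) = xvars n"
proof -
  have "inj_on (J_var n t) {0..<2 * n}"
    by (rule inj_on_inverseI[of _ "J_pos n t"]) (simp add: J_pos_var)
  then show "distinct (J_list n t)" by (simp add: J_list_def distinct_map)
  show "set (J_list n t) = xvars n"
  proof
    show "set (J_list n t) \<subseteq> xvars n" unfolding J_list_def using J_var_xvars by auto
    show "xvars n \<subseteq> set (J_list n t)"
    proof
      fix x assume "x \<in> xvars n"
      from J_var_pos[OF this] show "x \<in> set (J_list n t)"
        unfolding J_list_def by (auto intro!: image_eqI[of x _ "J_pos n t x"])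
    qed
  qed
qed

lemma set_take_J_list: "set (take k (J_list n t)) = {x \<in> xvars n. J_pos n t x < k}"
proof
  show "set (take k (J_list n t)) \<subseteq> {x \<in> xvars n. J_pos n t x < k}"
  proof
    fix x assume "x \<in> set (take k (J_list n t))"
    then obtain i where "i < k" "i < 2 * n" "x = J_var n t i"
      by (auto simp: in_set_conv_nth J_list_def)
    then show "x \<in> {x \<in> xvars n. J_pos n t x < k}" using J_pos_var J_var_xvars by simp
  qed
  show "{x \<in> xvars n. J_pos n t x < k} \<subseteq> set (take k (J_list n t))"
  proof
    fix x assume "x \<in> {x \<in> xvars n. J_pos n t x < k}"
    then have x: "x \<in> xvars n" "J_pos n t x < k" by auto
    note p = J_var_pos[OF x(1)]
    have "J_list n t ! J_pos n t x = x" using p by (simp add: J_list_def)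
    moreover have "J_pos n t x < length (take k (J_list n t))" using p x by (simp add: J_list_def)
    ultimately show "x \<in> set (take k (J_list n t))" using nth_mem[of "J_pos n t x" "take k (J_list n t)"] x(2) by simp
  qed
qed

lemma J_monomialsD:
  assumes "u \<in> J_monomials n t"
  shows "keys u \<subseteq> xvars n" "mon_degree u = t"
    "\<And>i. (i, 2) \<in> keys u \<Longrightarrow> i \<le> n - t + 1" "\<And>i. (i, 1) \<in> keys u \<Longrightarrow> i + x_degree u \<le> n + 1"
    "keys u \<noteq> {}"
  using assms t by (auto simp: J_monomials_def)

lemma J_max_in: "u \<in> J_monomials n t \<Longrightarrow> \<exists>x\<in>keys u. J_max n t u = J_pos n t x"
  using Max_in[of "J_pos n t ` keys u"] J_monomialsD(5)[of u] unfolding J_max_def by fastforce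

lemma J_max_ge: "x \<in> keys u \<Longrightarrow> J_pos n t x \<le> J_max n t u"
  unfolding J_max_def by (intro Max_ge) auto

text \<open>Strong stability. An exchange for an earlier variable never raises
  \<open>x_degree\<close>. A variable of the second block can only be replaced by one of the second
  block; within the first block the index drops; and passing from the first block to the second
  relaxes the bound on the rest.\<close>

lemma J_swap:
  assumes u: "u \<in> J_monomials n t" and x: "x \<in> keys u" and y: "y \<in> xvars n" and lt: "J_pos n t y < J_pos n t x"
  shows "single y 1 + (u - single x 1) \<in> J_monomials n t"
proof -
  note uD = J_monomialsD[OF u]
  define r where "r = u - single x 1"
  have ur: "u = single x 1 + r" unfolding r_def by (rule mon_split[OF x])
  have xV: "x \<in> xvars n" using x uD(1) by blast
  have "keys r \<subseteq> keys u" unfolding ur keys_plus_nat by blast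
  obtain i j where xe: "x = (i, j)" by fastforce
  obtain k l where ye: "y = (k, l)" by fastforce
  have ij: "1 \<le> i" "i \<le> n" "j = 1 \<or> j = 2" and kl: "1 \<le> k" "k \<le> n" "l = 1 \<or> l = 2"
    using xV y xe ye by (auto simp: xvars_def)
  have xb: "j = 2 \<Longrightarrow> i \<le> n - t + 1" using uD(3) x xe by blast
  have yb: "l = 2 \<Longrightarrow> k \<le> n - t + 1" and jl: "j = 2 \<Longrightarrow> l = 2" and ki: "j = 1 \<Longrightarrow> l = 1 \<Longrightarrow> k < i"
    using lt ij kl xb t unfolding J_pos_def xe ye by (auto split: if_splits)
  define v where "v = single y 1 + r"
  have "x_degree v \<le> x_degree u" using jl ij(3) kl(3) xe ye unfolding v_def ur by auto
  moreover have "k + x_degree v \<le> n + 1" if "l = 1"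
  proof -
    have "j = 1" using jl that ij(3) by auto
    then have "k < i" "x_degree v = x_degree u" using ki that xe ye by (simp_all add: v_def ur)
    then show ?thesis using uD(4)[of i] x xe \<open>j = 1\<close> by simp
  qed
  ultimately have "(a, 1) \<in> keys v \<Longrightarrow> a + x_degree v \<le> n + 1" for a
    using uD(4)[of a] \<open>keys r \<subseteq> keys u\<close> ye unfolding v_def keys_plus_nat by force
  moreover have "(a, 2) \<in> keys v \<Longrightarrow> a \<le> n - t + 1" for a
    using uD(3)[of a] \<open>keys r \<subseteq> keys u\<close> yb ye unfolding v_def keys_plus_nat by auto
  moreover have "keys v \<subseteq> xvars n" using uD(1) y \<open>keys r \<subseteq> keys u\<close> unfolding v_def keys_plus_nat by auto
  moreover have "mon_degree v = t" using uD(2) unfolding v_def ur by simp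
  ultimately show ?thesis unfolding J_monomials_def v_def r_def by blast
qed

text \<open>Among the generators dividing the monomial, one with least sum of positions works: a
  variable of the cofactor before its last variable could be exchanged for that last one.\<close>

lemma J_decompose:
  assumes u: "u \<in> J_monomials n t" and m: "keys m \<subseteq> xvars n"
  shows "\<exists>v\<in>J_monomials n t. \<exists>w. m + u = v + w \<and> keys w \<subseteq> xvars n - set (J_vars n t v)"
proof -
  define P where "P v \<longleftrightarrow> v \<in> J_monomials n t \<and> (\<exists>w. m + u = v + w)" for v
  have Pu: "P u" using u unfolding P_def by (metis add.commute)
  obtain v where v: "P v" and min: "\<And>v'. P v' \<Longrightarrow> wsum (J_pos n t) v \<le> wsum (J_pos n t) v'"
    using ex_has_least_nat[of P u "wsum (J_pos n t)", OF Pu] by blast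
  then obtain w where w: "m + u = v + w" by (auto simp: P_def)
  have vJ: "v \<in> J_monomials n t" using v by (simp add: P_def)
  have "keys (m + u) \<subseteq> xvars n" using J_monomialsD(1)[OF u] m by (simp add: keys_plus_nat)
  then have wV: "keys w \<subseteq> xvars n" unfolding w keys_plus_nat by blast
  have "y \<notin> set (J_vars n t v)" if y: "y \<in> keys w" for y
  proof
    assume "y \<in> set (J_vars n t v)"
    then have yV: "y \<in> xvars n" and lt: "J_pos n t y < J_max n t v"
      unfolding J_vars_def set_take_J_list by auto
    obtain x where x: "x \<in> keys v" "J_max n t v = J_pos n t x" using J_max_in[OF vJ] by blast
    define v' where "v' = single y 1 + (v - single x 1)"
    have v': "v' \<in> J_monomials n t" unfolding v'_def using J_swap[OF vJ x(1) yV] lt x(2) by simp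
    have vx: "v = single x 1 + (v - single x 1)" by (rule mon_split[OF x(1)])
    have "m + u = v + (single y 1 + (w - single y 1))" unfolding w using mon_split[OF y] by simp
    also have "\<dots> = v' + (single x 1 + (w - single y 1))"
      unfolding v'_def by (subst (1) vx) (simp only: add_ac)
    finally have "P v'" using v' unfolding P_def by blast
    then have "wsum (J_pos n t) v \<le> wsum (J_pos n t) v'" by (rule min)
    moreover have "wsum (J_pos n t) v = J_pos n t x + wsum (J_pos n t) (v - single x 1)"
      by (subst (1) vx) (simp only: wsum_add wsum_single mult_1)
    moreover have "wsum (J_pos n t) v' = J_pos n t y + wsum (J_pos n t) (v - single x 1)"
      unfolding v'_def by (simp only: wsum_add wsum_single mult_1)
    ultimately show False using lt x(2) by simp
  qed
  then have "keys w \<subseteq> xvars n - set (J_vars n t v)" using wV by blast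
  then show ?thesis using vJ w by blast
qed

lemma mon_le_degree_eq:
  fixes u v :: "'a \<Rightarrow>\<^sub>0 nat"
  assumes "\<And>x. lookup u x \<le> lookup v x" "mon_degree u = mon_degree v"
  shows "u = v"
proof -
  have v: "v = u + (v - u)"
    using assms(1) by (intro poly_mapping_eqI) (simp add: lookup_add lookup_minus)
  then have "mon_degree v = mon_degree u + mon_degree (v - u)" by (metis mon_degree_simps(1))
  then have "v - u = 0" using assms(2) by (simp add: mon_degree_eq_0_iff)
  then show ?thesis using v by simp
qed

text \<open>If the last variable of \<open>u\<close> comes before that of \<open>v\<close>, then
  \<open>u\<close> divides \<open>v\<close>: before the last variable of \<open>v\<close> the
  cofactor \<open>w'\<close> has exponent 0, and from there on \<open>u\<close> has exponent 0. If
  the last variables coincide, the exponents agree everywhere else. Equal degrees finish both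
  cases.\<close>

lemma J_unique:
  assumes u: "u \<in> J_monomials n t" and v: "v \<in> J_monomials n t"
    and w: "keys w \<subseteq> xvars n - set (J_vars n t u)" and w': "keys w' \<subseteq> xvars n - set (J_vars n t v)"
    and eq: "u + w = v + w'"
  shows "u = v"
proof -
  have look: "lookup u x + lookup w x = lookup v x + lookup w' x" for x
    using arg_cong[OF eq, of "\<lambda>m. lookup m x"] by (simp add: lookup_add)
  have zero: "lookup w x = 0" if "x \<in> xvars n" "J_pos n t x < J_max n t u"
    "keys w \<subseteq> xvars n - set (J_vars n t u)" for x u w
    using that unfolding J_vars_def set_take_J_list in_keys_iff[symmetric] subset_iff
    by (metis (no_types, lifting) DiffE in_keys_iff mem_Collect_eq)
  have above: "lookup u x = 0" if "u \<in> J_monomials n t" "x \<notin> xvars n \<or> J_max n t u < J_pos n t x" for x u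
  proof (rule ccontr)
    assume "lookup u x \<noteq> 0"
    then have "x \<in> keys u" by (simp add: in_keys_iff)
    then show False using that(2) J_max_ge[of x u] J_monomialsD(1)[OF that(1)] by auto
  qed
  have le: "u = v" if u: "u \<in> J_monomials n t" and v: "v \<in> J_monomials n t"
    and w': "keys w' \<subseteq> xvars n - set (J_vars n t v)"
    and look: "\<And>x. lookup u x + lookup w x = lookup v x + lookup w' x" and lt: "J_max n t u < J_max n t v" for u v w w'
  proof (rule mon_le_degree_eq)
    show "lookup u x \<le> lookup v x" for x
    proof (cases "x \<in> xvars n \<and> J_pos n t x < J_max n t v")
      case True
      then show ?thesis using zero[of x v w'] w' look[of x] by simp
    next
      case False
      then show ?thesis using above[OF u, of x] lt by auto
    qed
  qed (use J_monomialsD(2) u v in simp)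
  consider "J_max n t u < J_max n t v" | "J_max n t v < J_max n t u" | "J_max n t u = J_max n t v" by linarith
  then show ?thesis
  proof cases
    case 1 show ?thesis by (rule le[OF u v w' look 1])
  next
    case 2 show ?thesis by (rule le[OF v u w look[symmetric] 2, symmetric])
  next
    case 3
    define x0 where "x0 = J_var n t (J_max n t u)"
    have ne: "lookup u x = lookup v x" if "x \<noteq> x0" for x
    proof (cases "x \<in> xvars n")
      case True
      then have "J_pos n t x \<noteq> J_max n t u" using J_var_pos(1)[OF True] that x0_def by metis
      then consider "J_pos n t x < J_max n t u" | "J_max n t u < J_pos n t x" by linarith
      then show ?thesis
      proof cases
        case 1
        then show ?thesis using zero[OF True _ w] zero[OF True _ w'] 3 look[of x] by simp
      next
        case 2
        then show ?thesis using above[OF u, of x] above[OF v, of x] 3 by simp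
      qed
    next
      case False
      then show ?thesis using above[OF u, of x] above[OF v, of x] by simp
    qed
    have deg: "mon_degree u = mon_degree v" using J_monomialsD(2) u v by simp
    show ?thesis
    proof (cases "lookup u x0 \<le> lookup v x0")
      case True
      then have "lookup u x \<le> lookup v x" for x using ne[of x] by (cases "x = x0") auto
      then show ?thesis using deg by (rule mon_le_degree_eq)
    next
      case False
      then have "lookup v x \<le> lookup u x" for x using ne[of x] by (cases "x = x0") auto
      then show ?thesis using mon_le_degree_eq[of v u] deg by simp
    qed
  qed
qed

lemma leading_monomials_J: "leading_monomials (xvars n) (J_monomials n t) (J_vars n t)"
proof
  show "u = u'" if "u \<in> J_monomials n t" "u' \<in> J_monomials n t" "keys w \<subseteq> xvars n - set (J_vars n t u)"
    "keys w' \<subseteq> xvars n - set (J_vars n t u')" "u + w = u' + w'" for u u' w w'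
    by (rule J_unique[OF that])
qed simp

lemma J_vars: "distinct (J_vars n t u)" "set (J_vars n t u) \<subseteq> xvars n" "\<exists>k. J_vars n t u = take k (J_list n t)"
  unfolding J_vars_def using J_list set_take_subset[of _ "J_list n t"] by auto

lemma J_vars_length: "u \<in> J_monomials n t \<Longrightarrow> length (J_vars n t u) = J_max n t u"
  using J_max_in[of u] J_monomialsD(1)[of u] J_var_pos(2) by (fastforce simp: J_vars_def J_list_def)

lemma linear_decomposition_J:
  "linear_decomposition (xvars n) (J_monomials n t) (\<lambda>u. single u (1 :: 'k::field)) (J_vars n t) t"
proof -
  interpret leading_monomials "xvars n" "J_monomials n t" "J_vars n t" by (rule leading_monomials_J)
  show ?thesis
    by (rule linear_decomposition_monomials) (use J_vars J_monomialsD J_decompose in blast)+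
qed

text \<open>Stated for arbitrary generators \<open>g\<close>, so that it serves the monomials of J
  as well as the minors of P.\<close>

lemma betti_nested_J:
  assumes "linear_decomposition (xvars n) (J_monomials n t) g (J_vars n t) t"
  shows "betti (xvars n) (combinations (xvars n) (J_monomials n t) (g :: _ \<Rightarrow> (nat \<times> nat, 'k::field) mpoly)) q =
     (\<Sum>u\<in>J_monomials n t. card (chains (J_max n t u) q))"
proof -
  have "\<exists>Vl. distinct Vl \<and> set Vl = xvars n \<and> (\<forall>u\<in>J_monomials n t. \<exists>k. J_vars n t u = take k Vl)"
    using J_list J_vars(3) by blast
  from betti_linear_decomposition[OF assms disjI1[OF this], of q]
  show ?thesis by (simp add: J_vars_length)
qed

end

section \<open>Generators of J as pairs of sorted lists of indices, counted from 0\<close>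

definition mon_list :: "nat \<Rightarrow> nat list \<Rightarrow> nat \<times> nat \<Rightarrow>\<^sub>0 nat" where
  "mon_list j l = (\<Sum>i\<leftarrow>l. single (i + 1, j) 1)"

lemma mon_list_simps [simp]: "mon_list j [] = 0" "mon_list j (i # l) = single (i + 1, j) 1 + mon_list j l"
  by (simp_all add: mon_list_def)

lemma lookup_mon_list: "lookup (mon_list j l) (i + 1, j') = (if j = j' then count (mset l) i else 0)"
  by (induction l) (auto simp: lookup_add lookup_single when_def)

lemma keys_mon_list: "keys (mon_list j l) = (\<lambda>i. (i + 1, j)) ` set l"
  by (induction l) (auto simp: keys_plus_nat)

lemma mon_degree_mon_list: "mon_degree (mon_list j l) = length l"
  by (induction l) auto

lemma x_degree_mon_list: "x_degree (mon_list j l) = (if j = 1 then length l else 0)"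
  by (induction l) auto

lemma mon_list_insort: "mon_list j (insort i l) = single (i + 1, j) 1 + mon_list j l"
  by (induction l) (auto simp: add_ac)

lemma mon_list_ex:
  assumes "keys u \<subseteq> xvars n"
  shows "\<exists>a b. sorted a \<and> sorted b \<and> u = mon_list 1 a + mon_list 2 b"
  using assms
proof (induction "mon_degree u" arbitrary: u)
  case 0
  then have "u = mon_list 1 [] + mon_list 2 []" by (simp add: mon_degree_eq_0_iff)
  then show ?case by (intro exI[of _ "[]"]) simp
next
  case (Suc d)
  then have "keys u \<noteq> {}" by (auto simp: mon_degree_def)
  then obtain x where x: "x \<in> keys u" by blast
  define r where "r = u - single x 1"
  have ur: "u = single x 1 + r" unfolding r_def by (rule mon_split[OF x])
  have "keys r \<subseteq> xvars n" "d = mon_degree r"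
    using Suc.prems Suc.hyps(2) unfolding ur keys_plus_nat by auto
  then obtain a b where ab: "sorted a" "sorted b" "r = mon_list 1 a + mon_list 2 b"
    using Suc.hyps(1)[of r] by blast
  have xV: "x \<in> xvars n" using x Suc.prems by blast
  then obtain i where "x = (i + 1, 1) \<or> x = (i + 1, 2)"
  proof -
    assume *: "\<And>i. x = (i + 1, 1) \<or> x = (i + 1, 2) \<Longrightarrow> thesis"
    show thesis using xvars_cases[OF xV] xV by (intro *[of "fst x - 1"]) (auto simp: xvars_def)
  qed
  then show ?case
  proof
    assume xi: "x = (i + 1, 1)"
    have "u = mon_list 1 (insort i a) + mon_list 2 b"
      unfolding ur ab(3) xi mon_list_insort by (simp only: add_ac)
    then show ?thesis using ab sorted_insort[of i a] by (intro exI[of _ "insort i a"] exI[of _ b]) simp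
  next
    assume xi: "x = (i + 1, 2)"
    have "u = mon_list 1 a + mon_list 2 (insort i b)"
      unfolding ur ab(3) xi mon_list_insort by (simp only: add_ac)
    then show ?thesis using ab sorted_insort[of i b] by (intro exI[of _ a] exI[of _ "insort i b"]) simp
  qed
qed

definition J_lists :: "nat \<Rightarrow> nat \<Rightarrow> (nat list \<times> nat list) set" where
  "J_lists n t = {(a, b). sorted a \<and> sorted b \<and> length a + length b = t \<and>
     set b \<subseteq> {..<n - t + 1} \<and> set a \<subseteq> {..<n + 1 - length a}}"

definition J_mon :: "nat list \<times> nat list \<Rightarrow> nat \<times> nat \<Rightarrow>\<^sub>0 nat" where
  "J_mon = (\<lambda>(a, b). mon_list 1 a + mon_list 2 b)"

lemma inj_J_mon: "inj_on J_mon (J_lists n t)"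
proof (rule inj_onI)
  fix x y assume xy: "x \<in> J_lists n t" "y \<in> J_lists n t" "J_mon x = J_mon y"
  obtain a b where x: "x = (a, b)" by fastforce
  obtain a' b' where y: "y = (a', b')" by fastforce
  have eq: "mon_list 1 a + mon_list 2 b = mon_list 1 a' + mon_list 2 b'" using xy(3) by (simp add: J_mon_def x y)
  have "count (mset a) i = count (mset a') i" for i
    using arg_cong[OF eq, of "\<lambda>m. lookup m (i + 1, 1)"] by (simp only: lookup_add lookup_mon_list) simp
  then have a: "mset a = mset a'" by (rule multiset_eqI)
  have "count (mset b) i = count (mset b') i" for i
    using arg_cong[OF eq, of "\<lambda>m. lookup m (i + 1, 2)"] by (simp only: lookup_add lookup_mon_list) simp
  then have b: "mset b = mset b'" by (rule multiset_eqI)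
  have "sorted a" "sorted a'" "sorted b" "sorted b'" using xy by (auto simp: J_lists_def x y)
  then have "a = a'" "b = b'" using a b by (metis properties_for_sort)+
  then show "x = y" using x y by simp
qed

lemma J_monomials_lists:
  assumes t: "1 \<le> t" "t \<le> n"
  shows "J_monomials n t = J_mon ` J_lists n t"
proof
  show "J_monomials n t \<subseteq> J_mon ` J_lists n t"
  proof
    fix u assume u: "u \<in> J_monomials n t"
    note uD = J_monomialsD[OF t u]
    obtain a b where ab: "sorted a" "sorted b" "u = mon_list 1 a + mon_list 2 b"
      using mon_list_ex[OF uD(1)] by blast
    have keys: "keys u = (\<lambda>i. (i + 1, 1)) ` set a \<union> (\<lambda>i. (i + 1, 2)) ` set b"
      unfolding ab(3) keys_plus_nat keys_mon_list ..
    have len: "length a + length b = t" using uD(2) unfolding ab(3) by (simp add: mon_degree_mon_list)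
    have xd: "x_degree u = length a" unfolding ab(3) by (simp add: x_degree_mon_list)
    have "i < n - t + 1" if "i \<in> set b" for i using uD(3)[of "i + 1"] that unfolding keys by auto
    moreover have "i < n + 1 - length a" if "i \<in> set a" for i
      using uD(4)[of "i + 1"] that xd unfolding keys by auto
    ultimately have "(a, b) \<in> J_lists n t" using ab len by (auto simp: J_lists_def)
    then show "u \<in> J_mon ` J_lists n t" using ab(3) by (intro image_eqI[of _ _ "(a, b)"]) (simp_all add: J_mon_def)
  qed
  show "J_mon ` J_lists n t \<subseteq> J_monomials n t"
  proof
    fix u assume "u \<in> J_mon ` J_lists n t"
    then obtain a b where ab: "(a, b) \<in> J_lists n t" "u = mon_list 1 a + mon_list 2 b"
      by (auto simp: J_mon_def)
    have len: "length a + length b = t" and b: "\<And>i. i \<in> set b \<Longrightarrow> i < n - t + 1"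
      and a: "\<And>i. i \<in> set a \<Longrightarrow> i < n + 1 - length a"
      using ab(1) by (auto simp: J_lists_def)
    have keys: "keys u = (\<lambda>i. (i + 1, 1)) ` set a \<union> (\<lambda>i. (i + 1, 2)) ` set b"
      unfolding ab(2) keys_plus_nat keys_mon_list ..
    have xd: "x_degree u = length a" unfolding ab(2) by (simp add: x_degree_mon_list)
    have a': "i < n \<and> i + 1 + length a \<le> n + 1" if "i \<in> set a" for i
    proof -
      have "length a > 0" using that by (cases a) auto
      then show ?thesis using a[OF that] by linarith
    qed
    have "keys u \<subseteq> xvars n"
    proof
      fix x assume "x \<in> keys u"
      then consider i where "i \<in> set a" "x = (i + 1, 1)" | i where "i \<in> set b" "x = (i + 1, 2)"
        unfolding keys by blast
      then show "x \<in> xvars n"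
      proof cases
        case 1 then show ?thesis using a'[of i] by (simp add: xvars_def)
      next
        case 2 then show ?thesis using b[of i] t by (simp add: xvars_def)
      qed
    qed
    moreover have "mon_degree u = t" unfolding ab(2) using len by (simp add: mon_degree_mon_list)
    moreover have "i \<le> n - t + 1" if "(i, 2) \<in> keys u" for i
      using that b unfolding keys by (auto simp: less_Suc_eq_le)
    moreover have "i + x_degree u \<le> n + 1" if "(i, 1) \<in> keys u" for i
      using that a' unfolding keys xd by auto
    ultimately show "u \<in> J_monomials n t" by (simp add: J_monomials_def)
  qed
qed

text \<open>The admissible variables of the second block all precede the first block in the order,
  so the second list decides only when the first is empty.\<close>

lemma J_max_lists:
  assumes t: "1 \<le> t" "t \<le> n" and ab: "(a, b) \<in> J_lists n t"
  shows "J_max n t (J_mon (a, b)) = (if a = [] then last b else n - t + 1 + last a)"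
proof -
  have len: "length a + length b = t" and b: "\<And>i. i \<in> set b \<Longrightarrow> i < n - t + 1" and s: "sorted a" "sorted b"
    using ab by (auto simp: J_lists_def)
  have keys: "keys (J_mon (a, b)) = (\<lambda>i. (i + 1, 1)) ` set a \<union> (\<lambda>i. (i + 1, 2)) ` set b"
    unfolding J_mon_def by (simp add: keys_plus_nat keys_mon_list)
  have "J_pos n t ` keys (J_mon (a, b)) = (\<lambda>i. n - t + 1 + i) ` set a \<union> (\<lambda>i. i) ` set b"
    unfolding keys image_Un image_image
    by (intro arg_cong2[of _ _ _ _ "(\<union>)"] image_cong) (use b in \<open>auto simp: J_pos_def less_Suc_eq_le\<close>)
  then have m: "J_max n t (J_mon (a, b)) = Max ((\<lambda>i. n - t + 1 + i) ` set a \<union> set b)"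
    unfolding J_max_def by simp
  have last_max: "x \<le> last l" if l: "sorted l" and x: "x \<in> set l" for l and x :: nat
  proof -
    obtain i where i: "i < length l" "x = l ! i" using x by (auto simp: in_set_conv_nth)
    then have "l ! i \<le> l ! (length l - 1)" using l by (intro sorted_nth_mono) auto
    then show ?thesis using i by (cases l) (auto simp: last_conv_nth)
  qed
  show ?thesis
  proof (cases "a = []")
    case True
    then have "b \<noteq> []" using len t by auto
    then have "Max (set b) = last b" using last_max[OF s(2)] by (intro Max_eqI) auto
    then show ?thesis using m True by simp
  next
    case False
    have "Max ((\<lambda>i. n - t + 1 + i) ` set a \<union> set b) = n - t + 1 + last a"
    proof (rule Max_eqI)
      fix y assume "y \<in> (\<lambda>i. n - t + 1 + i) ` set a \<union> set b"
      then consider i where "i \<in> set a" "y = n - t + 1 + i" | "y \<in> set b" by blast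
      then show "y \<le> n - t + 1 + last a"
      proof cases
        case 1 then show ?thesis using last_max[OF s(1), of i] by simp
      next
        case 2 then show ?thesis using b[of y] by simp
      qed
    qed (use False in auto)
    then show ?thesis using False m by simp
  qed
qed

section \<open>Generators of J as diagonal products of T\<close>

definition T_var :: "nat \<Rightarrow> nat \<Rightarrow> nat \<Rightarrow> nat \<times> nat" where
  "T_var n r c = (if c < n then (c - r + 1, 1) else (c - n - r + 1, 2))"

text \<open>The selections of columns with nonzero diagonal product. In the first block
  \<open>r \<le> c r\<close> holds automatically for strictly increasing \<open>c\<close>; in the
  second block it has to be required relative to \<open>n\<close>.\<close>

definition J_columns :: "nat \<Rightarrow> nat \<Rightarrow> (nat \<Rightarrow> nat) set" where
  "J_columns n t = {c. strict_mono_on {..<t} c \<and> c ` {..<t} \<subseteq> {..<2 * n} \<and> (\<forall>r<t. c r < n \<or> n + r \<le> c r)}"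

lemma T_mat_entry:
  assumes "r < t" "c < 2 * n"
  shows "T_mat n t $$ (r, c) = (if r \<le> c \<and> (c < n \<or> n + r \<le> c) then var (T_var n r c) else 0)"
  using assms by (auto simp: T_mat_def beside_def T_block_def T_var_def)

lemma strict_mono_on_gap:
  fixes c :: "nat \<Rightarrow> nat"
  assumes "strict_mono_on {..<t} c" "r \<le> k" "k < t"
  shows "c r + (k - r) \<le> c k"
  using assms(2,3)
proof (induction k rule: dec_induct)
  case (step k)
  have "c k < c (Suc k)" using assms(1) step by (auto simp: strict_mono_on_def)
  then show ?case using step by simp
qed simp

lemma J_columns_monomial:
  assumes t: "1 \<le> t" "t \<le> n" and c: "c \<in> J_columns n t"
  shows "(\<Sum>r<t. single (T_var n r (c r)) 1) \<in> J_monomials n t"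
proof -
  have mono: "strict_mono_on {..<t} c" and range: "\<And>r. r < t \<Longrightarrow> c r < 2 * n"
    and valid: "\<And>r. r < t \<Longrightarrow> c r < n \<or> n + r \<le> c r"
    using c by (auto simp: J_columns_def)
  let ?u = "\<Sum>r<t. single (T_var n r (c r)) (1 :: nat)"
  \<comment> \<open>The number of columns taken from the first block; since \<open>c\<close>
    increases, they belong to the rows \<open>0, ..., s - 1\<close>.\<close>
  define s where "s = card {r\<in>{..<t}. c r < n}"
  have xd: "x_degree ?u = s"
  proof -
    have "x_degree (\<Sum>r\<in>A. single (T_var n r (c r)) 1) = card {r\<in>A. c r < n}" if "finite A" for A
      using that
    proof (induction A rule: finite_induct)
      case (insert a A)
      have "{r \<in> insert a A. c r < n} = (if c a < n then insert a {r\<in>A. c r < n} else {r\<in>A. c r < n})" by auto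
      then show ?case using insert by (simp add: T_var_def)
    qed simp
    then show ?thesis by (simp add: s_def)
  qed
  have below: "r < s" if "r < t" "c r < n" for r
  proof -
    have "{..r} \<subseteq> {r\<in>{..<t}. c r < n}"
    proof
      fix k assume "k \<in> {..r}"
      then show "k \<in> {r\<in>{..<t}. c r < n}" using strict_mono_on_gap[OF mono, of k r] that by auto
    qed
    then have "card {..r} \<le> s" unfolding s_def by (intro card_mono) auto
    then show ?thesis by simp
  qed
  have c_s: "c (s - 1) < n" "s - 1 < t" if "r < t" "c r < n" for r
  proof -
    have "s > 0" using below[OF that] by simp
    have "s \<le> t" unfolding s_def using card_mono[of "{..<t}" "{r\<in>{..<t}. c r < n}"] by auto
    then show "s - 1 < t" using \<open>s > 0\<close> by simp
    show "c (s - 1) < n"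
    proof (rule ccontr)
      assume ge: "\<not> c (s - 1) < n"
      have "{r\<in>{..<t}. c r < n} \<subseteq> {..<s - 1}"
      proof
        fix k assume k: "k \<in> {r\<in>{..<t}. c r < n}"
        have "\<not> s - 1 \<le> k"
        proof
          assume "s - 1 \<le> k"
          then have "c (s - 1) \<le> c k" using strict_mono_on_gap[OF mono, of "s - 1" k] k by simp
          then show False using k ge by simp
        qed
        then show "k \<in> {..<s - 1}" by simp
      qed
      then have "s \<le> s - 1" unfolding s_def using card_mono[of "{..<s - 1}"] by (metis card_lessThan finite_lessThan s_def)
      then show False using \<open>s > 0\<close> by simp
    qed
  qed
  have key: "\<exists>r<t. x = T_var n r (c r)" if "x \<in> keys ?u" for x
    using keys_sum_singles[OF that] by auto
  have ge: "r \<le> c r" if "r < t" for r using strict_mono_on_gap[OF mono, of 0 r] that by simp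
  \<comment> \<open>Columns grow by at least one per row, so the last row \<open>t - 1\<close>,
    whose column is below \<open>2 * n\<close>, gives the bound for the second block.\<close>
  have i2: "c r - n - r + 1 \<le> n - t + 1" if "r < t" "n + r \<le> c r" for r
    using strict_mono_on_gap[OF mono, of r "t - 1"] range[of "t - 1"] that t by linarith
  \<comment> \<open>Here the comparison is with row \<open>s - 1\<close>, the last one whose column
    lies in the first block.\<close>
  have i1: "c r - r + 1 + s \<le> n + 1" if "r < t" "c r < n" for r
    using strict_mono_on_gap[OF mono, of r "s - 1"] c_s[OF that] below[OF that] ge[OF that(1)] by linarith
  have "keys ?u \<subseteq> xvars n"
  proof
    fix x assume "x \<in> keys ?u"
    then obtain r where r: "r < t" "x = T_var n r (c r)" using key by blast
    show "x \<in> xvars n"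
    proof (cases "c r < n")
      case True
      then show ?thesis using r i1[OF r(1)] below[OF r(1)] by (simp add: T_var_def xvars_def)
    next
      case False
      then show ?thesis using r i2[OF r(1)] valid[OF r(1)] t by (simp add: T_var_def xvars_def)
    qed
  qed
  moreover have "mon_degree ?u = t" by (simp add: mon_degree_sum)
  moreover have "i \<le> n - t + 1" if x: "(i, 2) \<in> keys ?u" for i
  proof -
    obtain r where r: "r < t" "(i, 2) = T_var n r (c r)" using key[OF x] by blast
    then have "\<not> c r < n" "i = c r - n - r + 1" by (auto simp: T_var_def split: if_splits)
    then show ?thesis using i2[OF r(1)] valid[OF r(1)] by simp
  qed
  moreover have "i + x_degree ?u \<le> n + 1" if x: "(i, 1) \<in> keys ?u" for i
  proof -
    obtain r where r: "r < t" "(i, 1) = T_var n r (c r)" using key[OF x] by blast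
    then have "c r < n" "i = c r - r + 1" by (auto simp: T_var_def split: if_splits)
    then show ?thesis using i1[OF r(1)] xd by simp
  qed
  ultimately show ?thesis unfolding J_monomials_def by blast
qed

lemma J_monomial_columns:
  assumes t: "1 \<le> t" "t \<le> n" and u: "u \<in> J_monomials n t"
  shows "\<exists>c\<in>J_columns n t. u = (\<Sum>r<t. single (T_var n r (c r)) 1)"
proof -
  obtain a b where ab: "(a, b) \<in> J_lists n t" "u = mon_list 1 a + mon_list 2 b"
    using u unfolding J_monomials_lists[OF t] by (auto simp: J_mon_def)
  have len: "length a + length b = t" and b: "\<And>i. i \<in> set b \<Longrightarrow> i < n - t + 1"
    and a: "\<And>i. i \<in> set a \<Longrightarrow> i < n + 1 - length a" and s: "sorted a" "sorted b"
    using ab(1) by (auto simp: J_lists_def)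
  \<comment> \<open>Adding the row number turns the two weakly increasing lists into one strictly
    increasing selection of columns and cancels against the subtraction of the row in
    \<open>T_var\<close>.\<close>
  define c where "c r = (if r < length a then a ! r + r else n + b ! (r - length a) + r)" for r
  have ca: "c r = a ! r + r" "c r < n" if "r < length a" for r
    using a[of "a ! r"] that by (auto simp: c_def)
  have cb: "c r = n + b ! (r - length a) + r" "b ! (r - length a) < n - t + 1" if "\<not> r < length a" "r < t" for r
    using b[of "b ! (r - length a)"] that len by (auto simp: c_def)
  have "strict_mono_on {..<t} c"
  proof (rule strict_mono_onI)
    fix r k assume rk: "r \<in> {..<t}" "k \<in> {..<t}" "r < k"
    consider "k < length a" | "r < length a" "\<not> k < length a" | "\<not> r < length a" using rk by linarith
    then show "c r < c k"
    proof cases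
      case 1
      then have "a ! r \<le> a ! k" using s(1) rk by (intro sorted_nth_mono) auto
      then show ?thesis using ca(1)[of r] ca(1)[of k] 1 rk by simp
    next
      case 2
      then show ?thesis using ca(2)[of r] cb(1)[of k] rk by simp
    next
      case 3
      then have "b ! (r - length a) \<le> b ! (k - length a)" using s(2) rk len by (intro sorted_nth_mono) auto
      then show ?thesis using cb(1)[of r] cb(1)[of k] 3 rk by simp
    qed
  qed
  moreover have "c r < 2 * n" if "r < t" for r
  proof (cases "r < length a")
    case True then show ?thesis using ca(2)[of r] by simp
  next
    case False then show ?thesis using cb[OF False that] that t by linarith
  qed
  moreover have "c r < n \<or> n + r \<le> c r" if "r < t" for r
    using ca(2)[of r] cb(1)[of r] that by (cases "r < length a") auto
  ultimately have "c \<in> J_columns n t" by (auto simp: J_columns_def)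
  moreover have "(\<Sum>r<t. single (T_var n r (c r)) (1 :: nat)) = u"
  proof -
    have split: "(\<Sum>r<m + k. f r) = (\<Sum>r<m. f r) + (\<Sum>r<k. f (m + r))"
      for f :: "nat \<Rightarrow> nat \<times> nat \<Rightarrow>\<^sub>0 nat" and m k
      by (induction k) (simp_all add: add.assoc)
    have "(\<Sum>r<t. single (T_var n r (c r)) (1 :: nat)) =
       (\<Sum>r<length a. single (T_var n r (c r)) 1) + (\<Sum>r<length b. single (T_var n (length a + r) (c (length a + r))) 1)"
      unfolding len[symmetric] by (rule split)
    also have "(\<Sum>r<length a. single (T_var n r (c r)) (1 :: nat)) = (\<Sum>r<length a. single (a ! r + 1, 1) 1)"
      using ca by (intro sum.cong) (auto simp: T_var_def)
    also have "\<dots> = mon_list 1 a"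
      unfolding mon_list_def by (simp add: sum_list_sum_nth atLeast0LessThan)
    also have "(\<Sum>r<length b. single (T_var n (length a + r) (c (length a + r))) (1 :: nat)) =
       (\<Sum>r<length b. single (b ! r + 1, 2) 1)"
    proof (rule sum.cong)
      fix r assume "r \<in> {..<length b}"
      then have "c (length a + r) = n + b ! r + (length a + r)" using cb(1)[of "length a + r"] len by simp
      then show "single (T_var n (length a + r) (c (length a + r))) (1 :: nat) = single (b ! r + 1, 2) 1"
        by (simp add: T_var_def)
    qed simp
    also have "\<dots> = mon_list 2 b"
      unfolding mon_list_def by (simp add: sum_list_sum_nth atLeast0LessThan)
    finally show ?thesis by (simp add: ab(2))
  qed
  ultimately show ?thesis by blast
qed

lemma J_ideal_combinations:
  assumes t: "1 \<le> t" "t \<le> n"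
  shows "(J_ideal n t :: (nat \<times> nat, 'k::field) mpoly set) =
     combinations (xvars n) (J_monomials n t) (\<lambda>u. single u 1)"
proof -
  let ?S = "{\<Prod>r<t. T_mat n t $$ (r, c r) | c. strict_mono_on {..<t} c \<and> c ` {..<t} \<subseteq> {..<2 * n}} - {0}
    :: (nat \<times> nat, 'k) mpoly set"
  have prod: "(\<Prod>r<t. T_mat n t $$ (r, c r)) = single (\<Sum>r<t. single (T_var n r (c r)) 1) (1 :: 'k)"
    if c: "c \<in> J_columns n t" for c
  proof -
    have "(\<Prod>r<t. T_mat n t $$ (r, c r)) = (\<Prod>r<t. var (T_var n r (c r)) :: (nat \<times> nat, 'k) mpoly)"
    proof (rule prod.cong)
      fix r assume r: "r \<in> {..<t}"
      then have "r \<le> c r" "c r < 2 * n" "c r < n \<or> n + r \<le> c r"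
        using c strict_mono_on_gap[of t c 0 r] by (auto simp: J_columns_def)
      then show "T_mat n t $$ (r, c r) = (var (T_var n r (c r)) :: (nat \<times> nat, 'k) mpoly)"
        using r by (simp add: T_mat_entry)
    qed simp
    then show ?thesis by (simp add: prod_var)
  qed
  have S: "?S = (\<lambda>u. single u 1) ` J_monomials n t"
  proof
    show "?S \<subseteq> (\<lambda>u. single u 1) ` J_monomials n t"
    proof
      fix x assume "x \<in> ?S"
      then obtain c where c: "strict_mono_on {..<t} c" "c ` {..<t} \<subseteq> {..<2 * n}"
        "x = (\<Prod>r<t. T_mat n t $$ (r, c r))" "x \<noteq> 0" by blast
      have "c r < n \<or> n + r \<le> c r" if "r < t" for r
      proof (rule ccontr)
        assume "\<not> (c r < n \<or> n + r \<le> c r)"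
        then have "T_mat n t $$ (r, c r) = (0 :: (nat \<times> nat, 'k) mpoly)"
          using c(2) that by (subst T_mat_entry) auto
        then have "x = 0" unfolding c(3) using that by (intro prod_zero) auto
        then show False using c(4) by simp
      qed
      then have cJ: "c \<in> J_columns n t" using c by (auto simp: J_columns_def)
      show "x \<in> (\<lambda>u. single u 1) ` J_monomials n t"
        unfolding c(3) prod[OF cJ] using J_columns_monomial[OF t cJ] by blast
    qed
    show "(\<lambda>u. single u 1) ` J_monomials n t \<subseteq> ?S"
    proof
      fix x :: "(nat \<times> nat, 'k) mpoly" assume "x \<in> (\<lambda>u. single u 1) ` J_monomials n t"
      then obtain u where u: "u \<in> J_monomials n t" "x = single u 1" by blast
      obtain c where c: "c \<in> J_columns n t" "u = (\<Sum>r<t. single (T_var n r (c r)) 1)"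
        using J_monomial_columns[OF t u(1)] by blast
      have "x = (\<Prod>r<t. T_mat n t $$ (r, c r))" unfolding prod[OF c(1)] u(2) c(2) ..
      moreover have "x \<noteq> 0" using u(2) by simp
      ultimately show "x \<in> ?S" using c(1) unfolding J_columns_def by blast
    qed
  qed
  let ?C = "combinations (xvars n) (J_monomials n t) (\<lambda>u. single u (1 :: 'k))"
  have gen: "single u (1 :: 'k) \<in> polys (xvars n)" if "u \<in> J_monomials n t" for u
    using that by (auto simp: J_monomials_def polys_single)
  have sub: "(\<lambda>u. single u (1 :: 'k)) ` J_monomials n t \<subseteq> ?C"
    using single_in_combinations[of "J_monomials n t" _ "\<lambda>u. single u (1 :: 'k)"] by auto
  have sub': "(\<lambda>u. single u (1 :: 'k)) ` J_monomials n t \<subseteq> polys (xvars n)" using gen by auto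
  show ?thesis unfolding J_ideal_def S
  proof
    show "Idl\<^bsub>poly_ring (xvars n)\<^esub> ((\<lambda>u. single u (1 :: 'k)) ` J_monomials n t) \<subseteq> ?C"
      using gen sub by (rule Idl_subset_combinations)
    show "?C \<subseteq> Idl\<^bsub>poly_ring (xvars n)\<^esub> ((\<lambda>u. single u (1 :: 'k)) ` J_monomials n t)"
      using sub' by (rule combinations_subset_Idl) (intro Idl_self[OF sub'] imageI)
  qed
qed

section \<open>The generators of J and D have the same classes\<close>

definition sorted_lists :: "nat \<Rightarrow> nat \<Rightarrow> nat list set" where
  "sorted_lists p t = {l. sorted l \<and> length l = t \<and> set l \<subseteq> {..<p}}"

text \<open>The value 0 for the empty list makes \<open>top_entry (0 # l) = top_entry l\<close> hold
  for every \<open>l\<close>, which the recurrence of \<open>A_poly\<close> requires.\<close>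

definition top_entry :: "nat list \<Rightarrow> nat" where
  "top_entry l = (if l = [] then 0 else last l)"

abbreviation Z :: "int poly" where "Z \<equiv> [:0, 1:]"

definition A_poly :: "nat \<Rightarrow> nat \<Rightarrow> int poly" where
  "A_poly p t = (\<Sum>l\<in>sorted_lists p t. Z ^ top_entry l)"

definition N_poly :: "nat \<Rightarrow> nat \<Rightarrow> int poly" where
  "N_poly p t = (\<Sum>l\<in>sorted_lists p t. 1)"

lemma finite_sorted_lists [simp]: "finite (sorted_lists p t)"
  by (rule finite_subset[OF _ finite_lists_length_eq[of "{..<p}" t]]) (auto simp: sorted_lists_def)

lemma sorted_lists_0 [simp]: "sorted_lists p 0 = {[]}" "sorted_lists 0 (Suc t) = {}"
  by (auto simp: sorted_lists_def)

text \<open>Either the first entry is 0, or all entries are positive and can be lowered by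
  1.\<close>

lemma sorted_lists_Suc:
  "sorted_lists (Suc p) (Suc t) = (#) 0 ` sorted_lists (Suc p) t \<union> map Suc ` sorted_lists p (Suc t)"
proof
  show "sorted_lists (Suc p) (Suc t) \<subseteq> (#) 0 ` sorted_lists (Suc p) t \<union> map Suc ` sorted_lists p (Suc t)"
  proof
    fix l assume "l \<in> sorted_lists (Suc p) (Suc t)"
    then have l: "sorted l" "length l = Suc t" "set l \<subseteq> {..<Suc p}" by (auto simp: sorted_lists_def)
    then obtain x l' where xl: "l = x # l'" by (cases l) auto
    show "l \<in> (#) 0 ` sorted_lists (Suc p) t \<union> map Suc ` sorted_lists p (Suc t)"
    proof (cases "x = 0")
      case True
      then show ?thesis using l xl by (auto simp: sorted_lists_def)
    next
      case False
      then have pos: "y > 0" if "y \<in> set l" for y using l(1) that xl by auto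
      have "map (\<lambda>i. Suc (i - 1)) l = map (\<lambda>i. i) l"
      proof (rule map_cong[OF refl])
        fix y assume "y \<in> set l"
        then show "Suc (y - 1) = y" using pos[of y] by simp
      qed
      then have eq: "l = map Suc (map (\<lambda>i. i - 1) l)" by (simp add: comp_def)
      have "sorted (map (\<lambda>i. i - 1) l)"
        unfolding sorted_wrt_map by (rule sorted_wrt_mono_rel[OF _ l(1)]) simp
      moreover have "i - 1 < p" if "i \<in> set l" for i using pos[OF that] subsetD[OF l(3) that] by simp
      ultimately have "map (\<lambda>i. i - 1) l \<in> sorted_lists p (Suc t)"
        using l(2) unfolding sorted_lists_def by auto
      with eq show ?thesis by (intro UnI2 image_eqI)
    qed
  qed
  have "sorted (map Suc l)" if "sorted l" for l
    unfolding sorted_wrt_map by (rule sorted_wrt_mono_rel[OF _ that]) simp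
  then have "map Suc l \<in> sorted_lists (Suc p) (Suc t)" if "l \<in> sorted_lists p (Suc t)" for l
    using that unfolding sorted_lists_def by auto
  moreover have "0 # l \<in> sorted_lists (Suc p) (Suc t)" if "l \<in> sorted_lists (Suc p) t" for l
    using that unfolding sorted_lists_def by auto
  ultimately show "(#) 0 ` sorted_lists (Suc p) t \<union> map Suc ` sorted_lists p (Suc t) \<subseteq> sorted_lists (Suc p) (Suc t)"
    by blast
qed

lemma sum_sorted_lists_Suc:
  fixes f :: "nat list \<Rightarrow> int poly"
  shows "(\<Sum>l\<in>sorted_lists (Suc p) (Suc t). f l) =
    (\<Sum>l\<in>sorted_lists (Suc p) t. f (0 # l)) + (\<Sum>l\<in>sorted_lists p (Suc t). f (map Suc l))"
proof -
  have disj: "(#) 0 ` sorted_lists (Suc p) t \<inter> map Suc ` sorted_lists p (Suc t) = {}"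
    by auto
  have "(\<Sum>l\<in>sorted_lists (Suc p) (Suc t). f l) =
      (\<Sum>l\<in>(#) 0 ` sorted_lists (Suc p) t. f l) + (\<Sum>l\<in>map Suc ` sorted_lists p (Suc t). f l)"
    unfolding sorted_lists_Suc using disj by (intro sum.union_disjoint) simp_all
  also have "(\<Sum>l\<in>(#) 0 ` sorted_lists (Suc p) t. f l) = (\<Sum>l\<in>sorted_lists (Suc p) t. f (0 # l))"
    by (subst sum.reindex) (simp_all add: inj_on_def)
  also have "(\<Sum>l\<in>map Suc ` sorted_lists p (Suc t). f l) = (\<Sum>l\<in>sorted_lists p (Suc t). f (map Suc l))"
    by (subst sum.reindex) (simp_all add: inj_on_def inj_map_eq_map)
  finally show ?thesis .
qed

lemma A_poly_rec: "A_poly p 0 = 1" "A_poly 0 (Suc t) = 0"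
  "A_poly (Suc p) (Suc t) = A_poly (Suc p) t + Z * A_poly p (Suc t)"
proof -
  show "A_poly p 0 = 1" "A_poly 0 (Suc t) = 0" by (simp_all add: A_poly_def top_entry_def)
  have "(\<Sum>l\<in>sorted_lists p (Suc t). Z ^ top_entry (map Suc l)) = (\<Sum>l\<in>sorted_lists p (Suc t). Z * Z ^ top_entry l)"
    by (intro sum.cong) (auto simp: sorted_lists_def top_entry_def last_map)
  moreover have "top_entry (0 # l) = top_entry l" for l by (simp add: top_entry_def)
  ultimately show "A_poly (Suc p) (Suc t) = A_poly (Suc p) t + Z * A_poly p (Suc t)"
    unfolding A_poly_def sum_sorted_lists_Suc by (simp only: sum_distrib_left)
qed

lemma N_poly_rec: "N_poly p 0 = 1" "N_poly 0 (Suc t) = 0"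
  "N_poly (Suc p) (Suc t) = N_poly (Suc p) t + N_poly p (Suc t)"
  unfolding N_poly_def sum_sorted_lists_Suc by simp_all

text \<open>Summation by parts: the lists of length \<open>Suc t\<close> with last entry
  \<open>c\<close> are as many as the lists of length \<open>t\<close> with entries at most
  \<open>c\<close>. The proof instead verifies the recurrences in \<open>p\<close> and
  \<open>t\<close>.\<close>

lemma A_poly_truncation:
  "A_poly (Suc p) t = (1 - Z) * A_poly p (Suc t) + Z ^ p * N_poly (Suc p) t"
proof (induction p arbitrary: t)
  case 0
  have "A_poly (Suc 0) t = 1" by (induction t) (simp_all add: A_poly_rec)
  moreover have "N_poly (Suc 0) t = 1" by (induction t) (simp_all add: N_poly_rec)
  ultimately show ?case by (simp add: A_poly_rec)
next
  case (Suc p)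
  note IH = Suc.IH
  show ?case
  proof (induction t)
    case 0
    have "1 = (1 - Z) * A_poly p (Suc 0) + Z ^ p" using IH[of 0] by (simp only: A_poly_rec N_poly_rec mult_1_right)
    then have "Z = Z * ((1 - Z) * A_poly p (Suc 0) + Z ^ p)" by (metis mult_1_right)
    then show ?case by (simp only: A_poly_rec N_poly_rec power_Suc algebra_simps)
  next
    case (Suc t)
    have "A_poly (Suc (Suc p)) (Suc t) = A_poly (Suc (Suc p)) t + Z * A_poly (Suc p) (Suc t)" by (rule A_poly_rec)
    also have "\<dots> = (1 - Z) * A_poly (Suc p) (Suc t) + Z ^ Suc p * N_poly (Suc (Suc p)) t +
        Z * ((1 - Z) * A_poly p (Suc (Suc t)) + Z ^ p * N_poly (Suc p) (Suc t))"
      by (simp only: Suc.IH IH[of "Suc t"])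
    also have "\<dots> = (1 - Z) * (A_poly (Suc p) (Suc t) + Z * A_poly p (Suc (Suc t))) +
        Z ^ Suc p * (N_poly (Suc (Suc p)) t + N_poly (Suc p) (Suc t))"
      by (simp only: power_Suc ring_distribs left_diff_distrib right_diff_distrib mult_ac add_ac)
    finally show ?case by (simp only: A_poly_rec(3)[of p "Suc t"] N_poly_rec(3)[of "Suc p" t])
  qed
qed

text \<open>The contribution of generators with \<open>Suc s \<ge> 1\<close> variables of the first
  block, without the offset \<open>Z ^ p\<close>. With \<open>n + 1 = p + t\<close> their indices,
  counted from 0, are below \<open>n + 1 - Suc s\<close>. The other variables come earlier in the
  order and are only counted.\<close>

definition B_poly :: "nat \<Rightarrow> nat \<Rightarrow> int poly" where
  "B_poly p t = (\<Sum>s<t. N_poly p (t - Suc s) * A_poly (p + t - Suc s) (Suc s))"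

definition JJ_poly :: "nat \<Rightarrow> nat \<Rightarrow> int poly" where
  "JJ_poly p t = A_poly p t + Z ^ p * B_poly p t"

text \<open>The recurrence of \<open>A_poly\<close> splits each summand in two; the recurrence of
  \<open>N_poly\<close> splits the second part again. Up to shifts of \<open>s\<close>, the pieces
  are values of \<open>B_poly\<close> and one leftover term.\<close>

lemma B_poly_rec:
  "B_poly (Suc p) (Suc t) = (1 + Z) * B_poly (Suc p) t + Z * B_poly p (Suc t) + N_poly (Suc p) t"
proof -
  let ?N = "N_poly (Suc p)" and ?a = "\<lambda>s. A_poly (Suc p + t - s)"
  have "B_poly (Suc p) (Suc t) = (\<Sum>s<Suc t. ?N (t - s) * A_poly (Suc (p + t - s)) (Suc s))"
    unfolding B_poly_def by (intro sum.cong) (auto simp: Suc_diff_le)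
  also have "\<dots> = (\<Sum>s<Suc t. ?N (t - s) * A_poly (Suc (p + t - s)) s) +
      Z * (\<Sum>s<Suc t. ?N (t - s) * A_poly (p + t - s) (Suc s))"
    by (simp only: A_poly_rec(3) distrib_left sum.distrib sum_distrib_left mult.left_commute)
  also have "(\<Sum>s<Suc t. ?N (t - s) * A_poly (Suc (p + t - s)) s) = ?N t + B_poly (Suc p) t"
    unfolding sum.lessThan_Suc_shift B_poly_def
    by (intro arg_cong2[of _ _ _ _ "(+)"] sum.cong) (auto simp: A_poly_rec Suc_diff_le Suc_diff_Suc)
  also have "(\<Sum>s<Suc t. ?N (t - s) * A_poly (p + t - s) (Suc s)) = B_poly (Suc p) t + B_poly p (Suc t)"
  proof -
    have N: "?N (t - s) = ?N (t - Suc s) + N_poly p (t - s)" if "s < t" for s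
    proof -
      have "t - s = Suc (t - Suc s)" using that by simp
      then show ?thesis using N_poly_rec(3)[of p "t - Suc s"] by simp
    qed
    have "(\<Sum>s<Suc t. ?N (t - s) * A_poly (p + t - s) (Suc s)) =
        (\<Sum>s<t. ?N (t - Suc s) * A_poly (p + t - s) (Suc s)) +
        (\<Sum>s<Suc t. N_poly p (t - s) * A_poly (p + t - s) (Suc s))"
      by (simp add: N distrib_right sum.distrib N_poly_rec)
    then show ?thesis unfolding B_poly_def by (simp del: sum.lessThan_Suc)
  qed
  finally show ?thesis by (simp only: algebra_simps)
qed

lemma JJ_poly_rec: "JJ_poly p 0 = 1" "JJ_poly 0 (Suc t) = 0"
  "JJ_poly (Suc p) (Suc t) = (1 + Z) * JJ_poly (Suc p) t + Z ^ 2 * JJ_poly p (Suc t)"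
proof -
  show "JJ_poly p 0 = 1" by (simp add: JJ_poly_def B_poly_def A_poly_rec)
  have "N_poly 0 (t - s) * A_poly (0 + Suc t - Suc s) (Suc s) = 0" if "s < Suc t" for s
    using that by (cases "t - s") (auto simp: N_poly_rec A_poly_rec)
  then have "B_poly 0 (Suc t) = 0" unfolding B_poly_def by (intro sum.neutral) auto
  then show "JJ_poly 0 (Suc t) = 0" by (simp add: JJ_poly_def A_poly_rec)
  have 1: "A_poly (Suc p) (Suc t) = A_poly (Suc p) t + Z * A_poly p (Suc t)" by (rule A_poly_rec)
  \<comment> \<open>This use of the truncation identity absorbs the leftover \<open>N_poly\<close>
    term of \<open>B_poly_rec\<close> and leaves a recurrence in \<open>JJ_poly\<close>
    alone.\<close>
  have 2: "Z * A_poly (Suc p) t = Z * A_poly p (Suc t) - Z * (Z * A_poly p (Suc t)) + Z * (Z ^ p * N_poly (Suc p) t)"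
    using arg_cong[OF A_poly_truncation[of p t], of "\<lambda>x. Z * x"] by (simp only: algebra_simps)
  show "JJ_poly (Suc p) (Suc t) = (1 + Z) * JJ_poly (Suc p) t + Z ^ 2 * JJ_poly p (Suc t)"
    unfolding JJ_poly_def B_poly_rec 1 power2_eq_square power_Suc using 2
    by (simp only: algebra_simps)
qed

definition ternary_lists :: "nat \<Rightarrow> nat \<Rightarrow> nat list set" where
  "ternary_lists n t = {l. length l = n \<and> set l \<subseteq> {..2} \<and> length (filter (\<lambda>e. e \<noteq> 0) l) = t}"

fun ternary_weight :: "nat list \<Rightarrow> nat" where
  "ternary_weight [] = 0"
| "ternary_weight (e # l) =
     (if e = 0 then (if \<exists>x\<in>set l. x \<noteq> 0 then 2 else 0) else e - 1) + ternary_weight l"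

definition DD_poly :: "nat \<Rightarrow> nat \<Rightarrow> int poly" where
  "DD_poly n t = (\<Sum>l\<in>ternary_lists n t. Z ^ ternary_weight l)"

lemma finite_ternary_lists [simp]: "finite (ternary_lists n t)"
  by (rule finite_subset[OF _ finite_lists_length_eq[of "{..2}" n]]) (auto simp: ternary_lists_def)

lemma ternary_lists_Suc:
  "ternary_lists (Suc n) (Suc t) = (#) 1 ` ternary_lists n t \<union> ((#) 2 ` ternary_lists n t \<union> (#) 0 ` ternary_lists n (Suc t))"
proof
  show "ternary_lists (Suc n) (Suc t) \<subseteq> (#) 1 ` ternary_lists n t \<union> ((#) 2 ` ternary_lists n t \<union> (#) 0 ` ternary_lists n (Suc t))"
  proof
    fix l assume l: "l \<in> ternary_lists (Suc n) (Suc t)"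
    then obtain e l' where el: "l = e # l'" by (cases l) (auto simp: ternary_lists_def)
    then have "e = 0 \<or> e = 1 \<or> e = 2" using l by (auto simp: ternary_lists_def)
    then show "l \<in> (#) 1 ` ternary_lists n t \<union> ((#) 2 ` ternary_lists n t \<union> (#) 0 ` ternary_lists n (Suc t))"
      using l el by (elim disjE) (auto simp: ternary_lists_def)
  qed
qed (auto simp: ternary_lists_def)

text \<open>In the recurrence the first entries 1, 2 and 0 account for the factors 1,
  \<open>Z\<close> and \<open>Z ^ 2\<close>; the last one because a later row is used whenever the
  remaining degree is positive.\<close>

lemma DD_poly_rec: "DD_poly n 0 = 1" "t > n \<Longrightarrow> DD_poly n t = 0"
  "DD_poly (Suc n) (Suc t) = (1 + Z) * DD_poly n t + Z ^ 2 * DD_poly n (Suc t)"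
proof -
  have zeros: "ternary_weight l = 0" if "\<forall>e\<in>set l. e = 0" for l using that by (induction l) auto
  have "ternary_lists n 0 = {replicate n 0}"
    by (auto simp: ternary_lists_def filter_empty_conv intro: replicate_eqI)
  then show "DD_poly n 0 = 1" by (simp add: DD_poly_def zeros)
  have "ternary_lists n t = {}" if "t > n"
  proof -
    have "length (filter (\<lambda>e. e \<noteq> 0) l) \<le> length l" for l :: "nat list" by (rule length_filter_le)
    then show ?thesis using that unfolding ternary_lists_def by (metis (mono_tags, lifting) empty_Collect_eq leD)
  qed
  then show "t > n \<Longrightarrow> DD_poly n t = 0" by (simp add: DD_poly_def)
  have w0: "ternary_weight (0 # l) = 2 + ternary_weight l" if "l \<in> ternary_lists n (Suc t)" for l
  proof -
    have "filter (\<lambda>e. e \<noteq> 0) l \<noteq> []" using that by (auto simp: ternary_lists_def)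
    then show ?thesis by (auto simp: filter_empty_conv)
  qed
  have "DD_poly (Suc n) (Suc t) = (\<Sum>l\<in>ternary_lists n t. Z ^ ternary_weight (1 # l)) +
     ((\<Sum>l\<in>ternary_lists n t. Z ^ ternary_weight (2 # l)) + (\<Sum>l\<in>ternary_lists n (Suc t). Z ^ ternary_weight (0 # l)))"
    unfolding DD_poly_def ternary_lists_Suc
    by (subst sum.union_disjoint, force, force, force, subst sum.union_disjoint, force, force, force)
       (simp add: sum.reindex inj_on_def)
  also have "(\<Sum>l\<in>ternary_lists n (Suc t). Z ^ ternary_weight (0 # l)) =
      (\<Sum>l\<in>ternary_lists n (Suc t). Z ^ 2 * Z ^ ternary_weight l)"
    by (intro sum.cong refl) (simp only: w0 power_add)
  also have "(\<Sum>l\<in>ternary_lists n t. Z ^ ternary_weight (2 # l)) = (\<Sum>l\<in>ternary_lists n t. Z * Z ^ ternary_weight l)"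
    by (intro sum.cong) simp_all
  also have "(\<Sum>l\<in>ternary_lists n t. Z ^ ternary_weight (1 # l)) = (\<Sum>l\<in>ternary_lists n t. Z ^ ternary_weight l)"
    by (intro sum.cong) simp_all
  finally show "DD_poly (Suc n) (Suc t) = (1 + Z) * DD_poly n t + Z ^ 2 * DD_poly n (Suc t)"
    unfolding DD_poly_def by (simp only: sum_distrib_left[symmetric] distrib_right mult_1 add.assoc)
qed

text \<open>The substitution \<open>n = p + t - 1\<close> turns the recurrence in \<open>n\<close>
  and \<open>t\<close> into the one in \<open>p\<close> and \<open>t\<close>. For
  \<open>p = 0\<close> both sides vanish unless \<open>t = 0\<close>, where both are 1.\<close>

lemma DD_eq_JJ: "DD_poly (p + t - 1) t = JJ_poly p t"
proof (induction p arbitrary: t)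
  case 0
  then show ?case by (cases t) (simp_all add: DD_poly_rec JJ_poly_rec)
next
  case (Suc p)
  note IH = Suc.IH
  show ?case
  proof (induction t)
    case 0
    then show ?case by (simp only: DD_poly_rec JJ_poly_rec)
  next
    case (Suc t)
    have "Suc p + Suc t - 1 = Suc (p + t)" by simp
    then have "DD_poly (Suc p + Suc t - 1) (Suc t) = (1 + Z) * DD_poly (Suc p + t - 1) t + Z ^ 2 * DD_poly (p + Suc t - 1) (Suc t)"
      using DD_poly_rec(3)[of "p + t" t] by simp
    then show ?case by (simp only: Suc.IH IH[of "Suc t"] JJ_poly_rec(3))
  qed
qed

lemma J_polynomial:
  assumes t: "1 \<le> t" "t \<le> n"
  shows "(\<Sum>u\<in>J_monomials n t. Z ^ J_max n t u) = JJ_poly (n - t + 1) t"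
proof -
  define p where "p = n - t + 1"
  have n: "n + 1 = p + t" using t by (simp add: p_def)
  \<comment> \<open>Generators are grouped by the number \<open>s\<close> of variables of the first
    block; \<open>p + t - s\<close> is \<open>n + 1 - s\<close>.\<close>
  define P where "P s = sorted_lists (p + t - s) s \<times> sorted_lists p (t - s)" for s
  have J: "J_lists n t = (\<Union>s\<in>{..t}. P s)"
    unfolding J_lists_def P_def sorted_lists_def n p_def[symmetric] by auto
  have disj: "P s \<inter> P s' = {}" if "s \<noteq> s'" for s s'
    using that by (auto simp: P_def sorted_lists_def)
  define f where "f = (\<lambda>(a, b). Z ^ (if a = [] then last b else p + last a))"
  have "(\<Sum>u\<in>J_monomials n t. Z ^ J_max n t u) = (\<Sum>x\<in>J_lists n t. Z ^ J_max n t (J_mon x))"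
    unfolding J_monomials_lists[OF t] by (simp add: sum.reindex[OF inj_J_mon])
  also have "\<dots> = (\<Sum>x\<in>J_lists n t. f x)"
    by (intro sum.cong refl) (auto simp: f_def J_max_lists[OF t] p_def)
  also have "\<dots> = (\<Sum>s\<le>t. \<Sum>x\<in>P s. f x)"
    unfolding J using disj by (intro sum.UNION_disjoint) (auto simp: P_def)
  also have "\<dots> = (\<Sum>x\<in>P 0. f x) + (\<Sum>s<t. \<Sum>x\<in>P (Suc s). f x)"
    by (simp only: lessThan_Suc_atMost[symmetric] sum.lessThan_Suc_shift)
  also have "(\<Sum>x\<in>P 0. f x) = A_poly p t"
  proof -
    have "(\<Sum>x\<in>P 0. f x) = (\<Sum>b\<in>sorted_lists p t. f ([], b))"
    proof -
      have "P 0 = (\<lambda>b. ([], b)) ` sorted_lists p t" by (auto simp: P_def)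
      then show ?thesis by (simp add: sum.reindex inj_on_def)
    qed
    also have "\<dots> = A_poly p t" unfolding A_poly_def f_def
      using t by (intro sum.cong) (auto simp: sorted_lists_def top_entry_def)
    finally show ?thesis .
  qed
  also have "(\<Sum>s<t. \<Sum>x\<in>P (Suc s). f x) = Z ^ p * B_poly p t"
  proof -
    have "(\<Sum>x\<in>P (Suc s). f x) = Z ^ p * (N_poly p (t - Suc s) * A_poly (p + t - Suc s) (Suc s))" for s
    proof -
      have "(\<Sum>x\<in>P (Suc s). f x) = (\<Sum>a\<in>sorted_lists (p + t - Suc s) (Suc s). \<Sum>b\<in>sorted_lists p (t - Suc s). f (a, b))"
        unfolding P_def by (simp add: sum.cartesian_product)
      also have "\<dots> = (\<Sum>a\<in>sorted_lists (p + t - Suc s) (Suc s). \<Sum>b\<in>sorted_lists p (t - Suc s). Z ^ p * (1 * Z ^ top_entry a))"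
        by (intro sum.cong refl) (auto simp: f_def sorted_lists_def top_entry_def power_add)
      also have "\<dots> = Z ^ p * (N_poly p (t - Suc s) * A_poly (p + t - Suc s) (Suc s))"
        unfolding N_poly_def A_poly_def sum_product
        by (subst sum.swap) (simp only: sum_distrib_left)
      finally show ?thesis .
    qed
    then show ?thesis unfolding B_poly_def by (simp only: sum_distrib_left)
  qed
  finally show ?thesis by (simp add: JJ_poly_def p_def)
qed

section \<open>Generators of D as ternary lists\<close>

definition D_of_list :: "nat list \<Rightarrow> nat \<times> nat \<Rightarrow>\<^sub>0 nat" where
  "D_of_list l = (\<Sum>i<length l. if l ! i = 0 then 0 else single (i + 1, l ! i) 1)"

definition list_of_D :: "nat \<Rightarrow> (nat \<times> nat \<Rightarrow>\<^sub>0 nat) \<Rightarrow> nat list" where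
  "list_of_D n u = map (\<lambda>i. if (i + 1, 1) \<in> keys u then 1 else if (i + 1, 2) \<in> keys u then 2 else 0) [0..<n]"

lemma lookup_D_of_list:
  "lookup (D_of_list l) (a, j) = (if 1 \<le> a \<and> a \<le> length l \<and> l ! (a - 1) = j \<and> j \<noteq> 0 then 1 else 0)"
proof -
  have "lookup (D_of_list l) (a, j) =
      (\<Sum>i<length l. lookup (if l ! i = 0 then 0 else single (i + 1, l ! i) 1) (a, j))"
    unfolding D_of_list_def by (rule lookup_sum)
  also have "\<dots> = (\<Sum>i<length l. if i = a - 1 then (if 1 \<le> a \<and> l ! (a - 1) = j \<and> j \<noteq> 0 then 1 else 0) else 0)"
    by (intro sum.cong refl) (auto simp: lookup_single when_def)
  also have "\<dots> = (if 1 \<le> a \<and> a \<le> length l \<and> l ! (a - 1) = j \<and> j \<noteq> 0 then 1 else 0)"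
    by (auto simp: sum.delta)
  finally show ?thesis .
qed

lemma keys_D_of_list: "(a, j) \<in> keys (D_of_list l) \<longleftrightarrow> 1 \<le> a \<and> a \<le> length l \<and> l ! (a - 1) = j \<and> j \<noteq> 0"
  by (simp add: in_keys_iff lookup_D_of_list)

lemma ternary_nth_le:
  assumes "l \<in> ternary_lists n t" "i < n"
  shows "l ! i \<le> 2"
proof -
  have "length l = n" "set l \<subseteq> {..2}" using assms(1) by (auto simp: ternary_lists_def)
  then show ?thesis using nth_mem[of i l] assms(2) by blast
qed

lemma D_of_list_monomials:
  assumes l: "l \<in> ternary_lists n t"
  shows "D_of_list l \<in> D_monomials n t"
proof -
  have len: "length l = n" and cnt: "length (filter (\<lambda>e. e \<noteq> 0) l) = t"
    using l by (simp_all add: ternary_lists_def)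
  have "keys (D_of_list l) \<subseteq> xvars n"
  proof
    fix x assume x: "x \<in> keys (D_of_list l)"
    obtain a j where aj: "x = (a, j)" by fastforce
    have "1 \<le> a" "a \<le> n" "l ! (a - 1) = j" "j \<noteq> 0" using x len unfolding aj keys_D_of_list by auto
    then show "x \<in> xvars n" using ternary_nth_le[OF l, of "a - 1"] unfolding aj xvars_def by auto
  qed
  moreover have "mon_degree (D_of_list l) = t"
  proof -
    have "mon_degree (D_of_list l) = (\<Sum>i<n. if l ! i \<noteq> 0 then 1 else 0)"
      unfolding D_of_list_def mon_degree_sum len by (intro sum.cong refl) auto
    also have "\<dots> = card {i. i < n \<and> l ! i \<noteq> 0}" by (simp add: sum.If_cases Int_def)
    also have "\<dots> = t" unfolding cnt[symmetric] length_filter_conv_card len ..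
    finally show ?thesis .
  qed
  moreover have "block_degree (D_of_list l) i \<le> 1" for i
    unfolding block_degree_def lookup_D_of_list by auto
  ultimately show ?thesis by (simp add: D_monomials_def)
qed

lemma list_of_D_of_list:
  assumes l: "l \<in> ternary_lists n t"
  shows "list_of_D n (D_of_list l) = l"
proof (rule nth_equalityI)
  have len: "length l = n" using l by (simp add: ternary_lists_def)
  show "length (list_of_D n (D_of_list l)) = length l" by (simp add: list_of_D_def len)
  fix i assume "i < length (list_of_D n (D_of_list l))"
  then have i: "i < n" by (simp add: list_of_D_def)
  then have "l ! i \<le> 2" by (rule ternary_nth_le[OF l])
  then have "l ! i = 0 \<or> l ! i = 1 \<or> l ! i = 2" by linarith
  then show "list_of_D n (D_of_list l) ! i = l ! i"
    using i len by (elim disjE) (simp_all add: list_of_D_def keys_D_of_list)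
qed

lemma D_of_list_of_D:
  assumes u: "u \<in> D_monomials n t"
  shows "D_of_list (list_of_D n u) = u" "list_of_D n u \<in> ternary_lists n t"
proof -
  note cb = card_blocks[OF u]
  have uV: "keys u \<subseteq> xvars n" using u by (simp add: D_monomials_def)
  define l where "l = list_of_D n u"
  have len: "length l = n" by (simp add: l_def list_of_D_def)
  have nth: "l ! i = (if (i + 1, 1) \<in> keys u then 1 else if (i + 1, 2) \<in> keys u then 2 else 0)" if "i < n" for i
    using that by (simp add: l_def list_of_D_def)
  have nth_iff: "l ! i = j \<and> j \<noteq> 0 \<longleftrightarrow> (i + 1, j) \<in> keys u" if i: "i < n" for i j
  proof -
    have not_both: "\<not> ((i + 1, 1) \<in> keys u \<and> (i + 1, 2) \<in> keys u)"
      using inj_onD[OF cb(1), of "(i + 1, 1)" "(i + 1, 2)"] by auto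
    have "j = 1 \<or> j = 2" if "(i + 1, j) \<in> keys u" using subsetD[OF uV that] by (auto simp: xvars_def)
    then show ?thesis using nth[OF i] not_both by auto
  qed
  show "D_of_list (list_of_D n u) = u"
    unfolding l_def[symmetric]
  proof (rule poly_mapping_eqI)
    fix x :: "nat \<times> nat"
    obtain a j where x: "x = (a, j)" by fastforce
    show "lookup (D_of_list l) x = lookup u x"
    proof (cases "x \<in> keys u")
      case True
      then have "1 \<le> a" "a \<le> n" using uV x by (auto simp: xvars_def)
      then have "(a, j) \<in> keys u \<longleftrightarrow> l ! (a - 1) = j \<and> j \<noteq> 0" using nth_iff[of "a - 1" j] by simp
      then show ?thesis using True cb(3)[OF True] \<open>1 \<le> a\<close> \<open>a \<le> n\<close> by (simp add: x lookup_D_of_list len)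
    next
      case False
      then have "lookup u x = 0" by (simp add: in_keys_iff)
      moreover have "\<not> (1 \<le> a \<and> a \<le> n \<and> l ! (a - 1) = j \<and> j \<noteq> 0)"
        using nth_iff[of "a - 1" j] False x by auto
      ultimately show ?thesis by (auto simp: x lookup_D_of_list len)
    qed
  qed
  have "length (filter (\<lambda>e. e \<noteq> 0) l) = card {i. i < n \<and> l ! i \<noteq> 0}"
    by (simp add: length_filter_conv_card len)
  also have "\<dots> = card (Suc ` {i. i < n \<and> l ! i \<noteq> 0})" by (simp add: card_image)
  also have "Suc ` {i. i < n \<and> l ! i \<noteq> 0} = fst ` keys u"
  proof
    show "Suc ` {i. i < n \<and> l ! i \<noteq> 0} \<subseteq> fst ` keys u"
    proof
      fix a assume "a \<in> Suc ` {i. i < n \<and> l ! i \<noteq> 0}"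
      then obtain i where i: "i < n" "l ! i \<noteq> 0" "a = i + 1" by auto
      then have "(i + 1, l ! i) \<in> keys u" using nth_iff[OF i(1), of "l ! i"] by simp
      then show "a \<in> fst ` keys u" using i(3) by force
    qed
    show "fst ` keys u \<subseteq> Suc ` {i. i < n \<and> l ! i \<noteq> 0}"
    proof
      fix a assume "a \<in> fst ` keys u"
      then obtain j where aj: "(a, j) \<in> keys u" by auto
      then have a: "1 \<le> a" "a \<le> n" using uV by (auto simp: xvars_def)
      then have "l ! (a - 1) \<noteq> 0" using nth_iff[of "a - 1" j] aj by simp
      then show "a \<in> Suc ` {i. i < n \<and> l ! i \<noteq> 0}" using a by (intro image_eqI[of _ _ "a - 1"]) auto
    qed
  qed
  also have "card (fst ` keys u) = t" by (rule cb(2))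
  finally have "length (filter (\<lambda>e. e \<noteq> 0) l) = t" .
  moreover have "set l \<subseteq> {..2}" unfolding l_def list_of_D_def by auto
  ultimately show "list_of_D n u \<in> ternary_lists n t"
    using len unfolding ternary_lists_def l_def by simp
qed

definition entry_weight :: "nat list \<Rightarrow> nat \<Rightarrow> nat" where
  "entry_weight l i = (if l ! i = 0 then (if \<exists>k. i < k \<and> k < length l \<and> l ! k \<noteq> 0 then 2 else 0) else l ! i - 1)"

lemma ternary_weight_sum: "ternary_weight l = (\<Sum>i<length l. entry_weight l i)"
proof (induction l)
  case (Cons e l)
  have 1: "entry_weight (e # l) (Suc i) = entry_weight l i" for i
  proof -
    have "(\<exists>k. Suc i < k \<and> k < length (e # l) \<and> (e # l) ! k \<noteq> 0) \<longleftrightarrow> (\<exists>k. i < k \<and> k < length l \<and> l ! k \<noteq> 0)"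
    proof
      assume "\<exists>k. Suc i < k \<and> k < length (e # l) \<and> (e # l) ! k \<noteq> 0"
      then obtain k where "Suc i < k" "k < length (e # l)" "(e # l) ! k \<noteq> 0" by blast
      then show "\<exists>k. i < k \<and> k < length l \<and> l ! k \<noteq> 0" by (intro exI[of _ "k - 1"]) (cases k, auto)
    next
      assume "\<exists>k. i < k \<and> k < length l \<and> l ! k \<noteq> 0"
      then obtain k where "i < k" "k < length l" "l ! k \<noteq> 0" by blast
      then show "\<exists>k. Suc i < k \<and> k < length (e # l) \<and> (e # l) ! k \<noteq> 0" by (intro exI[of _ "Suc k"]) auto
    qed
    then show ?thesis by (simp add: entry_weight_def)
  qed
  have "(\<exists>k. 0 < k \<and> k < length (e # l) \<and> (e # l) ! k \<noteq> 0) \<longleftrightarrow> (\<exists>x\<in>set l. x \<noteq> 0)"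
  proof
    assume "\<exists>k. 0 < k \<and> k < length (e # l) \<and> (e # l) ! k \<noteq> 0"
    then obtain k where "0 < k" "k < length (e # l)" "(e # l) ! k \<noteq> 0" by blast
    then show "\<exists>x\<in>set l. x \<noteq> 0" by (intro bexI[of _ "l ! (k - 1)"]) (cases k, auto)
  next
    assume "\<exists>x\<in>set l. x \<noteq> 0"
    then obtain k where "k < length l" "l ! k \<noteq> 0" by (auto simp: in_set_conv_nth)
    then show "\<exists>k. 0 < k \<and> k < length (e # l) \<and> (e # l) ! k \<noteq> 0" by (intro exI[of _ "Suc k"]) auto
  qed
  then have "entry_weight (e # l) 0 = (if e = 0 then (if \<exists>x\<in>set l. x \<noteq> 0 then 2 else 0) else e - 1)"
    unfolding entry_weight_def nth_Cons_0 by (simp only:)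
  moreover have "(\<Sum>i<length (e # l). entry_weight (e # l) i) =
      entry_weight (e # l) 0 + (\<Sum>i<length l. entry_weight (e # l) (Suc i))"
    by (simp only: list.size add_0_right add_Suc_right sum.lessThan_Suc_shift)
  ultimately show ?case using Cons by (simp only: 1 ternary_weight.simps)
qed simp

lemma card_D_nonmult:
  assumes l: "l \<in> ternary_lists n t"
  shows "card (D_nonmult n (D_of_list l)) = ternary_weight l"
proof -
  let ?u = "D_of_list l"
  have len: "length l = n" using l by (simp add: ternary_lists_def)
  define J where "J i = {j \<in> {1..2}. (i + 1, j) \<in> D_nonmult n ?u}" for i
  have "D_nonmult n ?u = (\<lambda>(i, j). (i + 1, j)) ` (SIGMA i:{..<n}. J i)"
  proof
    show "D_nonmult n ?u \<subseteq> (\<lambda>(i, j). (i + 1, j)) ` (SIGMA i:{..<n}. J i)"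
    proof
      fix x assume x: "x \<in> D_nonmult n ?u"
      obtain a j where aj: "x = (a, j)" by fastforce
      have "1 \<le> a" "a \<le> n" "j \<in> {1..2}" using x by (auto simp: aj D_nonmult_def xvars_def)
      then show "x \<in> (\<lambda>(i, j). (i + 1, j)) ` (SIGMA i:{..<n}. J i)"
        using x aj by (intro image_eqI[of _ _ "(a - 1, j)"]) (auto simp: J_def)
    qed
  qed (auto simp: J_def)
  then have "card (D_nonmult n ?u) = card (SIGMA i:{..<n}. J i)"
    by (simp add: card_image inj_on_def)
  also have "\<dots> = (\<Sum>i<n. card (J i))" by (intro card_SigmaI) (auto simp: J_def)
  also have "\<dots> = (\<Sum>i<n. entry_weight l i)"
  proof (rule sum.cong)
    fix i assume "i \<in> {..<n}"
    then have i: "i < n" by simp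
    have "l ! i \<le> 2" using i by (rule ternary_nth_le[OF l])
    have blk: "i + 1 \<notin> fst ` keys ?u \<longleftrightarrow> l ! i = 0"
    proof
      assume "i + 1 \<notin> fst ` keys ?u"
      then have "(i + 1, l ! i) \<notin> keys ?u" by force
      then show "l ! i = 0" using i len by (simp add: keys_D_of_list)
    qed (auto simp: keys_D_of_list)
    have iff: "(i + 1, j) \<in> D_nonmult n ?u \<longleftrightarrow>
        j < l ! i \<or> l ! i = 0 \<and> (\<exists>k. i < k \<and> k < length l \<and> l ! k \<noteq> 0)" if j: "j \<in> {1..2}" for j
    proof
      assume "(i + 1, j) \<in> D_nonmult n ?u"
      then obtain x where x: "x \<in> keys ?u" "i + 1 = fst x \<and> j < snd x \<or> i + 1 < fst x \<and> i + 1 \<notin> fst ` keys ?u"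
        unfolding D_nonmult_def by auto
      obtain a m where am: "x = (a, m)" by fastforce
      have a: "1 \<le> a" "a \<le> length l" "l ! (a - 1) = m" "m \<noteq> 0" using x(1) unfolding am keys_D_of_list by auto
      from x(2) show "j < l ! i \<or> l ! i = 0 \<and> (\<exists>k. i < k \<and> k < length l \<and> l ! k \<noteq> 0)"
      proof
        assume "i + 1 = fst x \<and> j < snd x"
        then have "a = i + 1" "j < m" using am by simp_all
        then show ?thesis using a(3) by simp
      next
        assume *: "i + 1 < fst x \<and> i + 1 \<notin> fst ` keys ?u"
        then have "l ! i = 0" using blk by blast
        moreover have "i + 1 < a" using * am by simp
        then have "i < a - 1" "a - 1 < length l" using a(2) by linarith+
        moreover have "l ! (a - 1) \<noteq> 0" using a by simp
        ultimately show ?thesis by blast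
      qed
    next
      have xV: "(i + 1, j) \<in> xvars n" using i j by (simp add: xvars_def)
      assume "j < l ! i \<or> l ! i = 0 \<and> (\<exists>k. i < k \<and> k < length l \<and> l ! k \<noteq> 0)"
      then show "(i + 1, j) \<in> D_nonmult n ?u"
      proof
        assume "j < l ! i"
        moreover from this have "(i + 1, l ! i) \<in> keys ?u" using i len by (simp add: keys_D_of_list)
        ultimately show ?thesis unfolding D_nonmult_def using xV
          by (intro CollectI conjI bexI[of _ "(i + 1, l ! i)"]) simp_all
      next
        assume *: "l ! i = 0 \<and> (\<exists>k. i < k \<and> k < length l \<and> l ! k \<noteq> 0)"
        then obtain k where k: "i < k" "k < length l" "l ! k \<noteq> 0" by blast
        then have "(k + 1, l ! k) \<in> keys ?u" by (simp add: keys_D_of_list)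
        moreover have "i + 1 \<notin> fst ` keys ?u" using * blk by blast
        ultimately show ?thesis unfolding D_nonmult_def using xV k
          by (intro CollectI conjI bexI[of _ "(k + 1, l ! k)"]) simp_all
      qed
    qed
    define L where "L \<longleftrightarrow> (\<exists>k. i < k \<and> k < length l \<and> l ! k \<noteq> 0)"
    have Ji: "J i = {j \<in> {1..2}. j < l ! i \<or> l ! i = 0 \<and> L}" unfolding J_def L_def using iff by blast
    consider "l ! i = 0" L | "l ! i = 0" "\<not> L" | "l ! i = 1" | "l ! i = 2" using \<open>l ! i \<le> 2\<close> by linarith
    then have "card (J i) = (if l ! i = 0 then (if L then 2 else 0) else l ! i - 1)"
    proof cases
      case 1
      then have "J i = {1..2}" unfolding Ji by blast
      then show ?thesis using 1 by simp
    next
      case 2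
      then have "J i = {}" unfolding Ji by simp
      then show ?thesis using 2 by simp
    next
      case 3
      then have "J i = {}" unfolding Ji by auto
      then show ?thesis using 3 by simp
    next
      case 4
      then have "J i = {1}" unfolding Ji by auto
      then show ?thesis using 4 by simp
    qed
    then show "card (J i) = entry_weight l i" unfolding entry_weight_def L_def .
  qed simp
  finally show ?thesis by (simp add: ternary_weight_sum len)
qed

lemma D_polynomial: "(\<Sum>u\<in>D_monomials n t. Z ^ card (D_nonmult n u)) = DD_poly n t"
  unfolding DD_poly_def
proof (rule sum.reindex_bij_witness[of _ D_of_list "list_of_D n"])
  fix u assume u: "u \<in> D_monomials n t"
  show "D_of_list (list_of_D n u) = u" by (rule D_of_list_of_D[OF u])
  show l: "list_of_D n u \<in> ternary_lists n t" by (rule D_of_list_of_D[OF u])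
  show "Z ^ ternary_weight (list_of_D n u) = Z ^ card (D_nonmult n u)"
    using card_D_nonmult[OF l] D_of_list_of_D(1)[OF u] by simp
next
  fix l assume l: "l \<in> ternary_lists n t"
  show "list_of_D n (D_of_list l) = l" by (rule list_of_D_of_list[OF l])
  show "D_of_list l \<in> D_monomials n t" by (rule D_of_list_monomials[OF l])
qed

lemma sum_by_class:
  fixes f :: "'u \<Rightarrow> nat"
  assumes "finite U" "\<And>u. u \<in> U \<Longrightarrow> f u < B"
  shows "(\<Sum>u\<in>U. h (f u)) = (\<Sum>c<B. card {u \<in> U. f u = c} * (h c :: nat))"
proof -
  have "(\<Sum>u\<in>U. h (f u)) = (\<Sum>c\<in>{..<B}. \<Sum>u\<in>{u \<in> U. f u = c}. h (f u))"
    by (rule sum.group[symmetric]) (use assms in auto)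
  also have "\<dots> = (\<Sum>c<B. card {u \<in> U. f u = c} * h c)"
    by (intro sum.cong refl) simp
  finally show ?thesis .
qed

lemma coeff_sum_Z_power:
  assumes "finite U"
  shows "coeff (\<Sum>u\<in>U. Z ^ f u) c = int (card {u \<in> U. f u = c})"
proof -
  have "Z ^ k = monom 1 k" for k by (simp add: monom_altdef)
  then have "coeff (\<Sum>u\<in>U. Z ^ f u) c = (\<Sum>u\<in>U. if f u = c then 1 else 0)"
    by (simp add: coeff_sum)
  also have "\<dots> = int (card {u \<in> U. f u = c})" using assms by (simp add: sum.If_cases Int_def)
  finally show ?thesis .
qed

text \<open>Equal generating polynomials mean that \<open>J_max\<close> and
  \<open>card (D_nonmult n u)\<close> are equally distributed. The function \<open>h\<close> is left
  open because it is needed both for ranks in the resolution and for counting monomials in a given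
  degree.\<close>

lemma same_classes:
  fixes h :: "nat \<Rightarrow> nat"
  assumes t: "1 \<le> t" "t \<le> n"
  shows "(\<Sum>u\<in>J_monomials n t. h (J_max n t u)) = (\<Sum>u\<in>D_monomials n t. h (card (D_nonmult n u)))"
proof -
  have "(\<Sum>u\<in>J_monomials n t. Z ^ J_max n t u) = (\<Sum>u\<in>D_monomials n t. Z ^ card (D_nonmult n u))"
    using DD_eq_JJ[of "n - t + 1" t] t by (simp add: J_polynomial[OF t] D_polynomial)
  then have c: "card {u \<in> J_monomials n t. J_max n t u = c} = card {u \<in> D_monomials n t. card (D_nonmult n u) = c}" for c
    using coeff_sum_Z_power[OF finite_J_monomials, of "J_max n t" n t c]
      coeff_sum_Z_power[OF finite_D_monomials, of "\<lambda>u. card (D_nonmult n u)" n t c] by simp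
  define B where "B = Suc (Max (J_max n t ` J_monomials n t \<union> (\<lambda>u. card (D_nonmult n u)) ` D_monomials n t))"
  have "J_max n t u < B" if "u \<in> J_monomials n t" for u
    unfolding B_def using that by (intro le_imp_less_Suc Max_ge) auto
  moreover have "card (D_nonmult n u) < B" if "u \<in> D_monomials n t" for u
    unfolding B_def using that by (intro le_imp_less_Suc Max_ge) auto
  ultimately show ?thesis
    using sum_by_class[of "J_monomials n t" "J_max n t" B h]
      sum_by_class[of "D_monomials n t" "\<lambda>u. card (D_nonmult n u)" B h] c by simp
qed

section \<open>Leading terms of the minors of P\<close>

definition P_var :: "nat \<Rightarrow> nat \<Rightarrow> nat \<Rightarrow> nat \<times> nat" where
  "P_var n r c = (if c < n then ((c + n - r) mod n + 1, 1) else ((c - n + n - r) mod n + 1, 2))"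

definition P_minor :: "nat \<Rightarrow> nat \<Rightarrow> (nat \<Rightarrow> nat) \<Rightarrow> (nat \<Rightarrow> nat) \<Rightarrow> (nat \<times> nat, 'k::field) mpoly" where
  "P_minor n t r c = det (mat t t (\<lambda>(i, j). P_mat n $$ (r i, c j)))"

definition P_term :: "nat \<Rightarrow> nat \<Rightarrow> (nat \<Rightarrow> nat) \<Rightarrow> (nat \<Rightarrow> nat) \<Rightarrow> (nat \<Rightarrow> nat) \<Rightarrow> nat \<times> nat \<Rightarrow>\<^sub>0 nat" where
  "P_term n t r c p = (\<Sum>i<t. single (P_var n (r i) (c (p i))) 1)"

lemma P_mat_entry:
  assumes "r < n" "c < 2 * n"
  shows "(P_mat n :: (nat \<times> nat, 'k::field) mpoly mat) $$ (r, c) = var (P_var n r c)"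
  using assms by (auto simp: P_mat_def beside_def circulant_def P_var_def)

lemma P_var_xvars: "n > 0 \<Longrightarrow> P_var n r c \<in> xvars n"
  by (auto simp: P_var_def xvars_def Suc_le_eq)

lemma P_minor_expansion:
  assumes r: "\<And>i. i < t \<Longrightarrow> r i < n" and c: "\<And>i. i < t \<Longrightarrow> c i < 2 * n"
  shows "(P_minor n t r c :: (nat \<times> nat, 'k::field) mpoly) =
    (\<Sum>p\<in>{p. p permutes {0..<t}}. single (P_term n t r c p) (of_int (sign p)))"
  unfolding P_minor_def det_mat_sum
proof (rule sum.cong[OF refl])
  fix p assume "p \<in> {p. p permutes {0..<t}}"
  then have p: "p i < t" if "i < t" for i using permutes_in_image[of p "{0..<t}" i] that by simp
  have "(\<Prod>i<t. case (i, p i) of (i, j) \<Rightarrow> P_mat n $$ (r i, c j)) = (\<Prod>i<t. var (P_var n (r i) (c (p i))) :: (nat \<times> nat, 'k) mpoly)"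
  proof (rule prod.cong[OF refl])
    fix i assume "i \<in> {..<t}"
    then have "r i < n" "c (p i) < 2 * n" using r c p by auto
    then show "(case (i, p i) of (i, j) \<Rightarrow> P_mat n $$ (r i, c j)) = (var (P_var n (r i) (c (p i))) :: (nat \<times> nat, 'k) mpoly)"
      by (simp add: P_mat_entry)
  qed
  also have "\<dots> = single (P_term n t r c p) 1" unfolding P_term_def by (rule prod_var)
  finally have eq: "(\<Prod>i<t. case (i, p i) of (i, j) \<Rightarrow> P_mat n $$ (r i, c j)) = single (P_term n t r c p) (1 :: 'k)" .
  have "of_int (sign p) * single (P_term n t r c p) (1 :: 'k) =
      single 0 (of_int (sign p)) * single (P_term n t r c p) 1"
    by (simp only: single_of_int)
  then show "of_int (sign p) * (\<Prod>i<t. case (i, p i) of (i, j) \<Rightarrow> P_mat n $$ (r i, c j)) =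
      single (P_term n t r c p) (of_int (sign p) :: 'k)"
    unfolding eq mult_single by simp
qed

section \<open>The rearrangement inequality and the choice of weights\<close>

lemma mono_permutation_id:
  fixes p :: "nat \<Rightarrow> nat"
  assumes p: "p permutes {0..<t}" and mono: "\<And>i j. i < j \<Longrightarrow> j < t \<Longrightarrow> p i < p j"
  shows "p = id"
proof
  have m: "strict_mono_on {..<t} p" using mono by (auto simp: strict_mono_on_def)
  fix i show "p i = id i"
  proof (cases "i < t")
    case True
    have "p (t - 1) < t" using permutes_in_image[OF p, of "t - 1"] True by simp
    moreover have "p i + (t - 1 - i) \<le> p (t - 1)" using strict_mono_on_gap[OF m, of i "t - 1"] True by simp
    ultimately have "p i \<le> i" using True by linarith
    moreover have "i \<le> p i" using strict_mono_on_gap[OF m, of 0 i] True by simp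
    ultimately show ?thesis by simp
  next
    case False
    then show ?thesis using p by (simp add: permutes_def)
  qed
qed

text \<open>Any permutation other than the identity has an inversion, and undoing it increases the
  sum. So a maximizer, which exists by finiteness, must be the identity.\<close>

lemma rearrangement_strict:
  fixes C p :: "nat \<Rightarrow> nat"
  assumes C: "\<And>i j. i < j \<Longrightarrow> j < t \<Longrightarrow> C i < C j" and p: "p permutes {0..<t}" "p \<noteq> id"
  shows "(\<Sum>i<t. i * C (p i)) < (\<Sum>i<t. i * C i)"
proof -
  define S where "S p = (\<Sum>i<t. i * C (p i))" for p
  let ?Q = "{p. p permutes {0..<t}}"
  have fin: "finite ?Q" by (simp add: finite_permutations)
  have better: "\<exists>q\<in>?Q. S p < S q" if p: "p permutes {0..<t}" "p \<noteq> id" for p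
  proof -
    have "\<exists>i j. i < j \<and> j < t \<and> \<not> p i < p j" using mono_permutation_id[OF p(1)] p(2) by blast
    then obtain i j where ij: "i < j" "j < t" "\<not> p i < p j" by blast
    have "p i \<noteq> p j" using permutes_inj[OF p(1)] ij by (auto dest: injD)
    then have lt: "p j < p i" using ij by simp
    have pi: "p i < t" using permutes_in_image[OF p(1), of i] ij by simp
    define q where "q = p \<circ> transpose i j"
    have q: "q permutes {0..<t}" unfolding q_def
      using p(1) ij by (intro permutes_compose[OF permutes_swap_id]) auto
    have qi: "q i = p j" "q j = p i" by (simp_all add: q_def)
    have rest: "(\<Sum>k\<in>{..<t} - {i} - {j}. k * C (q k)) = (\<Sum>k\<in>{..<t} - {i} - {j}. k * C (p k))"
      by (intro sum.cong refl) (auto simp: q_def transpose_def)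
    have split: "S f = i * C (f i) + (j * C (f j) + (\<Sum>k\<in>{..<t} - {i} - {j}. k * C (f k)))" for f
    proof -
      have "S f = i * C (f i) + (\<Sum>k\<in>{..<t} - {i}. k * C (f k))"
        unfolding S_def using ij by (intro sum.remove) auto
      also have "(\<Sum>k\<in>{..<t} - {i}. k * C (f k)) = j * C (f j) + (\<Sum>k\<in>{..<t} - {i} - {j}. k * C (f k))"
        using ij by (intro sum.remove) auto
      finally show ?thesis .
    qed
    have "i * C (p i) + j * C (p j) < i * C (p j) + j * C (p i)"
    proof -
      obtain a where a: "j = i + Suc a" using ij(1) less_imp_Suc_add by auto
      obtain b where b: "C (p i) = C (p j) + Suc b" using C[OF lt pi] less_imp_Suc_add by auto
      show ?thesis unfolding a b by (simp add: algebra_simps)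
    qed
    then have "S p < S q" unfolding split[of p] split[of q] qi rest by linarith
    then show ?thesis using q by blast
  qed
  have "id \<in> ?Q" by (simp add: permutes_id)
  have "Max (S ` ?Q) \<in> S ` ?Q" using fin \<open>id \<in> ?Q\<close> by (intro Max_in finite_imageI) blast+
  then obtain m where m: "m permutes {0..<t}" "S m = Max (S ` ?Q)" by auto
  have le: "S q \<le> S m" if "q permutes {0..<t}" for q unfolding m(2) using fin that by (intro Max_ge) auto
  have "m = id"
  proof (rule ccontr)
    assume "m \<noteq> id"
    then obtain q where "q permutes {0..<t}" "S m < S q" using better[OF m(1)] by blast
    then show False using le[of q] by simp
  qed
  obtain q where "q permutes {0..<t}" "S p < S q" using better[OF p] by blast
  then have "S p < S id" using le[of q] \<open>m = id\<close> by simp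
  then show ?thesis by (simp add: S_def)
qed

text \<open>Expanding the squares, only the mixed terms depend on the permutation. The bound
  \<open>t \<le> C i\<close> makes the subtraction of natural numbers exact; it accounts for the
  summand \<open>n\<close> in the weight below.\<close>

lemma rearrangement_squares:
  fixes C p :: "nat \<Rightarrow> nat"
  assumes C: "\<And>i j. i < j \<Longrightarrow> j < t \<Longrightarrow> C i < C j" and ge: "\<And>i. i < t \<Longrightarrow> t \<le> C i"
    and p: "p permutes {0..<t}" "p \<noteq> id"
  shows "(\<Sum>i<t. (C i - i)\<^sup>2) < (\<Sum>i<t. (C (p i) - i)\<^sup>2)"
proof -
  have sq: "int (\<Sum>i<t. (C (q i) - i)\<^sup>2) =
      (\<Sum>i<t. int ((C i)\<^sup>2)) + (\<Sum>i<t. int (i\<^sup>2)) - 2 * int (\<Sum>i<t. i * C (q i))"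
    if q: "q permutes {0..<t}" for q
  proof -
    have qt: "q i < t" if "i < t" for i using permutes_in_image[OF q, of i] that by simp
    have "int (\<Sum>i<t. (C (q i) - i)\<^sup>2) = (\<Sum>i<t. int ((C (q i))\<^sup>2) + int (i\<^sup>2) - 2 * int (i * C (q i)))"
      unfolding of_nat_sum
    proof (rule sum.cong[OF refl])
      fix i assume "i \<in> {..<t}"
      then have "i \<le> C (q i)" using ge[of "q i"] qt[of i] by simp
      then have "int (C (q i) - i) = int (C (q i)) - int i" by simp
      then show "int ((C (q i) - i)\<^sup>2) = int ((C (q i))\<^sup>2) + int (i\<^sup>2) - 2 * int (i * C (q i))"
        by (simp add: power2_diff)
    qed
    also have "\<dots> = (\<Sum>i<t. int ((C (q i))\<^sup>2)) + (\<Sum>i<t. int (i\<^sup>2)) - 2 * int (\<Sum>i<t. i * C (q i))"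
      by (simp only: sum_subtractf sum.distrib sum_distrib_left of_nat_sum)
    also have "(\<Sum>i<t. int ((C (q i))\<^sup>2)) = (\<Sum>i<t. int ((C i)\<^sup>2))"
      using sum.permute[OF q, of "\<lambda>i. int ((C i)\<^sup>2)"] by (simp add: comp_def atLeast0LessThan)
    finally show ?thesis .
  qed
  have id: "int (\<Sum>i<t. (C i - i)\<^sup>2) =
      (\<Sum>i<t. int ((C i)\<^sup>2)) + (\<Sum>i<t. int (i\<^sup>2)) - 2 * int (\<Sum>i<t. i * C i)"
    using sq[OF permutes_id] by simp
  have "(\<Sum>i<t. i * C (p i)) < (\<Sum>i<t. i * C i)" using C p by (rule rearrangement_strict)
  then have "int (\<Sum>i<t. (C i - i)\<^sup>2) < int (\<Sum>i<t. (C (p i) - i)\<^sup>2)" unfolding id sq[OF p(1)] by linarith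
  then show ?thesis by (simp only: of_nat_less_iff)
qed

text \<open>The weight is strictly convex along the diagonals of P, so that the main diagonal of a
  maximal minor is its unique term of least weight, by the rearrangement inequality.\<close>

definition P_weight :: "nat \<Rightarrow> nat \<times> nat \<Rightarrow> nat" where
  "P_weight n x = ((fst x - 1) + (snd x - 1) * n + n)\<^sup>2"

text \<open>An index that wraps around modulo \<open>n\<close> is raised by \<open>n\<close>, so
  such an entry weighs more than \<open>(c + n - r)\<^sup>2\<close>, the value attained at the
  entries that P shares with T.\<close>

lemma P_weight_var:
  assumes "r < n" "c < 2 * n"
  shows "(c + n - r)\<^sup>2 \<le> P_weight n (P_var n r c)"
    and "r \<le> c \<Longrightarrow> c < n \<or> n + r \<le> c \<Longrightarrow> P_var n r c = T_var n r c"
    and "r \<le> c \<Longrightarrow> c < n \<or> n + r \<le> c \<Longrightarrow> P_weight n (T_var n r c) = (c + n - r)\<^sup>2"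
proof -
  have mod: "(d + n - r) mod n = (if r \<le> d then d - r else d + n - r)" if "d < n" for d
  proof (cases "r \<le> d")
    case True
    then have "(d + n - r) mod n = ((d - r) + n) mod n" by simp
    also have "\<dots> = (d - r) mod n" by (rule mod_add_self2)
    finally show ?thesis using True that by simp
  next
    case False
    then show ?thesis using that by (simp add: mod_less)
  qed
  show "(c + n - r)\<^sup>2 \<le> P_weight n (P_var n r c)"
    unfolding P_weight_def
  proof (rule power_mono)
    show "c + n - r \<le> fst (P_var n r c) - 1 + (snd (P_var n r c) - 1) * n + n"
      using mod[of c] mod[of "c - n"] assms by (auto simp: P_var_def)
  qed simp
  assume *: "r \<le> c" "c < n \<or> n + r \<le> c"
  show "P_var n r c = T_var n r c"
    using mod[of c] mod[of "c - n"] assms * by (auto simp: P_var_def T_var_def)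
  show "P_weight n (T_var n r c) = (c + n - r)\<^sup>2"
    unfolding P_weight_def by (rule arg_cong[of _ _ "\<lambda>x. x\<^sup>2"]) (use assms * in \<open>auto simp: T_var_def\<close>)
qed

lemma wsum_P_term: "wsum f (P_term n t r c p) = (\<Sum>i<t. f (P_var n (r i) (c (p i))))"
  unfolding P_term_def wsum_sum by simp

lemma P_term_leading:
  assumes tn: "t \<le> n" and c: "c \<in> J_columns n t"
  shows "P_term n t id c id = (\<Sum>r<t. single (T_var n r (c r)) 1)"
    and "p permutes {0..<t} \<Longrightarrow> p \<noteq> id \<Longrightarrow>
      wsum (P_weight n) (P_term n t id c id) < wsum (P_weight n) (P_term n t id c p)"
proof -
  have mono: "strict_mono_on {..<t} c" and range: "\<And>i. i < t \<Longrightarrow> c i < 2 * n"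
    and valid: "\<And>i. i < t \<Longrightarrow> c i < n \<or> n + i \<le> c i"
    using c by (auto simp: J_columns_def)
  have ge: "i \<le> c i" if "i < t" for i using strict_mono_on_gap[OF mono, of 0 i] that by simp
  have eq: "P_var n i (c i) = T_var n i (c i)" "P_weight n (T_var n i (c i)) = (c i + n - i)\<^sup>2" if "i < t" for i
    using P_weight_var(2,3)[of i n "c i"] range valid ge that tn by auto
  show "P_term n t id c id = (\<Sum>r<t. single (T_var n r (c r)) 1)"
    unfolding P_term_def by (intro sum.cong refl) (simp add: eq)
  assume p: "p permutes {0..<t}" "p \<noteq> id"
  have pt: "p i < t" if "i < t" for i using permutes_in_image[OF p(1), of i] that by simp
  have "wsum (P_weight n) (P_term n t id c id) = (\<Sum>i<t. (c i + n - i)\<^sup>2)"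
    unfolding wsum_P_term by (intro sum.cong refl) (simp add: eq)
  also have "\<dots> < (\<Sum>i<t. (c (p i) + n - i)\<^sup>2)"
    using rearrangement_squares[of t "\<lambda>i. c i + n" p] mono p tn by (simp add: strict_mono_on_def)
  also have "\<dots> \<le> (\<Sum>i<t. P_weight n (P_var n i (c (p i))))"
    using range pt tn by (intro sum_mono P_weight_var) auto
  also have "\<dots> = wsum (P_weight n) (P_term n t id c p)" unfolding wsum_P_term by simp
  finally show "wsum (P_weight n) (P_term n t id c id) < wsum (P_weight n) (P_term n t id c p)" .
qed

definition J_column :: "nat \<Rightarrow> nat \<Rightarrow> (nat \<times> nat \<Rightarrow>\<^sub>0 nat) \<Rightarrow> nat \<Rightarrow> nat" where
  "J_column n t u = (SOME c. c \<in> J_columns n t \<and> u = (\<Sum>r<t. single (T_var n r (c r)) 1))"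

text \<open>The rows are the first \<open>t\<close> ones, where the unwrapped entries of P are those
  of T.\<close>

definition P_gen :: "nat \<Rightarrow> nat \<Rightarrow> (nat \<times> nat \<Rightarrow>\<^sub>0 nat) \<Rightarrow> (nat \<times> nat, 'k::field) mpoly" where
  "P_gen n t u = P_minor n t id (J_column n t u)"

lemma J_column:
  assumes "1 \<le> t" "t \<le> n" "u \<in> J_monomials n t"
  shows "J_column n t u \<in> J_columns n t" "u = (\<Sum>r<t. single (T_var n r (J_column n t u r)) 1)"
proof -
  have "\<exists>c. c \<in> J_columns n t \<and> u = (\<Sum>r<t. single (T_var n r (c r)) 1)"
    using J_monomial_columns[OF assms] by blast
  from someI_ex[OF this] show "J_column n t u \<in> J_columns n t"
    "u = (\<Sum>r<t. single (T_var n r (J_column n t u r)) 1)"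
    unfolding J_column_def by blast+
qed

text \<open>All terms of the expansion other than the diagonal are strictly heavier, so the leading
  coefficient is the sign of the identity and nonzero in every characteristic.\<close>

lemma P_gen_leading:
  assumes t: "1 \<le> t" "t \<le> n" and u: "u \<in> J_monomials n t"
  shows "lookup (P_gen n t u :: (nat \<times> nat, 'k::field) mpoly) u \<noteq> 0"
    and "m \<in> keys (P_gen n t u :: (nat \<times> nat, 'k) mpoly) \<Longrightarrow> m \<noteq> u \<Longrightarrow>
      wsum (P_weight n) u < wsum (P_weight n) m"
proof -
  define c where "c = J_column n t u"
  note cJ = J_column(1)[OF t u, folded c_def]
  have uid: "P_term n t id c id = u"
    using P_term_leading(1)[OF t(2) cJ] J_column(2)[OF t u, folded c_def] by simp
  have less: "wsum (P_weight n) u < wsum (P_weight n) (P_term n t id c p)" if "p permutes {0..<t}" "p \<noteq> id" for p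
    using P_term_leading(2)[OF t(2) cJ that] uid by simp
  have exp: "(P_gen n t u :: (nat \<times> nat, 'k) mpoly) =
      (\<Sum>p\<in>{p. p permutes {0..<t}}. single (P_term n t id c p) (of_int (sign p)))"
    unfolding P_gen_def c_def[symmetric] using cJ t
    by (intro P_minor_expansion) (auto simp: J_columns_def)
  have "lookup (P_gen n t u :: (nat \<times> nat, 'k) mpoly) u =
      (\<Sum>p\<in>{p. p permutes {0..<t}}. lookup (single (P_term n t id c p) (of_int (sign p))) u)"
    unfolding exp by (rule lookup_sum)
  also have "\<dots> = (\<Sum>p\<in>{p. p permutes {0..<t}}. if p = id then 1 else 0)"
  proof (rule sum.cong[OF refl])
    fix p assume "p \<in> {p. p permutes {0..<t}}"
    then show "lookup (single (P_term n t id c p) (of_int (sign p))) u = (if p = id then (1 :: 'k) else 0)"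
      using less[of p] uid by (auto simp: lookup_single when_def)
  qed
  also have "\<dots> = 1" by (simp add: finite_permutations permutes_id)
  finally show "lookup (P_gen n t u :: (nat \<times> nat, 'k) mpoly) u \<noteq> 0" by simp
  assume m: "m \<in> keys (P_gen n t u :: (nat \<times> nat, 'k) mpoly)" "m \<noteq> u"
  have "\<exists>p. p permutes {0..<t} \<and> m = P_term n t id c p"
  proof (rule ccontr)
    assume none: "\<not> ?thesis"
    have "lookup (P_gen n t u :: (nat \<times> nat, 'k) mpoly) m = 0"
      unfolding exp lookup_sum using none
      by (intro sum.neutral) (auto simp: lookup_single when_def)
    then show False using m(1) by (simp add: in_keys_iff)
  qed
  then obtain p where p: "p permutes {0..<t}" "m = P_term n t id c p" by blast
  then have "p \<noteq> id" using m(2) uid by auto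
  then show "wsum (P_weight n) u < wsum (P_weight n) m" using less p by simp
qed

lemma P_minor_polys:
  assumes "\<And>i. i < t \<Longrightarrow> r i < n" "\<And>i. i < t \<Longrightarrow> c i < 2 * n"
  shows "(P_minor n t r c :: (nat \<times> nat, 'k::field) mpoly) \<in> polys (xvars n)"
    and "homogeneous (int t) (P_minor n t r c :: (nat \<times> nat, 'k) mpoly)"
proof -
  have k: "keys (P_term n t r c p) \<subseteq> xvars n" for p
  proof
    fix x assume "x \<in> keys (P_term n t r c p)"
    from keys_sum_singles[OF this[unfolded P_term_def]]
    obtain i where "i < t" "x = P_var n (r i) (c (p i))" by blast
    then show "x \<in> xvars n" using P_var_xvars[of n] assms(1)[of i] by simp
  qed
  have d: "mon_degree (P_term n t r c p) = t" for p
    unfolding P_term_def mon_degree_sum by simp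
  have exp: "(P_minor n t r c :: (nat \<times> nat, 'k) mpoly) =
      (\<Sum>p\<in>{p. p permutes {0..<t}}. single (P_term n t r c p) (of_int (sign p)))"
    using assms by (rule P_minor_expansion)
  show "(P_minor n t r c :: (nat \<times> nat, 'k) mpoly) \<in> polys (xvars n)"
    unfolding exp by (intro polys_sum polys_single k)
  show "homogeneous (int t) (P_minor n t r c :: (nat \<times> nat, 'k) mpoly)"
    unfolding exp by (intro homogeneous_sum) (simp add: homogeneous_def d)
qed

lemma minors_P:
  "minors t (P_mat n :: (nat \<times> nat, 'k::field) mpoly mat) = {P_minor n t r c | r c.
     strict_mono_on {..<t} r \<and> r ` {..<t} \<subseteq> {..<n} \<and> strict_mono_on {..<t} c \<and> c ` {..<t} \<subseteq> {..<2 * n}}"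
proof -
  have "dim_row (P_mat n :: (nat \<times> nat, 'k) mpoly mat) = n" "dim_col (P_mat n :: (nat \<times> nat, 'k) mpoly mat) = 2 * n"
    by (simp_all add: P_mat_def beside_def circulant_def)
  then show ?thesis unfolding minors_alt P_minor_def by simp
qed

section \<open>Linear independence in one-parameter families\<close>

definition mscale :: "'k::field \<Rightarrow> ('v, 'k) mpoly \<Rightarrow> ('v, 'k) mpoly" where
  "mscale a p = single 0 a * p"

lemma vector_space_mscale: "vector_space (mscale :: 'k::field \<Rightarrow> ('v, 'k) mpoly \<Rightarrow> _)"
  by unfold_locales (auto simp: mscale_def algebra_simps single_add mult.assoc[symmetric] mult_single)

lemma lookup_mscale: "lookup (mscale a p) m = a * lookup p m"
  using lookup_single_times[of 0 a p m] by (simp add: mscale_def)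

definition independent_family :: "'i set \<Rightarrow> ('i \<Rightarrow> ('v, 'k::field) mpoly) \<Rightarrow> bool" where
  "independent_family I v \<longleftrightarrow> (\<forall>a. (\<Sum>i\<in>I. mscale (a i) (v i)) = 0 \<longrightarrow> (\<forall>i\<in>I. a i = 0))"

lemma independent_familyD:
  "independent_family I v \<Longrightarrow> (\<Sum>i\<in>I. mscale (a i) (v i)) = 0 \<Longrightarrow> i \<in> I \<Longrightarrow> a i = 0"
  by (simp add: independent_family_def)

lemma independent_family_inj:
  fixes v :: "'i \<Rightarrow> ('v, 'k::field) mpoly"
  assumes fin: "finite I" and ind: "independent_family I v"
  shows "inj_on v I"
proof (rule inj_onI)
  fix i j assume ij: "i \<in> I" "j \<in> I" "v i = v j"
  show "i = j"
  proof (rule ccontr)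
    assume ne: "i \<noteq> j"
    define a where "a k = (if k = i then 1 else if k = j then - 1 else (0 :: 'k))" for k
    have "(\<Sum>k\<in>I. mscale (a k) (v k)) = mscale (a i) (v i) + (\<Sum>k\<in>I - {i}. mscale (a k) (v k))"
      using fin ij by (intro sum.remove) auto
    also have "(\<Sum>k\<in>I - {i}. mscale (a k) (v k)) = mscale (a j) (v j) + (\<Sum>k\<in>I - {i} - {j}. mscale (a k) (v k))"
      using fin ij ne by (intro sum.remove) auto
    also have "(\<Sum>k\<in>I - {i} - {j}. mscale (a k) (v k)) = 0"
      by (intro sum.neutral) (auto simp: a_def mscale_def)
    finally have "(\<Sum>k\<in>I. mscale (a k) (v k)) = 0"
      using ij ne by (simp add: a_def mscale_def single_uminus)
    from independent_familyD[OF ind this ij(1)] show False by (simp add: a_def)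
  qed
qed

lemma independent_family_set:
  fixes v :: "'i \<Rightarrow> ('v, 'k::field) mpoly"
  assumes fin: "finite I" and ind: "independent_family I v"
  shows "\<not> module.dependent mscale (v ` I)"
proof -
  interpret vs: vector_space "mscale :: 'k \<Rightarrow> ('v, 'k) mpoly \<Rightarrow> _" by (rule vector_space_mscale)
  show ?thesis
  proof (rule vs.independent_if_scalars_zero)
    show "finite (v ` I)" using fin by simp
    fix f x assume s: "(\<Sum>x\<in>v ` I. mscale (f x) x) = 0" and x: "x \<in> v ` I"
    have "(\<Sum>i\<in>I. mscale (f (v i)) (v i)) = 0"
      using s by (simp add: sum.reindex[OF independent_family_inj[OF fin ind]])
    from independent_familyD[OF ind this] show "f x = 0" using x by auto
  qed
qed

lemma independent_family_card_le:
  fixes v :: "'i \<Rightarrow> ('v, 'k::field) mpoly"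
  assumes fin: "finite I" and ind: "independent_family I v" and T: "finite T"
    and span: "\<And>i. i \<in> I \<Longrightarrow> v i \<in> module.span mscale T"
  shows "card I \<le> card T"
proof -
  interpret vs: vector_space "mscale :: 'k \<Rightarrow> ('v, 'k) mpoly \<Rightarrow> _" by (rule vector_space_mscale)
  have "card (v ` I) \<le> card T"
    using vs.independent_span_bound[OF T independent_family_set[OF fin ind]] span by blast
  then show ?thesis using independent_family_inj[OF fin ind] by (simp add: card_image)
qed

text \<open>The coordinate functionals on the span of the family, extended linearly to all
  polynomials.\<close>

lemma dual_family:
  fixes v :: "'i \<Rightarrow> ('v, 'k::field) mpoly"
  assumes fin: "finite I" and ind: "independent_family I v"
  shows "\<exists>\<Lambda>. (\<forall>i p q. \<Lambda> i (p + q) = \<Lambda> i p + \<Lambda> i q) \<and> (\<forall>i a p. \<Lambda> i (mscale a p) = a * \<Lambda> i p) \<and>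
    (\<forall>i\<in>I. \<forall>j\<in>I. \<Lambda> i (v j) = (if i = j then 1 else 0))"
proof -
  interpret vs: vector_space_pair "mscale :: 'k \<Rightarrow> ('v, 'k) mpoly \<Rightarrow> _" "(*) :: 'k \<Rightarrow> 'k \<Rightarrow> 'k"
    unfolding vector_space_pair_def using vector_space_mscale
    by (simp add: vector_space_def algebra_simps)
  have "\<exists>g. Vector_Spaces.linear mscale (*) g \<and> (\<forall>x\<in>v ` I. g x = (if x = v i then 1 else 0))" for i
    by (rule vs.linear_independent_extend) (rule independent_family_set[OF fin ind])
  then obtain \<Lambda> where \<Lambda>: "\<And>i. Vector_Spaces.linear mscale (*) (\<Lambda> i)"
    "\<And>i. \<forall>x\<in>v ` I. \<Lambda> i x = (if x = v i then 1 else 0)" by metis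
  show ?thesis
  proof (intro exI[of _ \<Lambda>] conjI allI ballI)
    show "\<Lambda> i (p + q) = \<Lambda> i p + \<Lambda> i q" for i p q using vs.linear_add[OF \<Lambda>(1)] .
    show "\<Lambda> i (mscale a p) = a * \<Lambda> i p" for i a p using vs.linear_scale[OF \<Lambda>(1)] .
    fix i j assume ij: "i \<in> I" "j \<in> I"
    then have "v j = v i \<longleftrightarrow> i = j" using independent_family_inj[OF fin ind] by (auto simp: inj_on_def)
    then show "\<Lambda> i (v j) = (if i = j then 1 else 0)" using \<Lambda>(2)[of i] ij by simp
  qed
qed

text \<open>A family of polynomials that depends polynomially on a parameter and is independent at one
  value of the parameter is independent at all values but the zeros of a nonzero polynomial, namely
  of the determinant of the pairing with a dual family.\<close>

lemma independent_family_generic: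
  fixes F :: "'i \<Rightarrow> ('v, 'k::field) mpoly poly"
  assumes fin: "finite I" and ind: "independent_family I (\<lambda>i. poly (F i) (single 0 0))"
  shows "\<exists>Q. poly Q 0 \<noteq> 0 \<and> (\<forall>\<epsilon>. poly Q \<epsilon> \<noteq> 0 \<longrightarrow> independent_family I (\<lambda>i. poly (F i) (single 0 \<epsilon>)))"
proof -
  from dual_family[OF fin ind] obtain \<Lambda> where
    "(\<forall>i p q. \<Lambda> i (p + q) = \<Lambda> i p + \<Lambda> i q) \<and> (\<forall>i a p. \<Lambda> i (mscale a p) = a * \<Lambda> i p) \<and>
    (\<forall>i\<in>I. \<forall>j\<in>I. \<Lambda> i (poly (F j) (single 0 0)) = (if i = j then 1 else 0))" ..
  note add = this[THEN conjunct1, rule_format] and scale = this[THEN conjunct2, THEN conjunct1, rule_format]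
    and dual = this[THEN conjunct2, THEN conjunct2, rule_format]
  have zero: "\<Lambda> i 0 = 0" for i using scale[of i 0 0] by (simp add: mscale_def)
  have lsum: "\<Lambda> i (sum f A) = (\<Sum>a\<in>A. \<Lambda> i (f a))" for i A and f :: "nat \<Rightarrow> ('v, 'k) mpoly"
    by (induction A rule: infinite_finite_induct) (simp_all add: add zero)
  have lsum': "\<Lambda> i (sum f A) = (\<Sum>a\<in>A. \<Lambda> i (f a))" for i A and f :: "'i \<Rightarrow> ('v, 'k) mpoly"
    by (induction A rule: infinite_finite_induct) (simp_all add: add zero)
  \<comment> \<open>The pairing of the \<open>i\<close>-th functional with the \<open>j\<close>-th
    member is a polynomial in the parameter with scalar coefficients. The matrix of pairings is the
    identity at 0, so its determinant is a nonzero polynomial.\<close>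
  define A where "A i j = (\<Sum>k\<le>degree (F j). monom (\<Lambda> i (coeff (F j) k)) k)" for i j
  have A: "poly (A i j) \<epsilon> = \<Lambda> i (poly (F j) (single 0 \<epsilon>))" for i j \<epsilon>
  proof -
    have pw: "(single (0 :: 'v \<Rightarrow>\<^sub>0 nat) \<epsilon>) ^ k = single 0 (\<epsilon> ^ k)" for k
      by (induction k) (simp_all add: mult_single)
    have "poly (F j) (single 0 \<epsilon>) = (\<Sum>k\<le>degree (F j). mscale (\<epsilon> ^ k) (coeff (F j) k))"
      by (simp add: poly_altdef mscale_def pw mult.commute)
    then have "\<Lambda> i (poly (F j) (single 0 \<epsilon>)) = (\<Sum>k\<le>degree (F j). \<epsilon> ^ k * \<Lambda> i (coeff (F j) k))"
      by (simp add: lsum scale)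
    also have "\<dots> = poly (A i j) \<epsilon>" by (simp add: A_def poly_sum poly_monom mult.commute)
    finally show ?thesis by simp
  qed
  obtain e where e: "bij_betw e {..<card I} I"
    using ex_bij_betw_nat_finite[OF fin] by (auto simp: atLeast0LessThan)
  have eI: "e i \<in> I" if "i < card I" for i using bij_betw_apply[OF e] that by blast
  define M where "M = mat (card I) (card I) (\<lambda>(i, j). A (e i) (e j))"
  have hom: "comm_ring_hom (\<lambda>p :: 'k poly. poly p \<epsilon>)" for \<epsilon>
    by unfold_locales simp_all
  have det: "poly (det M) \<epsilon> = det (mat (card I) (card I) (\<lambda>(i, j). \<Lambda> (e i) (poly (F (e j)) (single 0 \<epsilon>))))" for \<epsilon>
  proof -
    have "map_mat (\<lambda>p. poly p \<epsilon>) M = mat (card I) (card I) (\<lambda>(i, j). \<Lambda> (e i) (poly (F (e j)) (single 0 \<epsilon>)))"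
      by (rule eq_matI) (auto simp: M_def A)
    then show ?thesis using comm_ring_hom.hom_det[OF hom, of \<epsilon> M] by simp
  qed
  have "mat (card I) (card I) (\<lambda>(i, j). \<Lambda> (e i) (poly (F (e j)) (single 0 0))) = 1\<^sub>m (card I)"
  proof (rule eq_matI)
    fix i j assume "i < dim_row (1\<^sub>m (card I) :: 'k mat)" "j < dim_col (1\<^sub>m (card I) :: 'k mat)"
    then have ij: "i < card I" "j < card I" by auto
    then have "e i = e j \<longleftrightarrow> i = j" using e by (auto simp: bij_betw_def inj_on_def)
    then show "mat (card I) (card I) (\<lambda>(i, j). \<Lambda> (e i) (poly (F (e j)) (single 0 0))) $$ (i, j) = 1\<^sub>m (card I) $$ (i, j)"
      using ij dual[OF eI eI, of i j] by simp
  qed auto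
  then have "poly (det M) 0 = 1" unfolding det by simp
  moreover have "independent_family I (\<lambda>i. poly (F i) (single 0 \<epsilon>))" if \<epsilon>: "poly (det M) \<epsilon> \<noteq> 0" for \<epsilon>
    unfolding independent_family_def
  proof (intro allI impI)
    fix a assume a: "(\<Sum>i\<in>I. mscale (a i) (poly (F i) (single 0 \<epsilon>))) = 0"
    define N where "N = mat (card I) (card I) (\<lambda>(i, j). \<Lambda> (e i) (poly (F (e j)) (single 0 \<epsilon>)))"
    define w where "w = vec (card I) (\<lambda>j. a (e j))"
    have "N *\<^sub>v w = 0\<^sub>v (card I)"
    proof (rule eq_vecI)
      fix i assume "i < dim_vec (0\<^sub>v (card I) :: 'k vec)"
      then have i: "i < card I" by simp
      have "(N *\<^sub>v w) $ i = (\<Sum>j<card I. \<Lambda> (e i) (poly (F (e j)) (single 0 \<epsilon>)) * a (e j))"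
        using i by (simp add: N_def w_def scalar_prod_def atLeast0LessThan)
      also have "\<dots> = (\<Sum>k\<in>I. \<Lambda> (e i) (poly (F k) (single 0 \<epsilon>)) * a k)"
        by (rule sum.reindex_bij_betw[OF e])
      also have "\<dots> = \<Lambda> (e i) (\<Sum>k\<in>I. mscale (a k) (poly (F k) (single 0 \<epsilon>)))"
        by (simp add: lsum' scale mult.commute)
      finally show "(N *\<^sub>v w) $ i = 0\<^sub>v (card I) $ i" using i by (simp add: a zero)
    qed (simp add: N_def)
    moreover have N: "N \<in> carrier_mat (card I) (card I)" by (simp add: N_def)
    moreover have "det N \<noteq> 0" using \<epsilon> unfolding det N_def .
    moreover have "w \<in> carrier_vec (card I)" by (simp add: w_def)
    ultimately have "w = 0\<^sub>v (card I)" using det_0_iff_vec_prod_zero_field[OF N] by blast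
    then have w0: "w $ j = 0" if "j < card I" for j using that by simp
    have ae: "a (e j) = 0" if "j < card I" for j using w0[OF that] that unfolding w_def by simp
    show "\<forall>i\<in>I. a i = 0"
    proof
      fix i assume "i \<in> I"
      then have "i \<in> e ` {..<card I}" using bij_betw_imp_surj_on[OF e] by simp
      then obtain j where "j < card I" "i = e j" by auto
      then show "a i = 0" using ae by simp
    qed
  qed
  ultimately show ?thesis by (intro exI[of _ "det M"]) simp
qed

section \<open>Separable parameters and interpolation\<close>

lemma alg_closed_nonroot:
  fixes p :: "'k::alg_closed_field poly"
  assumes "p \<noteq> 0"
  shows "\<exists>x. x \<noteq> 0 \<and> poly p x \<noteq> 0"
proof (rule ccontr)
  assume none: "\<not> ?thesis"
  \<comment> \<open>If \<open>p\<close> vanished at all nonzero points, \<open>r\<close> would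
    vanish everywhere, and the nonconstant polynomial \<open>r + 1\<close> would have no
    root.\<close>
  define r where "r = [:0, 1:] * p"
  have zero: "poly r x = 0" for x using none by (auto simp: r_def)
  have "degree r = Suc (degree p)" using assms by (simp add: r_def)
  then have "degree (r + 1) > 0" by (subst degree_add_eq_left) simp_all
  then obtain x where "poly (r + 1) x = 0" using alg_closed_imp_poly_has_root by blast
  then show False using zero[of x] by simp
qed

text \<open>A double root \<open>x\<close> of \<open>z ^ n - \<epsilon> * z - 1\<close> satisfies
  \<open>of_nat n * x ^ (n - 1) = \<epsilon>\<close>. In the first case this forces
  \<open>x = 0\<close>, which is not a root; in the second it contradicts
  \<open>\<epsilon> \<noteq> 0\<close>.\<close>

lemma card_separable_roots:
  fixes \<epsilon> :: "'k::alg_closed_field"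
  assumes n: "n \<ge> 1" and \<epsilon>: "of_nat n \<noteq> (0 :: 'k) \<and> \<epsilon> = 0 \<or> of_nat n = (0 :: 'k) \<and> \<epsilon> \<noteq> 0"
  shows "card {x. x ^ n = 1 + \<epsilon> * x} = n"
proof -
  define p where "p = monom 1 n - [:1, \<epsilon>:]"
  \<comment> \<open>In the second case \<open>n = 1\<close> is impossible, because 1 is not 0 in the
    field. So the linear part does not interfere with the leading term.\<close>
  have n2: "n \<ge> 2" if "\<epsilon> \<noteq> 0"
  proof (rule ccontr)
    assume "\<not> n \<ge> 2"
    then have "n = 1" using n by simp
    then show False using \<epsilon> that by simp
  qed
  have small: "coeff [:1, \<epsilon>:] k = 0" if "k \<ge> n" for k
  proof (cases "\<epsilon> = 0")
    case True
    then show ?thesis using that n by (cases k) auto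
  next
    case False
    then have "k \<ge> 2" using n2 that by simp
    then show ?thesis by (cases k) (auto simp: coeff_pCons split: nat.splits)
  qed
  have c1: "coeff p n = 1" using small[of n] by (simp add: p_def)
  have "degree p \<le> n"
    by (rule degree_le) (use small in \<open>auto simp: p_def\<close>)
  then have deg: "degree p = n" using le_degree[of p n] c1 by simp
  then have lead: "lead_coeff p = 1" using c1 by simp
  then have "p \<noteq> 0" by auto
  from alg_closed_imp_factorization[OF this] obtain A where
    A: "size A = n" "p = (\<Prod>x\<in>#A. [:- x, 1:])" unfolding deg c1 smult_1_left by blast
  have ev: "poly p x = x ^ n - (1 + \<epsilon> * x)" for x by (simp add: p_def poly_monom algebra_simps)
  have der: "poly (pderiv p) x = of_nat n * x ^ (n - 1) - \<epsilon>" for x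
    by (simp add: p_def pderiv_diff pderiv_monom poly_monom pderiv_pCons)
  have count: "count A x = 1" if x: "x \<in># A" for x
  proof (rule ccontr)
    assume "count A x \<noteq> 1"
    moreover have "count A x > 0" using x by (simp only: count_greater_zero_iff)
    ultimately have two: "count A x \<ge> 2" by linarith
    obtain B where B: "A = add_mset x B" using multi_member_split[OF x] by blast
    then have "count B x > 0" using two by simp
    then have xB: "x \<in># B" by (simp only: count_greater_zero_iff)
    obtain D where D: "B = add_mset x D" using multi_member_split[OF xB] by blast
    define r where "r = (\<Prod>x\<in>#D. [:- x, 1:])"
    have pr: "p = [:- x, 1:] * ([:- x, 1:] * r)" 
      by (simp only: A(2) B D r_def image_mset_add_mset prod_mset.add_mset)
    have "poly (pderiv p) x = 0" unfolding pr pderiv_mult by simp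
    then have d0: "of_nat n * x ^ (n - 1) = \<epsilon>" using der[of x] by simp
    have p0: "x ^ n = 1 + \<epsilon> * x" using ev[of x] unfolding pr by simp
    from \<epsilon> show False
    proof
      assume *: "of_nat n \<noteq> (0 :: 'k) \<and> \<epsilon> = 0"
      then have "x ^ (n - 1) = 0" using d0 by simp
      then have "x ^ n = 0" using n by (cases n) auto
      then show False using p0 * by simp
    next
      assume "of_nat n = (0 :: 'k) \<and> \<epsilon> \<noteq> 0"
      then show False using d0 by simp
    qed
  qed
  have "{x. x ^ n = 1 + \<epsilon> * x} = set_mset A"
  proof -
    have "x ^ n = 1 + \<epsilon> * x \<longleftrightarrow> poly p x = 0" for x using ev[of x] by simp
    also have "poly p x = 0 \<longleftrightarrow> x \<in># A" for x
      unfolding A(2) poly_prod_mset by (auto simp: prod_mset_zero_iff)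
    finally show ?thesis by blast
  qed
  moreover have "size A = card (set_mset A)"
    unfolding size_multiset_overloaded_eq using count by simp
  ultimately show ?thesis using A(1) by simp
qed

text \<open>The inverse of the Vandermonde matrix, read off from the Lagrange polynomials:
  \<open>monom 1 N\<close> and its interpolation have degree below \<open>n\<close> and agree at
  \<open>n\<close> points.\<close>

lemma lagrange_coefficients:
  fixes \<rho> :: "nat \<Rightarrow> 'k::field"
  assumes inj: "inj_on \<rho> {..<n}"
  shows "\<exists>b. \<forall>N<n. \<forall>c<n. (\<Sum>l<n. \<rho> l ^ N * b l c) = (if N = c then 1 else 0)"
proof -
  define L where "L l = smult (inverse (\<Prod>m\<in>{..<n} - {l}. \<rho> l - \<rho> m)) (\<Prod>m\<in>{..<n} - {l}. [:- \<rho> m, 1:])" for l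
  have deg: "degree (L l) < n" if "l < n" for l
  proof -
    have "degree (L l) \<le> degree (\<Prod>m\<in>{..<n} - {l}. [:- \<rho> m, 1:])" unfolding L_def by (rule degree_smult_le)
    also have "\<dots> \<le> (\<Sum>m\<in>{..<n} - {l}. degree [:- \<rho> m, 1:])" by (rule order_trans[OF degree_prod_sum_le]) simp_all
    also have "\<dots> = n - 1" using that by simp
    finally show ?thesis using that by simp
  qed
  have ev: "poly (L l) (\<rho> k) = (if k = l then 1 else 0)" if "l < n" "k < n" for l k
  proof (cases "k = l")
    case True
    have "(\<Prod>m\<in>{..<n} - {l}. \<rho> l - \<rho> m) \<noteq> 0" using inj that by (auto simp: inj_on_def)
    then show ?thesis using True by (simp add: L_def poly_prod)
  next
    case False
    have "(\<Prod>m\<in>{..<n} - {l}. \<rho> k - \<rho> m) = 0" using False that by (intro prod_zero) auto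
    then show ?thesis using False by (simp add: L_def poly_prod)
  qed
  have "(\<Sum>l<n. \<rho> l ^ N * coeff (L l) c) = (if N = c then 1 else 0)" if N: "N < n" for N c
  proof -
    define q where "q = monom 1 N - (\<Sum>l<n. smult (\<rho> l ^ N) (L l))"
    have "degree q \<le> n - 1"
      unfolding q_def
    proof (rule degree_diff_le)
      show "degree (monom (1 :: 'k) N) \<le> n - 1" using N by (simp add: degree_monom_eq)
      show "degree (\<Sum>l<n. smult (\<rho> l ^ N) (L l)) \<le> n - 1"
      proof (rule degree_sum_le)
        fix l assume "l \<in> {..<n}"
        then show "degree (smult (\<rho> l ^ N) (L l)) \<le> n - 1"
          using deg[of l] degree_smult_le[of "\<rho> l ^ N" "L l"] by simp
      qed simp
    qed
    moreover have "poly q (\<rho> k) = 0" if k: "k < n" for k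
    proof -
      have "poly (\<Sum>l<n. smult (\<rho> l ^ N) (L l)) (\<rho> k) = (\<Sum>l<n. if l = k then \<rho> k ^ N else 0)"
        unfolding poly_sum using k by (intro sum.cong refl) (auto simp: ev)
      then show ?thesis using k by (simp add: q_def poly_monom)
    qed
    ultimately have "q = 0"
    proof -
      assume dq: "degree q \<le> n - 1" and roots: "\<And>k. k < n \<Longrightarrow> poly q (\<rho> k) = 0"
      show "q = 0"
      proof (rule ccontr)
        assume q0: "q \<noteq> 0"
        have "n = card (\<rho> ` {..<n})" using inj by (simp add: card_image)
        also have "\<dots> \<le> card {x. poly q x = 0}"
          using roots poly_roots_finite[OF q0] by (intro card_mono) auto
        also have "\<dots> \<le> degree q" using q0 by (rule card_poly_roots_bound)
        finally show False using dq N by simp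
      qed
    qed
    then have "coeff q c = 0" by simp
    then show ?thesis by (simp add: q_def coeff_sum)
  qed
  then show ?thesis by (intro exI[of _ "\<lambda>l c. coeff (L l) c"]) blast
qed

section \<open>The deformed minors\<close>

interpretation mspace: vector_space "mscale :: 'k::field \<Rightarrow> ('v, 'k) mpoly \<Rightarrow> ('v, 'k) mpoly"
  by (rule vector_space_mscale)

lemma mult_mscale: "q * mscale a p = mscale a (q * p)"
  by (simp add: mscale_def mult.left_commute)

lemma prod_mscale: "(\<Prod>i\<in>A. mscale (a i) (p i)) = mscale (prod a A) (prod p A)"
  by (induction A rule: infinite_finite_induct)
     (simp_all add: mscale_def mult_single[of 0 _ 0, simplified, symmetric] mult_ac)

lemma mult_span:
  assumes "p \<in> mspace.span A" and "\<And>a. a \<in> A \<Longrightarrow> q * a \<in> mspace.span B"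
  shows "q * p \<in> mspace.span B"
  using assms(1)
proof (induction rule: mspace.span_induct_alt)
  case base
  then show ?case by (simp add: mspace.span_zero)
next
  case (step c x y)
  have "mscale c (q * x) \<in> mspace.span B" using step assms(2) by (intro mspace.span_scale) simp
  then show ?case unfolding distrib_left mult_mscale using step by (intro mspace.span_add)
qed

text \<open>Multilinearity in the columns: the Cauchy-Binet expansion before terms with the same
  column set are collected.\<close>

lemma det_sum_columns:
  fixes \<alpha> \<beta> :: "nat \<Rightarrow> nat \<Rightarrow> 'a::comm_ring_1"
  assumes S: "finite S"
  shows "det (mat t t (\<lambda>(i, j). \<Sum>l\<in>S. \<alpha> i l * \<beta> l j)) =
    (\<Sum>\<phi>\<in>{..<t} \<rightarrow>\<^sub>E S. (\<Prod>j<t. \<beta> (\<phi> j) j) * det (mat t t (\<lambda>(i, j). \<alpha> i (\<phi> j))))"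
proof -
  let ?Q = "{p. p permutes {0..<t}}"
  have tr: "det (mat t t f) = (\<Sum>p\<in>?Q. of_int (sign p) * (\<Prod>i<t. f (p i, i)))" for f :: "nat \<times> nat \<Rightarrow> 'a"
  proof -
    have "transpose_mat (mat t t f) = mat t t (\<lambda>(i, j). f (j, i))" by (rule eq_matI) auto
    then have "det (mat t t f) = det (mat t t (\<lambda>(i, j). f (j, i)))"
      using det_transpose[of "mat t t f" t] by simp
    then show ?thesis by (simp add: det_mat_sum)
  qed
  have "det (mat t t (\<lambda>(i, j). \<Sum>l\<in>S. \<alpha> i l * \<beta> l j)) =
      (\<Sum>p\<in>?Q. of_int (sign p) * (\<Prod>i<t. \<Sum>l\<in>S. \<alpha> (p i) l * \<beta> l i))"
    unfolding tr by simp
  also have "\<dots> = (\<Sum>p\<in>?Q. of_int (sign p) * (\<Sum>\<phi>\<in>{..<t} \<rightarrow>\<^sub>E S. \<Prod>i<t. \<alpha> (p i) (\<phi> i) * \<beta> (\<phi> i) i))"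
    using S by (subst prod_sum_PiE) auto
  also have "\<dots> = (\<Sum>p\<in>?Q. \<Sum>\<phi>\<in>{..<t} \<rightarrow>\<^sub>E S. (\<Prod>j<t. \<beta> (\<phi> j) j) * (of_int (sign p) * (\<Prod>i<t. \<alpha> (p i) (\<phi> i))))"
    by (simp only: sum_distrib_left prod.distrib mult_ac)
  also have "\<dots> = (\<Sum>\<phi>\<in>{..<t} \<rightarrow>\<^sub>E S. \<Sum>p\<in>?Q. (\<Prod>j<t. \<beta> (\<phi> j) j) * (of_int (sign p) * (\<Prod>i<t. \<alpha> (p i) (\<phi> i))))"
    by (rule sum.swap)
  also have "\<dots> = (\<Sum>\<phi>\<in>{..<t} \<rightarrow>\<^sub>E S. (\<Prod>j<t. \<beta> (\<phi> j) j) * det (mat t t (\<lambda>(i, j). \<alpha> i (\<phi> j))))"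
    unfolding tr by (simp only: sum_distrib_left prod.case)
  finally show ?thesis .
qed

lemma det_const:
  "det (mat t t (\<lambda>(i, j). single 0 (a i j))) = (single 0 (det (mat t t (\<lambda>(i, j). a i j))) :: ('v, 'k::field) mpoly)"
proof -
  have "comm_ring_hom (\<lambda>a. single 0 a :: ('v, 'k) mpoly)"
    by unfold_locales (simp_all add: single_add mult_single)
  moreover have "map_mat (\<lambda>a. single 0 a :: ('v, 'k) mpoly) (mat t t (\<lambda>(i, j). a i j)) = mat t t (\<lambda>(i, j). single 0 (a i j))"
    by (rule eq_matI) auto
  ultimately show ?thesis using comm_ring_hom.hom_det[of "\<lambda>a. single 0 a :: ('v, 'k) mpoly" "mat t t (\<lambda>(i, j). a i j)"] by simp
qed

text \<open>If the \<open>\<rho> l\<close> are distinct, the linear forms \<open>root_form n \<rho> x\<close> are new coordinates of the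
  polynomial ring. In these coordinates the deformed matrix has the entries
  \<open>\<rho> l ^ r * \<gamma>\<close> times the variables of the matrix D, so that its minors are combinations of
  the generators of the ideal of minors of D.\<close>

definition root_form :: "nat \<Rightarrow> (nat \<Rightarrow> 'k::field) \<Rightarrow> nat \<times> nat \<Rightarrow> (nat \<times> nat, 'k) mpoly" where
  "root_form n \<rho> x = (\<Sum>i<n. mscale (\<rho> (fst x - 1) ^ i) (var (i + 1, snd x)))"

definition root_monomial :: "nat \<Rightarrow> (nat \<Rightarrow> 'k::field) \<Rightarrow> (nat \<times> nat \<Rightarrow>\<^sub>0 nat) \<Rightarrow> (nat \<times> nat, 'k) mpoly" where
  "root_monomial n \<rho> m = (\<Prod>x\<in>xvars n. root_form n \<rho> x ^ lookup m x)"

text \<open>The monomials of degree \<open>d\<close> in the ideal of minors of D.\<close>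

definition D_multiples :: "nat \<Rightarrow> nat \<Rightarrow> nat \<Rightarrow> (nat \<times> nat \<Rightarrow>\<^sub>0 nat) set" where
  "D_multiples n t d = {m. keys m \<subseteq> xvars n \<and> mon_degree m = d \<and> (\<exists>u\<in>D_monomials n t. \<exists>w. m = u + w)}"

lemma D_monomials_multiples:
  assumes "u \<in> D_monomials n t"
  shows "u \<in> D_multiples n t t"
proof -
  have "u = u + 0" by simp
  then show ?thesis using assms unfolding D_multiples_def D_monomials_def by blast
qed

lemma root_monomial_add: "root_monomial n \<rho> (m + m') = root_monomial n \<rho> m * root_monomial n \<rho> m'"
  by (simp add: root_monomial_def lookup_add power_add prod.distrib)

lemma root_monomial_single:
  assumes "x \<in> xvars n"
  shows "root_monomial n \<rho> (single x 1) = root_form n \<rho> x"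
proof -
  have "root_monomial n \<rho> (single x 1) = (\<Prod>y\<in>xvars n. if y = x then root_form n \<rho> y else 1)"
    unfolding root_monomial_def by (intro prod.cong refl) (simp add: lookup_single when_def)
  then show ?thesis using assms by simp
qed

lemma root_monomial_sum:
  assumes "\<And>i. i \<in> A \<Longrightarrow> x i \<in> xvars n"
  shows "root_monomial n \<rho> (\<Sum>i\<in>A. single (x i) 1) = (\<Prod>i\<in>A. root_form n \<rho> (x i))"
  using assms
proof (induction A rule: infinite_finite_induct)
  case (insert a A)
  then have "root_monomial n \<rho> (single (x a) 1) = root_form n \<rho> (x a)" by (intro root_monomial_single) simp
  then show ?case using insert by (simp add: root_monomial_add)
qed (simp_all add: root_monomial_def)

lemma root_form_combination:
  "(\<Sum>l<n. mscale (a l) (root_form n \<rho> (l + 1, j))) = (\<Sum>i<n. mscale (\<Sum>l<n. \<rho> l ^ i * a l) (var (i + 1, j)))"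
proof -
  have "(\<Sum>l<n. mscale (a l) (root_form n \<rho> (l + 1, j))) =
      (\<Sum>l<n. \<Sum>i<n. mscale (\<rho> l ^ i * a l) (var (i + 1, j)))"
    by (simp add: root_form_def mspace.scale_sum_right mult.commute)
  also have "\<dots> = (\<Sum>i<n. \<Sum>l<n. mscale (\<rho> l ^ i * a l) (var (i + 1, j)))" by (rule sum.swap)
  finally show ?thesis by (simp add: mspace.scale_sum_left)
qed

text \<open>After expansion along columns, a choice \<open>\<phi>\<close> that repeats a value
  leaves two equal columns of constants, and an injective one contributes a product of forms from
  different rows, which is a generator of D in the new coordinates.\<close>

lemma root_minor_span:
  fixes \<rho> :: "nat \<Rightarrow> 'k::field"
  assumes h: "\<And>j. j < t \<Longrightarrow> h j \<in> {1, 2}"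
  shows "det (mat t t (\<lambda>(i, j). \<Sum>l<n. mscale (\<rho> l ^ r i * \<gamma> l j) (root_form n \<rho> (l + 1, h j)))) \<in>
    mspace.span (root_monomial n \<rho> ` D_multiples n t t)"
proof -
  have entry: "mscale (\<rho> l ^ r i * \<gamma> l j) (root_form n \<rho> (l + 1, h j)) =
      single 0 (\<rho> l ^ r i) * mscale (\<gamma> l j) (root_form n \<rho> (l + 1, h j))" for i j l
    by (simp add: mscale_def mult_single mult.assoc[symmetric])
  have "(\<Prod>j<t. mscale (\<gamma> (\<phi> j) j) (root_form n \<rho> (\<phi> j + 1, h j))) *
      det (mat t t (\<lambda>(i, j). single 0 (\<rho> (\<phi> j) ^ r i))) \<in> mspace.span (root_monomial n \<rho> ` D_multiples n t t)"
    if \<phi>: "\<phi> \<in> {..<t} \<rightarrow>\<^sub>E {..<n}" for \<phi>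
  proof (cases "inj_on \<phi> {..<t}")
    case True
    define x where "x j = (\<phi> j + 1, h j)" for j
    have xV: "x j \<in> xvars n" if "j < t" for j
    proof -
      have "\<phi> j < n" using \<phi> that by auto
      then show ?thesis using h[OF that] by (auto simp: x_def xvars_def)
    qed
    have "inj_on (fst \<circ> x) {..<t}" using True by (simp add: x_def inj_on_def)
    then have "(\<Sum>j<t. single (x j) 1) \<in> D_monomials n t" by (intro sum_singles_D_monomials xV) assumption
    then have "(\<Sum>j<t. single (x j) 1) \<in> D_multiples n t t"
      by (rule D_monomials_multiples)
    then have "root_monomial n \<rho> (\<Sum>j<t. single (x j) 1) \<in> mspace.span (root_monomial n \<rho> ` D_multiples n t t)"
      by (intro mspace.span_base imageI)
    moreover have "root_monomial n \<rho> (\<Sum>j<t. single (x j) 1) = (\<Prod>j<t. root_form n \<rho> (\<phi> j + 1, h j))"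
      using root_monomial_sum[of "{..<t}" x n \<rho>] xV by (simp add: x_def)
    ultimately have "mscale (det (mat t t (\<lambda>(i, j). \<rho> (\<phi> j) ^ r i))) (mscale (\<Prod>j<t. \<gamma> (\<phi> j) j)
        (\<Prod>j<t. root_form n \<rho> (\<phi> j + 1, h j))) \<in> mspace.span (root_monomial n \<rho> ` D_multiples n t t)"
      by (intro mspace.span_scale) simp
    then show ?thesis unfolding det_const prod_mscale
      unfolding mscale_def[of "det _"] by (simp only: mult.commute)
  next
    case False
    then obtain i j where ij: "i < t" "j < t" "i \<noteq> j" "\<phi> i = \<phi> j" by (auto simp: inj_on_def)
    have "det (mat t t (\<lambda>(i, j). single 0 (\<rho> (\<phi> j) ^ r i) :: (nat \<times> nat, 'k) mpoly)) = 0"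
    proof (rule det_identical_columns[of _ t i j])
      show "col (mat t t (\<lambda>(i, j). single 0 (\<rho> (\<phi> j) ^ r i) :: (nat \<times> nat, 'k) mpoly)) i =
          col (mat t t (\<lambda>(i, j). single 0 (\<rho> (\<phi> j) ^ r i))) j"
        using ij by (intro eq_vecI) auto
    qed (use ij in auto)
    then show ?thesis by (simp add: mspace.span_zero)
  qed
  then show ?thesis unfolding entry by (subst det_sum_columns) (auto intro: mspace.span_sum)
qed

text \<open>Ideal property in the new coordinates: \<open>b\<close> inverts the Vandermonde matrix
  of the \<open>\<rho> l\<close> and so writes a variable as a combination of root forms, each of
  which takes multiples of generators to such multiples.\<close>

lemma var_mult_span:
  fixes \<rho> :: "nat \<Rightarrow> 'k::field"
  assumes b: "\<And>N c. N < n \<Longrightarrow> c < n \<Longrightarrow> (\<Sum>l<n. \<rho> l ^ N * b l c) = (if N = c then 1 else 0)"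
    and x: "x \<in> xvars n" and p: "p \<in> mspace.span (root_monomial n \<rho> ` D_multiples n t d)"
  shows "var x * p \<in> mspace.span (root_monomial n \<rho> ` D_multiples n t (d + 1))"
proof (rule mult_span[OF p])
  fix q assume "q \<in> root_monomial n \<rho> ` D_multiples n t d"
  then obtain m where m: "m \<in> D_multiples n t d" "q = root_monomial n \<rho> m" by blast
  obtain i j where ij: "x = (i + 1, j)" "i < n"
    using x unfolding xvars_def by (cases x) (auto intro!: that[of "fst x - 1" "snd x"])
  have "(\<Sum>l<n. mscale (b l i) (root_form n \<rho> (l + 1, j))) = (\<Sum>k<n. if k = i then var (k + 1, j) else 0)"
    unfolding root_form_combination using b ij(2) by (intro sum.cong refl) simp
  then have var: "(var x :: (nat \<times> nat, 'k) mpoly) = (\<Sum>l<n. mscale (b l i) (root_form n \<rho> (l + 1, j)))"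
    using ij by simp
  have "q * mscale (b l i) (root_form n \<rho> (l + 1, j)) \<in> mspace.span (root_monomial n \<rho> ` D_multiples n t (d + 1))"
    if l: "l < n" for l
  proof -
    have lx: "(l + 1, j) \<in> xvars n" using l x ij by (auto simp: xvars_def)
    obtain u w where u: "u \<in> D_monomials n t" "m = u + w" using m(1) by (auto simp: D_multiples_def)
    have "m + single (l + 1, j) 1 = u + (w + single (l + 1, j) 1)" using u by (simp add: add.assoc)
    moreover have "keys (m + single (l + 1, j) 1) \<subseteq> xvars n" "mon_degree (m + single (l + 1, j) 1) = d + 1"
      using m(1) lx by (simp_all add: D_multiples_def keys_plus_nat)
    ultimately have "m + single (l + 1, j) 1 \<in> D_multiples n t (d + 1)"
      using u(1) unfolding D_multiples_def by blast
    then have "root_monomial n \<rho> (m + single (l + 1, j) 1) \<in> root_monomial n \<rho> ` D_multiples n t (d + 1)"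
      by (rule imageI)
    then have "q * root_form n \<rho> (l + 1, j) \<in> root_monomial n \<rho> ` D_multiples n t (d + 1)"
      unfolding root_monomial_add root_monomial_single[OF lx] m(2) .
    then show ?thesis unfolding mult_mscale by (intro mspace.span_scale mspace.span_base)
  qed
  then show "var x * q \<in> mspace.span (root_monomial n \<rho> ` D_multiples n t (d + 1))"
    unfolding var mult.commute[of _ q] sum_distrib_left by (intro mspace.span_sum) simp
qed

lemma monomial_mult_span:
  fixes \<rho> :: "nat \<Rightarrow> 'k::field"
  assumes b: "\<And>N c. N < n \<Longrightarrow> c < n \<Longrightarrow> (\<Sum>l<n. \<rho> l ^ N * b l c) = (if N = c then 1 else 0)"
    and m: "keys m \<subseteq> xvars n" and p: "p \<in> mspace.span (root_monomial n \<rho> ` D_multiples n t d)"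
  shows "single m 1 * p \<in> mspace.span (root_monomial n \<rho> ` D_multiples n t (d + mon_degree m))"
  using m
proof (induction "mon_degree m" arbitrary: m)
  case 0
  then have "m = 0" using mon_degree_eq_0_iff[of m] by simp
  then show ?case using p by simp
next
  case (Suc e)
  then have "m \<noteq> 0" using mon_degree_eq_0_iff[of m] by simp
  then obtain v where v: "v \<in> keys m" by (metis keys_eq_empty all_not_in_conv)
  define m' where "m' = m - single v 1"
  have mm: "m = single v 1 + m'" unfolding m'_def by (rule mon_split[OF v])
  then have "mon_degree m = 1 + mon_degree m'" by simp
  then have deg: "e = mon_degree m'" "mon_degree m = Suc e" using Suc(2) by simp_all
  have k: "keys m' \<subseteq> xvars n" using Suc(3) unfolding mm by (simp add: keys_plus_nat)
  have s: "single m (1 :: 'k) = var v * single m' 1" unfolding mm var_def by (simp add: mult_single)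
  have "var v * (single m' 1 * p) \<in> mspace.span (root_monomial n \<rho> ` D_multiples n t (d + mon_degree m' + 1))"
    using v Suc(3) by (intro var_mult_span[OF b] Suc(1)[OF deg(1) k]) auto
  then show ?case unfolding s mult.assoc deg(2) deg(1)[symmetric] by simp
qed

text \<open>For \<open>N \<le> 2 * n - 2\<close>, the coefficient of \<open>z ^ c\<close> in
  \<open>z ^ N\<close> reduced by \<open>z ^ n = 1 + \<epsilon> * z\<close>. The exponents
  \<open>r + i\<close> with \<open>r\<close> and \<open>i\<close> below \<open>n\<close> need no
  second reduction.\<close>

definition deform :: "nat \<Rightarrow> 'k::field \<Rightarrow> nat \<Rightarrow> nat \<Rightarrow> 'k" where
  "deform n \<epsilon> N c = (if N < n then if N = c then 1 else 0
     else (if N - n = c then 1 else 0) + (if N - n + 1 = c then \<epsilon> else 0))"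

text \<open>The same coefficients with the parameter as an indeterminate, as
  \<open>independent_family_generic\<close> requires.\<close>

definition deform_poly :: "nat \<Rightarrow> nat \<Rightarrow> nat \<Rightarrow> ('v, 'k::field) mpoly poly" where
  "deform_poly n N c = (if N < n then if N = c then 1 else 0
     else (if N - n = c then 1 else 0) + (if N - n + 1 = c then [:0, 1:] else 0))"

text \<open>Row \<open>r\<close> of a block lists the coefficients of \<open>z ^ r\<close> times the
  generic element, whose coefficient at \<open>z ^ i\<close> is the variable of index
  \<open>i + 1\<close>. For \<open>z ^ n = 1\<close> this is the generic circulant matrix.\<close>

definition P_family :: "nat \<Rightarrow> nat \<Rightarrow> nat \<Rightarrow> (nat \<times> nat, 'k::field) mpoly poly" where
  "P_family n r c = (\<Sum>i<n. [:var (i + 1, if c < n then 1 else 2):] * deform_poly n (r + i) (c mod n))"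

definition P_family_minor :: "nat \<Rightarrow> nat \<Rightarrow> (nat \<Rightarrow> nat) \<Rightarrow> (nat \<Rightarrow> nat) \<Rightarrow> (nat \<times> nat, 'k::field) mpoly poly" where
  "P_family_minor n t r c = det (mat t t (\<lambda>(i, j). P_family n (r i) (c j)))"

lemma poly_deform: "poly (deform_poly n N c) (single 0 \<epsilon>) = single 0 (deform n \<epsilon> N c)"
  by (simp add: deform_poly_def deform_def single_add)

lemma poly_P_family:
  "poly (P_family n r c) (single 0 \<epsilon>) =
    (\<Sum>i<n. mscale (deform n \<epsilon> (r + i) (c mod n)) (var (i + 1, if c < n then 1 else 2)))"
  by (simp add: P_family_def poly_sum poly_deform mscale_def mult.commute)

lemma poly_P_family_minor:
  fixes x :: "(nat \<times> nat, 'k::field) mpoly"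
  shows "poly (P_family_minor n t r c) x = det (mat t t (\<lambda>(i, j). poly (P_family n (r i) (c j)) x))"
proof -
  have "comm_ring_hom (\<lambda>p :: (nat \<times> nat, 'k) mpoly poly. poly p x)" by unfold_locales simp_all
  moreover have "map_mat (\<lambda>p. poly p x) (mat t t (\<lambda>(i, j). P_family n (r i) (c j))) =
      mat t t (\<lambda>(i, j). poly (P_family n (r i) (c j)) x)"
    by (rule eq_matI) auto
  ultimately show ?thesis unfolding P_family_minor_def
    using comm_ring_hom.hom_det[of "\<lambda>p. poly p x" "mat t t (\<lambda>(i, j). P_family n (r i) (c j))"] by simp
qed

lemma deform_0:
  assumes "i < n" "r < n" "c < n"
  shows "deform n 0 (r + i) c = (if i = (c + n - r) mod n then 1 else 0)"
proof (cases "r \<le> c")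
  case True
  then have "c + n - r = (c - r) + n" by simp
  then have "(c + n - r) mod n = c - r" using assms by (simp only: mod_add_self2) simp
  then show ?thesis using True assms by (auto simp: deform_def)
next
  case False
  then have "(c + n - r) mod n = c + n - r" using assms by simp
  then show ?thesis using False assms by (auto simp: deform_def)
qed

lemma P_family_0:
  assumes "r < n" "c < 2 * n"
  shows "poly (P_family n r c) (single 0 0) = (P_mat n :: (nat \<times> nat, 'k::field) mpoly mat) $$ (r, c)"
proof -
  define k where "k = (c mod n + n - r) mod n"
  have cn: "c mod n < n" "k < n" using assms by (simp_all add: k_def)
  have P: "P_var n r c = (k + 1, if c < n then 1 else 2)"
  proof (cases "c < n")
    case False
    then have "c mod n = c - n" using assms by (simp add: mod_if)
    then show ?thesis using False by (simp add: P_var_def k_def)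
  qed (simp add: P_var_def k_def)
  have "poly (P_family n r c) (single 0 0) =
      (\<Sum>i<n. if i = k then var (i + 1, if c < n then 1 else 2) else (0 :: (nat \<times> nat, 'k) mpoly))"
    unfolding poly_P_family
  proof (rule sum.cong[OF refl])
    fix i assume "i \<in> {..<n}"
    then have "deform n (0 :: 'k) (r + i) (c mod n) = (if i = k then 1 else 0)"
      unfolding k_def by (intro deform_0 assms cn(1)) simp
    then show "mscale (deform n 0 (r + i) (c mod n)) (var (i + 1, if c < n then 1 else 2)) =
        (if i = k then var (i + 1, if c < n then 1 else 2) else (0 :: (nat \<times> nat, 'k) mpoly))"
      by (cases "i = k") (simp_all only: if_True if_False mspace.scale_one mspace.scale_zero_left refl)
  qed
  also have "\<dots> = var (P_var n r c)" unfolding P using cn(2) by simp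
  finally show ?thesis unfolding P_mat_entry[OF assms] .
qed

lemma P_family_minor_0:
  assumes "\<And>i. i < t \<Longrightarrow> r i < n" "\<And>i. i < t \<Longrightarrow> c i < 2 * n"
  shows "poly (P_family_minor n t r c) (single 0 0) = P_minor n t r c"
  unfolding poly_P_family_minor P_minor_def
  using P_family_0[OF assms(1) assms(2)] by (intro arg_cong[of _ _ det] cong_mat) auto

text \<open>Evaluation at the roots followed by interpolation with \<open>b\<close> performs the
  reduction of powers of \<open>z\<close>. An entry therefore becomes a combination of the values of
  the generic element at the roots, which are the root forms, and \<open>root_minor_span\<close>
  applies.\<close>

lemma P_family_minor_span:
  fixes \<rho> :: "nat \<Rightarrow> 'k::field"
  assumes b: "\<And>N c. N < n \<Longrightarrow> c < n \<Longrightarrow> (\<Sum>l<n. \<rho> l ^ N * b l c) = (if N = c then 1 else 0)"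
    and root: "\<And>l. l < n \<Longrightarrow> \<rho> l ^ n = 1 + \<epsilon> * \<rho> l"
    and r: "\<And>i. i < t \<Longrightarrow> r i < n" and c: "\<And>i. i < t \<Longrightarrow> c i < 2 * n"
  shows "poly (P_family_minor n t r c) (single 0 \<epsilon>) \<in> mspace.span (root_monomial n \<rho> ` D_multiples n t t)"
proof -
  \<comment> \<open>The bound on \<open>N\<close> ensures that after one use of the equation both
    exponents, \<open>M\<close> and \<open>M + 1\<close>, are below \<open>n\<close>.\<close>
  have deform: "(\<Sum>l<n. \<rho> l ^ N * b l c) = deform n \<epsilon> N c" if N: "N + 2 \<le> 2 * n" and c: "c < n" for N c
  proof (cases "N < n")
    case True
    then show ?thesis using b[OF True c] by (simp add: deform_def)
  next
    case False
    define M where "M = N - n"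
    have NM: "N = M + n" "M < n" "M + 1 < n" using False N by (simp_all add: M_def)
    have "(\<Sum>l<n. \<rho> l ^ N * b l c) = (\<Sum>l<n. \<rho> l ^ M * b l c + \<epsilon> * (\<rho> l ^ (M + 1) * b l c))"
      unfolding NM(1) power_add using root by (intro sum.cong refl) (simp add: algebra_simps)
    also have "\<dots> = (if M = c then 1 else 0) + \<epsilon> * (if M + 1 = c then 1 else 0)"
      unfolding sum.distrib sum_distrib_left[symmetric] b[OF NM(2) c] b[OF NM(3) c] ..
    finally show ?thesis using NM by (simp add: deform_def)
  qed
  define h where "h j = (if c j < n then 1 else 2 :: nat)" for j
  have entry: "poly (P_family n (r i) (c j)) (single 0 \<epsilon>) =
      (\<Sum>l<n. mscale (\<rho> l ^ r i * b l (c j mod n)) (root_form n \<rho> (l + 1, h j)))" if ij: "i < t" "j < t" for i j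
  proof -
    have cm: "c j mod n < n" using r[OF ij(1)] by simp
    have "poly (P_family n (r i) (c j)) (single 0 \<epsilon>) =
        (\<Sum>k<n. mscale (\<Sum>l<n. \<rho> l ^ k * (\<rho> l ^ r i * b l (c j mod n))) (var (k + 1, h j)))"
      unfolding poly_P_family h_def
    proof (rule sum.cong[OF refl])
      fix k assume "k \<in> {..<n}"
      then have "r i + k + 2 \<le> 2 * n" using r[OF ij(1)] by simp
      from deform[OF this cm] have "deform n \<epsilon> (r i + k) (c j mod n) = (\<Sum>l<n. \<rho> l ^ k * (\<rho> l ^ r i * b l (c j mod n)))"
        by (simp add: power_add mult_ac)
      then show "mscale (deform n \<epsilon> (r i + k) (c j mod n)) (var (k + 1, if c j < n then 1 else 2)) =
          mscale (\<Sum>l<n. \<rho> l ^ k * (\<rho> l ^ r i * b l (c j mod n))) (var (k + 1, if c j < n then 1 else 2))"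
        by (simp only:)
    qed
    then show ?thesis unfolding root_form_combination .
  qed
  have "mat t t (\<lambda>(i, j). poly (P_family n (r i) (c j)) (single 0 \<epsilon>)) =
      mat t t (\<lambda>(i, j). \<Sum>l<n. mscale (\<rho> l ^ r i * b l (c j mod n)) (root_form n \<rho> (l + 1, h j)))"
    using entry by (intro cong_mat) auto
  then show ?thesis unfolding poly_P_family_minor
    using root_minor_span[where t = t and h = h and n = n and \<rho> = \<rho> and r = r and \<gamma> = "\<lambda>l j. b l (c j mod n)"] by (simp add: h_def)
qed

section \<open>Minors of P over an algebraically closed field\<close>

lemma card_monomials_le:
  fixes A :: "'a set" and B :: "'b set"
  assumes fin: "finite A" "finite B" and card: "card A = card B"
  shows "card {m :: 'a \<Rightarrow>\<^sub>0 nat. keys m \<subseteq> A \<and> mon_degree m = e} \<le>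
    card {m :: 'b \<Rightarrow>\<^sub>0 nat. keys m \<subseteq> B \<and> mon_degree m = e}"
proof -
  obtain f where f: "bij_betw f A B" using finite_same_card_bij[OF fin card] ..
  define g where "g m = (\<Sum>x\<in>A. single (f x) (lookup m x))" for m :: "'a \<Rightarrow>\<^sub>0 nat"
  have look: "lookup (g m) (f y) = lookup m y" if "y \<in> A" for m y
  proof -
    have "lookup (g m) (f y) = (\<Sum>x\<in>A. if x = y then lookup m x else 0)"
      unfolding g_def lookup_sum using f that
      by (intro sum.cong refl) (auto simp: lookup_single when_def bij_betw_def inj_on_def)
    then show ?thesis using that fin by simp
  qed
  have inj: "m = m'" if "keys m \<subseteq> A" "keys m' \<subseteq> A" "g m = g m'" for m m'
  proof (rule poly_mapping_eqI)
    fix x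
    show "lookup m x = lookup m' x"
    proof (cases "x \<in> A")
      case True
      then show ?thesis using look[OF True, of m] look[OF True, of m'] that(3) by simp
    next
      case False
      then have "x \<notin> keys m" "x \<notin> keys m'" using that(1,2) by auto
      then show ?thesis by (simp add: in_keys_iff)
    qed
  qed
  have keys: "keys (g m) \<subseteq> B" for m
  proof
    fix y assume "y \<in> keys (g m)"
    then have "(\<Sum>x\<in>A. lookup (single (f x) (lookup m x)) y) \<noteq> 0" by (simp add: in_keys_iff g_def lookup_sum)
    then obtain x where "x \<in> A" "lookup (single (f x) (lookup m x)) y \<noteq> 0" by (rule sum.not_neutral_contains_not_neutral)
    then have "y = f x" by (simp add: lookup_single when_def split: if_splits)
    then show "y \<in> B" using \<open>x \<in> A\<close> f by (auto simp: bij_betw_def)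
  qed
  have deg: "mon_degree (g m) = mon_degree m" if "keys m \<subseteq> A" for m
    unfolding g_def mon_degree_sum using wsum_superset[OF fin(1) that, of "\<lambda>_. 1"] by (simp add: mon_degree_wsum)
  show ?thesis
  proof (rule card_inj_on_le[of g])
    show "inj_on g {m. keys m \<subseteq> A \<and> mon_degree m = e}" using inj by (auto intro!: inj_onI)
    show "g ` {m. keys m \<subseteq> A \<and> mon_degree m = e} \<subseteq> {m. keys m \<subseteq> B \<and> mon_degree m = e}"
      using keys deg by auto
    show "finite {m :: 'b \<Rightarrow>\<^sub>0 nat. keys m \<subseteq> B \<and> mon_degree m = e}"
      using fin(2) by (rule finite_bounded_monomials)
  qed
qed

definition monomial_count :: "nat \<Rightarrow> nat \<Rightarrow> nat" where
  "monomial_count k e = card {m :: nat \<Rightarrow>\<^sub>0 nat. keys m \<subseteq> {..<k} \<and> mon_degree m = e}"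

lemma card_monomials:
  assumes "finite A"
  shows "card {m :: 'a \<Rightarrow>\<^sub>0 nat. keys m \<subseteq> A \<and> mon_degree m = e} = monomial_count (card A) e"
  unfolding monomial_count_def using assms by (intro antisym card_monomials_le) simp_all

lemma card_xvars: "card (xvars n) = 2 * n"
  by (simp add: xvars_def card_cartesian_product)

lemma finite_D_multiples: "finite (D_multiples n t d)"
  by (rule finite_subset[OF _ finite_bounded_monomials[of "xvars n" d]]) (auto simp: D_multiples_def)

text \<open>An upper bound is enough here, so only the existence of decompositions is used and not
  their uniqueness.\<close>

lemma card_D_multiples:
  "card (D_multiples n t (t + e)) \<le> (\<Sum>u\<in>D_monomials n t. monomial_count (2 * n - card (D_nonmult n u)) e)"
proof -
  define W where "W u = {w. keys w \<subseteq> xvars n - D_nonmult n u \<and> mon_degree w = e}" for u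
  have sub: "D_nonmult n u \<subseteq> xvars n" for u by (auto simp: D_nonmult_def)
  have finW: "finite (W u)" for u unfolding W_def by (rule finite_bounded_monomials) simp
  have "D_multiples n t (t + e) \<subseteq> (\<Union>u\<in>D_monomials n t. (+) u ` W u)"
  proof
    fix m assume m: "m \<in> D_multiples n t (t + e)"
    then obtain u w where uw: "u \<in> D_monomials n t" "m = u + w" by (auto simp: D_multiples_def)
    have "keys m \<subseteq> xvars n" using m by (simp add: D_multiples_def)
    then have "keys w \<subseteq> xvars n" using keys_plus_nat[of u w] uw(2) by simp
    from D_decompose[OF uw(1) this] obtain u' w' where
      u': "u' \<in> D_monomials n t" "w + u = u' + w'" "keys w' \<subseteq> xvars n - D_nonmult n u'" by (elim exE conjE)
    have mm: "m = u' + w'" using u'(2) uw(2) by (simp add: add.commute)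
    have "mon_degree m = t + e" using m by (simp add: D_multiples_def)
    then have "mon_degree w' = e" using u'(1) unfolding mm by (simp add: D_monomials_def)
    then have "w' \<in> W u'" using u'(3) by (simp add: W_def)
    then show "m \<in> (\<Union>u\<in>D_monomials n t. (+) u ` W u)" using u'(1) unfolding mm by blast
  qed
  then have "card (D_multiples n t (t + e)) \<le> card (\<Union>u\<in>D_monomials n t. (+) u ` W u)"
    using finW by (intro card_mono) auto
  also have "\<dots> \<le> (\<Sum>u\<in>D_monomials n t. card ((+) u ` W u))" by (rule card_UN_le) simp
  also have "\<dots> \<le> (\<Sum>u\<in>D_monomials n t. card (W u))" using finW by (intro sum_mono card_image_le)
  also have "\<dots> = (\<Sum>u\<in>D_monomials n t. monomial_count (2 * n - card (D_nonmult n u)) e)"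
    unfolding W_def using sub
    by (intro sum.cong refl) (simp add: card_monomials card_Diff_subset card_xvars)
  finally show ?thesis .
qed

text \<open>Index set of the normal products in degree \<open>t + e\<close>: a generator together
  with a cofactor of degree \<open>e\<close> in its multiplicative variables.\<close>

definition J_normal :: "nat \<Rightarrow> nat \<Rightarrow> nat \<Rightarrow> ((nat \<times> nat \<Rightarrow>\<^sub>0 nat) \<times> (nat \<times> nat \<Rightarrow>\<^sub>0 nat)) set" where
  "J_normal n t e = (SIGMA u:J_monomials n t. {w. keys w \<subseteq> xvars n - set (J_vars n t u) \<and> mon_degree w = e})"

lemma finite_J_normal: "finite (J_normal n t e)"
  unfolding J_normal_def by (intro finite_SigmaI finite_bounded_monomials) simp_all

lemma card_J_normal:
  assumes t: "1 \<le> t" "t \<le> n"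
  shows "card (J_normal n t e) = (\<Sum>u\<in>D_monomials n t. monomial_count (2 * n - card (D_nonmult n u)) e)"
proof -
  have "card (J_normal n t e) = (\<Sum>u\<in>J_monomials n t. card {w. keys w \<subseteq> xvars n - set (J_vars n t u) \<and> mon_degree w = e})"
    unfolding J_normal_def by (intro card_SigmaI ballI finite_bounded_monomials) simp_all
  also have "\<dots> = (\<Sum>u\<in>J_monomials n t. monomial_count (2 * n - J_max n t u) e)"
  proof (rule sum.cong[OF refl])
    fix u assume u: "u \<in> J_monomials n t"
    have "card (xvars n - set (J_vars n t u)) = 2 * n - J_max n t u"
      using J_vars(1,2)[OF t, of u] J_vars_length[OF t u] distinct_card[of "J_vars n t u"]
      by (simp add: card_Diff_subset card_xvars)
    then show "card {w. keys w \<subseteq> xvars n - set (J_vars n t u) \<and> mon_degree w = e} = monomial_count (2 * n - J_max n t u) e"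
      by (simp add: card_monomials)
  qed
  also have "\<dots> = (\<Sum>u\<in>D_monomials n t. monomial_count (2 * n - card (D_nonmult n u)) e)"
    by (rule same_classes[OF t])
  finally show ?thesis .
qed

text \<open>Grouped by the generator, a linear relation over the field becomes a relation with
  normal coefficients, to which \<open>leading_independent\<close> applies.\<close>

lemma independent_J_normal:
  assumes t: "1 \<le> t" "t \<le> n"
  shows "independent_family (J_normal n t e) (\<lambda>s. single (snd s) 1 * (P_gen n t (fst s) :: (nat \<times> nat, 'k::field) mpoly))"
  unfolding independent_family_def
proof (intro allI impI ballI)
  fix a :: "_ \<Rightarrow> 'k" and s
  assume zero: "(\<Sum>s\<in>J_normal n t e. mscale (a s) (single (snd s) 1 * P_gen n t (fst s))) = 0" and s: "s \<in> J_normal n t e"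
  interpret leading_monomials "xvars n" "J_monomials n t" "J_vars n t" by (rule leading_monomials_J[OF t])
  define B where "B u = {w. keys w \<subseteq> xvars n - set (J_vars n t u) \<and> mon_degree w = e}" for u
  have finB: "finite (B u)" for u unfolding B_def by (rule finite_bounded_monomials) simp
  define f where "f u = (\<Sum>w\<in>B u. single w (a (u, w)))" for u
  have nf: "f \<in> normal_forms (xvars n) (J_monomials n t) (J_vars n t)"
    unfolding normal_forms_def f_def B_def by (auto intro!: polys_sum polys_single)
  have "(\<Sum>u\<in>J_monomials n t. P_gen n t u * f u) =
      (\<Sum>u\<in>J_monomials n t. \<Sum>w\<in>B u. mscale (a (u, w)) (single w 1 * P_gen n t u))"
    unfolding f_def sum_distrib_left
    by (intro sum.cong refl) (simp add: mscale_def mult.assoc[symmetric] mult_single mult.commute)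
  also have "\<dots> = (\<Sum>s\<in>J_normal n t e. mscale (a s) (single (snd s) 1 * P_gen n t (fst s)))"
    unfolding J_normal_def B_def[symmetric] using finB by (subst sum.Sigma) (auto simp: case_prod_unfold)
  finally have "(\<Sum>u\<in>J_monomials n t. P_gen n t u * f u) = 0" unfolding zero .
  from leading_independent[OF P_gen_leading(1)[OF t] P_gen_leading(2)[OF t] nf this]
  have f0: "f u = 0" if "u \<in> J_monomials n t" for u using that by blast
  obtain u w where uw: "s = (u, w)" "u \<in> J_monomials n t" "w \<in> B u"
    using s by (auto simp: J_normal_def B_def)
  have "lookup (f u) w = (\<Sum>w'\<in>B u. if w' = w then a (u, w') else 0)"
    unfolding f_def lookup_sum by (intro sum.cong refl) (simp add: lookup_single when_def)
  then have "lookup (f u) w = a s" using uw finB by simp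
  then show "a s = 0" using f0[OF uw(2)] by simp
qed

text \<open>The value 0 serves unless the characteristic divides \<open>n\<close>; in that case
  every nonzero parameter gives distinct roots, and one of these is not a zero of
  \<open>Q\<close>.\<close>

lemma exists_separable_parameter:
  fixes Q :: "'k::alg_closed_field poly"
  assumes n: "n \<ge> 1" and Q: "poly Q 0 \<noteq> 0"
  shows "\<exists>\<epsilon>. poly Q \<epsilon> \<noteq> 0 \<and> card {x. x ^ n = 1 + \<epsilon> * x} = n"
proof (cases "of_nat n = (0 :: 'k)")
  case True
  have "Q \<noteq> 0" using Q by auto
  from alg_closed_nonroot[OF this] obtain \<epsilon> where "\<epsilon> \<noteq> 0 \<and> poly Q \<epsilon> \<noteq> 0" ..
  then show ?thesis using card_separable_roots[OF n, of \<epsilon>] True by auto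
next
  case False
  then show ?thesis using card_separable_roots[OF n, of 0] Q by (intro exI[of _ 0]) simp
qed

text \<open>Otherwise the normal products of the generators together with \<open>single m 1 * P_minor\<close> would
  remain independent after a deformation for which \<open>z ^ n - \<epsilon> * z - 1\<close> is separable. The deformed
  family spans a space whose dimension is at most the number of monomials of its degree in the ideal of
  minors of D, which is the number of normal products. For \<open>\<epsilon> = 0\<close> the
  polynomial is inseparable if the characteristic divides \<open>n\<close>.\<close>

lemma P_minor_normal_span:
  fixes r c :: "nat \<Rightarrow> nat"
  assumes t: "1 \<le> t" "t \<le> n" and r: "\<And>i. i < t \<Longrightarrow> r i < n" and c: "\<And>i. i < t \<Longrightarrow> c i < 2 * n"
    and m: "keys m \<subseteq> xvars n"
  shows "(single m 1 * P_minor n t r c :: (nat \<times> nat, 'k::alg_closed_field) mpoly) \<in>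
    mspace.span ((\<lambda>s. single (snd s) 1 * P_gen n t (fst s)) ` J_normal n t (mon_degree m))"
proof (rule ccontr)
  define e where "e = mon_degree m"
  define g where "g s = single (snd s) 1 * (P_gen n t (fst s) :: (nat \<times> nat, 'k) mpoly)" for s
  let ?W = "J_normal n t e"
  assume "\<not> ?thesis"
  then have out: "single m 1 * P_minor n t r c \<notin> mspace.span (g ` ?W)" by (simp add: e_def g_def)
  \<comment> \<open>\<open>None\<close> stands for the product claimed to lie outside the span and
    \<open>Some s\<close> for the normal products; all members are deformed by the same
    parameter.\<close>
  define F :: "_ \<Rightarrow> (nat \<times> nat, 'k) mpoly poly" where
    "F s = (case s of None \<Rightarrow> [:single m 1:] * P_family_minor n t r c
      | Some s \<Rightarrow> [:single (snd s) 1:] * P_family_minor n t id (J_column n t (fst s)))" for s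
  let ?I = "insert None (Some ` ?W)"
  have finI: "finite ?I" by (simp add: finite_J_normal)
  have col: "J_column n t u i < 2 * n" if "u \<in> J_monomials n t" "i < t" for u i
    using J_column(1)[OF t that(1)] that(2) by (auto simp: J_columns_def)
  have F_None: "poly (F None) (single 0 0) = single m 1 * P_minor n t r c"
  proof -
    have "poly (P_family_minor n t r c) (single 0 0) = (P_minor n t r c :: (nat \<times> nat, 'k) mpoly)"
      using r c by (rule P_family_minor_0)
    then show ?thesis by (simp add: F_def)
  qed
  have F_Some: "poly (F (Some s)) (single 0 0) = g s" if "s \<in> ?W" for s
  proof -
    have u: "fst s \<in> J_monomials n t" using that by (auto simp: J_normal_def)
    have "poly (P_family_minor n t id (J_column n t (fst s))) (single 0 0) = (P_gen n t (fst s) :: (nat \<times> nat, 'k) mpoly)"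
      unfolding P_gen_def using t col[OF u] by (intro P_family_minor_0) auto
    then show ?thesis by (simp add: F_def g_def)
  qed
  have "independent_family ?I (\<lambda>s. poly (F s) (single 0 0))"
    unfolding independent_family_def
  proof (intro allI impI)
    fix a assume zero: "(\<Sum>s\<in>?I. mscale (a s) (poly (F s) (single 0 0))) = 0"
    have "(\<Sum>s\<in>?I. mscale (a s) (poly (F s) (single 0 0))) =
        mscale (a None) (single m 1 * P_minor n t r c) + (\<Sum>s\<in>?W. mscale (a (Some s)) (g s))"
      using F_None F_Some by (simp add: finite_J_normal sum.reindex)
    then have eq: "mscale (a None) (single m 1 * P_minor n t r c) + (\<Sum>s\<in>?W. mscale (a (Some s)) (g s)) = 0"
      using zero by simp
    have none: "a None = 0"
    proof (rule ccontr)
      assume a: "a None \<noteq> 0"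
      have "mscale (a None) (single m 1 * P_minor n t r c) = - (\<Sum>s\<in>?W. mscale (a (Some s)) (g s))"
        using eq by (simp add: eq_neg_iff_add_eq_0)
      moreover have "- (\<Sum>s\<in>?W. mscale (a (Some s)) (g s)) \<in> mspace.span (g ` ?W)"
        by (intro mspace.span_neg mspace.span_sum mspace.span_scale mspace.span_base imageI)
      ultimately have "mscale (a None) (single m 1 * P_minor n t r c) \<in> mspace.span (g ` ?W)" by (simp only:)
      from mspace.span_scale[OF this, of "inverse (a None)"] show False using out a by simp
    qed
    have "(\<Sum>s\<in>?W. mscale (a (Some s)) (g s)) = 0" using eq unfolding none by simp
    from independent_familyD[OF independent_J_normal[OF t] this[unfolded g_def]]
    show "\<forall>i\<in>?I. a i = 0" using none by auto
  qed
  from independent_family_generic[OF finI this] obtain Q where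
    Q: "poly Q 0 \<noteq> 0 \<and> (\<forall>\<epsilon>. poly Q \<epsilon> \<noteq> 0 \<longrightarrow> independent_family ?I (\<lambda>i. poly (F i) (single 0 \<epsilon>)))" ..
  have n: "n \<ge> 1" using t by simp
  from exists_separable_parameter[OF n Q[THEN conjunct1]] obtain \<epsilon> where
    \<epsilon>: "poly Q \<epsilon> \<noteq> 0 \<and> card {x. x ^ n = 1 + \<epsilon> * x} = n" ..
  then have ind: "independent_family ?I (\<lambda>i. poly (F i) (single 0 \<epsilon>))" using Q by blast
  have fin: "finite {x. x ^ n = 1 + \<epsilon> * x}" using \<epsilon> n by (intro card_ge_0_finite) simp
  obtain \<rho> where \<rho>: "bij_betw \<rho> {0..<n} {x. x ^ n = 1 + \<epsilon> * x}"
    using ex_bij_betw_nat_finite[OF fin] \<epsilon> by auto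
  then have inj: "inj_on \<rho> {..<n}" by (simp add: bij_betw_def atLeast0LessThan)
  have root: "\<rho> l ^ n = 1 + \<epsilon> * \<rho> l" if "l < n" for l
    using bij_betw_apply[OF \<rho>, of l] that by simp
  from lagrange_coefficients[OF inj] obtain b where
    "\<forall>N<n. \<forall>c<n. (\<Sum>l<n. \<rho> l ^ N * b l c) = (if N = c then 1 else 0)" ..
  then have b: "(\<Sum>l<n. \<rho> l ^ N * b l c) = (if N = c then 1 else 0)" if "N < n" "c < n" for N c
    using that by simp
  have "poly (F s) (single 0 \<epsilon>) \<in> mspace.span (root_monomial n \<rho> ` D_multiples n t (t + e))" if s: "s \<in> ?I" for s
  proof (cases s)
    case None
    show ?thesis unfolding None F_def e_def
      using monomial_mult_span[OF b m P_family_minor_span[OF b root r c]] by simp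
  next
    case (Some p)
    then have p: "p \<in> ?W" using s by auto
    then have u: "fst p \<in> J_monomials n t" and w: "keys (snd p) \<subseteq> xvars n" "mon_degree (snd p) = e"
      by (auto simp: J_normal_def)
    have id: "id i < n" if "i < t" for i using that t by simp
    show ?thesis unfolding Some F_def
      using monomial_mult_span[OF b w(1) P_family_minor_span[OF b root id col[OF u]]] w(2) by simp
  qed
  \<comment> \<open>One member more than there are normal products would be independent in a space
    spanned by at most that many elements.\<close>
  then have "card ?I \<le> card (root_monomial n \<rho> ` D_multiples n t (t + e))"
    using finite_D_multiples by (intro independent_family_card_le[OF finI ind]) auto
  also have "\<dots> \<le> card (D_multiples n t (t + e))" by (intro card_image_le finite_D_multiples)
  also have "\<dots> \<le> card ?W" unfolding card_J_normal[OF t] by (rule card_D_multiples)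
  finally show False by (simp add: finite_J_normal card_image card_insert_if)
qed

section \<open>Minors of P over an arbitrary field\<close>

text \<open>Descent from the algebraic closure: comparing coefficients of monomials gives a linear
  system over the base field that is solvable in the closure, and a linear retraction turns that
  solution into one over the base field.\<close>

lemma P_minor_decomposable:
  assumes t: "1 \<le> t" "t \<le> n" and r: "\<And>i. i < t \<Longrightarrow> r i < n" and c: "\<And>i. i < t \<Longrightarrow> c i < 2 * n"
    and m: "keys m \<subseteq> xvars n"
  shows "leading_monomials.decomposable (xvars n) (J_monomials n t) (J_vars n t) (P_gen n t)
    (single m 1 * P_minor n t r c :: (nat \<times> nat, 'k::field) mpoly)"
proof -
  interpret leading_monomials "xvars n" "J_monomials n t" "J_vars n t" by (rule leading_monomials_J[OF t])
  let ?L = "\<lambda>x. to_ac x :: 'k alg_closure"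
  define W where "W = J_normal n t (mon_degree m)"
  have finW: "finite W" unfolding W_def by (rule finite_J_normal)
  interpret ext: vector_space "\<lambda>(a :: 'k) x. ?L a * x" by unfold_locales (simp_all add: algebra_simps)
  interpret ext_pair: vector_space_pair "\<lambda>(a :: 'k) x. ?L a * x" "(*) :: 'k \<Rightarrow> 'k \<Rightarrow> 'k"
    by unfold_locales (simp_all add: algebra_simps)
  have "\<not> ext.dependent {1}" by simp
  \<comment> \<open>\<open>\<pi>\<close> is linear over the base field and fixes its elements. It
    need not be multiplicative, because the coefficients of the known products lie in the base
    field.\<close>
  from ext_pair.linear_independent_extend[OF this, of "\<lambda>_. 1"] obtain \<pi> where
    "Vector_Spaces.linear (\<lambda>(a :: 'k) x. ?L a * x) (*) \<pi> \<and> (\<forall>x\<in>{1}. \<pi> x = 1)" ..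
  then have lin: "Vector_Spaces.linear (\<lambda>(a :: 'k) x. ?L a * x) (*) \<pi>" and \<pi>1: "\<pi> 1 = 1" by simp_all
  have \<pi>add: "\<pi> (x + y) = \<pi> x + \<pi> y" for x y using ext_pair.linear_add[OF lin] .
  have \<pi>scale: "\<pi> (?L a * x) = a * \<pi> x" for a x using ext_pair.linear_scale[OF lin] .
  have \<pi>L: "\<pi> (?L a) = a" for a using \<pi>scale[of a 1] \<pi>1 by simp
  have \<pi>0: "\<pi> 0 = 0" using \<pi>L[of 0] by simp
  have \<pi>sum: "\<pi> (sum f A) = (\<Sum>x\<in>A. \<pi> (f x))" for f :: "(nat \<times> nat \<Rightarrow>\<^sub>0 nat) \<times> (nat \<times> nat \<Rightarrow>\<^sub>0 nat) \<Rightarrow> _" and A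
    by (induction A rule: infinite_finite_induct) (simp_all add: \<pi>add \<pi>0)
  \<comment> \<open>Minors of P are sums of monomials with signs, so their coefficients over the
    closure are the images of those over the base field.\<close>
  have lookup_product: "lookup (single w 1 * P_minor n t r c :: (nat \<times> nat, 'k alg_closure) mpoly) M =
      ?L (lookup (single w 1 * P_minor n t r c) M)"
    if rc: "\<And>i. i < t \<Longrightarrow> r i < n" "\<And>i. i < t \<Longrightarrow> c i < 2 * n" for r c w M
  proof -
    have "P_minor n t r c = (\<Sum>p\<in>{p. p permutes {0..<t}}. single (P_term n t r c p) (of_int (sign p) :: 'k alg_closure))"
      using rc by (rule P_minor_expansion)
    then have "single w (1 :: 'k alg_closure) * P_minor n t r c =
        (\<Sum>p\<in>{p. p permutes {0..<t}}. single (w + P_term n t r c p) (of_int (sign p)))"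
      by (simp add: sum_distrib_left mult_single)
    moreover have "P_minor n t r c = (\<Sum>p\<in>{p. p permutes {0..<t}}. single (P_term n t r c p) (of_int (sign p) :: 'k))"
      using rc by (rule P_minor_expansion)
    then have "single w (1 :: 'k) * P_minor n t r c =
        (\<Sum>p\<in>{p. p permutes {0..<t}}. single (w + P_term n t r c p) (of_int (sign p)))"
      by (simp add: sum_distrib_left mult_single)
    ultimately show ?thesis
      by (simp add: lookup_sum to_ac_sum lookup_single when_def if_distrib[of ?L] cong: if_cong)
  qed
  define gL where "gL s = single (snd s) 1 * (P_gen n t (fst s) :: (nat \<times> nat, 'k alg_closure) mpoly)" for s
  define gK where "gK s = single (snd s) 1 * (P_gen n t (fst s) :: (nat \<times> nat, 'k) mpoly)" for s
  have gLK: "lookup (gL s) M = ?L (lookup (gK s) M)" if "s \<in> W" for s M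
  proof -
    have u: "fst s \<in> J_monomials n t" using that by (auto simp: W_def J_normal_def)
    have "J_column n t (fst s) i < 2 * n" if "i < t" for i
      using J_column(1)[OF t u] that by (auto simp: J_columns_def)
    then show ?thesis unfolding gL_def gK_def P_gen_def using t by (intro lookup_product) auto
  qed
  have "(single m 1 * P_minor n t r c :: (nat \<times> nat, 'k alg_closure) mpoly) \<in> mspace.span (gL ` W)"
    unfolding gL_def W_def by (rule P_minor_normal_span[OF t r c m])
  then obtain a where "single m 1 * P_minor n t r c = (\<Sum>x\<in>gL ` W. mscale (a x) x)"
    using mspace.span_finite[OF finite_imageI[OF finW], of gL] by auto
  moreover have injL: "inj_on gL W"
    unfolding gL_def W_def by (rule independent_family_inj[OF finite_J_normal independent_J_normal[OF t]])
  ultimately have eqL: "single m 1 * P_minor n t r c = (\<Sum>s\<in>W. mscale (a (gL s)) (gL s))"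
    by (simp add: sum.reindex)
  have "single m 1 * P_minor n t r c = (\<Sum>s\<in>W. mscale (\<pi> (a (gL s))) (gK s))"
  proof (rule poly_mapping_eqI)
    fix M
    have "?L (lookup (single m 1 * P_minor n t r c) M) =
        lookup (single m 1 * P_minor n t r c :: (nat \<times> nat, 'k alg_closure) mpoly) M"
      using r c by (rule lookup_product[symmetric])
    also have "\<dots> = (\<Sum>s\<in>W. ?L (lookup (gK s) M) * a (gL s))"
      unfolding eqL lookup_sum by (intro sum.cong refl) (simp add: lookup_mscale gLK mult.commute)
    finally have "\<pi> (?L (lookup (single m 1 * P_minor n t r c) M)) = \<pi> (\<Sum>s\<in>W. ?L (lookup (gK s) M) * a (gL s))"
      by (rule arg_cong)
    then show "lookup (single m 1 * P_minor n t r c) M = lookup (\<Sum>s\<in>W. mscale (\<pi> (a (gL s))) (gK s)) M"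
      unfolding \<pi>L \<pi>sum \<pi>scale lookup_sum lookup_mscale by (simp only: mult.commute)
  qed
  moreover have "decomposable (P_gen n t) (\<Sum>s\<in>W. mscale (\<pi> (a (gL s))) (gK s))"
  proof (rule decomposable_sum)
    fix s assume "s \<in> W"
    then have u: "fst s \<in> J_monomials n t" and w: "keys (snd s) \<subseteq> xvars n - set (J_vars n t (fst s))"
      by (auto simp: W_def J_normal_def)
    have "mscale (\<pi> (a (gL s))) (gK s) = P_gen n t (fst s) * single (snd s) (\<pi> (a (gL s)))"
      by (simp add: mscale_def gK_def mult.assoc[symmetric] mult_single mult.commute)
    then show "decomposable (P_gen n t) (mscale (\<pi> (a (gL s))) (gK s))"
      using decomposable_normal[OF u polys_single[OF w]] by simp
  qed
  ultimately show ?thesis by simp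
qed

lemma P_gen_polys:
  assumes t: "1 \<le> t" "t \<le> n" and u: "u \<in> J_monomials n t"
  shows "(P_gen n t u :: (nat \<times> nat, 'k::field) mpoly) \<in> polys (xvars n)"
    and "homogeneous (int t) (P_gen n t u :: (nat \<times> nat, 'k) mpoly)"
proof -
  have "id i < n" "J_column n t u i < 2 * n" if "i < t" for i
    using J_column(1)[OF t u] that t by (auto simp: J_columns_def)
  then show "(P_gen n t u :: (nat \<times> nat, 'k) mpoly) \<in> polys (xvars n)"
    "homogeneous (int t) (P_gen n t u :: (nat \<times> nat, 'k) mpoly)"
    unfolding P_gen_def using P_minor_polys[of t id n "J_column n t u"] by blast+
qed

lemma linear_decomposition_P:
  assumes t: "1 \<le> t" "t \<le> n"
  shows "linear_decomposition (xvars n) (J_monomials n t) (P_gen n t :: _ \<Rightarrow> (nat \<times> nat, 'k::field) mpoly) (J_vars n t) t"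
proof -
  interpret leading_monomials "xvars n" "J_monomials n t" "J_vars n t" by (rule leading_monomials_J[OF t])
  show ?thesis
  proof (rule linear_decomposition_leading[where \<omega> = "P_weight n"])
    fix u m :: "nat \<times> nat \<Rightarrow>\<^sub>0 nat" assume u: "u \<in> J_monomials n t" and m: "keys m \<subseteq> xvars n"
    have "id i < n" "J_column n t u i < 2 * n" if "i < t" for i
      using J_column(1)[OF t u] that t by (auto simp: J_columns_def)
    then show "decomposable (P_gen n t) (single m 1 * (P_gen n t u :: (nat \<times> nat, 'k) mpoly))"
      unfolding P_gen_def[of n t u] using m by (intro P_minor_decomposable[OF t])
  qed (simp_all add: J_vars[OF t] P_gen_polys[OF t] P_gen_leading[OF t])
qed

text \<open>The generators \<open>P_gen\<close> only use the first \<open>t\<close> rows; that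
  minors on other rows lie in the same ideal is \<open>P_minor_decomposable\<close> for the monomial
  1.\<close>

lemma I_P_combinations:
  assumes t: "1 \<le> t" "t \<le> n"
  shows "(I_P n t :: (nat \<times> nat, 'k::field) mpoly set) = combinations (xvars n) (J_monomials n t) (P_gen n t)"
proof
  interpret leading_monomials "xvars n" "J_monomials n t" "J_vars n t" by (rule leading_monomials_J[OF t])
  have sub: "minors t (P_mat n) \<subseteq> combinations (xvars n) (J_monomials n t) (P_gen n t :: _ \<Rightarrow> (nat \<times> nat, 'k) mpoly)"
  proof
    fix x :: "(nat \<times> nat, 'k) mpoly" assume "x \<in> minors t (P_mat n)"
    then obtain r c where x: "x = P_minor n t r c" and rc: "r ` {..<t} \<subseteq> {..<n}" "c ` {..<t} \<subseteq> {..<2 * n}"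
      unfolding minors_P by auto
    have "decomposable (P_gen n t) (single 0 1 * x)"
      unfolding x using rc by (intro P_minor_decomposable[OF t]) auto
    then obtain f where f: "f \<in> normal_forms (xvars n) (J_monomials n t) (J_vars n t)"
      "x = (\<Sum>u\<in>J_monomials n t. P_gen n t u * f u)"
      unfolding decomposable_def by auto
    have "\<forall>u\<in>J_monomials n t. f u \<in> polys (xvars n)"
      using f(1) by (auto simp: normal_forms_def intro: polys_mono)
    then show "x \<in> combinations (xvars n) (J_monomials n t) (P_gen n t)"
      using f(2) unfolding combinations_def by blast
  qed
  show "I_P n t \<subseteq> combinations (xvars n) (J_monomials n t) (P_gen n t :: _ \<Rightarrow> (nat \<times> nat, 'k) mpoly)"
    unfolding I_P_def minors_ideal_def by (rule Idl_subset_combinations[OF P_gen_polys(1)[OF t] sub])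
  have "minors t (P_mat n) \<subseteq> (polys (xvars n) :: (nat \<times> nat, 'k) mpoly set)"
    using sub combinations_subset_polys[OF P_gen_polys(1)[OF t]] by (rule order_trans)
  then show "combinations (xvars n) (J_monomials n t) (P_gen n t :: _ \<Rightarrow> (nat \<times> nat, 'k) mpoly) \<subseteq> I_P n t"
    unfolding I_P_def minors_ideal_def
  proof (rule combinations_subset_Idl)
    fix u assume u: "u \<in> J_monomials n t"
    have "strict_mono_on {..<t} (id :: nat \<Rightarrow> nat)" by (simp add: strict_mono_on_def)
    moreover have "id ` {..<t} \<subseteq> {..<n}" using t by auto
    moreover have "strict_mono_on {..<t} (J_column n t u)" "J_column n t u ` {..<t} \<subseteq> {..<2 * n}"
      using J_column(1)[OF t u] by (simp_all add: J_columns_def)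
    ultimately have "(P_gen n t u :: (nat \<times> nat, 'k) mpoly) \<in> minors t (P_mat n)"
      unfolding minors_P P_gen_def by blast
    with \<open>minors t (P_mat n) \<subseteq> polys (xvars n)\<close>
    show "(P_gen n t u :: (nat \<times> nat, 'k) mpoly) \<in> Idl\<^bsub>poly_ring (xvars n)\<^esub> (minors t (P_mat n))"
      by (rule Idl_self)
  qed
qed

theorem theorem3p6:
  fixes n t q :: nat
  assumes "n \<ge> 1" and "t \<in> {n, n - 1, n - 2}" and "t \<ge> 1" and "q \<le> 2 * n - t"
  shows "betti (xvars n) (J_ideal n t :: (nat \<times> nat, 'k::field) mpoly set) q =
           betti (xvars n) (I_D n t :: (nat \<times> nat, 'k) mpoly set) q
       \<and> betti (xvars n) (I_D n t :: (nat \<times> nat, 'k) mpoly set) q =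
           betti (xvars n) (I_P n t :: (nat \<times> nat, 'k) mpoly set) q"
proof -
  have t: "1 \<le> t" "t \<le> n" using assms(2,3) by auto
  have "betti (xvars n) (J_ideal n t :: (nat \<times> nat, 'k) mpoly set) q = (\<Sum>u\<in>J_monomials n t. card (chains (J_max n t u) q))"
    unfolding J_ideal_combinations[OF t] by (rule betti_nested_J[OF t linear_decomposition_J[OF t]])
  moreover have "betti (xvars n) (I_P n t :: (nat \<times> nat, 'k) mpoly set) q = (\<Sum>u\<in>J_monomials n t. card (chains (J_max n t u) q))"
    unfolding I_P_combinations[OF t] by (rule betti_nested_J[OF t linear_decomposition_P[OF t]])
  moreover have "betti (xvars n) (I_D n t :: (nat \<times> nat, 'k) mpoly set) q = (\<Sum>u\<in>J_monomials n t. card (chains (J_max n t u) q))"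
    unfolding I_D_combinations betti_D same_classes[OF t, of "\<lambda>c. card (chains c q)"] ..
  ultimately show ?thesis by simp
qed

end
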